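(* Let $G=SL(2n+1,\mathbb{C})$, $K=SO(2n+1,\mathbb{C})$ and let $K\backslash G/B$ be parametrized by the set of involutions in $W=S_{2n+1}$ (the identity counted as an involution) via $Q\mapsto\phi(Q)w_0$, where $\phi$ is the Richardson–Springer map and $w_0$ is the longest element. Then the unique closed orbit corresponds to $w_0$, and the weak order can be generated inductively, starting at $w_0$ and moving up, as follows. Given an involution $b\in W$ and a simple reflection $s_i=(i,i+1)$ such that $l(s_ib)<l(b)$, one of the following two scenarios holds: (1) $s_ibs_i\ne b$, in which case $b<_i s_ibs_i$, and the edge in the weak order graph is black; (2) $s_ibs_i=b$, in which case $b<_i s_ib$, and the edge in the weak order graph is blue.
   Context: $J$ is the $(2n+1)\times(2n+1)$ antidiagonal matrix of $1$'s, $\theta(g)=J(g^{-1})^tJ$, $K=G^\theta$; $T$ is the diagonal torus and $B$ the lower-triangular Borel subgroup of $G$, both $\theta$-stable. $l$ is the length function on $S_{2n+1}$. $\theta$ induces $w\mapsto w_0ww_0$ on $W$; twisted involutions are the $w\in W$ with $\theta(w)=w^{-1}$, and $a\mapsto aw_0$ is a bijection from twisted involutions to elements of $W$ with square $1$. Richardson–Springer map: every $K$-orbit on $G/B$ can be written $K\cdot g^{-1}B$ with $g\theta(g)^{-1}\in N_G(T)$, and $\phi(K\cdot g^{-1}B)\in W=N_G(T)/T$ is the class of $g\theta(g)^{-1}$; this is well-defined and is a twisted involution. For this pair it is known that $\phi$ is a bijection from $K\backslash G/B$ onto the set of twisted involutions. Weak order: for a simple root $\alpha_i=Y_i-Y_{i+1}$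 let $P_{\alpha_i}\supset B$ be the minimal parabolic subgroup of type $\alpha_i$ and $\pi_i:G/B\to G/P_{\alpha_i}$ the projection. For a $K$-orbit $Q$, $s_i\cdot Q$ denotes the dense $K$-orbit in $\pi_i^{-1}(\pi_i(Q))$. Write $Q<_iQ'$ if $Q'=s_i\cdot Q$ and $\dim Q'=\dim Q+1$; the weak order is the partial order generated by these relations, and its graph has an edge labelled $i$ from $Q$ to $Q'$ for each such relation. The edge is black if the restriction of $\pi_i$ to the closure $\overline Q$ has degree $1$ over its image, and blue if it has degree $2$. The notation $b<_ib'$ for involutions means this relation for the corresponding orbits. *)

theory Defs
  imports
    "HOL-Algebra.Group_Action"
    "HOL-Algebra.Left_Coset"
    "HOL-Analysis.Abstract_Topology"
    "HOL-Combinatorics.Permutations"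
    "HOL-Library.Extended_Nat"
    "Jordan_Normal_Form.Determinant"
begin

text \<open>
  Conventions: the matrix size is \<open>N\<close>, rows and columns are indexed by \<open>0, \<dots>, N - 1\<close>, and the
  Weyl group is realised as the permutations of \<open>{..<N}\<close>.  The simple reflection with (0-based)
  index \<open>i\<close> is the transposition of \<open>i\<close> and \<open>Suc i\<close>, for \<open>Suc i < N\<close>.
\<close>

section \<open>The groups\<close>

definition SL :: "nat \<Rightarrow> complex mat monoid" where
  "SL N = \<lparr>carrier = {A \<in> carrier_mat N N. det A = 1}, monoid.mult = (*), one = 1\<^sub>m N\<rparr>"

definition antidiag :: "nat \<Rightarrow> complex mat" where
  "antidiag N = mat N N (\<lambda>(i, j). if i + j + 1 = N then 1 else 0)"

definition theta :: "nat \<Rightarrow> complex mat \<Rightarrow> complex mat" where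
  "theta N g = antidiag N * transpose_mat (inv\<^bsub>SL N\<^esub> g) * antidiag N"

definition fixed_group :: "nat \<Rightarrow> complex mat set" where
  "fixed_group N = {g \<in> carrier (SL N). theta N g = g}"

definition torus :: "nat \<Rightarrow> complex mat set" where
  "torus N = {g \<in> carrier (SL N). \<forall>r<N. \<forall>c<N. r \<noteq> c \<longrightarrow> g $$ (r, c) = 0}"

definition borel_subgroup :: "nat \<Rightarrow> complex mat set" where
  "borel_subgroup N = {g \<in> carrier (SL N). \<forall>r<N. \<forall>c<N. r < c \<longrightarrow> g $$ (r, c) = 0}"

text \<open>Block lower triangular, with the single nontrivial diagonal block in rows \<open>i\<close>, \<open>Suc i\<close>.\<close>

definition min_parabolic :: "nat \<Rightarrow> nat \<Rightarrow> complex mat set" where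
  "min_parabolic N i =
     {g \<in> carrier (SL N). \<forall>r<N. \<forall>c<N. r < c \<and> (r, c) \<noteq> (i, Suc i) \<longrightarrow> g $$ (r, c) = 0}"


section \<open>The Weyl group\<close>

abbreviation simple_refl :: "nat \<Rightarrow> nat \<Rightarrow> nat" where
  "simple_refl i \<equiv> transpose i (Suc i)"

definition coxeter_length :: "nat \<Rightarrow> (nat \<Rightarrow> nat) \<Rightarrow> nat" where
  "coxeter_length N w =
     (LEAST k. \<exists>is. length is = k \<and> (\<forall>i\<in>set is. Suc i < N) \<and>
                    w = foldr (\<lambda>i f. simple_refl i \<circ> f) is id)"

definition longest :: "nat \<Rightarrow> nat \<Rightarrow> nat" where
  "longest N = (\<lambda>i. if i < N then N - 1 - i else i)"

definition involutions :: "nat \<Rightarrow> (nat \<Rightarrow> nat) set" where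
  "involutions N = {b. b permutes {..<N} \<and> b \<circ> b = id}"

text \<open>
  A matrix \<open>x\<close> in the normaliser of the torus represents \<open>w\<close> if it maps the \<open>j\<close>-th coordinate line
  to the \<open>w j\<close>-th one; this identifies \<open>N\<^sub>G(T)/T\<close> with the symmetric group.
\<close>

definition represents :: "nat \<Rightarrow> complex mat \<Rightarrow> (nat \<Rightarrow> nat) \<Rightarrow> bool" where
  "represents N x w \<longleftrightarrow>
     x \<in> normalizer (SL N) (torus N) \<and> w permutes {..<N} \<and>
     (\<forall>r<N. \<forall>c<N. x $$ (r, c) \<noteq> 0 \<longleftrightarrow> r = w c)"


section \<open>Zariski topology, dimension and degree\<close>

inductive_set poly_funs :: "nat \<Rightarrow> (complex mat \<Rightarrow> complex) set" for N :: nat where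
  const: "(\<lambda>A. a) \<in> poly_funs N"
| entry: "r < N \<Longrightarrow> c < N \<Longrightarrow> (\<lambda>A. A $$ (r, c)) \<in> poly_funs N"
| add: "f \<in> poly_funs N \<Longrightarrow> g \<in> poly_funs N \<Longrightarrow> (\<lambda>A. f A + g A) \<in> poly_funs N"
| mult: "f \<in> poly_funs N \<Longrightarrow> g \<in> poly_funs N \<Longrightarrow> (\<lambda>A. f A * g A) \<in> poly_funs N"

definition zariski :: "nat \<Rightarrow> complex mat topology" where
  "zariski N = topology_generated_by {{g \<in> carrier (SL N). f g \<noteq> 0} | f. f \<in> poly_funs N}"

text \<open>
  For a closed subgroup \<open>H\<close>, the Zariski topology of the variety \<open>G/H\<close> is the quotient topology, and
  every subset of \<open>G/H\<close> carries the subspace topology.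
\<close>

definition coset_top :: "nat \<Rightarrow> complex mat set \<Rightarrow> complex mat set topology" where
  "coset_top N H =
     topology (\<lambda>U. U \<subseteq> lcosets\<^bsub>SL N\<^esub> H \<and>
                   openin (zariski N) {g \<in> carrier (SL N). g <#\<^bsub>SL N\<^esub> H \<in> U})"

lemma topspace_zariski: "topspace (zariski N) = carrier (SL N)"
proof -
  have "(\<lambda>A. 1) \<in> poly_funs N"
    by (rule poly_funs.const)
  then have "carrier (SL N) \<in> {{g \<in> carrier (SL N). f g \<noteq> 0} | f. f \<in> poly_funs N}"
    by (intro CollectI exI[of _ "\<lambda>A. 1"]) simp
  then have "\<Union>{{g \<in> carrier (SL N). f g \<noteq> 0} | f. f \<in> poly_funs N} = carrier (SL N)"
    by (intro equalityI Union_upper Union_least) auto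
  then show ?thesis
    by (simp only: zariski_def topology_generated_by_topspace)
qed

lemma openin_coset_top:
  "openin (coset_top N H) U \<longleftrightarrow>
     U \<subseteq> lcosets\<^bsub>SL N\<^esub> H \<and> openin (zariski N) {g \<in> carrier (SL N). g <#\<^bsub>SL N\<^esub> H \<in> U}"
proof -
  define q where "q = (\<lambda>U. {g \<in> carrier (SL N). g <#\<^bsub>SL N\<^esub> H \<in> U})"
  have inter: "q (S \<inter> T) = q S \<inter> q T" for S T
    by (auto simp: q_def)
  have union: "q (\<Union>\<K>) = \<Union>(q ` \<K>)" for \<K>
    by (auto simp: q_def)
  have "istopology (\<lambda>U. U \<subseteq> lcosets\<^bsub>SL N\<^esub> H \<and> openin (zariski N) (q U))"
    unfolding istopology_def inter union by (auto intro!: openin_Int openin_Union)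
  then show ?thesis
    unfolding q_def by (simp only: coset_top_def topology_inverse')
qed

lemma topspace_coset_top: "topspace (coset_top N H) = lcosets\<^bsub>SL N\<^esub> H"
proof (rule equalityI)
  have "{g \<in> carrier (SL N). g <#\<^bsub>SL N\<^esub> H \<in> lcosets\<^bsub>SL N\<^esub> H} = topspace (zariski N)"
    unfolding topspace_zariski LCOSETS_def by blast
  then have "openin (coset_top N H) (lcosets\<^bsub>SL N\<^esub> H)"
    by (simp only: openin_coset_top openin_topspace subset_refl simp_thms)
  then show "lcosets\<^bsub>SL N\<^esub> H \<subseteq> topspace (coset_top N H)"
    by (rule openin_subset)
next
  show "topspace (coset_top N H) \<subseteq> lcosets\<^bsub>SL N\<^esub> H"
    using openin_topspace[of "coset_top N H"] unfolding openin_coset_top by (rule conjunct1)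
qed

definition irreducible_in :: "'a topology \<Rightarrow> 'a set \<Rightarrow> bool" where
  "irreducible_in X S \<longleftrightarrow> S \<noteq> {} \<and>
     (\<forall>A B. closedin X A \<and> closedin X B \<and> S \<subseteq> A \<union> B \<longrightarrow> S \<subseteq> A \<or> S \<subseteq> B)"

definition krull_dim :: "'a topology \<Rightarrow> enat" where
  "krull_dim X =
     Sup {enat k | k. \<exists>Z. (\<forall>j\<le>k. closedin X (Z j) \<and> irreducible_in X (Z j)) \<and>
                          (\<forall>j<k. Z j \<subset> Z (Suc j))}"

text \<open>
  The degree of a generically finite dominant morphism of irreducible complex varieties is the
  number of points of a general fibre.  Here it is taken for \<open>p\<close> restricted to \<open>S\<close>, over the
  image \<open>p ` S\<close> in the topological space \<open>Y\<close>, and "general" means: in a dense open subset.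
\<close>

definition has_degree_over_image :: "'b topology \<Rightarrow> ('a \<Rightarrow> 'b) \<Rightarrow> 'a set \<Rightarrow> nat \<Rightarrow> bool" where
  "has_degree_over_image Y p S d \<longleftrightarrow>
     (\<exists>U. openin (subtopology Y (p ` S)) U \<and> p ` S \<subseteq> Y closure_of U \<and>
          (\<forall>y\<in>U. finite {x \<in> S. p x = y} \<and> card {x \<in> S. p x = y} = d))"


section \<open>Orbits on the flag variety\<close>

abbreviation flag_variety :: "nat \<Rightarrow> complex mat set set" where
  "flag_variety N \<equiv> lcosets\<^bsub>SL N\<^esub> (borel_subgroup N)"

abbreviation flag_top :: "nat \<Rightarrow> complex mat set topology" where
  "flag_top N \<equiv> coset_top N (borel_subgroup N)"

abbreviation K_group :: "nat \<Rightarrow> complex mat monoid" where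
  "K_group N \<equiv> SL N\<lparr>carrier := fixed_group N\<rparr>"

definition K_orbit :: "nat \<Rightarrow> complex mat set \<Rightarrow> complex mat set set" where
  "K_orbit N = orbit (K_group N) (\<lambda>k x. k <#\<^bsub>SL N\<^esub> x)"

definition K_orbits :: "nat \<Rightarrow> complex mat set set set" where
  "K_orbits N = orbits (K_group N) (flag_variety N) (\<lambda>k x. k <#\<^bsub>SL N\<^esub> x)"

definition RS_map :: "nat \<Rightarrow> complex mat set set \<Rightarrow> nat \<Rightarrow> nat" where
  "RS_map N Q =
     (THE w. \<exists>g\<in>carrier (SL N).
        Q = K_orbit N (inv\<^bsub>SL N\<^esub> g <#\<^bsub>SL N\<^esub> borel_subgroup N) \<and>
        represents N (g \<otimes>\<^bsub>SL N\<^esub> inv\<^bsub>SL N\<^esub> (theta N g)) w)"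

definition orbit_param :: "nat \<Rightarrow> complex mat set set \<Rightarrow> nat \<Rightarrow> nat" where
  "orbit_param N Q = RS_map N Q \<circ> longest N"

definition orbit_of :: "nat \<Rightarrow> (nat \<Rightarrow> nat) \<Rightarrow> complex mat set set" where
  "orbit_of N = the_inv_into (K_orbits N) (orbit_param N)"


section \<open>The weak order\<close>

text \<open>The projection \<open>G/B \<rightarrow> G/P\<close> sends the coset \<open>gB\<close> to \<open>gB P = gP\<close>.\<close>

definition proj :: "nat \<Rightarrow> nat \<Rightarrow> complex mat set \<Rightarrow> complex mat set" where
  "proj N i x = x <#>\<^bsub>SL N\<^esub> min_parabolic N i"

definition saturation :: "nat \<Rightarrow> nat \<Rightarrow> complex mat set set \<Rightarrow> complex mat set set" where
  "saturation N i Q = {x \<in> flag_variety N. proj N i x \<in> proj N i ` Q}"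

definition simple_act :: "nat \<Rightarrow> nat \<Rightarrow> complex mat set set \<Rightarrow> complex mat set set" where
  "simple_act N i Q =
     (THE Q'. Q' \<in> K_orbits N \<and> Q' \<subseteq> saturation N i Q \<and>
              saturation N i Q \<subseteq> flag_top N closure_of Q')"

definition orbit_dim :: "nat \<Rightarrow> complex mat set set \<Rightarrow> enat" where
  "orbit_dim N Q = krull_dim (subtopology (flag_top N) Q)"

definition orbit_cover :: "nat \<Rightarrow> nat \<Rightarrow> complex mat set set \<Rightarrow> complex mat set set \<Rightarrow> bool" where
  "orbit_cover N i Q Q' \<longleftrightarrow> Q' = simple_act N i Q \<and> orbit_dim N Q' = orbit_dim N Q + 1"

definition proj_degree :: "nat \<Rightarrow> nat \<Rightarrow> complex mat set set \<Rightarrow> nat \<Rightarrow> bool" where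
  "proj_degree N i Q d \<longleftrightarrow>
     has_degree_over_image (coset_top N (min_parabolic N i)) (proj N i) (flag_top N closure_of Q) d"

definition weak_cover :: "nat \<Rightarrow> nat \<Rightarrow> (nat \<Rightarrow> nat) \<Rightarrow> (nat \<Rightarrow> nat) \<Rightarrow> bool" where
  "weak_cover N i b b' \<longleftrightarrow>
     b \<in> involutions N \<and> b' \<in> involutions N \<and> Suc i < N \<and>
     orbit_cover N i (orbit_of N b) (orbit_of N b')"

definition black_edge :: "nat \<Rightarrow> nat \<Rightarrow> (nat \<Rightarrow> nat) \<Rightarrow> (nat \<Rightarrow> nat) \<Rightarrow> bool" where
  "black_edge N i b b' \<longleftrightarrow> weak_cover N i b b' \<and> proj_degree N i (orbit_of N b) 1"

definition blue_edge :: "nat \<Rightarrow> nat \<Rightarrow> (nat \<Rightarrow> nat) \<Rightarrow> (nat \<Rightarrow> nat) \<Rightarrow> bool" where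
  "blue_edge N i b b' \<longleftrightarrow> weak_cover N i b b' \<and> proj_degree N i (orbit_of N b) 2"

definition weak_order :: "nat \<Rightarrow> ((nat \<Rightarrow> nat) \<times> (nat \<Rightarrow> nat)) set" where
  "weak_order N = {(b, b'). \<exists>i. weak_cover N i b b'}\<^sup>*"

end

(*
  Sending gB to the bilinear form g^t J g turns K-orbits on G/B into B-congruence classes of symmetric
  matrices of determinant (-1)^n.  Elimination brings each class to a monomial matrix whose pattern is an
  involution b, and the ranks of the lower right blocks of the form determine b and can only drop in
  closures.  A lower triangular change of the form in two adjacent columns exhibits the fibre of
  G/B -> G/P_i over a point of the orbit of b: it meets that orbit in one point if s_i and b do not
  commute and in two points if they do, and otherwise lies in the orbit of s_i b s_i or s_i b.

  Dimensions are only needed up to a sandwich.  Sweeping a chain of closed irreducible sets along the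
  fibres of G/B -> G/P_i lengthens it by one for every edge of the weak order, measured by the growth of
  the restrictions of polynomials of bounded degree.  Products of root subgroups of K give a chain of
  length n^2 in the closed orbit, while growth bounds all chains in G/B by n(2n+1); since inversions plus
  excedances of b drop by exactly two along every edge, from 2n(n+1) at w_0 to 0 at the identity, all
  these inequalities are equalities.
*)

theory Submission
  imports Defs "HOL-Computational_Algebra.Fundamental_Theorem_Algebra"
begin

section \<open>Polynomial functions\<close>

text \<open>The work is done in the group: subsets of \<open>G/B\<close> become right
  \<open>B\<close>-stable subsets, closures correspond, and irreducible sets correspond because
  \<open>B\<close> itself is irreducible. An upper bound for the Krull dimension must hold for every
  chain. If \<open>f\<close> vanishes on \<open>Z\<close> but not on the irreducible set
  \<open>Z'\<close>, powers of \<open>f\<close> fit \<open>d + 1\<close> copies of the degree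
  \<open>d\<close> functions on \<open>Z\<close> into functions on \<open>Z'\<close> of degree
  proportional to \<open>d + 1\<close>, so a strict inclusion costs one power of \<open>d\<close>.
  The least exponent of growth thus serves as dimension wherever members of a chain have to be told
  apart. Along an edge a chain gains its extra member at the bottom: one coset \<open>yB\<close>
  below the swept sets. The length \<open>n^2\<close> is the number of positive roots of
  \<open>SO(2n+1)\<close>; half of inversions plus excedances is the codimension of the orbit. The
  degree needs a dense open set of the image over which all fibres are known. The image of the orbit
  itself serves; it is open in the image of the closure because the ranks make the closure order on
  the finitely many saturated sets antisymmetric.\<close>

inductive pdeg :: "nat \<Rightarrow> nat \<Rightarrow> (complex mat \<Rightarrow> complex) \<Rightarrow> bool" for N :: nat where
  const: "pdeg N d (\<lambda>A. a)"
| entry: "r < N \<Longrightarrow> c < N \<Longrightarrow> pdeg N (Suc d) (\<lambda>A. A $$ (r, c))"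
| add: "pdeg N d f \<Longrightarrow> pdeg N d g \<Longrightarrow> pdeg N d (\<lambda>A. f A + g A)"
| mult: "pdeg N d f \<Longrightarrow> pdeg N e g \<Longrightarrow> pdeg N (d + e) (\<lambda>A. f A * g A)"

text \<open>The constant \<open>1\<close> may be given the degree \<open>e - d\<close>, so
  multiplying by it raises the bound.\<close>

lemma pdeg_mono: "pdeg N d f \<Longrightarrow> d \<le> e \<Longrightarrow> pdeg N e f"
  using pdeg.mult[OF _ pdeg.const[of N "e - d" 1], of d f] by simp

lemma pdeg_cmult: "pdeg N d f \<Longrightarrow> pdeg N d (\<lambda>A. a * f A)"
  using pdeg.mult[OF pdeg.const[of N 0 a], of d f] by simp

lemma pdeg_sum: "(\<And>i. i \<in> I \<Longrightarrow> pdeg N d (f i)) \<Longrightarrow> pdeg N d (\<lambda>A. \<Sum>i\<in>I. f i A)"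
  by (induction I rule: infinite_finite_induct) (auto intro: pdeg.intros)

lemma poly_funs_iff_pdeg: "f \<in> poly_funs N \<longleftrightarrow> (\<exists>d. pdeg N d f)"
proof
  assume "f \<in> poly_funs N"
  then show "\<exists>d. pdeg N d f"
  proof induction
    case (add f g)
    then obtain d e where "pdeg N d f" "pdeg N e g" by blast
    then have "pdeg N (max d e) f" "pdeg N (max d e) g"
      by (auto intro: pdeg_mono)
    then show ?case by (blast intro: pdeg.add)
  qed (auto intro: pdeg.intros)
next
  assume "\<exists>d. pdeg N d f"
  then obtain d where "pdeg N d f" by blast
  then show "f \<in> poly_funs N"
    by induction (auto intro: poly_funs.intros)
qed

lemma pdeg_poly_funs: "pdeg N d f \<Longrightarrow> f \<in> poly_funs N"
  using poly_funs_iff_pdeg by blast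

lemma poly_funs_cmult: "f \<in> poly_funs N \<Longrightarrow> (\<lambda>A. a * f A) \<in> poly_funs N"
  by (rule poly_funs.mult[OF poly_funs.const])

lemma poly_funs_diff:
  assumes "f \<in> poly_funs N" "g \<in> poly_funs N" shows "(\<lambda>A. f A - g A) \<in> poly_funs N"
  using poly_funs.add[OF assms(1) poly_funs_cmult[OF assms(2), of "-1"]] by simp

lemma poly_funs_sum: "(\<And>i. i \<in> I \<Longrightarrow> f i \<in> poly_funs N) \<Longrightarrow> (\<lambda>A. \<Sum>i\<in>I. f i A) \<in> poly_funs N"
  by (induction I rule: infinite_finite_induct) (auto intro: poly_funs.intros)

lemma poly_funs_prod: "(\<And>i. i \<in> I \<Longrightarrow> f i \<in> poly_funs N) \<Longrightarrow> (\<lambda>A. \<Prod>i\<in>I. f i A) \<in> poly_funs N"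
  by (induction I rule: infinite_finite_induct) (auto intro: poly_funs.intros)

lemma poly_funs_det:
  assumes "\<And>p q. p < m \<Longrightarrow> q < m \<Longrightarrow> F p q \<in> poly_funs N"
  shows "(\<lambda>A. det (mat m m (\<lambda>(p, q). F p q A))) \<in> poly_funs N"
proof -
  have "det (mat m m (\<lambda>(p, q). F p q A)) =
      (\<Sum>\<pi>\<in>{\<pi>. \<pi> permutes {0..<m}}. signof \<pi> * (\<Prod>i = 0..<m. F i (\<pi> i) A))" for A
    by (subst det_def'[of _ m]) (auto intro!: sum.cong prod.cong simp: permutes_in_image[unfolded atLeastLessThan_iff])
  then show ?thesis
    using assms
    by (auto intro!: poly_funs_sum poly_funs_cmult poly_funs_prod
        simp: permutes_in_image[unfolded atLeastLessThan_iff])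
qed

text \<open>Members of \<open>poly_funs N\<close> only see the entries with indices below
  \<open>N\<close>, whereas \<open>det\<close> depends on the dimensions of its argument; hence a
  polynomial function that agrees with it on \<open>N\<close> by \<open>N\<close> matrices.\<close>

lemma poly_funs_det_mat:
  obtains f where "f \<in> poly_funs N" "\<And>A. A \<in> carrier_mat N N \<Longrightarrow> f A = det A"
proof
  show "(\<lambda>A. det (mat N N (\<lambda>(p, q). A $$ (p, q)))) \<in> poly_funs N"
    by (rule poly_funs_det) (rule poly_funs.entry)
  show "det (mat N N (\<lambda>(p, q). A $$ (p, q))) = det A" if "A \<in> carrier_mat N N" for A
  proof -
    have "mat N N (\<lambda>(p, q). A $$ (p, q)) = A" using that by (intro eq_matI) auto
    then show ?thesis by simp
  qed
qed

lemma pdeg_subst: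
  assumes "pdeg N d f" "\<And>r c. r < N \<Longrightarrow> c < N \<Longrightarrow> pdeg N 1 (\<lambda>A. \<phi> A $$ (r, c))"
  shows "pdeg N d (\<lambda>A. f (\<phi> A))"
  using assms(1)
proof induction
  case (entry r c d)
  then show ?case using assms(2)[of r c] pdeg_mono[of N 1 _ "Suc d"] by simp
qed (auto intro: pdeg.intros)

lemma poly_funs_subst:
  assumes "f \<in> poly_funs N" "\<And>r c. r < N \<Longrightarrow> c < N \<Longrightarrow> (\<lambda>A. \<phi> A $$ (r, c)) \<in> poly_funs N"
  shows "(\<lambda>A. f (\<phi> A)) \<in> poly_funs N"
  using assms(1) by induction (auto intro: poly_funs.intros assms(2))

lemma poly_funs_cong:
  assumes "f \<in> poly_funs N" "\<And>r c. r < N \<Longrightarrow> c < N \<Longrightarrow> A $$ (r, c) = B $$ (r, c)"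
  shows "f A = f B"
  using assms(1) by induction (auto simp: assms(2))

lemma mult_mat_entry:
  assumes "A \<in> carrier_mat n m" "B \<in> carrier_mat m k" "r < n" "c < k"
  shows "(A * B) $$ (r, c) = (\<Sum>s<m. A $$ (r, s) * B $$ (s, c))"
  using assms by (auto simp: scalar_prod_def atLeast0LessThan)

lemma poly_funs_mult_right:
  assumes "f \<in> poly_funs N" "p \<in> carrier_mat N N"
  obtains f' where "f' \<in> poly_funs N" "\<And>A. A \<in> carrier_mat N N \<Longrightarrow> f' A = f (A * p)"
proof
  let ?\<phi> = "\<lambda>A. mat N N (\<lambda>(r, c). \<Sum>s<N. A $$ (r, s) * p $$ (s, c))"
  show "(\<lambda>A. f (?\<phi> A)) \<in> poly_funs N"
    by (rule poly_funs_subst[OF assms(1)]) (auto intro!: poly_funs_sum poly_funs.intros)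
  show "f (?\<phi> A) = f (A * p)" if "A \<in> carrier_mat N N" for A
    using that assms(2)
    by (intro poly_funs_cong[OF assms(1)]) (auto simp: mult_mat_entry simp del: index_mult_mat)
qed

lemma poly_funs_mult_left:
  assumes "f \<in> poly_funs N" "p \<in> carrier_mat N N"
  obtains f' where "f' \<in> poly_funs N" "\<And>A. A \<in> carrier_mat N N \<Longrightarrow> f' A = f (p * A)"
proof
  let ?\<phi> = "\<lambda>A. mat N N (\<lambda>(r, c). \<Sum>s<N. p $$ (r, s) * A $$ (s, c))"
  show "(\<lambda>A. f (?\<phi> A)) \<in> poly_funs N"
    by (rule poly_funs_subst[OF assms(1)]) (auto intro!: poly_funs_sum poly_funs.intros)
  show "f (?\<phi> A) = f (p * A)" if "A \<in> carrier_mat N N" for A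
    using that assms(2)
    by (intro poly_funs_cong[OF assms(1)]) (auto simp: mult_mat_entry simp del: index_mult_mat)
qed


section \<open>Zariski closure and irreducible sets\<close>

text \<open>Closure in terms of the vanishing ideal; \<open>zariski_closure_of\<close> identifies it
  with the closure in the given topology.\<close>

definition zcl :: "nat \<Rightarrow> complex mat set \<Rightarrow> complex mat set" where
  "zcl N Z = {g \<in> carrier (SL N). \<forall>f\<in>poly_funs N. (\<forall>z\<in>Z. f z = 0) \<longrightarrow> f g = 0}"

text \<open>Primeness of the vanishing ideal. It is stated for arbitrary sets of matrices, so that
  it applies to linear spaces as well as to subsets of the group;
  \<open>zirr_iff_irreducible_in\<close> compares it with the topological notion.\<close>

definition zirr :: "nat \<Rightarrow> complex mat set \<Rightarrow> bool" where
  "zirr N Z \<longleftrightarrow> Z \<noteq> {} \<and>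
     (\<forall>f\<in>poly_funs N. \<forall>g\<in>poly_funs N. (\<forall>z\<in>Z. f z * g z = 0) \<longrightarrow> (\<forall>z\<in>Z. f z = 0) \<or> (\<forall>z\<in>Z. g z = 0))"

text \<open>Unlike \<open>zcl\<close>, which is cut down to the group, this relation also compares
  sets of matrices of other determinants, as in \<open>growth_borel_ge\<close>.\<close>

definition zdense :: "nat \<Rightarrow> complex mat set \<Rightarrow> complex mat set \<Rightarrow> bool" where
  "zdense N Z W \<longleftrightarrow> (\<forall>f\<in>poly_funs N. (\<forall>z\<in>Z. f z = 0) \<longrightarrow> (\<forall>w\<in>W. f w = 0))"

lemma zdense_iff_subset_zcl: "W \<subseteq> carrier (SL N) \<Longrightarrow> zdense N Z W \<longleftrightarrow> W \<subseteq> zcl N Z"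
  unfolding zdense_def zcl_def by blast

lemma zdense_mono: "W \<subseteq> Z \<Longrightarrow> zdense N Z W"
  unfolding zdense_def by blast

lemma zdense_trans: "zdense N Z W \<Longrightarrow> zdense N W V \<Longrightarrow> zdense N Z V"
  unfolding zdense_def by blast

lemma zcl_subset_carrier: "zcl N Z \<subseteq> carrier (SL N)"
  unfolding zcl_def by blast

lemma subset_zcl: "Z \<subseteq> carrier (SL N) \<Longrightarrow> Z \<subseteq> zcl N Z"
  unfolding zcl_def by blast

lemma zcl_mono: "Z \<subseteq> W \<Longrightarrow> zcl N Z \<subseteq> zcl N W"
  unfolding zcl_def by blast

lemma zcl_minimal: "Z \<subseteq> zcl N W \<Longrightarrow> zcl N Z \<subseteq> zcl N W"
  unfolding zcl_def by blast

lemma zcl_idem: "zcl N (zcl N Z) = zcl N Z"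
  unfolding zcl_def by blast

text \<open>The generating sets already form a basis: the product of two polynomial functions
  defines the intersection of their nonvanishing sets.\<close>

lemma openin_zariski_basis:
  assumes "openin (zariski N) U" "x \<in> U"
  obtains f where "f \<in> poly_funs N" "f x \<noteq> 0" "{g \<in> carrier (SL N). f g \<noteq> 0} \<subseteq> U"
proof -
  let ?S = "{{g \<in> carrier (SL N). f g \<noteq> 0} | f. f \<in> poly_funs N}"
  have "generate_topology_on ?S U"
    using assms(1) unfolding zariski_def by (rule openin_topology_generated_by)
  then have "\<forall>x\<in>U. \<exists>f\<in>poly_funs N. f x \<noteq> 0 \<and> {g \<in> carrier (SL N). f g \<noteq> 0} \<subseteq> U"
  proof induction
    case (Int a b)
    show ?case
    proof
      fix x assume "x \<in> a \<inter> b"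
      then obtain f g where "f \<in> poly_funs N" "f x \<noteq> 0" "{g \<in> carrier (SL N). f g \<noteq> 0} \<subseteq> a"
        "g \<in> poly_funs N" "g x \<noteq> 0" "{h \<in> carrier (SL N). g h \<noteq> 0} \<subseteq> b"
        using Int.IH by blast
      then show "\<exists>f\<in>poly_funs N. f x \<noteq> 0 \<and> {g \<in> carrier (SL N). f g \<noteq> 0} \<subseteq> a \<inter> b"
        by (intro bexI[of _ "\<lambda>A. f A * g A"]) (auto intro: poly_funs.intros)
    qed
  next
    case (UN K)
    show ?case
    proof
      fix x assume "x \<in> \<Union>K"
      then obtain k where k: "k \<in> K" "x \<in> k" by blast
      then obtain f where "f \<in> poly_funs N" "f x \<noteq> 0" "{g \<in> carrier (SL N). f g \<noteq> 0} \<subseteq> k"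
        using UN.IH by blast
      then show "\<exists>f\<in>poly_funs N. f x \<noteq> 0 \<and> {g \<in> carrier (SL N). f g \<noteq> 0} \<subseteq> \<Union>K"
        using k(1) by blast
    qed
  next
    case (Basis s)
    then show ?case by blast
  qed auto
  then show ?thesis using assms(2) that by blast
qed

lemma openin_zariski_nonzero: "f \<in> poly_funs N \<Longrightarrow> openin (zariski N) {g \<in> carrier (SL N). f g \<noteq> 0}"
  unfolding zariski_def by (rule topology_generated_by_Basis) blast

lemma closedin_zariski_zcl: "closedin (zariski N) (zcl N Z)"
proof -
  have "carrier (SL N) - zcl N Z =
      \<Union>{{g \<in> carrier (SL N). f g \<noteq> 0} | f. f \<in> poly_funs N \<and> (\<forall>z\<in>Z. f z = 0)}"
    unfolding zcl_def by auto
  moreover have "openin (zariski N) \<dots>"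
    by (rule openin_Union) (auto intro: openin_zariski_nonzero)
  ultimately show ?thesis
    by (simp add: closedin_def topspace_zariski zcl_subset_carrier)
qed

lemma zariski_closure_of:
  assumes "Z \<subseteq> carrier (SL N)" shows "zariski N closure_of Z = zcl N Z"
proof
  show "zariski N closure_of Z \<subseteq> zcl N Z"
    by (rule closure_of_minimal[OF subset_zcl[OF assms] closedin_zariski_zcl])
  show "zcl N Z \<subseteq> zariski N closure_of Z"
  proof
    fix x assume x: "x \<in> zcl N Z"
    have "\<exists>y. y \<in> Z \<and> y \<in> U" if U: "x \<in> U" "openin (zariski N) U" for U
    proof -
      obtain f where f: "f \<in> poly_funs N" "f x \<noteq> 0" "{g \<in> carrier (SL N). f g \<noteq> 0} \<subseteq> U"
        using openin_zariski_basis[OF U(2,1)] .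
      then obtain y where "y \<in> Z" "f y \<noteq> 0" using x unfolding zcl_def by blast
      then show ?thesis using f(3) assms by blast
    qed
    then show "x \<in> zariski N closure_of Z"
      using x zcl_subset_carrier by (auto simp: in_closure_of topspace_zariski)
  qed
qed

lemma closedin_zariski_iff: "closedin (zariski N) Z \<longleftrightarrow> Z \<subseteq> carrier (SL N) \<and> zcl N Z = Z"
  by (metis closedin_zariski_zcl closure_of_eq closedin_subset topspace_zariski zariski_closure_of)

lemma zirr_iff_irreducible_in:
  assumes "Z \<subseteq> carrier (SL N)" shows "irreducible_in (zariski N) Z \<longleftrightarrow> zirr N Z"
proof
  assume irr: "irreducible_in (zariski N) Z"
  show "zirr N Z" unfolding zirr_def
  proof (intro conjI ballI impI)
    show "Z \<noteq> {}" using irr by (simp add: irreducible_in_def)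
    fix f g assume fg: "f \<in> poly_funs N" "g \<in> poly_funs N" "\<forall>z\<in>Z. f z * g z = 0"
    have cl: "closedin (zariski N) {x \<in> carrier (SL N). h x = 0}" if "h \<in> poly_funs N" for h
    proof -
      have "carrier (SL N) - {x \<in> carrier (SL N). h x = 0} = {x \<in> carrier (SL N). h x \<noteq> 0}" by blast
      then show ?thesis
        using openin_zariski_nonzero[OF that] unfolding closedin_def topspace_zariski by auto
    qed
    have "Z \<subseteq> {x \<in> carrier (SL N). f x = 0} \<union> {x \<in> carrier (SL N). g x = 0}"
      using fg assms by auto
    then have "Z \<subseteq> {x \<in> carrier (SL N). f x = 0} \<or> Z \<subseteq> {x \<in> carrier (SL N). g x = 0}"
      using irr[unfolded irreducible_in_def, THEN conjunct2, rule_format] cl[OF fg(1)] cl[OF fg(2)] by presburger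
    then show "(\<forall>z\<in>Z. f z = 0) \<or> (\<forall>z\<in>Z. g z = 0)" by blast
  qed
next
  assume irr: "zirr N Z"
  show "irreducible_in (zariski N) Z" unfolding irreducible_in_def
  proof (intro conjI allI impI)
    show "Z \<noteq> {}" using irr by (simp add: zirr_def)
    fix A B assume AB: "closedin (zariski N) A \<and> closedin (zariski N) B \<and> Z \<subseteq> A \<union> B"
    show "Z \<subseteq> A \<or> Z \<subseteq> B"
    proof (rule ccontr)
      assume "\<not> (Z \<subseteq> A \<or> Z \<subseteq> B)"
      then obtain x y where xy: "x \<in> Z" "x \<notin> A" "y \<in> Z" "y \<notin> B" by blast
      have "zcl N A = A" "zcl N B = B" using AB closedin_zariski_iff by blast+
      then have "x \<notin> zcl N A" "y \<notin> zcl N B" "x \<in> carrier (SL N)" "y \<in> carrier (SL N)"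
        using xy assms by auto
      then obtain f g where "f \<in> poly_funs N" "\<forall>z\<in>A. f z = 0" "f x \<noteq> 0"
        "g \<in> poly_funs N" "\<forall>z\<in>B. g z = 0" "g y \<noteq> 0"
        unfolding zcl_def by blast
      then have fg: "f \<in> poly_funs N" "g \<in> poly_funs N" "\<forall>z\<in>Z. f z * g z = 0" "f x \<noteq> 0" "g y \<noteq> 0"
        using AB by fastforce+
      then have "(\<forall>z\<in>Z. f z = 0) \<or> (\<forall>z\<in>Z. g z = 0)" using irr unfolding zirr_def by blast
      then show False using fg xy by blast
    qed
  qed
qed

lemma zirr_dense:
  assumes "zirr N Z" "zdense N Z W" "Z \<subseteq> W" shows "zirr N W"
  unfolding zirr_def
proof (intro conjI ballI impI)
  show "W \<noteq> {}" using assms by (auto simp: zirr_def)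
  fix f g assume fg: "f \<in> poly_funs N" "g \<in> poly_funs N" "\<forall>z\<in>W. f z * g z = 0"
  then have "(\<forall>z\<in>Z. f z = 0) \<or> (\<forall>z\<in>Z. g z = 0)"
    using assms(1,3) unfolding zirr_def by blast
  then show "(\<forall>z\<in>W. f z = 0) \<or> (\<forall>z\<in>W. g z = 0)"
    using assms(2) fg unfolding zdense_def by blast
qed

text \<open>Some polynomial \<open>h\<close> vanishes on \<open>A\<close> but not on all of
  \<open>Z\<close>. If \<open>f\<close> vanishes on \<open>Z\<close> off the closure of
  \<open>A\<close>, then \<open>h f\<close> vanishes on all of \<open>Z\<close>, and primeness lets
  \<open>h\<close> be cancelled.\<close>

lemma zirr_open:
  assumes "zirr N Z" "Z \<subseteq> carrier (SL N)" "\<not> Z \<subseteq> zcl N A"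
  shows "zirr N (Z - zcl N A)" "zdense N (Z - zcl N A) Z"
proof -
  obtain y h where y: "y \<in> Z" "h \<in> poly_funs N" "\<forall>z\<in>A. h z = 0" "h y \<noteq> 0"
    using assms(2,3) unfolding zcl_def by blast
  have h0: "h z = 0" if "z \<in> zcl N A" for z
    using that y unfolding zcl_def by blast
  have ynot: "y \<notin> zcl N A" using h0 y(4) by blast
  show dense: "zdense N (Z - zcl N A) Z"
    unfolding zdense_def
  proof (intro ballI impI)
    fix f w assume f: "f \<in> poly_funs N" "\<forall>z\<in>Z - zcl N A. f z = 0" "w \<in> Z"
    then have "\<forall>z\<in>Z. h z * f z = 0" using h0 by auto
    then have "(\<forall>z\<in>Z. h z = 0) \<or> (\<forall>z\<in>Z. f z = 0)"
      using assms(1) y(2) f(1) unfolding zirr_def by blast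
    then show "f w = 0" using y f(3) by blast
  qed
  show "zirr N (Z - zcl N A)" unfolding zirr_def
  proof (intro conjI ballI impI)
    show "Z - zcl N A \<noteq> {}" using y(1) ynot by blast
    fix f g assume fg: "f \<in> poly_funs N" "g \<in> poly_funs N" "\<forall>z\<in>Z - zcl N A. f z * g z = 0"
    have "(\<lambda>z. f z * g z) \<in> poly_funs N" using fg(1,2) by (rule poly_funs.mult)
    then have "\<forall>z\<in>Z. f z * g z = 0"
      using bspec[OF dense[unfolded zdense_def], of "\<lambda>z. f z * g z"] fg(3) by simp
    then have "(\<forall>z\<in>Z. f z = 0) \<or> (\<forall>z\<in>Z. g z = 0)"
      using assms(1) fg unfolding zirr_def by blast
    then show "(\<forall>z\<in>Z - zcl N A. f z = 0) \<or> (\<forall>z\<in>Z - zcl N A. g z = 0)" by blast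
  qed
qed

section \<open>Irreducibility tested on rational curves\<close>

lemma poly_funs_rational_curve:
  assumes "f \<in> poly_funs N"
    and "\<And>r c. r < N \<Longrightarrow> c < N \<Longrightarrow> \<exists>P. \<forall>t. poly D t \<noteq> 0 \<longrightarrow> \<gamma> t $$ (r, c) * poly D t = poly P t"
  shows "\<exists>k P. \<forall>t. poly D t \<noteq> 0 \<longrightarrow> f (\<gamma> t) * poly D t ^ k = poly P t"
  using assms(1)
proof induction
  case (const a)
  show ?case by (intro exI[of _ 0] exI[of _ "[:a:]"]) simp
next
  case (entry r c)
  then obtain P where "\<forall>t. poly D t \<noteq> 0 \<longrightarrow> \<gamma> t $$ (r, c) * poly D t = poly P t"
    using assms(2) by blast
  then show ?case by (intro exI[of _ 1] exI[of _ P]) simp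
next
  case (add f g)
  then obtain k P l Q where
    *: "\<forall>t. poly D t \<noteq> 0 \<longrightarrow> f (\<gamma> t) * poly D t ^ k = poly P t"
       "\<forall>t. poly D t \<noteq> 0 \<longrightarrow> g (\<gamma> t) * poly D t ^ l = poly Q t" by blast
  have "(f (\<gamma> t) + g (\<gamma> t)) * poly D t ^ (k + l) = poly (P * D ^ l + Q * D ^ k) t"
    if "poly D t \<noteq> 0" for t
    using *(1)[rule_format, OF that, symmetric] *(2)[rule_format, OF that, symmetric]
    by (simp add: algebra_simps power_add)
  then show ?case by blast
next
  case (mult f g)
  then obtain k P l Q where
    *: "\<forall>t. poly D t \<noteq> 0 \<longrightarrow> f (\<gamma> t) * poly D t ^ k = poly P t"
       "\<forall>t. poly D t \<noteq> 0 \<longrightarrow> g (\<gamma> t) * poly D t ^ l = poly Q t" by blast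
  have "(f (\<gamma> t) * g (\<gamma> t)) * poly D t ^ (k + l) = poly (P * Q) t"
    if "poly D t \<noteq> 0" for t
    using *(1)[rule_format, OF that, symmetric] *(2)[rule_format, OF that, symmetric]
    by (simp add: algebra_simps power_add)
  then show ?case by blast
qed

text \<open>The entries of the curve \<open>\<gamma>\<close> have the common denominator \<open>D\<close>.\<close>

lemma zirr_rational_curves:
  assumes "Z \<noteq> {}"
    and "\<And>x y. x \<in> Z \<Longrightarrow> y \<in> Z \<Longrightarrow> \<exists>\<gamma> D. \<gamma> 0 = x \<and> \<gamma> 1 = y \<and> poly D 0 \<noteq> 0 \<and> poly D 1 \<noteq> 0 \<and>
      (\<forall>t. poly D t \<noteq> 0 \<longrightarrow> \<gamma> t \<in> Z) \<and>
      (\<forall>r<N. \<forall>c<N. \<exists>P. \<forall>t. poly D t \<noteq> 0 \<longrightarrow> \<gamma> t $$ (r, c) * poly D t = poly P t)"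
  shows "zirr N Z"
  unfolding zirr_def
proof (intro conjI ballI impI)
  fix f g assume fg: "f \<in> poly_funs N" "g \<in> poly_funs N" "\<forall>z\<in>Z. f z * g z = 0"
  show "(\<forall>z\<in>Z. f z = 0) \<or> (\<forall>z\<in>Z. g z = 0)"
  proof (rule ccontr)
    assume "\<not> ?thesis"
    then obtain x y where xy: "x \<in> Z" "y \<in> Z" "f x \<noteq> 0" "g y \<noteq> 0" by blast
    from assms(2)[OF xy(1,2)] obtain \<gamma> D where \<gamma>: "\<gamma> 0 = x" "\<gamma> 1 = y" "poly D 0 \<noteq> 0" "poly D 1 \<noteq> 0"
      "\<And>t. poly D t \<noteq> 0 \<Longrightarrow> \<gamma> t \<in> Z"
      "\<And>r c. r < N \<Longrightarrow> c < N \<Longrightarrow> \<exists>P. \<forall>t. poly D t \<noteq> 0 \<longrightarrow> \<gamma> t $$ (r, c) * poly D t = poly P t"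
      by blast
    obtain k P where P: "\<forall>t. poly D t \<noteq> 0 \<longrightarrow> f (\<gamma> t) * poly D t ^ k = poly P t"
      using poly_funs_rational_curve[OF fg(1) \<gamma>(6)] by blast
    obtain l Q where Q: "\<forall>t. poly D t \<noteq> 0 \<longrightarrow> g (\<gamma> t) * poly D t ^ l = poly Q t"
      using poly_funs_rational_curve[OF fg(2) \<gamma>(6)] by blast
    have "poly P 0 \<noteq> 0" "poly Q 1 \<noteq> 0"
      using P[rule_format, OF \<gamma>(3)] Q[rule_format, OF \<gamma>(4)] xy \<gamma>(1-4) by auto
    \<comment> \<open>A nonzero polynomial has finitely many roots, so some parameter
      \<open>t\<close> avoids the zeros of both numerators and of the denominator; there
      \<open>f\<close> and \<open>g\<close> are both nonzero.\<close>
    then have "P * Q * D \<noteq> 0" using \<gamma>(3) by auto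
    then have "finite {t. poly (P * Q * D) t = 0}" by (rule poly_roots_finite)
    then obtain t where "t \<notin> {t. poly (P * Q * D) t = 0}"
      using ex_new_if_finite[OF infinite_UNIV_char_0[where 'a = complex]] by blast
    then have "poly P t \<noteq> 0" "poly Q t \<noteq> 0" "poly D t \<noteq> 0" by auto
    then have "f (\<gamma> t) * g (\<gamma> t) \<noteq> 0" using P Q by fastforce
    then show False using fg(3) \<gamma>(5) \<open>poly D t \<noteq> 0\<close> by blast
  qed
qed (use assms(1) in blast)

section \<open>Growth of the coordinate ring\<close>

text \<open>\<open>hilbert_ge N Z d m\<close>: the polynomials of degree at most \<open>d\<close>, restricted to \<open>Z\<close>, contain
  \<open>m\<close> linearly independent ones.\<close>

definition hilbert_ge :: "nat \<Rightarrow> complex mat set \<Rightarrow> nat \<Rightarrow> nat \<Rightarrow> bool" where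
  "hilbert_ge N Z d m \<longleftrightarrow> (\<exists>g. (\<forall>j<m. pdeg N d (g j)) \<and>
     (\<forall>c. (\<forall>z\<in>Z. (\<Sum>j<m. c j * g j z) = 0) \<longrightarrow> (\<forall>j<m. c j = 0)))"

text \<open>Only an upper bound on the Hilbert function. The least admissible exponent plays the
  role of the dimension of the closure of \<open>Z\<close> in the space of matrices.\<close>

definition growth :: "nat \<Rightarrow> complex mat set \<Rightarrow> nat \<Rightarrow> bool" where
  "growth N Z r \<longleftrightarrow> (\<exists>C. \<forall>d m. hilbert_ge N Z d m \<longrightarrow> m \<le> C * (d + 1) ^ r)"

lemma pdeg_lincomb: "(\<And>j. j < m \<Longrightarrow> pdeg N d (g j)) \<Longrightarrow> pdeg N d (\<lambda>A. \<Sum>j<m. c j * g j A)" for m :: nat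
  by (rule pdeg_sum) (auto intro: pdeg_cmult)

text \<open>A combination vanishing on \<open>Z\<close> vanishes on \<open>W\<close> by density, so
  functions independent on \<open>W\<close> are independent on \<open>Z\<close>.\<close>

lemma hilbert_ge_dense:
  assumes "zdense N Z W" "hilbert_ge N W d m" shows "hilbert_ge N Z d m"
proof -
  obtain g where g: "\<And>j. j < m \<Longrightarrow> pdeg N d (g j)"
    "\<And>c. (\<forall>z\<in>W. (\<Sum>j<m. c j * g j z) = 0) \<Longrightarrow> (\<forall>j<m. c j = 0)"
    using assms(2) unfolding hilbert_ge_def by auto
  show ?thesis unfolding hilbert_ge_def
  proof (intro exI[of _ g] conjI allI impI)
    fix c j assume c: "\<forall>z\<in>Z. (\<Sum>j<m. c j * g j z) = 0" and "j < m"
    have "(\<lambda>z. \<Sum>j<m. c j * g j z) \<in> poly_funs N"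
      by (rule pdeg_poly_funs[OF pdeg_lincomb]) (rule g(1))
    then have "\<forall>z\<in>W. (\<Sum>j<m. c j * g j z) = 0"
      using bspec[OF assms(1)[unfolded zdense_def], of "\<lambda>z. \<Sum>j<m. c j * g j z"] c by simp
    from g(2)[OF this] show "c j = 0" using \<open>j < m\<close> by simp
  qed (use g(1) in simp)
qed

lemma growth_dense: "growth N Z r \<Longrightarrow> zdense N Z W \<Longrightarrow> growth N W r"
  unfolding growth_def by (blast dest: hilbert_ge_dense)

lemma growth_subset: "growth N Z r \<Longrightarrow> W \<subseteq> Z \<Longrightarrow> growth N W r"
  by (rule growth_dense[OF _ zdense_mono])

lemma hilbert_ge_mono_degree:
  assumes "hilbert_ge N Z d m" "d \<le> e" shows "hilbert_ge N Z e m"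
proof -
  obtain g where g: "\<forall>j<m. pdeg N d (g j)"
    "\<forall>c. (\<forall>z\<in>Z. (\<Sum>j<m. c j * g j z) = 0) \<longrightarrow> (\<forall>j<m. c j = 0)"
    using assms(1) unfolding hilbert_ge_def by (elim exE conjE)
  have "\<forall>j<m. pdeg N e (g j)" using g(1) pdeg_mono[OF _ assms(2)] by simp
  then show ?thesis unfolding hilbert_ge_def using g(2) by (intro exI[of _ g] conjI)
qed

text \<open>Functions independent on \<open>Z'\<close>, multiplied by \<open>f\<close>, are put next
  to functions independent on \<open>Z\<close>. Restricting a relation to \<open>Z\<close> kills the
  products and hence the second set of coefficients; what remains is \<open>f\<close> times a
  combination, and irreducibility of \<open>Z'\<close> cancels \<open>f\<close>.\<close>

lemma hilbert_ge_add:
  assumes irr: "zirr N Z'" and sub: "Z \<subseteq> Z'"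
    and f: "pdeg N a f" "\<forall>z\<in>Z. f z = 0" "w \<in> Z'" "f w \<noteq> 0"
    and m: "hilbert_ge N Z (d + a) m" and m': "hilbert_ge N Z' d m'"
  shows "hilbert_ge N Z' (d + a) (m' + m)"
proof -
  obtain g where g: "\<And>j. j < m \<Longrightarrow> pdeg N (d + a) (g j)"
    "\<And>c. (\<forall>z\<in>Z. (\<Sum>j<m. c j * g j z) = 0) \<Longrightarrow> (\<forall>j<m. c j = 0)"
    using m unfolding hilbert_ge_def by blast
  obtain g' where g': "\<And>j. j < m' \<Longrightarrow> pdeg N d (g' j)"
    "\<And>c. (\<forall>z\<in>Z'. (\<Sum>j<m'. c j * g' j z) = 0) \<Longrightarrow> (\<forall>j<m'. c j = 0)"
    using m' unfolding hilbert_ge_def by blast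
  define G where "G j = (if j < m' then (\<lambda>A. g' j A * f A) else g (j - m'))" for j
  have G: "pdeg N (d + a) (G j)" if "j < m' + m" for j
    using that g g' f(1) unfolding G_def by (auto intro: pdeg.mult)
  have split: "(\<Sum>j<m'+m. c j * G j z) = f z * (\<Sum>j<m'. c j * g' j z) + (\<Sum>j<m. c (m' + j) * g j z)" for c z
  proof -
    have "(\<Sum>j<m'+m. c j * G j z) = (\<Sum>j<m'. c j * G j z) + (\<Sum>j<m. c (m' + j) * G (m' + j) z)"
      by (induction m) (auto simp: add.assoc)
    then show ?thesis by (simp add: G_def sum_distrib_left algebra_simps)
  qed
  have "\<forall>j<m'+m. c j = 0" if c: "\<forall>z\<in>Z'. (\<Sum>j<m'+m. c j * G j z) = 0" for c
  proof -
    have "\<forall>z\<in>Z. (\<Sum>j<m. c (m' + j) * g j z) = 0"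
      using c sub f(2) unfolding split by fastforce
    then have c1: "\<forall>j<m. c (m' + j) = 0" by (rule g(2))
    then have "\<forall>z\<in>Z'. f z * (\<Sum>j<m'. c j * g' j z) = 0"
      using c unfolding split by simp
    moreover have "f \<in> poly_funs N" by (rule pdeg_poly_funs[OF f(1)])
    moreover have "(\<lambda>z. \<Sum>j<m'. c j * g' j z) \<in> poly_funs N"
      by (rule pdeg_poly_funs[OF pdeg_lincomb]) (rule g'(1))
    ultimately have "(\<forall>z\<in>Z'. f z = 0) \<or> (\<forall>z\<in>Z'. (\<Sum>j<m'. c j * g' j z) = 0)"
      by (intro irr[unfolded zirr_def, THEN conjunct2, rule_format]) auto
    then have "\<forall>z\<in>Z'. (\<Sum>j<m'. c j * g' j z) = 0" using f(3,4) by auto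
    then have c2: "\<forall>j<m'. c j = 0" by (rule g'(2))
    show ?thesis
    proof (intro allI impI)
      fix j assume "j < m' + m"
      then show "c j = 0" using c1[rule_format, of "j - m'"] c2 by (cases "j < m'") auto
    qed
  qed
  then show ?thesis unfolding hilbert_ge_def using G by (intro exI[of _ G]) simp
qed

text \<open>Repeating \<open>hilbert_ge_add\<close> with the same \<open>f\<close> stacks
  \<open>k\<close> copies of the functions on \<open>Z\<close> into functions on \<open>Z'\<close>,
  at a cost of \<open>a\<close> in the degree for each copy.\<close>

lemma growth_strict:
  assumes irr: "zirr N Z'" and sub: "Z \<subseteq> Z'" "Z \<noteq> {}"
    and f: "f \<in> poly_funs N" "\<forall>z\<in>Z. f z = 0" "w \<in> Z'" "f w \<noteq> 0"
    and gr: "growth N Z' r"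
  shows "0 < r \<and> growth N Z (r - 1)"
proof -
  obtain a where a: "pdeg N a f" using f(1) poly_funs_iff_pdeg by blast
  obtain C where C: "\<And>d m. hilbert_ge N Z' d m \<Longrightarrow> m \<le> C * (d + 1) ^ r"
    using gr unfolding growth_def by blast
  have iter: "hilbert_ge N Z' (e + a * k) (k * m)" if "hilbert_ge N Z e m" for e m k
  proof (induction k)
    case 0
    show ?case unfolding hilbert_ge_def by simp
  next
    case (Suc k)
    have "hilbert_ge N Z (e + a * k + a) m" using that by (rule hilbert_ge_mono_degree) simp
    then show ?case
      using hilbert_ge_add[OF irr sub(1) a f(2-4) _ Suc.IH] by (simp add: algebra_simps)
  qed
  \<comment> \<open>With \<open>k = e + 1\<close> copies the degree reached is less than a constant
    times \<open>e + 1\<close>, so dividing by \<open>e + 1\<close> lowers the exponent by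
    one.\<close>
  have bound: "(e + 1) * m \<le> C * (a + 1) ^ r * (e + 1) ^ r" if "hilbert_ge N Z e m" for e m
  proof -
    have "(e + 1) * m \<le> C * ((e + a * (e + 1)) + 1) ^ r"
      by (rule C) (rule iter[OF that])
    also have "(e + a * (e + 1)) + 1 = (a + 1) * (e + 1)" by (simp add: algebra_simps)
    finally show ?thesis by (simp only: power_mult_distrib mult.assoc)
  qed
  have one: "hilbert_ge N Z e 1" for e
    unfolding hilbert_ge_def using sub(2) by (intro exI[of _ "\<lambda>j A. 1"]) (auto intro: pdeg.const)
  \<comment> \<open>Exponent \<open>0\<close> would bound \<open>e + 1\<close> by a constant for
    every \<open>e\<close>.\<close>
  have r: "0 < r"
  proof (rule ccontr)
    assume "\<not> 0 < r"
    then have "e + 1 \<le> C" for e using bound[OF one[of e]] by simp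
    from this[of C] show False by simp
  qed
  moreover have "growth N Z (r - 1)"
    unfolding growth_def
  proof (intro exI[of _ "C * (a + 1) ^ r"] allI impI)
    fix d m assume "hilbert_ge N Z d m"
    from bound[OF this] have "(d + 1) * m \<le> (d + 1) * (C * (a + 1) ^ r * (d + 1) ^ (r - 1))"
      using r by (cases r) (auto simp: algebra_simps)
    then show "m \<le> C * (a + 1) ^ r * (d + 1) ^ (r - 1)"
      by (simp only: mult_le_cancel1)
  qed
  ultimately show ?thesis by blast
qed

section \<open>Upper bounds for the growth of one-parameter families\<close>

lemma homogeneous_system:
  fixes a :: "nat \<Rightarrow> 'q \<Rightarrow> complex"
  assumes "finite Q" "card Q < m"
  obtains c where "\<exists>i<m. c i \<noteq> 0" "\<And>q. q \<in> Q \<Longrightarrow> (\<Sum>i<m. c i * a i q) = 0"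
proof -
  obtain e where e: "bij_betw e {..<card Q} Q"
    using ex_bij_betw_nat_finite[OF assms(1)] by (auto simp: atLeast0LessThan)
  \<comment> \<open>Zero rows complete the coefficient matrix to a square one. Row
    \<open>card Q\<close> is one of them, so the determinant vanishes and a kernel vector
    exists.\<close>
  define A where "A = mat m m (\<lambda>(j, i). if j < card Q then a i (e j) else 0)"
  have A: "A \<in> carrier_mat m m" by (simp add: A_def)
  have "det A = 0"
  proof -
    have "det A = (\<Sum>p\<in>{p. p permutes {0..<m}}. signof p * (\<Prod>i = 0..<m. A $$ (i, p i)))"
      by (rule det_def'[OF A])
    also have "\<dots> = 0"
    proof (rule sum.neutral, rule ballI)
      fix p assume "p \<in> {p. p permutes {0..<m}}"
      then have "p (card Q) < m" using assms(2) permutes_in_image[of p "{0..<m}" "card Q"] by auto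
      then have "A $$ (card Q, p (card Q)) = 0" using assms(2) by (simp add: A_def)
      then have "(\<Prod>i = 0..<m. A $$ (i, p i)) = 0" using assms(2) by (intro prod_zero) auto
      then show "signof p * (\<Prod>i = 0..<m. A $$ (i, p i)) = 0" by simp
    qed
    finally show ?thesis .
  qed
  then obtain v where v: "v \<in> carrier_vec m" "v \<noteq> 0\<^sub>v m" "A *\<^sub>v v = 0\<^sub>v m"
    using det_0_iff_vec_prod_zero[OF A] by blast
  have "\<exists>i<m. v $ i \<noteq> 0" 
  proof (rule ccontr)
    assume "\<not> ?thesis"
    then have "v = 0\<^sub>v m" using v(1) by (intro eq_vecI) auto
    then show False using v(2) by simp
  qed
  moreover have "(\<Sum>i<m. v $ i * a i q) = 0" if "q \<in> Q" for q
  proof -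
    have "q \<in> e ` {..<card Q}" using e that by (simp add: bij_betw_def)
    then obtain j where j: "j < card Q" "q = e j" by auto
    have "(A *\<^sub>v v) $ j = 0" using v(3) j assms(2) by simp
    then show ?thesis using j assms(2) v(1)
      by (simp add: A_def scalar_prod_def mult.commute atLeast0LessThan)
  qed
  ultimately show ?thesis by (intro that)
qed

text \<open>A maximal independent family spans: adjoining \<open>f\<close> to it produces a
  relation, in which the coefficient of \<open>f\<close> cannot be zero.\<close>

lemma hilbert_span:
  assumes bound: "\<And>m. hilbert_ge N Z d m \<Longrightarrow> m \<le> k"
  obtains K g where "K \<le> k" "\<And>f. pdeg N d f \<Longrightarrow> \<exists>c. \<forall>z\<in>Z. f z = (\<Sum>j<K. c j * g j z)"
proof -
  define K where "K = (GREATEST m. hilbert_ge N Z d m)"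
  have "hilbert_ge N Z d 0" by (simp add: hilbert_ge_def)
  then have K: "hilbert_ge N Z d K" and max: "\<And>m. hilbert_ge N Z d m \<Longrightarrow> m \<le> K"
    unfolding K_def using bound by (blast intro: GreatestI_nat Greatest_le_nat)+
  obtain g where g: "\<And>j. j < K \<Longrightarrow> pdeg N d (g j)"
    "\<And>c. (\<forall>z\<in>Z. (\<Sum>j<K. c j * g j z) = 0) \<Longrightarrow> (\<forall>j<K. c j = 0)"
    using K unfolding hilbert_ge_def by blast
  show thesis
  proof (rule that[of K g])
    show "K \<le> k" by (rule bound[OF K])
    fix f assume f: "pdeg N d f"
    have "\<not> hilbert_ge N Z d (Suc K)" using max[of "Suc K"] by auto
    moreover have "\<forall>j<Suc K. pdeg N d ((g(K := f)) j)" using g(1) f by (auto simp: less_Suc_eq)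
    moreover have "hilbert_ge N Z d (Suc K)"
      if "\<And>c. \<forall>z\<in>Z. (\<Sum>j<Suc K. c j * (g(K := f)) j z) = 0 \<Longrightarrow> \<forall>j<Suc K. c j = 0"
      unfolding hilbert_ge_def using calculation(2) that by (intro exI[of _ "g(K := f)"]) simp
    ultimately obtain c where c: "\<forall>z\<in>Z. (\<Sum>j<Suc K. c j * (g(K := f)) j z) = 0" "\<not> (\<forall>j<Suc K. c j = 0)"
      by metis
    have c': "(\<Sum>j<K. c j * g j z) + c K * f z = 0" if "z \<in> Z" for z
      using c(1) that by simp
    have cK: "c K \<noteq> 0"
    proof
      assume "c K = 0"
      then have "\<forall>j<K. c j = 0" using g(2)[of c] c' by simp
      then show False using c(2) \<open>c K = 0\<close> by (auto simp: less_Suc_eq)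
    qed
    have "f z = (\<Sum>j<K. (- c j / c K) * g j z)" if "z \<in> Z" for z
    proof -
      have "c K * f z = - (\<Sum>j<K. c j * g j z)" using c'[OF that] by (simp add: eq_neg_iff_add_eq_0 add.commute)
      then have "f z = - (\<Sum>j<K. c j * g j z) / c K" using cK by (simp add: field_simps)
      then show ?thesis by (simp add: sum_divide_distrib sum_negf)
    qed
    then show "\<exists>c. \<forall>z\<in>Z. f z = (\<Sum>j<K. c j * g j z)"
      by (intro exI[of _ "\<lambda>j. - c j / c K"] ballI)
  qed
qed

text \<open>The coefficients of the powers of \<open>t\<close> are kept as functions of the point
  \<open>z\<close>, with the same degree bound \<open>d\<close>, so that they can be expanded in a
  spanning family of the functions on \<open>Z\<close>.\<close>

lemma pdeg_along_line:
  assumes "pdeg N d f"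
    and "\<And>r c. r < N \<Longrightarrow> c < N \<Longrightarrow> pdeg N 1 (u r c) \<and> pdeg N 1 (v r c)"
  shows "\<exists>F. (\<forall>z. degree (F z) \<le> d) \<and> (\<forall>e. pdeg N d (\<lambda>z. coeff (F z) e)) \<and>
     (\<forall>z t B. (\<forall>r<N. \<forall>c<N. B $$ (r, c) = u r c z + t * v r c z) \<longrightarrow> f B = poly (F z) t)"
  using assms(1)
proof induction
  case (const d a)
  show ?case
    by (rule exI[of _ "\<lambda>z. [:a:]"]) (auto simp: coeff_pCons split: nat.splits intro: pdeg.const)
next
  case (entry r c d)
  have "pdeg N (Suc d) (u r c)" "pdeg N (Suc d) (v r c)"
    using assms(2)[OF entry] pdeg_mono[of N 1 _ "Suc d"] by auto
  then have "pdeg N (Suc d) (\<lambda>z. coeff [:u r c z, v r c z:] e)" for e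
    by (cases e; cases "e - 1") (auto simp: coeff_pCons intro: pdeg.const)
  moreover have "degree [:u r c z, v r c z:] \<le> Suc d" for z
    by (rule degree_le) (auto simp: coeff_pCons split: nat.splits)
  ultimately show ?case using entry
    by (intro exI[of _ "\<lambda>z. [:u r c z, v r c z:]"]) auto
next
  case (add d f g)
  then obtain F G where
    FG: "\<forall>z. degree (F z) \<le> d" "\<forall>e. pdeg N d (\<lambda>z. coeff (F z) e)"
    "\<forall>z t B. (\<forall>r<N. \<forall>c<N. B $$ (r, c) = u r c z + t * v r c z) \<longrightarrow> f B = poly (F z) t"
    "\<forall>z. degree (G z) \<le> d" "\<forall>e. pdeg N d (\<lambda>z. coeff (G z) e)"
    "\<forall>z t B. (\<forall>r<N. \<forall>c<N. B $$ (r, c) = u r c z + t * v r c z) \<longrightarrow> g B = poly (G z) t"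
    by blast
  have "f B + g B = poly (F z + G z) t" if "\<forall>r<N. \<forall>c<N. B $$ (r, c) = u r c z + t * v r c z" for z t B
    using FG(3)[rule_format, of B z t] FG(6)[rule_format, of B z t] that by simp
  moreover have "degree (F z + G z) \<le> d" for z using FG(1,4) by (simp add: degree_add_le)
  moreover have "pdeg N d (\<lambda>z. coeff (F z + G z) k)" for k
    unfolding coeff_add using FG(2,5) by (intro pdeg.add) auto
  ultimately show ?case
    by (intro exI[of _ "\<lambda>z. F z + G z"]) simp
next
  case (mult d f e g)
  then obtain F G where
    FG: "\<forall>z. degree (F z) \<le> d" "\<forall>e. pdeg N d (\<lambda>z. coeff (F z) e)"
    "\<forall>z t B. (\<forall>r<N. \<forall>c<N. B $$ (r, c) = u r c z + t * v r c z) \<longrightarrow> f B = poly (F z) t"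
    "\<forall>z. degree (G z) \<le> e" "\<forall>e'. pdeg N e (\<lambda>z. coeff (G z) e')"
    "\<forall>z t B. (\<forall>r<N. \<forall>c<N. B $$ (r, c) = u r c z + t * v r c z) \<longrightarrow> g B = poly (G z) t"
    by blast
  have "degree (F z * G z) \<le> d + e" for z
    using degree_mult_le[of "F z" "G z"] FG(1,4) by (meson add_mono order_trans)
  moreover have "pdeg N (d + e) (\<lambda>z. coeff (F z * G z) k)" for k
    unfolding coeff_mult using FG(2,5) by (intro pdeg_sum pdeg.mult) auto
  moreover have "f B * g B = poly (F z * G z) t" if "\<forall>r<N. \<forall>c<N. B $$ (r, c) = u r c z + t * v r c z" for z t B
    using FG(3)[rule_format, of B z t] FG(6)[rule_format, of B z t] that by simp
  ultimately show ?case
    by (intro exI[of _ "\<lambda>z. F z * G z"]) simp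
qed

text \<open>A function of degree \<open>d\<close> on \<open>W\<close> is determined by
  \<open>d + 1\<close> coefficients, each a combination of at most \<open>C (d + 1)^r\<close>
  functions on \<open>Z\<close>. One parameter thus costs at most one power of
  \<open>d + 1\<close>.\<close>

lemma growth_line:
  assumes gr: "growth N Z r"
    and uv: "\<And>r c. r < N \<Longrightarrow> c < N \<Longrightarrow> pdeg N 1 (u r c) \<and> pdeg N 1 (v r c)"
    and W: "\<And>w. w \<in> W \<Longrightarrow> \<exists>z\<in>Z. \<exists>t. \<forall>r<N. \<forall>c<N. w $$ (r, c) = u r c z + t * v r c z"
  shows "growth N W (Suc r)"
proof -
  obtain C where C: "\<And>d m. hilbert_ge N Z d m \<Longrightarrow> m \<le> C * (d + 1) ^ r"
    using gr unfolding growth_def by blast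
  show ?thesis unfolding growth_def
  proof (intro exI[of _ C] allI impI)
    fix d m assume "hilbert_ge N W d m"
    then obtain f where f: "\<And>i. i < m \<Longrightarrow> pdeg N d (f i)"
      "\<And>c. (\<forall>z\<in>W. (\<Sum>i<m. c i * f i z) = 0) \<Longrightarrow> (\<forall>i<m. c i = 0)"
      unfolding hilbert_ge_def by blast
    obtain K g where K: "K \<le> C * (d + 1) ^ r"
      and g: "\<And>f. pdeg N d f \<Longrightarrow> \<exists>c. \<forall>z\<in>Z. f z = (\<Sum>j<K. c j * g j z)"
      using hilbert_span[OF C] by blast
    let ?P = "\<lambda>i F. (\<forall>z. degree (F z) \<le> d) \<and> (\<forall>e. pdeg N d (\<lambda>z. coeff (F z) e)) \<and>
       (\<forall>z t B. (\<forall>r<N. \<forall>c<N. B $$ (r, c) = u r c z + t * v r c z) \<longrightarrow> f i B = poly (F z) t)"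
    define F where "F i = (SOME F. ?P i F)" for i
    have "?P i (F i)" if "i < m" for i
      unfolding F_def by (rule someI_ex[of "?P i"]) (rule pdeg_along_line[OF f(1)[OF that] uv])
    then have F: "\<And>i z. i < m \<Longrightarrow> degree (F i z) \<le> d"
      "\<And>i e. i < m \<Longrightarrow> pdeg N d (\<lambda>z. coeff (F i z) e)"
      "\<And>i z t B. i < m \<Longrightarrow> (\<forall>r<N. \<forall>c<N. B $$ (r, c) = u r c z + t * v r c z) \<Longrightarrow> f i B = poly (F i z) t"
      by simp_all
    define a where "a i e = (SOME c. \<forall>z\<in>Z. coeff (F i z) e = (\<Sum>j<K. c j * g j z))" for i e
    have "\<forall>z\<in>Z. coeff (F i z) e = (\<Sum>j<K. a i e j * g j z)" if "i < m" for i e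
      unfolding a_def
      by (rule someI_ex[of "\<lambda>c. \<forall>z\<in>Z. coeff (F i z) e = (\<Sum>j<K. c j * g j z)"]) (rule g[OF F(2)[OF that]])
    then have a: "\<And>i e z. i < m \<Longrightarrow> z \<in> Z \<Longrightarrow> coeff (F i z) e = (\<Sum>j<K. a i e j * g j z)"
      by simp
    \<comment> \<open>The unknowns are the coefficients of a combination of the \<open>f i\<close>;
      there is one equation for each power \<open>e \<le> d\<close> and each spanning function
      \<open>j < K\<close>.\<close>
    have "m \<le> (d + 1) * K"
    proof (rule ccontr)
      assume "\<not> m \<le> (d + 1) * K"
      then have "card ({..d} \<times> {..<K}) < m" by (simp add: card_cartesian_product)
      then obtain c where c: "\<exists>i<m. c i \<noteq> 0"
        "\<And>q. q \<in> {..d} \<times> {..<K} \<Longrightarrow> (\<Sum>i<m. c i * (case q of (e, j) \<Rightarrow> a i e j)) = 0"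
        using homogeneous_system[of "{..d} \<times> {..<K}" m "\<lambda>i q. case q of (e, j) \<Rightarrow> a i e j"] by auto
      have "(\<Sum>i<m. c i * f i w) = 0" if "w \<in> W" for w
      proof -
        obtain z t where z: "z \<in> Z" "\<forall>r<N. \<forall>c<N. w $$ (r, c) = u r c z + t * v r c z"
          using W[OF \<open>w \<in> W\<close>] by blast
        have "f i w = (\<Sum>e\<le>d. \<Sum>j<K. a i e j * (g j z * t ^ e))" if "i < m" for i
        proof -
          have "f i w = poly (F i z) t" using F(3)[OF that z(2)] .
          also have "\<dots> = (\<Sum>e\<le>d. coeff (F i z) e * t ^ e)"
            unfolding poly_altdef using F(1)[OF that, of z]
            by (intro sum.mono_neutral_left) (auto simp: coeff_eq_0)
          finally show ?thesis using a[OF that z(1)] by (simp add: sum_distrib_right mult.assoc)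
        qed
        then have "(\<Sum>i<m. c i * f i w) = (\<Sum>i<m. \<Sum>e\<le>d. \<Sum>j<K. (c i * a i e j) * (g j z * t ^ e))"
          by (simp add: sum_distrib_left mult.assoc)
        also have "\<dots> = (\<Sum>e\<le>d. \<Sum>j<K. (\<Sum>i<m. c i * a i e j) * (g j z * t ^ e))"
          unfolding sum_distrib_right
          by (subst sum.swap, rule sum.cong[OF refl], subst sum.swap, rule refl)
        also have "\<dots> = 0" using c(2) by (intro sum.neutral ballI) auto
        finally show ?thesis .
      qed
      then have "\<forall>i<m. c i = 0" by (intro f(2)) simp
      then show False using c(1) by blast
    qed
    also have "\<dots> \<le> (d + 1) * (C * (d + 1) ^ r)" using K by (rule mult_le_mono2)
    finally show "m \<le> C * (d + 1) ^ Suc r" by (simp add: algebra_simps)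
  qed
qed

lemma growth_mult_line:
  assumes gr: "growth N Z r" "Z \<subseteq> carrier_mat N N" "A0 \<in> carrier_mat N N" "A1 \<in> carrier_mat N N"
    and W: "\<And>w. w \<in> W \<Longrightarrow> \<exists>z\<in>Z. \<exists>t. w = z * (A0 + t \<cdot>\<^sub>m A1)"
  shows "growth N W (Suc r)"
proof -
  let ?u = "\<lambda>r c A. \<Sum>s<N. A0 $$ (s, c) * A $$ (r, s)"
  let ?v = "\<lambda>r c A. \<Sum>s<N. A1 $$ (s, c) * A $$ (r, s)"
  have uv: "pdeg N 1 (?u r c) \<and> pdeg N 1 (?v r c)" if "r < N" "c < N" for r c
    using that by (auto intro!: pdeg_sum pdeg_cmult pdeg.entry)
  have line: "\<exists>z\<in>Z. \<exists>t. \<forall>r<N. \<forall>c<N. w $$ (r, c) = ?u r c z + t * ?v r c z" if "w \<in> W" for w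
  proof -
    obtain z t where z: "z \<in> Z" "w = z * (A0 + t \<cdot>\<^sub>m A1)" using W[OF \<open>w \<in> W\<close>] by blast
    have "w $$ (r, c) = ?u r c z + t * ?v r c z" if "r < N" "c < N" for r c
    proof -
      have "w $$ (r, c) = (\<Sum>s<N. z $$ (r, s) * (A0 + t \<cdot>\<^sub>m A1) $$ (s, c))"
        unfolding z(2) by (rule mult_mat_entry) (use z gr that in auto)
      also have "\<dots> = (\<Sum>s<N. A0 $$ (s, c) * z $$ (r, s) + t * (A1 $$ (s, c) * z $$ (r, s)))"
        using gr(3,4) that by (intro sum.cong) (auto simp: algebra_simps)
      finally show ?thesis by (simp add: sum.distrib sum_distrib_left)
    qed
    then show ?thesis using z(1) by blast
  qed
  show ?thesis by (rule growth_line[OF gr(1) uv line])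
qed

text \<open>The substitution \<open>A \<mapsto> q A\<close> keeps degrees and undoes the translation
  by \<open>p\<close>, so it carries functions independent on \<open>Z\<close> to functions
  independent on \<open>p Z\<close>.\<close>

lemma growth_left_translate:
  assumes gr: "growth N ((*) p ` Z) r" and Z: "Z \<subseteq> carrier_mat N N"
    and p: "p \<in> carrier_mat N N" "q \<in> carrier_mat N N" "q * p = 1\<^sub>m N"
  shows "growth N Z r"
proof -
  let ?\<phi> = "\<lambda>A. mat N N (\<lambda>(r, c). \<Sum>s<N. q $$ (r, s) * A $$ (s, c))"
  have "pdeg N 1 (\<lambda>A. ?\<phi> A $$ (r, c))" if "r < N" "c < N" for r c
    using that by (auto intro!: pdeg_sum pdeg_cmult pdeg.entry)
  then have sub: "pdeg N d (\<lambda>A. f (?\<phi> A))" if "pdeg N d f" for d f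
    by (rule pdeg_subst[OF that])
  have eq: "f (?\<phi> (p * z)) = f z" if "f \<in> poly_funs N" "z \<in> Z" for f z
  proof (rule poly_funs_cong[OF that(1)])
    fix r c assume rc: "r < N" "c < N"
    have z: "z \<in> carrier_mat N N" using that(2) Z by blast
    have "?\<phi> (p * z) $$ (r, c) = (q * (p * z)) $$ (r, c)"
      using mult_mat_entry[of q N N "p * z" N r c] rc p z by simp
    also have "q * (p * z) = z"
      using p z by (simp add: assoc_mult_mat[symmetric, of q N N p N z N])
    finally show "?\<phi> (p * z) $$ (r, c) = z $$ (r, c)" .
  qed
  have "hilbert_ge N ((*) p ` Z) d m" if hil: "hilbert_ge N Z d m" for d m
  proof -
    obtain g where g: "\<And>j. j < m \<Longrightarrow> pdeg N d (g j)"
      "\<And>c. (\<forall>z\<in>Z. (\<Sum>j<m. c j * g j z) = 0) \<Longrightarrow> (\<forall>j<m. c j = 0)"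
      using hil unfolding hilbert_ge_def by auto
    have "\<forall>j<m. c j = 0" if "\<forall>z\<in>(*) p ` Z. (\<Sum>j<m. c j * g j (?\<phi> z)) = 0" for c
    proof (rule g(2), rule ballI)
      fix z assume z: "z \<in> Z"
      have "(\<Sum>j<m. c j * g j (?\<phi> (p * z))) = 0" using that z by blast
      then show "(\<Sum>j<m. c j * g j z) = 0"
        using eq[OF pdeg_poly_funs[OF g(1)] z] by simp
    qed
    then show ?thesis
      unfolding hilbert_ge_def using sub[OF g(1)]
      by (intro exI[of _ "\<lambda>j A. g j (?\<phi> A)"]) simp
  qed
  then show ?thesis using gr unfolding growth_def by blast
qed

lemma growth_singleton: "growth N {z} 0"
  unfolding growth_def
proof (intro exI[of _ 1] allI impI)
  fix d m assume "hilbert_ge N {z} d m"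
  then obtain g where "\<forall>j<m. pdeg N d (g j)"
    "\<forall>c. (\<forall>z\<in>{z}. (\<Sum>j<m. c j * g j z) = 0) \<longrightarrow> (\<forall>j<m. c j = 0)"
    unfolding hilbert_ge_def by (elim exE conjE)
  then have g: "(\<Sum>j<m. c j * g j z) = 0 \<Longrightarrow> (\<forall>j<m. c j = 0)" for c by simp
  show "m \<le> 1 * (d + 1) ^ 0"
  proof (rule ccontr)
    assume "\<not> m \<le> 1 * (d + 1) ^ 0"
    then have m: "card {()} < m" by simp
    then obtain c where "\<exists>i<m. c i \<noteq> 0" "(\<Sum>i<m. c i * g i z) = 0"
      using homogeneous_system[of "{()}" m "\<lambda>i q. g i z"] by auto
    then show False using g[of c] by blast
  qed
qed

section \<open>Coordinate subspaces of matrices and their growth\<close>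

definition supp_mat :: "nat \<Rightarrow> (nat \<times> nat) set \<Rightarrow> complex mat set" where
  "supp_mat N S = {A \<in> carrier_mat N N. \<forall>r<N. \<forall>c<N. (r, c) \<notin> S \<longrightarrow> A $$ (r, c) = 0}"

lemma zirr_supp_mat: "zirr N (supp_mat N S)"
proof (rule zirr_rational_curves)
  have "0\<^sub>m N N \<in> supp_mat N S" by (simp add: supp_mat_def)
  then show "supp_mat N S \<noteq> {}" by blast
  fix x y assume xy: "x \<in> supp_mat N S" "y \<in> supp_mat N S"
  let ?\<gamma> = "\<lambda>t. mat N N (\<lambda>(r, c). x $$ (r, c) + t * (y $$ (r, c) - x $$ (r, c)))"
  have "\<exists>P. \<forall>t. poly 1 t \<noteq> 0 \<longrightarrow> ?\<gamma> t $$ (r, c) * poly 1 t = poly P t" if "r < N" "c < N" for r c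
    using that by (intro exI[of _ "[:x $$ (r, c), y $$ (r, c) - x $$ (r, c):]"]) simp
  moreover have "?\<gamma> 0 = x" "?\<gamma> 1 = y" "\<And>t. ?\<gamma> t \<in> supp_mat N S"
    using xy unfolding supp_mat_def by (auto intro!: eq_matI)
  ultimately show "\<exists>\<gamma> D. \<gamma> 0 = x \<and> \<gamma> 1 = y \<and> poly D 0 \<noteq> 0 \<and> poly D 1 \<noteq> 0 \<and>
      (\<forall>t. poly D t \<noteq> 0 \<longrightarrow> \<gamma> t \<in> supp_mat N S) \<and>
      (\<forall>r<N. \<forall>c<N. \<exists>P. \<forall>t. poly D t \<noteq> 0 \<longrightarrow> \<gamma> t $$ (r, c) * poly D t = poly P t)"
    by (intro exI[of _ ?\<gamma>] exI[of _ 1]) simp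
qed

lemma growth_supp_mat:
  assumes "S \<subseteq> {..<N} \<times> {..<N}"
  shows "growth N (supp_mat N S) (card S)"
proof -
  have "finite S" using assms by (rule finite_subset) simp
  then show ?thesis using assms
  proof induction
    case empty
    have "supp_mat N {} = {0\<^sub>m N N}" unfolding supp_mat_def by (auto intro!: eq_matI)
    then show ?case by (simp add: growth_singleton)
  next
    case (insert x S)
    obtain i j where x: "x = (i, j)" "i < N" "j < N" using insert.prems by auto
    have "growth N (supp_mat N (insert x S)) (Suc (card S))"
    proof (rule growth_line[OF insert.IH, of "\<lambda>r c A. A $$ (r, c)" "\<lambda>r c A. if r = i \<and> c = j then 1 else 0"])
      show "S \<subseteq> {..<N} \<times> {..<N}" using insert.prems by blast
      show "pdeg N 1 (\<lambda>A. A $$ (r, c)) \<and> pdeg N 1 (\<lambda>A. if r = i \<and> c = j then 1 else 0)"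
        if "r < N" "c < N" for r c
        using that by (simp add: pdeg.const pdeg.entry)
      fix w assume w: "w \<in> supp_mat N (insert x S)"
      let ?z = "mat N N (\<lambda>(r, c). if r = i \<and> c = j then 0 else w $$ (r, c))"
      have "?z \<in> supp_mat N S" using w x by (auto simp: supp_mat_def)
      moreover have "\<forall>r<N. \<forall>c<N. w $$ (r, c) = ?z $$ (r, c) + w $$ (i, j) * (if r = i \<and> c = j then 1 else 0)"
        by auto
      ultimately show "\<exists>z\<in>supp_mat N S. \<exists>t. \<forall>r<N. \<forall>c<N. w $$ (r, c) = z $$ (r, c) + t * (if r = i \<and> c = j then 1 else 0)"
        by blast
    qed
    then show ?case using insert.hyps by simp
  qed
qed

text \<open>Each coordinate in \<open>S\<close> vanishes on the subspace without it and not on the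
  one with it, so by \<open>growth_strict\<close> removing it costs one in the exponent, which never
  drops below zero.\<close>

lemma growth_supp_mat_ge:
  assumes "S \<subseteq> {..<N} \<times> {..<N}" "growth N (supp_mat N S) r"
  shows "card S \<le> r"
proof -
  have "finite S" using assms(1) by (rule finite_subset) simp
  then show ?thesis using assms
  proof (induction arbitrary: r)
    case (insert x S)
    obtain i j where x: "x = (i, j)" "i < N" "j < N" using insert.prems by auto
    let ?w = "mat N N (\<lambda>(r, c). if r = i \<and> c = j then 1 else 0 :: complex)"
    have "0 < r \<and> growth N (supp_mat N S) (r - 1)"
    proof (rule growth_strict[OF zirr_supp_mat])
      show "(\<lambda>A. A $$ (i, j)) \<in> poly_funs N" using x by (auto intro: poly_funs.entry)
      show "?w \<in> supp_mat N (insert x S)" using x by (auto simp: supp_mat_def)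
      have "0\<^sub>m N N \<in> supp_mat N S" by (simp add: supp_mat_def)
      then show "supp_mat N S \<noteq> {}" by blast
      show "\<forall>z\<in>supp_mat N S. z $$ (i, j) = 0" using insert.hyps x by (auto simp: supp_mat_def)
    qed (use insert.prems x in \<open>auto simp: supp_mat_def\<close>)
    then have "0 < r" "card S \<le> r - 1"
      using insert.prems by (auto intro!: insert.IH)
    then show ?case using insert.hyps by simp
  qed simp
qed

section \<open>The special linear group and its subgroups\<close>

lemma SL_carrier_iff: "g \<in> carrier (SL N) \<longleftrightarrow> g \<in> carrier_mat N N \<and> det g = 1"
  by (simp add: SL_def)

lemma SL_carrier_mat: "g \<in> carrier (SL N) \<Longrightarrow> g \<in> carrier_mat N N"
  by (simp add: SL_def)

lemma SL_mult [simp]: "x \<otimes>\<^bsub>SL N\<^esub> y = x * y"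
  by (simp add: SL_def)

lemma SL_one [simp]: "\<one>\<^bsub>SL N\<^esub> = 1\<^sub>m N"
  by (simp add: SL_def)

lemma SL_mult_closed: "x \<in> carrier (SL N) \<Longrightarrow> y \<in> carrier (SL N) \<Longrightarrow> x * y \<in> carrier (SL N)"
  by (auto simp: SL_carrier_iff det_mult)

lemma SL_one_closed: "1\<^sub>m N \<in> carrier (SL N)"
  by (simp add: SL_carrier_iff)

lemma group_SL: "group (SL N)"
proof (rule groupI)
  fix x assume x: "x \<in> carrier (SL N)"
  then have xm: "x \<in> carrier_mat N N" "det x = 1" by (auto simp: SL_carrier_iff)
  have a: "adj_mat x \<in> carrier_mat N N" "x * adj_mat x = 1\<^sub>m N" "adj_mat x * x = 1\<^sub>m N"
    using adj_mat[OF xm(1)] xm(2) by auto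
  have "det x * det (adj_mat x) = 1" using det_mult[OF xm(1) a(1)] a(2) by simp
  then have "adj_mat x \<in> carrier (SL N)" using a(1) xm(2) by (simp add: SL_carrier_iff)
  then show "\<exists>y\<in>carrier (SL N). y \<otimes>\<^bsub>SL N\<^esub> x = \<one>\<^bsub>SL N\<^esub>" using a(3) by auto
qed (auto simp: SL_carrier_iff det_mult assoc_mult_mat[of _ N N _ N _ N])

lemma SL_assoc:
  "x \<in> carrier (SL N) \<Longrightarrow> y \<in> carrier (SL N) \<Longrightarrow> z \<in> carrier (SL N) \<Longrightarrow> x * y * z = x * (y * z)"
  by (auto simp: SL_carrier_iff assoc_mult_mat[of _ N N _ N _ N])

lemma SL_left_one: "x \<in> carrier (SL N) \<Longrightarrow> 1\<^sub>m N * x = x"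
  by (auto simp: SL_carrier_iff)

lemma SL_right_one: "x \<in> carrier (SL N) \<Longrightarrow> x * 1\<^sub>m N = x"
  by (auto simp: SL_carrier_iff)

abbreviation SL_inv :: "nat \<Rightarrow> complex mat \<Rightarrow> complex mat" where
  "SL_inv N g \<equiv> inv\<^bsub>SL N\<^esub> g"

lemma SL_inv_closed: "g \<in> carrier (SL N) \<Longrightarrow> SL_inv N g \<in> carrier (SL N)"
  by (rule group.inv_closed[OF group_SL])

lemma SL_inv_left: "g \<in> carrier (SL N) \<Longrightarrow> SL_inv N g * g = 1\<^sub>m N"
  using group.l_inv[OF group_SL, of g N] by simp

lemma SL_inv_right: "g \<in> carrier (SL N) \<Longrightarrow> g * SL_inv N g = 1\<^sub>m N"
  using group.r_inv[OF group_SL, of g N] by simp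

lemma SL_inv_mult_cancel:
  assumes "g \<in> carrier (SL N)" "x \<in> carrier (SL N)"
  shows "SL_inv N g * (g * x) = x" "g * (SL_inv N g * x) = x"
    "x * g * SL_inv N g = x" "x * SL_inv N g * g = x"
proof -
  have i: "SL_inv N g \<in> carrier (SL N)" by (rule SL_inv_closed[OF assms(1)])
  show "SL_inv N g * (g * x) = x"
    using SL_assoc[OF i assms] SL_inv_left[OF assms(1)] SL_left_one[OF assms(2)] by simp
  show "g * (SL_inv N g * x) = x"
    using SL_assoc[OF assms(1) i assms(2)] SL_inv_right[OF assms(1)] SL_left_one[OF assms(2)] by simp
  show "x * g * SL_inv N g = x"
    using SL_assoc[OF assms(2,1) i] SL_inv_right[OF assms(1)] SL_right_one[OF assms(2)] by simp
  show "x * SL_inv N g * g = x"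
    using SL_assoc[OF assms(2) i assms(1)] SL_inv_left[OF assms(1)] SL_right_one[OF assms(2)] by simp
qed

lemma SL_inv_unique:
  assumes "g \<in> carrier (SL N)" "h \<in> carrier (SL N)" "h * g = 1\<^sub>m N"
  shows "SL_inv N g = h"
  by (rule group.inv_equality[OF group_SL]) (use assms in simp_all)

lemma SL_inv_inv: "g \<in> carrier (SL N) \<Longrightarrow> SL_inv N (SL_inv N g) = g"
  by (rule group.inv_inv[OF group_SL])

section \<open>Two by two blocks in adjacent rows and columns\<close>

definition blk :: "nat \<Rightarrow> nat \<Rightarrow> complex \<Rightarrow> complex \<Rightarrow> complex \<Rightarrow> complex \<Rightarrow> complex mat" where
  "blk N i a b c d = mat N N (\<lambda>(r, s).
     if r = i then (if s = i then a else if s = Suc i then b else 0)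
     else if r = Suc i then (if s = i then c else if s = Suc i then d else 0)
     else if r = s then 1 else 0)"

lemma blk_carrier: "blk N i a b c d \<in> carrier_mat N N"
  by (simp add: blk_def)

lemma sum_two_points:
  fixes f :: "nat \<Rightarrow> complex"
  assumes "i < N" "j < N" "i \<noteq> j" "\<And>k. k < N \<Longrightarrow> k \<noteq> i \<Longrightarrow> k \<noteq> j \<Longrightarrow> f k = 0"
  shows "(\<Sum>k<N. f k) = f i + f j"
proof -
  have "(\<Sum>k<N. f k) = (\<Sum>k\<in>{i, j}. f k)"
    using assms by (intro sum.mono_neutral_right) auto
  then show ?thesis using assms(3) by simp
qed

lemma sum_one_point:
  fixes f :: "nat \<Rightarrow> complex"
  assumes "i < N" "\<And>k. k < N \<Longrightarrow> k \<noteq> i \<Longrightarrow> f k = 0"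
  shows "(\<Sum>k<N. f k) = f i"
proof -
  have "(\<Sum>k<N. f k) = (\<Sum>k\<in>{i}. f k)"
    using assms by (intro sum.mono_neutral_right) auto
  then show ?thesis by simp
qed

lemma blk_mult_left:
  assumes "Suc i < N" "M \<in> carrier_mat N N" "r < N" "s < N"
  shows "(blk N i a b c d * M) $$ (r, s) =
    (if r = i then a * M $$ (i, s) + b * M $$ (Suc i, s)
     else if r = Suc i then c * M $$ (i, s) + d * M $$ (Suc i, s) else M $$ (r, s))"
proof -
  have eq: "(blk N i a b c d * M) $$ (r, s) = (\<Sum>k<N. blk N i a b c d $$ (r, k) * M $$ (k, s))"
    by (rule mult_mat_entry[OF blk_carrier assms(2-4)])
  show ?thesis
  proof (cases "r = i \<or> r = Suc i")
    case True
    then show ?thesis unfolding eq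
      by (subst sum_two_points[of i N "Suc i"]) (use assms in \<open>auto simp: blk_def\<close>)
  next
    case False
    then show ?thesis unfolding eq
      by (subst sum_one_point[of r N]) (use assms in \<open>auto simp: blk_def\<close>)
  qed
qed

lemma blk_mult_right:
  assumes "Suc i < N" "M \<in> carrier_mat N N" "r < N" "s < N"
  shows "(M * blk N i a b c d) $$ (r, s) =
    (if s = i then a * M $$ (r, i) + c * M $$ (r, Suc i)
     else if s = Suc i then b * M $$ (r, i) + d * M $$ (r, Suc i) else M $$ (r, s))"
proof -
  have eq: "(M * blk N i a b c d) $$ (r, s) = (\<Sum>k<N. M $$ (r, k) * blk N i a b c d $$ (k, s))"
    by (rule mult_mat_entry[OF assms(2) blk_carrier assms(3-4)])
  show ?thesis
  proof (cases "s = i \<or> s = Suc i")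
    case True
    then show ?thesis unfolding eq
      by (subst sum_two_points[of i N "Suc i"]) (use assms in \<open>auto simp: blk_def\<close>)
  next
    case False
    then show ?thesis unfolding eq
      by (subst sum_one_point[of s N]) (use assms in \<open>auto simp: blk_def\<close>)
  qed
qed

lemma blk_mult_blk:
  assumes "Suc i < N"
  shows "blk N i a b c d * blk N i a' b' c' d' =
    blk N i (a * a' + b * c') (a * b' + b * d') (c * a' + d * c') (c * b' + d * d')"
    (is "?L = ?R")
proof (rule eq_matI)
  fix r s assume "r < dim_row ?R" "s < dim_col ?R"
  then have rs: "r < N" "s < N" by (simp_all add: blk_def)
  show "?L $$ (r, s) = ?R $$ (r, s)"
    unfolding blk_mult_left[OF assms blk_carrier rs] using rs assms by (simp add: blk_def)
qed (simp_all add: blk_def)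

lemma blk_one: "blk N i 1 0 0 1 = 1\<^sub>m N"
  by (rule eq_matI) (auto simp: blk_def)

lemma det_unitriangular:
  assumes "A \<in> carrier_mat N N" "\<And>i. i < N \<Longrightarrow> A $$ (i, i) = (1::complex)"
    and "(\<forall>i<N. \<forall>j<N. i < j \<longrightarrow> A $$ (i, j) = 0) \<or> (\<forall>i<N. \<forall>j<N. j < i \<longrightarrow> A $$ (i, j) = 0)"
  shows "det A = 1"
proof -
  have d: "prod_list (diag_mat A) = 1"
    using assms(1,2) by (simp add: prod_list_diag_prod)
  show ?thesis using assms(3)
  proof
    assume "\<forall>i<N. \<forall>j<N. i < j \<longrightarrow> A $$ (i, j) = 0"
    then show ?thesis using det_lower_triangular[OF _ assms(1)] d by simp
  next
    assume "\<forall>i<N. \<forall>j<N. j < i \<longrightarrow> A $$ (i, j) = 0"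
    then have "upper_triangular A" using assms(1) by (auto intro!: upper_triangularI)
    then show ?thesis using det_upper_triangular[OF _ assms(1)] d by simp
  qed
qed

text \<open>The block is factored into unipotent triangular blocks, whose determinant is known.
  These yield the antidiagonal blocks, from which come the diagonal ones and finally the general
  block, with a separate factorization when \<open>a = 0\<close>.\<close>

lemma det_blk:
  assumes "Suc i < N" "a * d - b * c = 1" "b = 0 \<or> c = 0 \<or> a = 0 \<or> d = 0"
  shows "det (blk N i a b c d) = 1"
proof -
  have up: "det (blk N i 1 x 0 1) = 1" for x
    by (rule det_unitriangular[of _ N]) (auto simp: blk_def)
  have lo: "det (blk N i 1 0 x 1) = 1" for x
    by (rule det_unitriangular[of _ N]) (auto simp: blk_def)
  have m: "det (blk N i x y z w * blk N i x' y' z' w') = det (blk N i x y z w) * det (blk N i x' y' z' w')"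
    for x y z w x' y' z' w'
    by (rule det_mult[OF blk_carrier blk_carrier])
  have s: "det (blk N i 0 x (- 1 / x) 0) = 1" if "x \<noteq> 0" for x
  proof -
    have "blk N i 0 x (- 1 / x) 0 = blk N i 1 x 0 1 * blk N i 1 0 (- 1 / x) 1 * blk N i 1 x 0 1"
      using assms(1) that by (simp add: blk_mult_blk field_simps)
    then have "det (blk N i 0 x (- 1 / x) 0) = det (blk N i 1 x 0 1) * det (blk N i 1 0 (- 1 / x) 1) * det (blk N i 1 x 0 1)"
      by (metis det_mult[of _ N] blk_carrier mult_carrier_mat)
    then show ?thesis by (simp only: up lo mult_1_right)
  qed
  have diag: "det (blk N i x 0 0 (1 / x)) = 1" if "x \<noteq> 0" for x
  proof -
    have "blk N i x 0 0 (1 / x) = blk N i 0 x (- 1 / x) 0 * blk N i 0 (- 1) 1 0"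
      using assms(1) by (simp add: blk_mult_blk)
    then have "det (blk N i x 0 0 (1 / x)) = det (blk N i 0 x (- 1 / x) 0) * det (blk N i 0 (- 1) 1 0)"
      by (simp only: m)
    then show ?thesis using s[OF that] s[of "- 1"] by simp
  qed
  show ?thesis
  proof (cases "a = 0")
    case True
    then have bc: "b \<noteq> 0" "c = - 1 / b" using assms(2) by (auto simp: field_simps minus_equation_iff)
    have "blk N i 0 b (- 1 / b) 0 * blk N i 1 (- d * b) 0 1 = blk N i a b c d"
      using True bc assms(1) by (simp add: blk_mult_blk)
    then have "det (blk N i a b c d) = det (blk N i 0 b (- 1 / b) 0) * det (blk N i 1 (- d * b) 0 1)"
      by (simp only: m flip: m)
    then show ?thesis by (simp only: s[OF bc(1)] up mult_1_right)
  next
    case False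
    then have d: "(1 + b * c) / a = d" using assms(2) by (simp add: field_simps)
    have "blk N i 1 0 (c / a) 1 * blk N i a 0 0 (1 / a) * blk N i 1 (b / a) 0 1 = blk N i a b c ((1 + b * c) / a)"
      using False assms(1) by (simp add: blk_mult_blk field_simps)
    then have "blk N i 1 0 (c / a) 1 * blk N i a 0 0 (1 / a) * blk N i 1 (b / a) 0 1 = blk N i a b c d"
      unfolding d .
    then have "det (blk N i a b c d) = det (blk N i 1 0 (c / a) 1) * det (blk N i a 0 0 (1 / a)) * det (blk N i 1 (b / a) 0 1)"
      by (metis det_mult[of _ N] blk_carrier mult_carrier_mat)
    then show ?thesis by (simp only: diag[OF False] up lo mult_1_right)
  qed
qed

lemma blk_SL: "Suc i < N \<Longrightarrow> a * d - b * c = 1 \<Longrightarrow> b = 0 \<or> c = 0 \<or> a = 0 \<or> d = 0 \<Longrightarrow> blk N i a b c d \<in> carrier (SL N)"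
  by (simp add: SL_carrier_iff blk_carrier det_blk)

section \<open>The Borel subgroup and the minimal parabolic subgroups\<close>

lemma borel_SL: "g \<in> borel_subgroup N \<Longrightarrow> g \<in> carrier (SL N)"
  by (simp add: borel_subgroup_def)

lemma parabolic_SL: "g \<in> min_parabolic N i \<Longrightarrow> g \<in> carrier (SL N)"
  by (simp add: min_parabolic_def)

lemma borel_parabolic: "borel_subgroup N \<subseteq> min_parabolic N i"
  by (auto simp: borel_subgroup_def min_parabolic_def)

lemma blk_parabolic: "blk N i a b c d \<in> carrier (SL N) \<Longrightarrow> blk N i a b c d \<in> min_parabolic N i"
  unfolding min_parabolic_def by (simp add: blk_def)

lemma blk_borel: "blk N i a 0 c d \<in> carrier (SL N) \<Longrightarrow> blk N i a 0 c d \<in> borel_subgroup N"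
  unfolding borel_subgroup_def by (simp add: blk_def)

lemma borel_mult:
  assumes "x \<in> borel_subgroup N" "y \<in> borel_subgroup N" shows "x * y \<in> borel_subgroup N"
proof -
  have xy: "x \<in> carrier (SL N)" "y \<in> carrier (SL N)" using assms borel_SL by blast+
  have "(x * y) $$ (r, c) = 0" if "r < N" "c < N" "r < c" for r c
  proof -
    have "(x * y) $$ (r, c) = (\<Sum>k<N. x $$ (r, k) * y $$ (k, c))"
      using mult_mat_entry SL_carrier_mat xy that by blast
    also have "\<dots> = 0"
    proof (intro sum.neutral ballI)
      fix k assume "k \<in> {..<N}"
      then show "x $$ (r, k) * y $$ (k, c) = 0"
        using assms that by (cases "r < k") (auto simp: borel_subgroup_def)
    qed
    finally show ?thesis .
  qed
  then show ?thesis using SL_mult_closed[OF xy] by (simp add: borel_subgroup_def)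
qed

lemma parabolic_mult:
  assumes "x \<in> min_parabolic N i" "y \<in> min_parabolic N i" shows "x * y \<in> min_parabolic N i"
proof -
  have xy: "x \<in> carrier (SL N)" "y \<in> carrier (SL N)" using assms parabolic_SL by blast+
  have "(x * y) $$ (r, c) = 0" if "r < N" "c < N" "r < c" "(r, c) \<noteq> (i, Suc i)" for r c
  proof -
    have "(x * y) $$ (r, c) = (\<Sum>k<N. x $$ (r, k) * y $$ (k, c))"
      using mult_mat_entry SL_carrier_mat xy that by blast
    also have "\<dots> = 0"
    proof (intro sum.neutral ballI)
      fix k assume k: "k \<in> {..<N}"
      \<comment> \<open>Passing from \<open>r\<close> to \<open>c > r\<close> through
        \<open>k\<close> uses an increasing step. The step from \<open>i\<close> to
        \<open>Suc i\<close> can be used only once and is not the whole passage, so a step with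
        vanishing entry occurs.\<close>
      have "r < k \<and> (r, k) \<noteq> (i, Suc i) \<or> k < c \<and> (k, c) \<noteq> (i, Suc i)"
        using that by auto
      then show "x $$ (r, k) * y $$ (k, c) = 0"
        using assms that k by (auto simp: min_parabolic_def)
    qed
    finally show ?thesis .
  qed
  then show ?thesis using SL_mult_closed[OF xy] by (simp add: min_parabolic_def)
qed

lemma borel_diag_nonzero:
  assumes "x \<in> borel_subgroup N" "r < N" shows "x $$ (r, r) \<noteq> 0"
proof
  assume "x $$ (r, r) = 0"
  have x: "x \<in> carrier_mat N N" "det x = 1" using borel_SL[OF assms(1)] by (auto simp: SL_carrier_iff)
  have "det x = prod_list (diag_mat x)"
    using assms(1) by (intro det_lower_triangular[OF _ x(1)]) (auto simp: borel_subgroup_def)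
  moreover have "0 \<in> set (diag_mat x)"
    using \<open>x $$ (r, r) = 0\<close> assms(2) x(1) by (force simp: diag_mat_def)
  ultimately show False using x(2) by (metis prod_list_zero_iff zero_neq_one)
qed

text \<open>Forward substitution: in row \<open>r\<close> of the product with the inverse all terms
  but the one with the nonzero diagonal entry vanish, by triangularity of \<open>x\<close> and by
  induction on \<open>r\<close>.\<close>

lemma borel_inv:
  assumes "x \<in> borel_subgroup N" shows "SL_inv N x \<in> borel_subgroup N"
proof -
  let ?y = "SL_inv N x"
  have x: "x \<in> carrier (SL N)" by (rule borel_SL[OF assms])
  have y: "?y \<in> carrier (SL N)" by (rule SL_inv_closed[OF x])
  have "?y $$ (r, c) = 0" if "r < c" "c < N" for r c
    using that(1)
  proof (induction r rule: less_induct)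
    case (less r)
    then have r: "r < N" using that(2) by simp
    have "0 = (x * ?y) $$ (r, c)" using SL_inv_right[OF x] less.prems that(2) r by simp
    also have "\<dots> = (\<Sum>k<N. x $$ (r, k) * ?y $$ (k, c))"
      using mult_mat_entry SL_carrier_mat x y r that(2) by blast
    also have "\<dots> = (\<Sum>k<N. if k = r then x $$ (r, r) * ?y $$ (r, c) else 0)"
    proof (intro sum.cong refl)
      fix k assume k: "k \<in> {..<N}"
      have "x $$ (r, k) = 0" if "r < k" using assms r k that by (auto simp: borel_subgroup_def)
      moreover have "?y $$ (k, c) = 0" if "k < r" using less.IH[OF that] less.prems that by simp
      ultimately show "x $$ (r, k) * ?y $$ (k, c) = (if k = r then x $$ (r, r) * ?y $$ (r, c) else 0)"
        by (cases k r rule: linorder_cases) auto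
    qed
    finally show ?case using borel_diag_nonzero[OF assms r] r by simp
  qed
  then show ?thesis using y by (simp add: borel_subgroup_def)
qed

lemma borel_one: "1\<^sub>m N \<in> borel_subgroup N"
  by (auto simp: borel_subgroup_def SL_one_closed)

lemma parabolic_one: "1\<^sub>m N \<in> min_parabolic N i"
  using borel_one borel_parabolic by blast

lemma borel_subgroup_SL: "subgroup (borel_subgroup N) (SL N)"
  by (rule group.subgroupI[OF group_SL])
    (auto simp: borel_SL borel_mult borel_inv intro: borel_one)

text \<open>\<open>P\<close> is \<open>B\<close> together with an affine line of cosets.
  \<open>lineL\<close> represents the cosets \<open>B p\<close> and \<open>lineR\<close> the cosets
  \<open>p B\<close> outside \<open>B\<close>; in both, \<open>t\<close> is the affine coordinate on
  the projective line minus one point.\<close>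

definition lineL :: "nat \<Rightarrow> nat \<Rightarrow> complex \<Rightarrow> complex mat" where
  "lineL N i t = blk N i t 1 (- 1) 0"

definition lineR :: "nat \<Rightarrow> nat \<Rightarrow> complex \<Rightarrow> complex mat" where
  "lineR N i t = blk N i 0 1 (- 1) t"

lemma lineL_parabolic: "Suc i < N \<Longrightarrow> lineL N i t \<in> min_parabolic N i"
  unfolding lineL_def by (intro blk_parabolic blk_SL) auto

lemma lineR_parabolic: "Suc i < N \<Longrightarrow> lineR N i t \<in> min_parabolic N i"
  unfolding lineR_def by (intro blk_parabolic blk_SL) auto

text \<open>Bruhat decomposition of \<open>P\<close>: if the entry above the diagonal is nonzero,
  right multiplication by the inverse of a suitable \<open>lineL\<close> removes it.\<close>

lemma parabolic_cases_left:
  assumes "p \<in> min_parabolic N i" "Suc i < N"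
  obtains "p \<in> borel_subgroup N" | \<beta> t where "\<beta> \<in> borel_subgroup N" "p = \<beta> * lineL N i t"
proof (cases "p $$ (i, Suc i) = 0")
  case True
  then show ?thesis using assms that(1) by (force simp: min_parabolic_def borel_subgroup_def)
next
  case False
  \<comment> \<open>The entry of the product at \<open>(i, Suc i)\<close> will be
    \<open>- p(i, i) + t p(i, Suc i)\<close>, which this value of \<open>t\<close> makes
    zero.\<close>
  define t where "t = p $$ (i, i) / p $$ (i, Suc i)"
  have p: "p \<in> carrier (SL N)" by (rule parabolic_SL[OF assms(1)])
  let ?q = "blk N i 0 (- 1) 1 t"
  have q: "?q \<in> carrier (SL N)" using assms(2) by (intro blk_SL) auto
  have qt: "?q * lineL N i t = 1\<^sub>m N"
    using assms(2) by (simp add: lineL_def blk_mult_blk flip: blk_one[of N i])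
  have "p * ?q \<in> borel_subgroup N"
    unfolding borel_subgroup_def
  proof (intro CollectI conjI allI impI)
    show "p * ?q \<in> carrier (SL N)" by (rule SL_mult_closed[OF p q])
    fix r c assume rc: "r < N" "c < N" "r < c"
    have p0: "p $$ (r', c') = 0" if "r' < N" "c' < N" "r' < c'" "(r', c') \<noteq> (i, Suc i)" for r' c'
      using assms(1) that by (simp add: min_parabolic_def)
    show "(p * ?q) $$ (r, c) = 0"
    proof (cases "r = i \<and> c = Suc i")
      case True
      then show ?thesis using assms False rc
        by (subst blk_mult_right[OF assms(2) SL_carrier_mat[OF p] rc(1,2)]) (auto simp: t_def)
    next
      case nd: False
      then have "c = Suc i \<Longrightarrow> p $$ (r, i) = 0 \<and> p $$ (r, Suc i) = 0" "c \<noteq> Suc i \<Longrightarrow> p $$ (r, c) = 0"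
        "c = i \<Longrightarrow> p $$ (r, Suc i) = 0"
        using rc assms(2) by (auto intro!: p0)
      then show ?thesis
        by (subst blk_mult_right[OF assms(2) SL_carrier_mat[OF p] rc(1,2)]) auto
    qed
  qed
  moreover have "p * ?q * lineL N i t = p"
    using p q qt assms(2) parabolic_SL[OF lineL_parabolic] by (simp add: SL_assoc SL_right_one)
  ultimately show ?thesis using that(2) by metis
qed

lemma parabolic_inv:
  assumes "p \<in> min_parabolic N i" "Suc i < N" shows "SL_inv N p \<in> min_parabolic N i"
  using assms
proof (cases rule: parabolic_cases_left)
  case 1
  then show ?thesis using borel_inv borel_parabolic by blast
next
  case (2 \<beta> t)
  let ?q = "blk N i 0 (- 1) 1 t"
  have q: "?q \<in> min_parabolic N i"
    using assms(2) by (intro blk_parabolic blk_SL) auto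
  have qt: "?q * lineL N i t = 1\<^sub>m N"
    using assms(2) by (simp add: lineL_def blk_mult_blk flip: blk_one[of N i])
  have l: "lineL N i t \<in> carrier (SL N)" using lineL_parabolic parabolic_SL assms(2) by blast
  have "SL_inv N p = ?q * SL_inv N \<beta>"
  proof (rule SL_inv_unique)
    show "p \<in> carrier (SL N)" using assms parabolic_SL by blast
    show "?q * SL_inv N \<beta> \<in> carrier (SL N)"
      using q 2 parabolic_SL borel_SL SL_inv_closed SL_mult_closed by blast
    have b: "\<beta> \<in> carrier (SL N)" using 2 borel_SL by blast
    have "?q * SL_inv N \<beta> * p = ?q * (SL_inv N \<beta> * (\<beta> * lineL N i t))"
      unfolding 2(2) using parabolic_SL[OF q] b l by (simp add: SL_assoc SL_inv_closed SL_mult_closed)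
    then show "?q * SL_inv N \<beta> * p = 1\<^sub>m N" using SL_inv_mult_cancel(1)[OF b l] qt by simp
  qed
  then show ?thesis using q 2 borel_inv borel_parabolic parabolic_mult by (metis subsetD)
qed

lemma parabolic_subgroup_SL: "Suc i < N \<Longrightarrow> subgroup (min_parabolic N i) (SL N)"
  by (rule group.subgroupI[OF group_SL])
    (auto simp: parabolic_SL parabolic_mult parabolic_inv intro: parabolic_one)

text \<open>The left decomposition of the inverse is inverted. The inverse of
  \<open>lineL N i t\<close> is \<open>lineR N i (- t)\<close> times the diagonal block with entries
  \<open>- 1\<close>, and this block is absorbed into \<open>B\<close>.\<close>

lemma parabolic_cases_right:
  assumes "p \<in> min_parabolic N i" "Suc i < N"
  obtains "p \<in> borel_subgroup N" | \<beta> t where "\<beta> \<in> borel_subgroup N" "p = lineR N i t * \<beta>"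
  using parabolic_inv[OF assms] assms(2)
proof (cases rule: parabolic_cases_left)
  case 1
  then show ?thesis using that(1) borel_inv SL_inv_inv parabolic_SL[OF assms(1)] by metis
next
  case (2 \<beta> t)
  have p: "p \<in> carrier (SL N)" by (rule parabolic_SL[OF assms(1)])
  have b: "\<beta> \<in> carrier (SL N)" using 2 borel_SL by blast
  have l: "lineL N i t \<in> carrier (SL N)" using lineL_parabolic parabolic_SL assms(2) by blast
  let ?q = "blk N i 0 (- 1) 1 t" and ?d = "blk N i (- 1) 0 0 (- 1)"
  have r: "lineR N i t \<in> carrier (SL N)" using lineR_parabolic parabolic_SL assms(2) by blast
  have d: "?d \<in> borel_subgroup N"
    using assms(2) by (intro blk_borel blk_SL) auto
  have q: "?q \<in> carrier (SL N)" using assms(2) by (intro blk_SL) auto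
  have qr: "?q = lineR N i (- t) * ?d" using assms(2) by (simp add: lineR_def blk_mult_blk)
  have qt: "?q * lineL N i t = 1\<^sub>m N"
    using assms(2) by (simp add: lineL_def blk_mult_blk flip: blk_one[of N i])
  have "p = SL_inv N (SL_inv N p)" using SL_inv_inv p by simp
  also have "\<dots> = ?q * SL_inv N \<beta>"
  proof (rule SL_inv_unique)
    show "SL_inv N p \<in> carrier (SL N)" using SL_inv_closed p by blast
    show "?q * SL_inv N \<beta> \<in> carrier (SL N)" using q b SL_inv_closed SL_mult_closed by blast
    have "?q * SL_inv N \<beta> * SL_inv N p = ?q * (SL_inv N \<beta> * (\<beta> * lineL N i t))"
      unfolding 2(2) using q b l by (simp add: SL_assoc SL_inv_closed SL_mult_closed)
    then show "?q * SL_inv N \<beta> * SL_inv N p = 1\<^sub>m N" using SL_inv_mult_cancel(1)[OF b l] qt by simp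
  qed
  also have "\<dots> = lineR N i (- t) * (?d * SL_inv N \<beta>)"
    unfolding qr using b d r lineR_parabolic[OF assms(2)] parabolic_SL by (intro SL_assoc) (auto simp: borel_SL SL_inv_closed)
  finally show ?thesis using that(2)[of "?d * SL_inv N \<beta>" "- t"] d borel_inv[OF 2(1)] borel_mult by blast
qed

text \<open>Scaling the first column by \<open>1 / D\<close> moves the segment between two matrices of determinant
  \<open>1\<close> back into the group.\<close>

lemma zirr_SL_supp:
  assumes S: "\<And>r. r < N \<Longrightarrow> (r, r) \<in> S"
  shows "zirr N (carrier (SL N) \<inter> supp_mat N S)"
proof (cases "N = 0")
  \<comment> \<open>There is no first column to rescale; the group is a single point.\<close>
  case True
  have "carrier (SL N) \<inter> supp_mat N S = {1\<^sub>m N}"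
    using True by (auto simp: SL_carrier_iff supp_mat_def)
  then show ?thesis by (auto simp: zirr_def)
next
  case False
  show ?thesis
  proof (rule zirr_rational_curves)
    have "1\<^sub>m N \<in> carrier (SL N) \<inter> supp_mat N S" using S by (auto simp: SL_one_closed supp_mat_def)
    then show "carrier (SL N) \<inter> supp_mat N S \<noteq> {}" by blast
    fix x y assume xy: "x \<in> carrier (SL N) \<inter> supp_mat N S" "y \<in> carrier (SL N) \<inter> supp_mat N S"
    define l where "l t = mat N N (\<lambda>(r, c). x $$ (r, c) + t * (y $$ (r, c) - x $$ (r, c)))" for t
    obtain f where f: "f \<in> poly_funs N" "\<And>A. A \<in> carrier_mat N N \<Longrightarrow> f A = det A"
      using poly_funs_det_mat[of N] by blast
    have "\<exists>k P. \<forall>t. poly 1 t \<noteq> 0 \<longrightarrow> f (l t) * poly 1 t ^ k = poly P t"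
    proof (rule poly_funs_rational_curve[OF f(1)])
      show "\<exists>P. \<forall>t. poly 1 t \<noteq> 0 \<longrightarrow> l t $$ (r, c) * poly 1 t = poly P t" if "r < N" "c < N" for r c
        using that by (intro exI[of _ "[:x $$ (r, c), y $$ (r, c) - x $$ (r, c):]"]) (simp add: l_def)
    qed
    then obtain D where D: "\<And>t. det (l t) = poly D t" using f(2)[of "l t" for t] by (auto simp: l_def)
    define \<gamma> where "\<gamma> t = mat N N (\<lambda>(r, c). if c = 0 then l t $$ (r, c) / poly D t else l t $$ (r, c))" for t
    have l01: "l 0 = x" "l 1 = y"
      using xy by (auto simp: l_def SL_carrier_iff intro!: eq_matI)
    then have D01: "poly D 0 = 1" "poly D 1 = 1" using D[of 0] D[of 1] xy by (auto simp: SL_carrier_iff)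
    then have \<gamma>01: "\<gamma> 0 = x" "\<gamma> 1 = y"
      using l01 xy by (auto simp: \<gamma>_def SL_carrier_iff intro!: eq_matI)
    have "\<gamma> t \<in> carrier (SL N) \<inter> supp_mat N S" if t: "poly D t \<noteq> 0" for t
    proof -
      let ?E = "mat N N (\<lambda>(r, c). if r = c then if c = 0 then 1 / poly D t else 1 else 0)"
      have "\<gamma> t = l t * ?E"
      proof (rule eq_matI)
        fix r c assume "r < dim_row (l t * ?E)" "c < dim_col (l t * ?E)"
        then have rc: "r < N" "c < N" by (auto simp: l_def)
        have "(l t * ?E) $$ (r, c) = (\<Sum>k<N. l t $$ (r, k) * ?E $$ (k, c))"
          using rc by (intro mult_mat_entry) (auto simp: l_def)
        also have "\<dots> = (\<Sum>k<N. if k = c then \<gamma> t $$ (r, c) else 0)"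
          using rc by (intro sum.cong) (auto simp: \<gamma>_def)
        finally show "\<gamma> t $$ (r, c) = (l t * ?E) $$ (r, c)" using rc by simp
      qed (auto simp: \<gamma>_def l_def)
      moreover have "det (l t * ?E) = det (l t) * det ?E" by (rule det_mult[of _ N]) (auto simp: l_def)
      moreover have "det ?E = 1 / poly D t"
      proof -
        have "det ?E = prod_list (diag_mat ?E)" by (rule det_lower_triangular[of N]) auto
        also have "\<dots> = (\<Prod>r = 0..<N. ?E $$ (r, r))" by (simp add: prod_list_diag_prod)
        also have "\<dots> = (\<Prod>r = 0..<N. if r = 0 then 1 / poly D t else 1)" by (intro prod.cong) auto
        finally show ?thesis using False by simp
      qed
      ultimately have "det (\<gamma> t) = 1" using D t by simp
      moreover have "\<gamma> t \<in> supp_mat N S" using xy by (auto simp: supp_mat_def \<gamma>_def l_def)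
      ultimately show ?thesis by (simp add: SL_carrier_iff \<gamma>_def)
    qed
    moreover have "\<exists>P. \<forall>t. poly D t \<noteq> 0 \<longrightarrow> \<gamma> t $$ (r, c) * poly D t = poly P t" if "r < N" "c < N" for r c
      using that by (intro exI[of _ "if c = 0 then [:x $$ (r, c), y $$ (r, c) - x $$ (r, c):]
        else [:x $$ (r, c), y $$ (r, c) - x $$ (r, c):] * D"]) (simp add: \<gamma>_def l_def field_simps)
    ultimately show "\<exists>\<gamma> D. \<gamma> 0 = x \<and> \<gamma> 1 = y \<and> poly D 0 \<noteq> 0 \<and> poly D 1 \<noteq> 0 \<and>
      (\<forall>t. poly D t \<noteq> 0 \<longrightarrow> \<gamma> t \<in> carrier (SL N) \<inter> supp_mat N S) \<and>
      (\<forall>r<N. \<forall>c<N. \<exists>P. \<forall>t. poly D t \<noteq> 0 \<longrightarrow> \<gamma> t $$ (r, c) * poly D t = poly P t)"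
      using \<gamma>01 D01 by (intro exI[of _ \<gamma>] exI[of _ D]) simp
  qed
qed

lemma zirr_borel: "zirr N (borel_subgroup N)"
proof -
  have "borel_subgroup N = carrier (SL N) \<inter> supp_mat N {(r, c). c \<le> r}"
    by (auto simp: borel_subgroup_def supp_mat_def SL_carrier_mat not_le)
  then show ?thesis using zirr_SL_supp[of N "{(r, c). c \<le> r}"] by simp
qed

lemma zirr_parabolic: "zirr N (min_parabolic N i)"
proof -
  have "min_parabolic N i = carrier (SL N) \<inter> supp_mat N {(r, c). c \<le> r \<or> (r, c) = (i, Suc i)}"
    by (auto simp: min_parabolic_def supp_mat_def SL_carrier_mat not_le)
  then show ?thesis using zirr_SL_supp[of N "{(r, c). c \<le> r \<or> (r, c) = (i, Suc i)}"] by simp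
qed

section \<open>Products of subsets of the group\<close>

definition set_mul :: "complex mat set \<Rightarrow> complex mat set \<Rightarrow> complex mat set" where
  "set_mul A H = {a * h | a h. a \<in> A \<and> h \<in> H}"

lemma set_mulI: "a \<in> A \<Longrightarrow> h \<in> H \<Longrightarrow> a * h \<in> set_mul A H"
  unfolding set_mul_def by blast

text \<open>For each fixed \<open>a\<close>, irreducibility of \<open>H\<close> makes one of
  \<open>f\<close>, \<open>g\<close> vanish on \<open>a H\<close>. If neither vanished on the whole
  product, the right translates of \<open>f\<close> and \<open>g\<close> by suitable
  \<open>h\<close> and \<open>h'\<close> would contradict the irreducibility of
  \<open>A\<close>.\<close>

lemma zirr_set_mul:
  assumes "zirr N A" "zirr N H" "A \<subseteq> carrier_mat N N" "H \<subseteq> carrier_mat N N"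
  shows "zirr N (set_mul A H)"
  unfolding zirr_def
proof (intro conjI ballI impI)
  show "set_mul A H \<noteq> {}" using assms(1,2) by (auto simp: zirr_def set_mul_def)
  fix f g assume fg: "f \<in> poly_funs N" "g \<in> poly_funs N" "\<forall>z\<in>set_mul A H. f z * g z = 0"
  have *: "(\<forall>h\<in>H. f (a * h) = 0) \<or> (\<forall>h\<in>H. g (a * h) = 0)" if a: "a \<in> A" for a
  proof -
    have am: "a \<in> carrier_mat N N" using a assms(3) by blast
    obtain f' where f': "f' \<in> poly_funs N" "\<And>A. A \<in> carrier_mat N N \<Longrightarrow> f' A = f (a * A)"
      using poly_funs_mult_left[OF fg(1) am] by blast
    obtain g' where g': "g' \<in> poly_funs N" "\<And>A. A \<in> carrier_mat N N \<Longrightarrow> g' A = g (a * A)"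
      using poly_funs_mult_left[OF fg(2) am] by blast
    have "\<forall>h\<in>H. f' h * g' h = 0" using fg(3) a f'(2) g'(2) assms(4) set_mulI[OF a] by (metis subsetD)
    then have "(\<forall>h\<in>H. f' h = 0) \<or> (\<forall>h\<in>H. g' h = 0)"
      using assms(2) f'(1) g'(1) unfolding zirr_def by blast
    then show ?thesis using f'(2) g'(2) assms(4) by (metis subsetD)
  qed
  show "(\<forall>z\<in>set_mul A H. f z = 0) \<or> (\<forall>z\<in>set_mul A H. g z = 0)"
  proof (rule ccontr)
    assume "\<not> ?thesis"
    then obtain a h a' h' where ah: "a \<in> A" "h \<in> H" "f (a * h) \<noteq> 0" "a' \<in> A" "h' \<in> H" "g (a' * h') \<noteq> 0"
      unfolding set_mul_def by blast
    have hm: "h \<in> carrier_mat N N" "h' \<in> carrier_mat N N" using ah assms(4) by blast+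
    obtain f' where f': "f' \<in> poly_funs N" "\<And>A. A \<in> carrier_mat N N \<Longrightarrow> f' A = f (A * h)"
      using poly_funs_mult_right[OF fg(1) hm(1)] by blast
    obtain g' where g': "g' \<in> poly_funs N" "\<And>A. A \<in> carrier_mat N N \<Longrightarrow> g' A = g (A * h')"
      using poly_funs_mult_right[OF fg(2) hm(2)] by blast
    have "f' b * g' b = 0" if "b \<in> A" for b
      using *[OF that] f'(2)[of b] g'(2)[of b] assms(3) that ah(2,5) by auto
    then have "(\<forall>b\<in>A. f' b = 0) \<or> (\<forall>b\<in>A. g' b = 0)"
      using assms(1) f'(1) g'(1) unfolding zirr_def by blast
    then show False using ah f'(2)[of a] g'(2)[of a'] assms(3) by auto
  qed
qed

lemma zdense_mult_right:
  assumes "zdense N Z W" "p \<in> carrier_mat N N" "Z \<subseteq> carrier_mat N N" "W \<subseteq> carrier_mat N N"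
    and "\<And>z. z \<in> Z \<Longrightarrow> z * p \<in> Z'"
  shows "zdense N Z' ((\<lambda>w. w * p) ` W)"
  unfolding zdense_def
proof (intro ballI impI)
  fix f w assume f: "f \<in> poly_funs N" "\<forall>z\<in>Z'. f z = 0" and "w \<in> (\<lambda>w. w * p) ` W"
  then obtain v where v: "v \<in> W" "w = v * p" by blast
  obtain f' where f': "f' \<in> poly_funs N" "\<And>A. A \<in> carrier_mat N N \<Longrightarrow> f' A = f (A * p)"
    using poly_funs_mult_right[OF f(1) assms(2)] by blast
  have "\<forall>z\<in>Z. f' z = 0" using f(2) f'(2) assms(3,5) by auto
  then have "f' v = 0" using assms(1) f'(1) v(1) unfolding zdense_def by blast
  then show "f w = 0" using f'(2) v assms(4) by auto
qed

lemma zcl_mult_right_closed: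
  assumes "\<And>z. z \<in> Z \<Longrightarrow> z * p \<in> Z" "Z \<subseteq> carrier (SL N)" "p \<in> carrier (SL N)" "g \<in> zcl N Z"
  shows "g * p \<in> zcl N Z"
proof -
  have "zdense N Z ((\<lambda>w. w * p) ` zcl N Z)"
    using assms(1-3) zcl_subset_carrier[of N Z]
    by (intro zdense_mult_right) (auto simp: SL_carrier_mat zdense_iff_subset_zcl subset_iff)
  then show ?thesis using assms(3,4) zcl_subset_carrier[of N Z]
    by (subst (asm) zdense_iff_subset_zcl) (auto simp: SL_mult_closed subset_iff)
qed

section \<open>Coset spaces\<close>

definition coset_img :: "nat \<Rightarrow> complex mat set \<Rightarrow> complex mat set \<Rightarrow> complex mat set set" where
  "coset_img N H A = (\<lambda>g. g <#\<^bsub>SL N\<^esub> H) ` A"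

text \<open>For a subgroup \<open>H\<close> the stable subsets of the group are the preimages of
  subsets of \<open>G/H\<close>; on them \<open>coset_img\<close> loses no information.\<close>

definition rstable :: "complex mat set \<Rightarrow> complex mat set \<Rightarrow> bool" where
  "rstable H A \<longleftrightarrow> (\<forall>a\<in>A. \<forall>h\<in>H. a * h \<in> A)"

lemma lcos_eq: "g <#\<^bsub>SL N\<^esub> H = (*) g ` H"
  by (auto simp: l_coset_def)

lemma lcos_eq_iff:
  assumes "subgroup H (SL N)" "g \<in> carrier (SL N)" "g' \<in> carrier (SL N)"
  shows "g <#\<^bsub>SL N\<^esub> H = g' <#\<^bsub>SL N\<^esub> H \<longleftrightarrow> (\<exists>h\<in>H. g' = g * h)"
proof
  have one: "1\<^sub>m N \<in> H" using subgroup.one_closed[OF assms(1)] by simp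
  assume "g <#\<^bsub>SL N\<^esub> H = g' <#\<^bsub>SL N\<^esub> H"
  moreover have "g' \<in> g' <#\<^bsub>SL N\<^esub> H"
    unfolding lcos_eq by (rule image_eqI[OF _ one]) (simp add: SL_right_one assms(3))
  ultimately show "\<exists>h\<in>H. g' = g * h" unfolding lcos_eq by blast
next
  have H: "H \<subseteq> carrier (SL N)" by (rule subgroup.subset[OF assms(1)])
  assume "\<exists>h\<in>H. g' = g * h"
  then obtain h where h: "h \<in> H" "g' = g * h" by blast
  have hc: "h \<in> carrier (SL N)" using h H by blast
  have "g * h * x \<in> (*) g ` H" if "x \<in> H" for x
  proof -
    have "h * x \<in> H" using subgroup.m_closed[OF assms(1) h(1) that] by simp
    moreover have "g * h * x = g * (h * x)" using SL_assoc assms(2) hc that H by blast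
    ultimately show ?thesis by blast
  qed
  moreover have "g * x \<in> (*) (g * h) ` H" if "x \<in> H" for x
  proof -
    have i: "SL_inv N h \<in> H" using subgroup.m_inv_closed[OF assms(1) h(1)] .
    then have "SL_inv N h * x \<in> H" using subgroup.m_closed[OF assms(1) _ that] by simp
    moreover have "g * h * (SL_inv N h * x) = g * x"
    proof -
      have xc: "x \<in> carrier (SL N)" using that H by blast
      show ?thesis
        using SL_assoc[OF assms(2) hc SL_mult_closed[OF SL_inv_closed[OF hc] xc]] SL_inv_mult_cancel(2)[OF hc xc]
        by simp
    qed
    ultimately show ?thesis by (metis image_eqI)
  qed
  ultimately show "g <#\<^bsub>SL N\<^esub> H = g' <#\<^bsub>SL N\<^esub> H" unfolding lcos_eq h(2) by blast
qed

lemma mem_coset_img: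
  assumes "subgroup H (SL N)" "A \<subseteq> carrier (SL N)" "rstable H A" "g \<in> carrier (SL N)"
  shows "g <#\<^bsub>SL N\<^esub> H \<in> coset_img N H A \<longleftrightarrow> g \<in> A"
proof
  assume "g <#\<^bsub>SL N\<^esub> H \<in> coset_img N H A"
  then obtain a where a: "a \<in> A" "a <#\<^bsub>SL N\<^esub> H = g <#\<^bsub>SL N\<^esub> H" unfolding coset_img_def by auto
  then obtain h where "h \<in> H" "g = a * h" using lcos_eq_iff[OF assms(1)] assms(2,4) by blast
  then show "g \<in> A" using a(1) assms(3) unfolding rstable_def by blast
qed (simp add: coset_img_def)

lemma coset_img_lcosets: "A \<subseteq> carrier (SL N) \<Longrightarrow> coset_img N H A \<subseteq> lcosets\<^bsub>SL N\<^esub> H"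
  unfolding coset_img_def LCOSETS_def by blast

lemma coset_img_preimage:
  assumes "C \<subseteq> lcosets\<^bsub>SL N\<^esub> H"
  shows "coset_img N H {g \<in> carrier (SL N). g <#\<^bsub>SL N\<^esub> H \<in> C} = C"
  using assms unfolding coset_img_def LCOSETS_def by auto

lemma rstable_preimage:
  assumes "subgroup H (SL N)"
  shows "rstable H {g \<in> carrier (SL N). g <#\<^bsub>SL N\<^esub> H \<in> C}"
  unfolding rstable_def
proof (intro ballI)
  fix a h assume a: "a \<in> {g \<in> carrier (SL N). g <#\<^bsub>SL N\<^esub> H \<in> C}" and h: "h \<in> H"
  then have "a * h \<in> carrier (SL N)" using subgroup.subset[OF assms] SL_mult_closed by blast
  moreover from this have "a <#\<^bsub>SL N\<^esub> H = (a * h) <#\<^bsub>SL N\<^esub> H" using lcos_eq_iff[OF assms] a h by blast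
  ultimately show "a * h \<in> {g \<in> carrier (SL N). g <#\<^bsub>SL N\<^esub> H \<in> C}" using a by simp
qed

lemma coset_img_mono_iff:
  assumes "subgroup H (SL N)" "A \<subseteq> carrier (SL N)" "B \<subseteq> carrier (SL N)" "rstable H B"
  shows "coset_img N H A \<subseteq> coset_img N H B \<longleftrightarrow> A \<subseteq> B"
proof
  assume sub: "coset_img N H A \<subseteq> coset_img N H B"
  show "A \<subseteq> B"
  proof
    fix a assume a: "a \<in> A"
    then have "a <#\<^bsub>SL N\<^esub> H \<in> coset_img N H B" using sub by (auto simp: coset_img_def)
    then show "a \<in> B" using mem_coset_img[OF assms(1,3,4)] a assms(2) by blast
  qed
qed (auto simp: coset_img_def)

lemma coset_img_eq_iff:
  assumes "subgroup H (SL N)" "A \<subseteq> carrier (SL N)" "B \<subseteq> carrier (SL N)" "rstable H A" "rstable H B"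
  shows "coset_img N H A = coset_img N H B \<longleftrightarrow> A = B"
  using coset_img_mono_iff[OF assms(1-3,5)] coset_img_mono_iff[OF assms(1,3,2,4)] by blast

lemma coset_img_Int:
  assumes "subgroup H (SL N)" "A \<subseteq> carrier (SL N)" "B \<subseteq> carrier (SL N)" "rstable H B"
  shows "coset_img N H A \<inter> coset_img N H B = coset_img N H (A \<inter> B)"
proof
  show "coset_img N H A \<inter> coset_img N H B \<subseteq> coset_img N H (A \<inter> B)"
  proof
    fix x assume x: "x \<in> coset_img N H A \<inter> coset_img N H B"
    then obtain a where a: "a \<in> A" "x = a <#\<^bsub>SL N\<^esub> H" unfolding coset_img_def by blast
    then have "a \<in> B" using mem_coset_img[OF assms(1,3,4)] x assms(2) by blast
    then show "x \<in> coset_img N H (A \<inter> B)" using a unfolding coset_img_def by blast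
  qed
qed (auto simp: coset_img_def)

lemma rstable_Int: "rstable H A \<Longrightarrow> rstable H B \<Longrightarrow> rstable H (A \<inter> B)"
  by (auto simp: rstable_def)

lemma rstable_zcl:
  assumes "H \<subseteq> carrier (SL N)" "A \<subseteq> carrier (SL N)" "rstable H A" shows "rstable H (zcl N A)"
  unfolding rstable_def
proof (intro ballI)
  fix a h assume "a \<in> zcl N A" "h \<in> H"
  then show "a * h \<in> zcl N A"
    using assms by (intro zcl_mult_right_closed) (auto simp: rstable_def)
qed

lemma closedin_coset_top:
  "closedin (coset_top N H) C \<longleftrightarrow> C \<subseteq> lcosets\<^bsub>SL N\<^esub> H \<and>
     closedin (zariski N) {g \<in> carrier (SL N). g <#\<^bsub>SL N\<^esub> H \<in> C}"
proof -
  have "{g \<in> carrier (SL N). g <#\<^bsub>SL N\<^esub> H \<in> lcosets\<^bsub>SL N\<^esub> H - C} =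
      carrier (SL N) - {g \<in> carrier (SL N). g <#\<^bsub>SL N\<^esub> H \<in> C}"
    unfolding LCOSETS_def by auto
  then show ?thesis
    by (auto simp: closedin_def topspace_coset_top topspace_zariski openin_coset_top)
qed

lemma closedin_coset_img:
  assumes "subgroup H (SL N)" "A \<subseteq> carrier (SL N)" "rstable H A" "zcl N A = A"
  shows "closedin (coset_top N H) (coset_img N H A)"
proof -
  have "{g \<in> carrier (SL N). g <#\<^bsub>SL N\<^esub> H \<in> coset_img N H A} = A"
    using mem_coset_img[OF assms(1-3)] assms(2) by blast
  then show ?thesis
    using assms by (simp add: closedin_coset_top coset_img_lcosets closedin_zariski_iff)
qed

text \<open>The closure of a stable set is stable, so its image is closed; conversely the preimage
  of a closed set containing the image is closed and contains \<open>A\<close>.\<close>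

lemma closure_of_coset_img:
  assumes "subgroup H (SL N)" "A \<subseteq> carrier (SL N)" "rstable H A"
  shows "coset_top N H closure_of coset_img N H A = coset_img N H (zcl N A)"
proof
  have H: "H \<subseteq> carrier (SL N)" by (rule subgroup.subset[OF assms(1)])
  show "coset_top N H closure_of coset_img N H A \<subseteq> coset_img N H (zcl N A)"
  proof (rule closure_of_minimal)
    show "coset_img N H A \<subseteq> coset_img N H (zcl N A)"
      using subset_zcl[OF assms(2)] by (auto simp: coset_img_def)
    show "closedin (coset_top N H) (coset_img N H (zcl N A))"
      by (rule closedin_coset_img[OF assms(1) zcl_subset_carrier rstable_zcl[OF H assms(2,3)] zcl_idem])
  qed
  let ?C = "coset_top N H closure_of coset_img N H A"
  let ?D = "{g \<in> carrier (SL N). g <#\<^bsub>SL N\<^esub> H \<in> ?C}"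
  have "closedin (zariski N) ?D"
    using closedin_closure_of[of "coset_top N H"] unfolding closedin_coset_top by blast
  then have "zcl N ?D = ?D" using closedin_zariski_iff by blast
  moreover have "A \<subseteq> ?D"
  proof
    fix a assume a: "a \<in> A"
    have "coset_img N H A \<subseteq> ?C"
      by (rule closure_of_subset) (simp add: topspace_coset_top coset_img_lcosets assms(2))
    then show "a \<in> ?D" using a assms(2) by (auto simp: coset_img_def)
  qed
  ultimately have "zcl N A \<subseteq> ?D" using zcl_mono[of A ?D N] by simp
  then show "coset_img N H (zcl N A) \<subseteq> ?C" by (auto simp: coset_img_def)
qed

text \<open>Lifting irreducibility to the group rests on \<open>H\<close> being irreducible: each
  coset contained in \<open>A\<close> falls into one of two closed stable sets.\<close>

lemma irreducible_in_coset_img: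
  assumes H: "subgroup H (SL N)" "zirr N H" and A: "A \<subseteq> carrier (SL N)" "rstable H A"
  shows "irreducible_in (coset_top N H) (coset_img N H A) \<longleftrightarrow> zirr N A"
proof
  have Hc: "H \<subseteq> carrier (SL N)" by (rule subgroup.subset[OF H(1)])
  assume irr: "irreducible_in (coset_top N H) (coset_img N H A)"
  show "zirr N A" unfolding zirr_def
  proof (intro conjI ballI impI)
    show "A \<noteq> {}" using irr by (auto simp: irreducible_in_def coset_img_def)
    fix f g assume fg: "f \<in> poly_funs N" "g \<in> poly_funs N" "\<forall>z\<in>A. f z * g z = 0"
    \<comment> \<open>The largest stable set on which \<open>f\<close> vanishes. On a coset
      \<open>a H\<close> inside \<open>A\<close> the product \<open>f g\<close> vanishes, hence one
      factor does, and \<open>a\<close> lies in \<open>V f\<close> or in \<open>V g\<close>.\<close>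
    define V where "V f = {a \<in> carrier (SL N). \<forall>h\<in>H. f (a * h) = 0}" for f :: "complex mat \<Rightarrow> complex"
    have V: "V f \<subseteq> carrier (SL N)" "rstable H (V f)" "zcl N (V f) = V f" if f: "f \<in> poly_funs N" for f
    proof -
      show c: "V f \<subseteq> carrier (SL N)" by (auto simp: V_def)
      show "rstable H (V f)" unfolding rstable_def
      proof (intro ballI)
        fix a h assume a: "a \<in> V f" and h: "h \<in> H"
        have "f (a * h * x) = 0" if "x \<in> H" for x
        proof -
          have "h * x \<in> H" using subgroup.m_closed[OF H(1) h that] by simp
          moreover have "a * h * x = a * (h * x)"
            by (rule SL_assoc[of _ N]) (use a h that Hc in \<open>auto simp: V_def\<close>)
          ultimately show ?thesis using a by (simp add: V_def)
        qed
        then show "a * h \<in> V f" using a h Hc by (auto simp: V_def intro: SL_mult_closed)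
      qed
      have "x \<in> V f" if "x \<in> zcl N (V f)" for x
      proof -
        have xc: "x \<in> carrier (SL N)" using that zcl_subset_carrier by blast
        have "f (x * h) = 0" if h: "h \<in> H" for h
        proof -
          have hm: "h \<in> carrier_mat N N" using h Hc SL_carrier_mat by blast
          obtain f' where f': "f' \<in> poly_funs N" "\<And>A. A \<in> carrier_mat N N \<Longrightarrow> f' A = f (A * h)"
            using poly_funs_mult_right[OF f hm] by blast
          have "\<forall>z\<in>V f. f' z = 0" using f'(2) h SL_carrier_mat by (auto simp: V_def)
          then have "f' x = 0" using \<open>x \<in> zcl N (V f)\<close> f'(1) by (simp add: zcl_def)
          then show ?thesis using f'(2)[OF SL_carrier_mat[OF xc]] by simp
        qed
        then show ?thesis using xc by (simp add: V_def)
      qed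
      then show "zcl N (V f) = V f" using subset_zcl[OF c] by blast
    qed
    have "A \<subseteq> V f \<union> V g"
    proof
      fix a assume a: "a \<in> A"
      then have am: "a \<in> carrier_mat N N" "a \<in> carrier (SL N)" using A(1) SL_carrier_mat by blast+
      obtain f' where f': "f' \<in> poly_funs N" "\<And>A. A \<in> carrier_mat N N \<Longrightarrow> f' A = f (a * A)"
        using poly_funs_mult_left[OF fg(1) am(1)] by blast
      obtain g' where g': "g' \<in> poly_funs N" "\<And>A. A \<in> carrier_mat N N \<Longrightarrow> g' A = g (a * A)"
        using poly_funs_mult_left[OF fg(2) am(1)] by blast
      have Hm: "h \<in> carrier_mat N N" if "h \<in> H" for h using that Hc SL_carrier_mat by blast
      have "\<forall>h\<in>H. f' h * g' h = 0" using fg(3) a A(2) f'(2) g'(2) Hm by (simp add: rstable_def)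
      then have "(\<forall>h\<in>H. f' h = 0) \<or> (\<forall>h\<in>H. g' h = 0)"
        using H(2) f'(1) g'(1) unfolding zirr_def by blast
      then show "a \<in> V f \<union> V g" using f'(2) g'(2) Hm am(2) by (auto simp: V_def)
    qed
    then have "coset_img N H A \<subseteq> coset_img N H (V f) \<union> coset_img N H (V g)"
      by (auto simp: coset_img_def)
    moreover have "closedin (coset_top N H) (coset_img N H (V f))" "closedin (coset_top N H) (coset_img N H (V g))"
      using closedin_coset_img[OF H(1)] V fg(1,2) by auto
    ultimately have "coset_img N H A \<subseteq> coset_img N H (V f) \<or> coset_img N H A \<subseteq> coset_img N H (V g)"
      using irr[unfolded irreducible_in_def, THEN conjunct2, rule_format] by presburger
    then have "A \<subseteq> V f \<or> A \<subseteq> V g"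
      using coset_img_mono_iff[OF H(1) A(1) V(1,2)] fg(1,2) by simp
    moreover have "f a = 0" if "a \<in> V f" for a f
    proof -
      have "1\<^sub>m N \<in> H" using subgroup.one_closed[OF H(1)] by simp
      then have "f (a * 1\<^sub>m N) = 0" using that by (simp add: V_def)
      then show ?thesis using that SL_right_one by (simp add: V_def)
    qed
    ultimately show "(\<forall>z\<in>A. f z = 0) \<or> (\<forall>z\<in>A. g z = 0)" by blast
  qed
next
  assume irr: "zirr N A"
  show "irreducible_in (coset_top N H) (coset_img N H A)" unfolding irreducible_in_def
  proof (intro conjI allI impI)
    show "coset_img N H A \<noteq> {}" using irr by (auto simp: zirr_def coset_img_def)
    fix C D assume CD: "closedin (coset_top N H) C \<and> closedin (coset_top N H) D \<and> coset_img N H A \<subseteq> C \<union> D"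
    let ?p = "\<lambda>C. {g \<in> carrier (SL N). g <#\<^bsub>SL N\<^esub> H \<in> C}"
    have "closedin (zariski N) (?p C)" "closedin (zariski N) (?p D)" using CD closedin_coset_top by blast+
    moreover have "A \<subseteq> ?p C \<union> ?p D" using CD A(1) by (auto simp: coset_img_def)
    moreover have "irreducible_in (zariski N) A" using irr zirr_iff_irreducible_in[OF A(1)] by blast
    ultimately have "A \<subseteq> ?p C \<or> A \<subseteq> ?p D" unfolding irreducible_in_def by blast
    then show "coset_img N H A \<subseteq> C \<or> coset_img N H A \<subseteq> D" by (auto simp: coset_img_def)
  qed
qed

lemma irreducible_in_subtopology:
  assumes "S \<subseteq> Q" shows "irreducible_in (subtopology X Q) S \<longleftrightarrow> irreducible_in X S"
proof
  assume irr: "irreducible_in (subtopology X Q) S"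
  show "irreducible_in X S" unfolding irreducible_in_def
  proof (intro conjI allI impI)
    show "S \<noteq> {}" using irr by (simp add: irreducible_in_def)
    fix A B assume AB: "closedin X A \<and> closedin X B \<and> S \<subseteq> A \<union> B"
    then have "closedin (subtopology X Q) (A \<inter> Q)" "closedin (subtopology X Q) (B \<inter> Q)"
      by (auto simp: closedin_subtopology)
    moreover have "S \<subseteq> (A \<inter> Q) \<union> (B \<inter> Q)" using AB assms by blast
    ultimately have "S \<subseteq> A \<inter> Q \<or> S \<subseteq> B \<inter> Q"
      using irr[unfolded irreducible_in_def, THEN conjunct2, rule_format] by presburger
    then show "S \<subseteq> A \<or> S \<subseteq> B" by blast
  qed
next
  assume irr: "irreducible_in X S"
  show "irreducible_in (subtopology X Q) S" unfolding irreducible_in_def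
  proof (intro conjI allI impI)
    show "S \<noteq> {}" using irr by (simp add: irreducible_in_def)
    fix A B assume AB: "closedin (subtopology X Q) A \<and> closedin (subtopology X Q) B \<and> S \<subseteq> A \<union> B"
    then obtain A' B' where AB': "closedin X A'" "A = A' \<inter> Q" "closedin X B'" "B = B' \<inter> Q"
      by (auto simp: closedin_subtopology)
    moreover have "S \<subseteq> A' \<union> B'" using AB AB' by blast
    ultimately have "S \<subseteq> A' \<or> S \<subseteq> B'"
      using irr[unfolded irreducible_in_def, THEN conjunct2, rule_format] by presburger
    then show "S \<subseteq> A \<or> S \<subseteq> B" using AB' assms by blast
  qed
qed

text \<open>Chains of closed irreducible subsets of a subset of the flag variety, seen in the group.\<close>

definition flag_chain :: "nat \<Rightarrow> complex mat set \<Rightarrow> (nat \<Rightarrow> complex mat set) \<Rightarrow> nat \<Rightarrow> bool" where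
  "flag_chain N X Z k \<longleftrightarrow>
     (\<forall>j\<le>k. zirr N (Z j) \<and> rstable (borel_subgroup N) (Z j) \<and> X \<inter> zcl N (Z j) = Z j) \<and>
     (\<forall>j<k. Z j \<subset> Z (Suc j))"

lemma closedin_irreducible_flag:
  assumes X: "X \<subseteq> carrier (SL N)" "rstable (borel_subgroup N) X"
    and Z: "Z \<subseteq> X" "rstable (borel_subgroup N) Z"
  shows "closedin (subtopology (flag_top N) (coset_img N (borel_subgroup N) X)) (coset_img N (borel_subgroup N) Z)
      \<longleftrightarrow> X \<inter> zcl N Z = Z"
    and "irreducible_in (subtopology (flag_top N) (coset_img N (borel_subgroup N) X)) (coset_img N (borel_subgroup N) Z)
      \<longleftrightarrow> zirr N Z"
proof -
  note B = borel_subgroup_SL[of N]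
  have Bc: "borel_subgroup N \<subseteq> carrier (SL N)" using borel_SL by blast
  have Zc: "Z \<subseteq> carrier (SL N)" using Z X by blast
  have sub: "coset_img N (borel_subgroup N) Z \<subseteq> coset_img N (borel_subgroup N) X"
    using Z(1) by (auto simp: coset_img_def)
  let ?T = "subtopology (flag_top N) (coset_img N (borel_subgroup N) X)"
  note rz = rstable_zcl[OF Bc Zc Z(2)]
  have "?T closure_of coset_img N (borel_subgroup N) Z =
      coset_img N (borel_subgroup N) X \<inter> coset_img N (borel_subgroup N) (zcl N Z)"
    using sub by (simp add: closure_of_subtopology closure_of_coset_img[OF B Zc Z(2)] Int_absorb1)
  also have "\<dots> = coset_img N (borel_subgroup N) (X \<inter> zcl N Z)"
    by (rule coset_img_Int[OF B X(1) zcl_subset_carrier rz])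
  finally have cl: "?T closure_of coset_img N (borel_subgroup N) Z = coset_img N (borel_subgroup N) (X \<inter> zcl N Z)" .
  have "coset_img N (borel_subgroup N) (X \<inter> zcl N Z) = coset_img N (borel_subgroup N) Z \<longleftrightarrow> X \<inter> zcl N Z = Z"
    by (rule coset_img_eq_iff[OF B _ Zc rstable_Int[OF X(2) rz] Z(2)]) (use X in blast)
  then show "closedin ?T (coset_img N (borel_subgroup N) Z) \<longleftrightarrow> X \<inter> zcl N Z = Z"
    unfolding closure_of_eq[symmetric] cl .
  show "irreducible_in ?T (coset_img N (borel_subgroup N) Z) \<longleftrightarrow> zirr N Z"
    unfolding irreducible_in_subtopology[OF sub] by (rule irreducible_in_coset_img[OF B zirr_borel Zc Z(2)])
qed

text \<open>Images and preimages under \<open>g \<mapsto> gB\<close> exchange chains in the quotient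
  with chains of stable sets in the group, strict inclusions included.\<close>

lemma krull_dim_flag_subset:
  assumes X: "X \<subseteq> carrier (SL N)" "rstable (borel_subgroup N) X"
  shows "krull_dim (subtopology (flag_top N) (coset_img N (borel_subgroup N) X)) =
    Sup {enat k | k. \<exists>Z. flag_chain N X Z k}"
proof -
  note B = borel_subgroup_SL[of N]
  let ?T = "subtopology (flag_top N) (coset_img N (borel_subgroup N) X)"
  let ?p = "\<lambda>C. {g \<in> carrier (SL N). g <#\<^bsub>SL N\<^esub> borel_subgroup N \<in> C}"
  have "(\<exists>Z. (\<forall>j\<le>k. closedin ?T (Z j) \<and> irreducible_in ?T (Z j)) \<and> (\<forall>j<k. Z j \<subset> Z (Suc j))) \<longleftrightarrow>
      (\<exists>Z. flag_chain N X Z k)" for k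
  proof
    assume "\<exists>Z. flag_chain N X Z k"
    then obtain Z where Z: "\<And>j. j \<le> k \<Longrightarrow> zirr N (Z j) \<and> rstable (borel_subgroup N) (Z j) \<and> X \<inter> zcl N (Z j) = Z j"
      "\<And>j. j < k \<Longrightarrow> Z j \<subset> Z (Suc j)" unfolding flag_chain_def by blast
    have sub: "Z j \<subseteq> X" if "j \<le> k" for j using Z(1)[OF that] by blast
    have "closedin ?T (coset_img N (borel_subgroup N) (Z j)) \<and> irreducible_in ?T (coset_img N (borel_subgroup N) (Z j))"
      if "j \<le> k" for j
      using closedin_irreducible_flag[OF X sub[OF that]] Z(1)[OF that] by blast
    moreover have "coset_img N (borel_subgroup N) (Z j) \<subset> coset_img N (borel_subgroup N) (Z (Suc j))" if "j < k" for j
    proof -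
      have c: "Z j \<subseteq> carrier (SL N)" "Z (Suc j) \<subseteq> carrier (SL N)" using sub[of j] sub[of "Suc j"] that X(1) by auto
      have r: "rstable (borel_subgroup N) (Z j)" "rstable (borel_subgroup N) (Z (Suc j))"
        using Z(1)[of j] Z(1)[of "Suc j"] that by auto
      show ?thesis
        using coset_img_mono_iff[OF B c r(2)] coset_img_mono_iff[OF B c(2,1) r(1)] Z(2)[OF that] by blast
    qed
    ultimately show "\<exists>Z. (\<forall>j\<le>k. closedin ?T (Z j) \<and> irreducible_in ?T (Z j)) \<and> (\<forall>j<k. Z j \<subset> Z (Suc j))"
      by (intro exI[of _ "\<lambda>j. coset_img N (borel_subgroup N) (Z j)"]) simp
  next
    assume "\<exists>Z. (\<forall>j\<le>k. closedin ?T (Z j) \<and> irreducible_in ?T (Z j)) \<and> (\<forall>j<k. Z j \<subset> Z (Suc j))"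
    then obtain Z where Z: "\<And>j. j \<le> k \<Longrightarrow> closedin ?T (Z j) \<and> irreducible_in ?T (Z j)"
      "\<And>j. j < k \<Longrightarrow> Z j \<subset> Z (Suc j)" by blast
    have sub: "Z j \<subseteq> coset_img N (borel_subgroup N) X" if "j \<le> k" for j
      using closedin_subset[of ?T "Z j"] Z(1)[OF that] by simp
    have img: "coset_img N (borel_subgroup N) (?p (Z j)) = Z j" if "j \<le> k" for j
      using sub[OF that] coset_img_lcosets[OF X(1)] by (intro coset_img_preimage) blast
    have pX: "?p (Z j) \<subseteq> X" if "j \<le> k" for j
      using sub[OF that] mem_coset_img[OF B X] by blast
    note r = rstable_preimage[OF B]
    have "zirr N (?p (Z j)) \<and> X \<inter> zcl N (?p (Z j)) = ?p (Z j)" if "j \<le> k" for j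
      using closedin_irreducible_flag[OF X pX[OF that] r] Z(1)[OF that] unfolding img[OF that] by blast
    moreover have "?p (Z j) \<subset> ?p (Z (Suc j))" if "j < k" for j
    proof
      show "?p (Z j) \<subseteq> ?p (Z (Suc j))" using Z(2)[OF that] by blast
      show "?p (Z j) \<noteq> ?p (Z (Suc j))"
      proof
        assume eq: "?p (Z j) = ?p (Z (Suc j))"
        have "Z j = coset_img N (borel_subgroup N) (?p (Z j))" by (rule img[symmetric]) (use that in simp)
        also have "\<dots> = Z (Suc j)" unfolding eq by (rule img) (use that in simp)
        finally show False using Z(2)[OF that] by simp
      qed
    qed
    ultimately have "flag_chain N X (\<lambda>j. ?p (Z j)) k"
      unfolding flag_chain_def using r by simp
    then show "\<exists>Z. flag_chain N X Z k" by blast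
  qed
  then show ?thesis unfolding krull_dim_def by simp
qed

section \<open>Gram matrices of flags\<close>

text \<open>The Gram matrix of the form \<open>J\<close> on the columns of \<open>h\<close>.
  Elements of the group have equal Gram matrices exactly when they differ by \<open>K\<close> on the
  left; right multiplication by \<open>B\<close> acts by congruence.\<close>

definition gram :: "nat \<Rightarrow> complex mat \<Rightarrow> complex mat" where
  "gram N h = transpose_mat h * antidiag N * h"

definition has_pattern :: "nat \<Rightarrow> (nat \<Rightarrow> nat) \<Rightarrow> complex mat \<Rightarrow> bool" where
  "has_pattern N b M \<longleftrightarrow> (\<forall>p<N. \<forall>q<N. M $$ (p, q) \<noteq> 0 \<longleftrightarrow> p = b q)"

text \<open>The preimage in the group of the orbit with parameter \<open>b\<close>: the flag of
  \<open>h\<close> has a compatible basis in which the form is monomial of pattern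
  \<open>b\<close>.\<close>

definition adapted :: "nat \<Rightarrow> (nat \<Rightarrow> nat) \<Rightarrow> complex mat set" where
  "adapted N b = {h \<in> carrier (SL N). \<exists>\<beta>\<in>borel_subgroup N. has_pattern N b (gram N (h * \<beta>))}"

lemma antidiag_carrier: "antidiag N \<in> carrier_mat N N"
  by (simp add: antidiag_def)

lemma mat_assoc:
  "A \<in> carrier_mat N N \<Longrightarrow> B \<in> carrier_mat N N \<Longrightarrow> C \<in> carrier_mat N N \<Longrightarrow> A * B * C = A * (B * C)"
  for A B C :: "complex mat"
  by (rule assoc_mult_mat)

lemma mat_mult_carrier:
  "A \<in> carrier_mat N N \<Longrightarrow> B \<in> carrier_mat N N \<Longrightarrow> A * B \<in> carrier_mat N N"
  for A B :: "complex mat"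
  by (rule mult_carrier_mat)

lemma antidiag_mult_left:
  assumes "M \<in> carrier_mat N N" "r < N" "s < N"
  shows "(antidiag N * M) $$ (r, s) = M $$ (N - 1 - r, s)"
proof -
  have "(antidiag N * M) $$ (r, s) = (\<Sum>k<N. antidiag N $$ (r, k) * M $$ (k, s))"
    by (rule mult_mat_entry[OF antidiag_carrier assms])
  also have "\<dots> = antidiag N $$ (r, N - 1 - r) * M $$ (N - 1 - r, s)"
    by (rule sum_one_point) (use assms(2) in \<open>auto simp: antidiag_def\<close>)
  finally show ?thesis using assms(2) by (simp add: antidiag_def)
qed

lemma antidiag_mult_right:
  assumes "M \<in> carrier_mat N N" "r < N" "s < N"
  shows "(M * antidiag N) $$ (r, s) = M $$ (r, N - 1 - s)"
proof -
  have "(M * antidiag N) $$ (r, s) = (\<Sum>k<N. M $$ (r, k) * antidiag N $$ (k, s))"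
    by (rule mult_mat_entry[OF assms(1) antidiag_carrier assms(2,3)])
  also have "\<dots> = M $$ (r, N - 1 - s) * antidiag N $$ (N - 1 - s, s)"
    by (rule sum_one_point) (use assms(3) in \<open>auto simp: antidiag_def\<close>)
  finally show ?thesis using assms(3) by (simp add: antidiag_def)
qed

lemma antidiag_sq: "antidiag N * antidiag N = 1\<^sub>m N"
proof (rule eq_matI)
  fix r s assume "r < dim_row (1\<^sub>m N)" "s < dim_col (1\<^sub>m N)"
  then have "r < N" "s < N" by simp_all
  then show "(antidiag N * antidiag N) $$ (r, s) = 1\<^sub>m N $$ (r, s)"
    by (subst antidiag_mult_left[OF antidiag_carrier]) (auto simp: antidiag_def)
qed (simp_all add: antidiag_def)

lemma antidiag_transpose: "transpose_mat (antidiag N) = antidiag N"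
  by (rule eq_matI) (auto simp: antidiag_def)

lemma antidiag_cancel:
  assumes "A \<in> carrier_mat N N"
  shows "antidiag N * (antidiag N * A) = A"
  using assms mat_assoc[OF antidiag_carrier antidiag_carrier assms] by (simp add: antidiag_sq)

lemma antidiag_one [simp]: "1\<^sub>m N * antidiag N = antidiag N" "antidiag N * 1\<^sub>m N = antidiag N"
  by (rule left_mult_one_mat[OF antidiag_carrier], rule right_mult_one_mat[OF antidiag_carrier])

lemma det_antidiag_nonzero: "det (antidiag N) * det (antidiag N) = 1"
  using det_mult[OF antidiag_carrier antidiag_carrier, of N] antidiag_sq[of N] by simp

lemma transpose_mult_SL:
  "A \<in> carrier_mat N N \<Longrightarrow> B \<in> carrier_mat N N \<Longrightarrow>
   transpose_mat (A * B) = transpose_mat B * transpose_mat A" for A B :: "complex mat"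
  by (rule transpose_mult)

lemma gram_carrier: "h \<in> carrier_mat N N \<Longrightarrow> gram N h \<in> carrier_mat N N"
  by (auto simp: gram_def antidiag_carrier intro!: mat_mult_carrier)

lemma gram_mult:
  assumes "h \<in> carrier_mat N N" "\<beta> \<in> carrier_mat N N"
  shows "gram N (h * \<beta>) = transpose_mat \<beta> * gram N h * \<beta>"
  using assms by (simp add: gram_def transpose_mult_SL[of _ N] mat_assoc[of _ N] mat_mult_carrier antidiag_carrier)

lemma transpose_gram:
  assumes "h \<in> carrier_mat N N" shows "transpose_mat (gram N h) = gram N h"
  using assms by (simp add: gram_def transpose_mult_SL[of _ N] mat_assoc[of _ N] mat_mult_carrier antidiag_carrier antidiag_transpose)

lemma det_gram: "h \<in> carrier (SL N) \<Longrightarrow> det (gram N h) = det (antidiag N)"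
  by (simp add: gram_def SL_carrier_iff det_mult[of _ N] mat_mult_carrier antidiag_carrier det_transpose[of _ N])

lemma fixed_group_iff: "k \<in> fixed_group N \<longleftrightarrow> k \<in> carrier (SL N) \<and> gram N k = antidiag N"
proof (cases "k \<in> carrier (SL N)")
  case True
  let ?J = "antidiag N" and ?i = "SL_inv N k"
  have km: "k \<in> carrier_mat N N" and im: "?i \<in> carrier_mat N N"
    using True SL_inv_closed SL_carrier_mat by blast+
  note c = mat_assoc[of _ N] mat_mult_carrier antidiag_carrier km im
  have ik: "transpose_mat k * transpose_mat ?i = 1\<^sub>m N" "transpose_mat ?i * transpose_mat k = 1\<^sub>m N"
    using SL_inv_left[OF True] SL_inv_right[OF True] transpose_mult_SL[OF im km] transpose_mult_SL[OF km im]
    by (metis transpose_one)+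
  have "theta N k = k \<longleftrightarrow> gram N k = ?J"
  proof
    assume eq: "theta N k = k"
    have "?J * theta N k = transpose_mat ?i * ?J"
      unfolding theta_def by (simp add: c antidiag_cancel)
    then have "transpose_mat k * (?J * k) = transpose_mat k * (transpose_mat ?i * ?J)" using eq by simp
    also have "\<dots> = ?J" using ik by (simp add: mat_mult_carrier antidiag_carrier km im flip: mat_assoc[of _ N])
    finally show "gram N k = ?J" by (simp add: gram_def c)
  next
    assume eq: "gram N k = ?J"
    have "theta N k = ?J * (transpose_mat ?i * ?J)" unfolding theta_def by (simp add: c)
    also have "\<dots> = ?J * (transpose_mat ?i * (transpose_mat k * (?J * k)))"
      using eq by (simp add: gram_def c)
    also have "transpose_mat ?i * (transpose_mat k * (?J * k)) = (transpose_mat ?i * transpose_mat k) * (?J * k)"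
      by (simp add: c)
    also have "\<dots> = ?J * k" unfolding ik by (rule left_mult_one_mat[OF mat_mult_carrier[OF antidiag_carrier km]])
    also have "?J * (?J * k) = k" by (rule antidiag_cancel[OF km])
    finally show "theta N k = k" .
  qed
  then show ?thesis using True by (simp add: fixed_group_def)
qed (simp add: fixed_group_def)

lemma fixed_SL: "k \<in> fixed_group N \<Longrightarrow> k \<in> carrier (SL N)"
  by (simp add: fixed_group_iff)

lemma gram_fixed_mult:
  assumes "k \<in> fixed_group N" "h \<in> carrier_mat N N" shows "gram N (k * h) = gram N h"
  using assms gram_mult[of k N h] by (simp add: fixed_group_iff SL_carrier_mat gram_def)

lemma fixed_one: "1\<^sub>m N \<in> fixed_group N"
  by (simp add: fixed_group_iff SL_one_closed gram_def antidiag_carrier)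

lemma fixed_mult: "k \<in> fixed_group N \<Longrightarrow> l \<in> fixed_group N \<Longrightarrow> k * l \<in> fixed_group N"
  using gram_fixed_mult[of k N l] by (simp add: fixed_group_iff SL_mult_closed SL_carrier_mat)

lemma fixed_of_gram_eq:
  assumes "g \<in> carrier (SL N)" "h \<in> carrier (SL N)" "gram N g = gram N h"
  shows "h * SL_inv N g \<in> fixed_group N"
proof -
  let ?i = "SL_inv N g"
  have i: "?i \<in> carrier (SL N)" by (rule SL_inv_closed[OF assms(1)])
  have m: "g \<in> carrier_mat N N" "h \<in> carrier_mat N N" "?i \<in> carrier_mat N N"
    using assms i SL_carrier_mat by blast+
  have "gram N (h * ?i) = transpose_mat ?i * gram N g * ?i" using gram_mult[OF m(2,3)] assms(3) by simp
  also have "\<dots> = gram N (g * ?i)" using gram_mult[OF m(1,3)] by simp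
  also have "\<dots> = antidiag N" using SL_inv_right[OF assms(1)] by (simp add: gram_def antidiag_carrier)
  finally show ?thesis using assms i by (simp add: fixed_group_iff SL_mult_closed)
qed

lemma quadratic_entry:
  assumes "M \<in> carrier_mat N N" "A \<in> carrier_mat N m" "B \<in> carrier_mat N m'" "p < m" "q < m'"
  shows "(transpose_mat A * M * B) $$ (p, q) = (\<Sum>k<N. \<Sum>l<N. A $$ (k, p) * M $$ (k, l) * B $$ (l, q))"
proof -
  have "(transpose_mat A * M * B) $$ (p, q) = (\<Sum>l<N. (transpose_mat A * M) $$ (p, l) * B $$ (l, q))"
    by (rule mult_mat_entry) (use assms in auto)
  also have "\<dots> = (\<Sum>l<N. (\<Sum>k<N. A $$ (k, p) * M $$ (k, l)) * B $$ (l, q))"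
  proof (rule sum.cong[OF refl])
    fix l assume "l \<in> {..<N}"
    then have "(transpose_mat A * M) $$ (p, l) = (\<Sum>k<N. transpose_mat A $$ (p, k) * M $$ (k, l))"
      by (intro mult_mat_entry[of _ m]) (use assms in auto)
    then show "(transpose_mat A * M) $$ (p, l) * B $$ (l, q) = (\<Sum>k<N. A $$ (k, p) * M $$ (k, l)) * B $$ (l, q)"
      using assms by auto
  qed
  also have "\<dots> = (\<Sum>k<N. \<Sum>l<N. A $$ (k, p) * M $$ (k, l) * B $$ (l, q))"
    by (subst sum.swap) (simp add: sum_distrib_right)
  finally show ?thesis .
qed

subsection \<open>Reduction to a monomial Gram matrix\<close>

text \<open>Right multiplication adds \<open>a q\<close> times column \<open>r\<close> to each
  earlier column \<open>q\<close>, the kind of column operation that the lower triangular group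
  offers.\<close>

definition addrows :: "nat \<Rightarrow> nat \<Rightarrow> (nat \<Rightarrow> complex) \<Rightarrow> complex mat" where
  "addrows N r a = mat N N (\<lambda>(p, q). (if p = q then 1 else 0) + (if p = r \<and> q < r then a q else 0))"

lemma addrows_borel: "addrows N r a \<in> borel_subgroup N"
proof -
  have "det (addrows N r a) = 1"
    by (rule det_unitriangular[of _ N]) (auto simp: addrows_def)
  then show ?thesis by (auto simp: borel_subgroup_def SL_carrier_iff addrows_def)
qed

lemma addrows_congruence:
  fixes a c :: "nat \<Rightarrow> complex"
  assumes M: "M \<in> carrier_mat N N" and r: "r < N" and pq: "p < N" "q < N"
  defines "c \<equiv> \<lambda>q. if q < r then a q else 0"
  shows "(transpose_mat (addrows N r a) * M * addrows N r a) $$ (p, q) =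
    M $$ (p, q) + c p * M $$ (r, q) + c q * M $$ (p, r) + c p * c q * M $$ (r, r)"
proof -
  have A: "addrows N r a $$ (k, p) = (if k = p then 1 else 0) + (if k = r then c p else 0)" if "k < N" "p < N" for k p
    using that by (auto simp: addrows_def c_def)
  have *: "(\<Sum>k<N. ((if k = p then 1 else 0) + (if k = r then c p else 0)) * f k) = f p + c p * f r"
    if "p < N" for f p
  proof -
    have "(\<Sum>k<N. ((if k = p then 1 else 0) + (if k = r then c p else 0)) * f k) =
        (\<Sum>k<N. if k = p then f p else 0) + (\<Sum>k<N. if k = r then c p * f r else 0)"
      unfolding sum.distrib[symmetric] by (intro sum.cong) (auto simp: algebra_simps)
    then show ?thesis using that r by (simp add: sum.delta)
  qed
  have "(transpose_mat (addrows N r a) * M * addrows N r a) $$ (p, q) =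
      (\<Sum>k<N. \<Sum>l<N. addrows N r a $$ (k, p) * M $$ (k, l) * addrows N r a $$ (l, q))"
    by (rule quadratic_entry[OF M]) (use pq in \<open>auto simp: addrows_def\<close>)
  also have "\<dots> = (\<Sum>k<N. ((if k = p then 1 else 0) + (if k = r then c p else 0)) *
      (\<Sum>l<N. ((if l = q then 1 else 0) + (if l = r then c q else 0)) * M $$ (k, l)))"
    unfolding sum_distrib_left by (intro sum.cong refl) (simp only: A pq lessThan_iff mult.assoc mult.commute mult.left_commute)
  also have "\<dots> = (M $$ (p, q) + c q * M $$ (p, r)) + c p * (M $$ (r, q) + c q * M $$ (r, r))"
    by (simp only: *[OF pq(2)] *[OF pq(1)])
  finally show ?thesis by (simp add: algebra_simps)
qed

lemma symmetric_entry:
  "transpose_mat M = M \<Longrightarrow> M \<in> carrier_mat N N \<Longrightarrow> p < N \<Longrightarrow> q < N \<Longrightarrow> M $$ (p, q) = M $$ (q, p)"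
  by (metis carrier_matD index_transpose_mat(1))

lemma congruence_props:
  assumes "M \<in> carrier_mat N N" "transpose_mat M = M" "det M \<noteq> 0" "\<beta> \<in> borel_subgroup N"
  shows "transpose_mat \<beta> * M * \<beta> \<in> carrier_mat N N"
    "transpose_mat (transpose_mat \<beta> * M * \<beta>) = transpose_mat \<beta> * M * \<beta>"
    "det (transpose_mat \<beta> * M * \<beta>) \<noteq> 0"
proof -
  have b: "\<beta> \<in> carrier_mat N N" "det \<beta> = 1" using borel_SL[OF assms(4)] by (auto simp: SL_carrier_iff)
  show "transpose_mat \<beta> * M * \<beta> \<in> carrier_mat N N" using b assms(1) by (auto intro!: mat_mult_carrier)
  show "transpose_mat (transpose_mat \<beta> * M * \<beta>) = transpose_mat \<beta> * M * \<beta>"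
    using b assms(1,2) by (simp add: transpose_mult_SL[of _ N] mat_mult_carrier mat_assoc[of _ N])
  show "det (transpose_mat \<beta> * M * \<beta>) \<noteq> 0"
    using b assms(1,3) by (simp add: det_mult[of _ N] mat_mult_carrier det_transpose[of _ N])
qed

lemma involutionI:
  assumes "\<And>p. p < N \<Longrightarrow> b p < N" "\<And>p. p < N \<Longrightarrow> b (b p) = p" "\<And>p. \<not> p < N \<Longrightarrow> b p = p"
  shows "b \<in> involutions N"
proof -
  have bb: "b (b p) = p" for p using assms by (cases "p < N") auto
  then have "b permutes {..<N}" unfolding permutes_def using assms(3) by (metis lessThan_iff)
  then show ?thesis using bb by (auto simp: involutions_def)
qed

lemma involution_involutive: "b \<in> involutions N \<Longrightarrow> b (b p) = p"
  unfolding involutions_def by (metis (mono_tags, lifting) comp_apply id_apply mem_Collect_eq)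

lemma involution_permutes: "b \<in> involutions N \<Longrightarrow> b permutes {..<N}"
  by (simp add: involutions_def)

lemma involution_less: "b \<in> involutions N \<Longrightarrow> p < N \<Longrightarrow> b p < N"
  using permutes_in_image[OF involution_permutes, of b N p] by simp

lemma involution_outside: "b \<in> involutions N \<Longrightarrow> \<not> p < N \<Longrightarrow> b p = p"
  using permutes_not_in[OF involution_permutes, of b N p] by simp

lemma involution_eq_iff: "b \<in> involutions N \<Longrightarrow> b p = q \<longleftrightarrow> p = b q"
  using involution_involutive by metis

text \<open>\<open>S\<close> holds the indices not yet split off; outside \<open>S\<close> the
  matrix is already monomial with pattern \<open>b0\<close>. Each round splits off one index with a
  nonzero diagonal entry or two indices paired with each other, by operations of
  \<open>B\<close>.\<close>

lemma monomial_reduction: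
  assumes "M \<in> carrier_mat N N" "transpose_mat M = M" "det M \<noteq> 0" "S \<subseteq> {..<N}"
    and "\<And>p. p < N \<Longrightarrow> p \<notin> S \<Longrightarrow> b0 p < N \<and> b0 p \<notin> S \<and> b0 (b0 p) = p"
    and "\<And>p q. p < N \<Longrightarrow> p \<notin> S \<Longrightarrow> q < N \<Longrightarrow> M $$ (p, q) \<noteq> 0 \<longleftrightarrow> q = b0 p"
  shows "\<exists>\<beta>\<in>borel_subgroup N. \<exists>b\<in>involutions N. has_pattern N b (transpose_mat \<beta> * M * \<beta>)"
  using assms
proof (induction "card S" arbitrary: S M b0 rule: less_induct)
  case less
  note M = less.prems(1) and sym = less.prems(2) and dM = less.prems(3) and S = less.prems(4)
    and b0 = less.prems(5) and pat = less.prems(6)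
  have M': "M $$ (p, q) = M $$ (q, p)" if "p < N" "q < N" for p q
    by (rule symmetric_entry[OF sym M that])
  have fin: "finite S" using S finite_subset by blast
  \<comment> \<open>One round: after a congruence by \<open>\<beta>\<close> the induction hypothesis
    applies to a smaller set, and the two congruences compose.\<close>
  have reduce: ?case if "\<beta> \<in> borel_subgroup N" "S' \<subseteq> S" "S' \<noteq> S" "M1 = transpose_mat \<beta> * M * \<beta>"
    "\<And>p. p < N \<Longrightarrow> p \<notin> S' \<Longrightarrow> b1 p < N \<and> b1 p \<notin> S' \<and> b1 (b1 p) = p"
    "\<And>p q. p < N \<Longrightarrow> p \<notin> S' \<Longrightarrow> q < N \<Longrightarrow> M1 $$ (p, q) \<noteq> 0 \<longleftrightarrow> q = b1 p" for \<beta> S' M1 b1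
  proof -
    note pr = congruence_props[OF M sym dM that(1), folded that(4)]
    have "card S' < card S" using that(2,3) fin by (intro psubset_card_mono) auto
    from less.hyps[OF this pr _ that(5,6)] that(2) S
    obtain \<gamma> b where g: "\<gamma> \<in> borel_subgroup N" "b \<in> involutions N" "has_pattern N b (transpose_mat \<gamma> * M1 * \<gamma>)"
      by blast
    have m: "\<beta> \<in> carrier_mat N N" "\<gamma> \<in> carrier_mat N N" using that(1) g(1) borel_SL SL_carrier_mat by blast+
    have "transpose_mat \<gamma> * M1 * \<gamma> = transpose_mat (\<beta> * \<gamma>) * M * (\<beta> * \<gamma>)"
      unfolding that(4) using m M by (simp add: transpose_mult_SL[of _ N] mat_assoc[of _ N] mat_mult_carrier)
    then show ?thesis using g borel_mult[OF that(1) g(1)] by metis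
  qed
  show ?case
  proof (cases "S = {}")
    case True
    let ?b = "\<lambda>p. if p < N then b0 p else p"
    have b: "?b \<in> involutions N" by (rule involutionI) (use True b0 in auto)
    have "has_pattern N ?b M" unfolding has_pattern_def
    proof (intro allI impI)
      fix p q assume pq: "p < N" "q < N"
      have "M $$ (p, q) \<noteq> 0 \<longleftrightarrow> M $$ (q, p) \<noteq> 0" using M'[OF pq] by simp
      also have "\<dots> \<longleftrightarrow> p = b0 q" using pat[of q p] True pq by simp
      finally show "M $$ (p, q) \<noteq> 0 \<longleftrightarrow> p = ?b q" using pq by simp
    qed
    then have "has_pattern N ?b (transpose_mat (1\<^sub>m N) * M * 1\<^sub>m N)" using M by simp
    then show ?thesis using b borel_one by blast
  next
    case False
    \<comment> \<open>Columns are only added to columns on their left, so the pivot is sought at the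
      right end.\<close>
    define s where "s = Max S"
    have s: "s \<in> S" "s < N" "\<And>p. p \<in> S \<Longrightarrow> p \<le> s"
      using False fin S unfolding s_def by (auto simp: subset_iff)
    have outside: "M $$ (p, q) = 0" if "p < N" "p \<notin> S" "q \<in> S" for p q
      using pat[of p q] b0[of p] that S by auto
    have outside': "M $$ (q, p) = 0" if "p < N" "p \<notin> S" "q \<in> S" for p q
      using outside[OF that] M'[of p q] that S by auto
    show ?thesis
    proof (cases "M $$ (s, s) = 0")
      case nz: False
      define a where "a q = - M $$ (q, s) / M $$ (s, s)" for q
      define M1 where "M1 = transpose_mat (addrows N s a) * M * addrows N s a"
      have M1: "M1 $$ (p, q) = M $$ (p, q) + (if p < s then a p else 0) * M $$ (s, q) +
          (if q < s then a q else 0) * M $$ (p, s) + (if p < s then a p else 0) * (if q < s then a q else 0) * M $$ (s, s)"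
        if "p < N" "q < N" for p q
        unfolding M1_def by (rule addrows_congruence[OF M s(2) that])
      show ?thesis
      proof (rule reduce[OF addrows_borel _ _ M1_def])
        show "S - {s} \<subseteq> S" "S - {s} \<noteq> S" using s(1) by auto
        show "(b0(s := s)) p < N \<and> (b0(s := s)) p \<notin> S - {s} \<and> (b0(s := s)) ((b0(s := s)) p) = p"
          if "p < N" "p \<notin> S - {s}" for p
          using b0[of p] that s(1) by (cases "p = s") auto
        show "M1 $$ (p, q) \<noteq> 0 \<longleftrightarrow> q = (b0(s := s)) p" if "p < N" "p \<notin> S - {s}" "q < N" for p q
        proof (cases "p = s")
          case True
          have "M1 $$ (s, q) = (if q = s then M $$ (s, s) else 0)"
          proof (cases q s rule: linorder_cases)
            case less
            then show ?thesis using M1[of s q] s(2) that(3) nz M'[of q s] by (simp add: a_def)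
          next
            case greater
            then have "q \<notin> S" using s(3)[of q] by auto
            then show ?thesis using M1[of s q] s(1,2) that(3) greater outside'[of q s] by simp
          qed (use M1[of s s] s(2) in simp)
          then show ?thesis using True nz by auto
        next
          case False
          then have pS: "p \<notin> S" using that by blast
          have "M $$ (p, s) = 0" using outside[OF that(1) pS s(1)] .
          then have "a p = 0" by (simp add: a_def)
          then have "M1 $$ (p, q) = M $$ (p, q)" using M1[OF that(1,3)] \<open>M $$ (p, s) = 0\<close> by simp
          then show ?thesis using pat[OF that(1) pS that(3)] False by simp
        qed
      qed
    next
      case sz: True
      have "\<exists>k<N. M $$ (s, k) \<noteq> 0"
      proof (rule ccontr)
        assume no: "\<not> ?thesis"
        have "det M = (\<Sum>\<pi>\<in>{\<pi>. \<pi> permutes {0..<N}}. signof \<pi> * (\<Prod>i = 0..<N. M $$ (i, \<pi> i)))"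
          by (rule det_def'[OF M])
        also have "\<dots> = 0"
        proof (rule sum.neutral, rule ballI)
          fix \<pi> assume "\<pi> \<in> {\<pi>. \<pi> permutes {0..<N}}"
          then have "\<pi> s < N" using s(2) permutes_in_image[of \<pi> "{0..<N}" s] by auto
          then have "M $$ (s, \<pi> s) = 0" using no by blast
          then have "(\<Prod>i = 0..<N. M $$ (i, \<pi> i)) = 0" using s(2) by (intro prod_zero) auto
          then show "signof \<pi> * (\<Prod>i = 0..<N. M $$ (i, \<pi> i)) = 0" by simp
        qed
        finally show False using dM by simp
      qed
      \<comment> \<open>The rightmost nonzero entry of row \<open>s\<close> can clear all the
        others, which lie to its left.\<close>
      define k where "k = Max {k. k < N \<and> M $$ (s, k) \<noteq> 0}"
      have "k \<in> {k. k < N \<and> M $$ (s, k) \<noteq> 0}" unfolding k_def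
        using \<open>\<exists>k<N. M $$ (s, k) \<noteq> 0\<close> by (intro Max_in) auto
      then have k: "k < N" "M $$ (s, k) \<noteq> 0" by auto
      have kmax: "M $$ (s, q) = 0" if "k < q" "q < N" for q
      proof (rule ccontr)
        assume "M $$ (s, q) \<noteq> 0"
        then have "q \<le> k" unfolding k_def using that(2) by (intro Max_ge) auto
        then show False using that(1) by simp
      qed
      have kS: "k \<in> S" using outside'[of k s] k s(1) by blast
      have ks: "k < s" using s(3)[OF kS] k(2) sz by (cases "k = s") auto
      have ksM: "M $$ (k, s) \<noteq> 0" using M'[of k s] k s(2) by simp
      define a where "a q = - M $$ (q, s) / M $$ (k, s)" for q
      define M1 where "M1 = transpose_mat (addrows N k a) * M * addrows N k a"
      have M1: "M1 $$ (p, q) = M $$ (p, q) + (if p < k then a p else 0) * M $$ (k, q) +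
          (if q < k then a q else 0) * M $$ (p, k) + (if p < k then a p else 0) * (if q < k then a q else 0) * M $$ (k, k)"
        if "p < N" "q < N" for p q
        unfolding M1_def by (rule addrows_congruence[OF M k(1) that])
      note pr1 = congruence_props[OF M sym dM addrows_borel[of N k a], folded M1_def]
      have M1': "M1 $$ (p, q) = M1 $$ (q, p)" if "p < N" "q < N" for p q
        by (rule symmetric_entry[OF pr1(2,1) that])
      have M1out: "M1 $$ (p, q) = M $$ (p, q)" if "p < N" "p \<notin> S" "q < N" for p q
        using M1[OF that(1,3)] outside[OF that(1,2) s(1)] outside[OF that(1,2) kS] by (simp add: a_def)
      have M1s: "M1 $$ (p, s) = (if p = k then M $$ (k, s) else 0)" if "p < N" for p
      proof (cases p k rule: linorder_cases)
        case less
        then show ?thesis using M1[OF that s(2)] ks ksM by (simp add: a_def)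
      next
        case equal
        then show ?thesis using M1[OF that s(2)] ks by simp
      next
        case greater
        have "M $$ (p, s) = 0" using kmax[OF greater that] M'[OF that s(2)] by simp
        then show ?thesis using M1[OF that s(2)] ks greater by simp
      qed
      \<comment> \<open>Adding a multiple of column and row \<open>s\<close> changes the diagonal
        entry at \<open>k\<close> twice, once from each side; hence the factor \<open>2\<close>
        there.\<close>
      define c where "c q = (if q = k then - M1 $$ (k, k) / (2 * M1 $$ (k, s)) else - M1 $$ (q, k) / M1 $$ (k, s))" for q
      define M2 where "M2 = transpose_mat (addrows N s c) * M1 * addrows N s c"
      have M1ss: "M1 $$ (s, s) = 0" using M1s[OF s(2)] ks by simp
      have M1sp: "M1 $$ (s, p) = (if p = k then M $$ (k, s) else 0)" if "p < N" for p
        using M1s[OF that] M1'[OF that s(2)] by simp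
      have M2: "M2 $$ (p, q) = M1 $$ (p, q) + (if p < s then c p else 0) * M1 $$ (s, q) +
          (if q < s then c q else 0) * M1 $$ (p, s)"
        if "p < N" "q < N" for p q
        unfolding M2_def using addrows_congruence[OF pr1(1) s(2) that, of c] M1ss by simp
      have M1k: "M1 $$ (k, s) = M $$ (k, s)" using M1s[OF k(1)] by simp
      have M2eq: "M2 = transpose_mat (addrows N k a * addrows N s c) * M * (addrows N k a * addrows N s c)"
      proof -
        have m: "addrows N k a \<in> carrier_mat N N" "addrows N s c \<in> carrier_mat N N" by (simp_all add: addrows_def)
        show ?thesis unfolding M2_def M1_def using m M
          by (simp add: transpose_mult_SL[of _ N] mat_assoc[of _ N] mat_mult_carrier)
      qed
      show ?thesis
      proof (rule reduce[OF borel_mult[OF addrows_borel addrows_borel] _ _ M2eq])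
        let ?b = "b0(s := k, k := s)"
        show "S - {s, k} \<subseteq> S" "S - {s, k} \<noteq> S" using s(1) by auto
        show "?b p < N \<and> ?b p \<notin> S - {s, k} \<and> ?b (?b p) = p" if "p < N" "p \<notin> S - {s, k}" for p
        proof (cases "p = s \<or> p = k")
          case True
          then show ?thesis using s(2) k(1) ks by auto
        next
          case False
          then have "p \<notin> S" using that by blast
          then have "b0 p \<notin> S" "b0 p < N" "b0 (b0 p) = p" using b0[OF that(1)] by auto
          moreover have "b0 p \<noteq> s" "b0 p \<noteq> k" using calculation s(1) kS by auto
          ultimately show ?thesis using False by simp
        qed
        show "M2 $$ (p, q) \<noteq> 0 \<longleftrightarrow> q = ?b p" if "p < N" "p \<notin> S - {s, k}" "q < N" for p q
        proof -
          consider "p = s" | "p = k" | "p \<noteq> s" "p \<noteq> k" "p \<notin> S"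
            using \<open>p \<notin> S - {s, k}\<close> by blast
          then show ?thesis
          proof cases
            case 1
            have "M2 $$ (s, q) = (if q = k then M $$ (k, s) else 0)"
              using M2[OF s(2) that(3)] M1ss M1sp[OF that(3)] by simp
            then show ?thesis using 1 ks ksM by auto
          next
            case 2
            have "M2 $$ (k, q) = M1 $$ (k, q) + c k * M1 $$ (s, q) + (if q < s then c q else 0) * M $$ (k, s)"
              using M2[OF k(1) that(3)] ks M1k by simp
            also have "\<dots> = (if q = s then M $$ (k, s) else 0)"
            proof -
              consider "q = k" | "q = s" | "q < s" "q \<noteq> k" | "q > s" by linarith
              then show ?thesis
              proof cases
                case 1
                then show ?thesis using ks ksM M1k M1sp[OF k(1)] by (simp add: c_def field_simps)
              next
                case 2
                then show ?thesis using M1ss M1k by simp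
              next
                case 3
                then show ?thesis using ks ksM M1k M1sp[OF that(3)] M1'[OF k(1) that(3)] by (simp add: c_def)
              next
                case 4
                then have "q \<notin> S" using s(3) by force
                then have "M1 $$ (k, q) = 0" using M1out[OF that(3) _ k(1)] outside[OF that(3) _ kS] M1'[OF k(1) that(3)] by simp
                then show ?thesis using 4 ks M1sp[OF that(3)] by simp
              qed
            qed
            finally show ?thesis using 2 ks ksM by auto
          next
            case 3
            have "M1 $$ (p, k) = 0" using M1out[OF that(1) 3(3) k(1)] outside[OF that(1) 3(3) kS] by simp
            then have "c p = 0" using 3 by (simp add: c_def)
            moreover have "M1 $$ (p, s) = 0" using M1s[OF that(1)] 3 by simp
            ultimately have "M2 $$ (p, q) = M $$ (p, q)"
              using M2[OF that(1,3)] M1out[OF that(1) 3(3) that(3)] by simp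
            then show ?thesis using pat[OF that(1) 3(3) that(3)] 3 by simp
          qed
        qed
      qed
    qed
  qed
qed

lemma adapted_cover:
  assumes "h \<in> carrier (SL N)" shows "\<exists>b\<in>involutions N. h \<in> adapted N b"
proof -
  have h: "h \<in> carrier_mat N N" by (rule SL_carrier_mat[OF assms])
  have d: "det (gram N h) \<noteq> 0" using det_gram[OF assms] det_antidiag_nonzero[of N] by auto
  obtain \<beta> b where b: "\<beta> \<in> borel_subgroup N" "b \<in> involutions N"
    "has_pattern N b (transpose_mat \<beta> * gram N h * \<beta>)"
    using monomial_reduction[OF gram_carrier[OF h] transpose_gram[OF h] d, of "{..<N}" id] by auto
  have "\<beta> \<in> carrier_mat N N" using b(1) borel_SL SL_carrier_mat by blast
  then have "has_pattern N b (gram N (h * \<beta>))" using b(3) gram_mult[OF h] by simp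
  then show ?thesis using b(1,2) assms unfolding adapted_def by blast
qed

section \<open>Orbits and involutions\<close>

lemma monomial_inverse:
  assumes "D \<in> carrier_mat N N" "M \<in> carrier_mat N N" "D * M = 1\<^sub>m N"
    and "has_pattern N b D" "b permutes {..<N}" "p < N" "q < N"
  shows "M $$ (p, q) \<noteq> 0 \<longleftrightarrow> b p = q"
proof -
  have bp: "b p < N" using permutes_in_image[OF assms(5), of p] assms(6) by simp
  have "(D * M) $$ (b p, q) = (\<Sum>k<N. D $$ (b p, k) * M $$ (k, q))"
    by (rule mult_mat_entry[OF assms(1,2) bp assms(7)])
  also have "\<dots> = D $$ (b p, p) * M $$ (p, q)"
  proof (rule sum_one_point[OF assms(6)])
    fix k assume k: "k < N" "k \<noteq> p"
    then have "b p \<noteq> b k" using permutes_inj[OF assms(5)] by (auto dest: injD)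
    then have "D $$ (b p, k) = 0" using assms(4) bp k(1) unfolding has_pattern_def by blast
    then show "D $$ (b p, k) * M $$ (k, q) = 0" by simp
  qed
  finally have "D $$ (b p, p) * M $$ (p, q) = (if b p = q then 1 else 0)"
    using bp assms(3,7) by simp
  moreover have "D $$ (b p, p) \<noteq> 0" using assms(4,6) bp unfolding has_pattern_def by blast
  ultimately show ?thesis by (auto split: if_splits)
qed

lemma monomial_conj_torus:
  assumes x: "x \<in> carrier (SL N)" "has_pattern N w x" "w permutes {..<N}" and t: "t \<in> torus N"
  shows "x * t * SL_inv N x \<in> torus N"
proof -
  have tc: "t \<in> carrier (SL N)" using t by (simp add: torus_def)
  have ic: "SL_inv N x \<in> carrier (SL N)" by (rule SL_inv_closed[OF x(1)])
  note m = SL_carrier_mat[OF x(1)] SL_carrier_mat[OF tc] SL_carrier_mat[OF ic]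
  have "(x * t * SL_inv N x) $$ (r, c) = 0" if rc: "r < N" "c < N" "r \<noteq> c" for r c
  proof -
    have "(x * t * SL_inv N x) $$ (r, c) = (\<Sum>k<N. (x * t) $$ (r, k) * SL_inv N x $$ (k, c))"
      by (rule mult_mat_entry[OF mat_mult_carrier[OF m(1,2)] m(3) rc(1,2)])
    also have "\<dots> = 0"
    proof (rule sum.neutral, rule ballI)
      fix k assume "k \<in> {..<N}"
      then have k: "k < N" by simp
      have "(x * t) $$ (r, k) = (\<Sum>l<N. x $$ (r, l) * t $$ (l, k))"
        by (rule mult_mat_entry[OF m(1,2) rc(1) k])
      also have "\<dots> = x $$ (r, k) * t $$ (k, k)"
        by (rule sum_one_point[OF k]) (use t k in \<open>auto simp: torus_def\<close>)
      finally have "(x * t) $$ (r, k) \<noteq> 0 \<Longrightarrow> r = w k"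
        using x(2) rc(1) k by (auto simp: has_pattern_def)
      moreover have "SL_inv N x $$ (k, c) \<noteq> 0 \<Longrightarrow> w k = c"
        using monomial_inverse[OF m(1,3) SL_inv_right[OF x(1)] x(2,3) k rc(2)] by blast
      ultimately show "(x * t) $$ (r, k) * SL_inv N x $$ (k, c) = 0" using rc(3) by auto
    qed
    finally show ?thesis .
  qed
  then show ?thesis using x(1) tc ic by (simp add: torus_def SL_mult_closed)
qed

lemma monomial_normalizer:
  assumes x: "x \<in> carrier (SL N)" "has_pattern N w x" "w permutes {..<N}"
  shows "x \<in> normalizer (SL N) (torus N)"
proof -
  have ic: "SL_inv N x \<in> carrier (SL N)" by (rule SL_inv_closed[OF x(1)])
  have inv_pat: "has_pattern N (inv_into UNIV w) (SL_inv N x)" unfolding has_pattern_def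
  proof (intro allI impI)
    fix p q assume pq: "p < N" "q < N"
    have "SL_inv N x $$ (p, q) \<noteq> 0 \<longleftrightarrow> w p = q"
      by (rule monomial_inverse[OF SL_carrier_mat[OF x(1)] SL_carrier_mat[OF ic] SL_inv_right[OF x(1)] x(2,3) pq])
    also have "\<dots> \<longleftrightarrow> p = inv_into UNIV w q" using permutes_inverses[OF x(3)] by metis
    finally show "SL_inv N x $$ (p, q) \<noteq> 0 \<longleftrightarrow> p = inv_into UNIV w q" .
  qed
  have eq: "x <#\<^bsub>SL N\<^esub> torus N #>\<^bsub>SL N\<^esub> SL_inv N x = (\<lambda>t. x * t * SL_inv N x) ` torus N"
    by (auto simp: l_coset_def r_coset_def)
  have "(\<lambda>t. x * t * SL_inv N x) ` torus N = torus N"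
  proof
    show "(\<lambda>t. x * t * SL_inv N x) ` torus N \<subseteq> torus N" using monomial_conj_torus[OF x] by blast
    show "torus N \<subseteq> (\<lambda>t. x * t * SL_inv N x) ` torus N"
    proof
      fix t assume t: "t \<in> torus N"
      then have tc: "t \<in> carrier (SL N)" by (simp add: torus_def)
      have s: "SL_inv N x * t * SL_inv N (SL_inv N x) \<in> torus N"
        by (rule monomial_conj_torus[OF ic inv_pat permutes_inv[OF x(3)] t])
      have "x * (SL_inv N x * t * x) * SL_inv N x = t"
        using x(1) ic tc SL_inv_mult_cancel[OF x(1)] by (simp add: SL_assoc[of _ N] SL_mult_closed SL_inv_right SL_right_one)
      then show "t \<in> (\<lambda>t. x * t * SL_inv N x) ` torus N"
        using s unfolding SL_inv_inv[OF x(1)] by (metis image_eqI)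
    qed
  qed
  then show ?thesis using x(1) eq
    by (auto simp: normalizer_def stabilizer_def torus_def)
qed

lemma longest_involution: "longest N \<in> involutions N"
  by (rule involutionI) (auto simp: longest_def)

lemma longest_less: "p < N \<Longrightarrow> longest N p < N"
  by (rule involution_less[OF longest_involution])

text \<open>For the element \<open>x\<close> represented here, \<open>x J = g J g^t\<close>, the
  inverse of the Gram matrix of the inverse of \<open>g\<close>. The inverse of a symmetric monomial
  matrix has the same pattern, and multiplication by \<open>J\<close> composes the permutation with
  \<open>longest N\<close>.\<close>

lemma represents_iff_pattern:
  assumes g: "g \<in> carrier (SL N)"
  shows "represents N (g \<otimes>\<^bsub>SL N\<^esub> SL_inv N (theta N g)) w \<longleftrightarrow>
    w permutes {..<N} \<and> has_pattern N (w \<circ> longest N) (gram N (SL_inv N g))"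
proof -
  let ?J = "antidiag N" and ?i = "SL_inv N g"
  have ic: "?i \<in> carrier (SL N)" by (rule SL_inv_closed[OF g])
  note gm = SL_carrier_mat[OF g] and im = SL_carrier_mat[OF ic]
  note c = mat_assoc[of _ N] mat_mult_carrier antidiag_carrier gm im
  have JgJ: "?J * transpose_mat h * ?J \<in> carrier (SL N)" if "h \<in> carrier (SL N)" for h
    using that det_antidiag_nonzero[of N]
    by (auto simp: SL_carrier_iff det_mult[of _ N] antidiag_carrier mat_mult_carrier det_transpose[of _ N])
  have gi: "transpose_mat g * transpose_mat ?i = 1\<^sub>m N"
    using SL_inv_left[OF g] transpose_mult_SL[OF im gm] by simp
  have th: "SL_inv N (theta N g) = ?J * transpose_mat g * ?J"
  proof (rule SL_inv_unique)
    show "theta N g \<in> carrier (SL N)" unfolding theta_def by (rule JgJ[OF ic])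
    show "?J * transpose_mat g * ?J \<in> carrier (SL N)" by (rule JgJ[OF g])
    have "?J * transpose_mat g * ?J * theta N g = ?J * (transpose_mat g * (?J * (?J * (transpose_mat ?i * ?J))))"
      unfolding theta_def by (simp add: c)
    also have "\<dots> = ?J * (transpose_mat g * (transpose_mat ?i * ?J))"
      by (simp add: antidiag_cancel c)
    also have "transpose_mat g * (transpose_mat ?i * ?J) = (transpose_mat g * transpose_mat ?i) * ?J"
      by (simp add: c)
    finally show "?J * transpose_mat g * ?J * theta N g = 1\<^sub>m N" by (simp add: gi antidiag_sq)
  qed
  define x where "x = g \<otimes>\<^bsub>SL N\<^esub> SL_inv N (theta N g)"
  have xc: "x \<in> carrier (SL N)" unfolding x_def th using SL_mult_closed[OF g JgJ[OF g]] by simp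
  note xm = SL_carrier_mat[OF xc]
  have Mm: "gram N ?i \<in> carrier_mat N N" by (rule gram_carrier[OF im])
  have xJm: "x * ?J \<in> carrier_mat N N" by (simp add: xm antidiag_carrier mat_mult_carrier)
  have xJ: "x * ?J = g * (?J * transpose_mat g)"
    unfolding x_def th by (simp add: c antidiag_sq right_mult_one_mat[of _ N N])
  have one: "x * ?J * gram N ?i = 1\<^sub>m N"
  proof -
    have "x * ?J * gram N ?i = g * (?J * ((transpose_mat g * transpose_mat ?i) * (?J * ?i)))"
      unfolding xJ gram_def by (simp add: c)
    also have "\<dots> = g * (?J * (?J * ?i))"
      unfolding gi by (simp add: left_mult_one_mat[OF mat_mult_carrier[OF antidiag_carrier im]])
    finally show ?thesis using SL_inv_right[OF g] by (simp add: antidiag_cancel im)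
  qed
  have one': "gram N ?i * (x * ?J) = 1\<^sub>m N"
    by (rule mat_mult_left_right_inverse[OF xJm Mm one])
  have sym: "gram N ?i $$ (p, q) = gram N ?i $$ (q, p)" if "p < N" "q < N" for p q
    by (rule symmetric_entry[OF transpose_gram[OF im] Mm that])
  let ?b = "w \<circ> longest N"
  have xJ_pat: "has_pattern N ?b (x * ?J) \<longleftrightarrow> has_pattern N w x"
  proof -
    have e: "(x * ?J) $$ (p, q) = x $$ (p, longest N q)" if "p < N" "q < N" for p q
      using antidiag_mult_right[OF xm that] that by (simp add: longest_def)
    have ll: "longest N (longest N q) = q" for q by (rule involution_involutive[OF longest_involution])
    show ?thesis unfolding has_pattern_def
    proof (rule iffI; intro allI impI)
      fix p q assume h: "\<forall>p<N. \<forall>q<N. ((x * ?J) $$ (p, q) \<noteq> 0) = (p = ?b q)" and pq: "p < N" "q < N"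
      from h[rule_format, OF pq(1) longest_less[OF pq(2)]] show "x $$ (p, q) \<noteq> 0 \<longleftrightarrow> p = w q"
        unfolding e[OF pq(1) longest_less[OF pq(2)]] by (simp add: ll)
    next
      fix p q assume h: "\<forall>p<N. \<forall>q<N. (x $$ (p, q) \<noteq> 0) = (p = w q)" and pq: "p < N" "q < N"
      from h[rule_format, OF pq(1) longest_less[OF pq(2)]] show "(x * ?J) $$ (p, q) \<noteq> 0 \<longleftrightarrow> p = ?b q"
        unfolding e[OF pq] by simp
    qed
  qed
  have main: "has_pattern N w x \<longleftrightarrow> has_pattern N ?b (gram N ?i)" if w: "w permutes {..<N}"
  proof -
    have b: "?b permutes {..<N}"
      by (rule permutes_compose[OF involution_permutes[OF longest_involution] w])
    show ?thesis
    proof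
      assume "has_pattern N w x"
      then have "has_pattern N ?b (x * ?J)" using xJ_pat by blast
      from monomial_inverse[OF xJm Mm one this b]
      show "has_pattern N ?b (gram N ?i)" unfolding has_pattern_def using sym by (metis (no_types, lifting))
    next
      assume h: "has_pattern N ?b (gram N ?i)"
      have inv: "(x * ?J) $$ (p, q) \<noteq> 0 \<longleftrightarrow> ?b p = q" if "p < N" "q < N" for p q
        by (rule monomial_inverse[OF Mm xJm one' h b that])
      have "?b p = q \<longleftrightarrow> p = ?b q" if "p < N" "q < N" for p q
        using h sym[OF that] that unfolding has_pattern_def by metis
      then have "has_pattern N ?b (x * ?J)" unfolding has_pattern_def using inv by metis
      then show "has_pattern N w x" using xJ_pat by blast
    qed
  qed
  have "represents N x w \<longleftrightarrow> w permutes {..<N} \<and> has_pattern N w x"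
    unfolding represents_def using monomial_normalizer[OF xc] by (auto simp: has_pattern_def)
  then show ?thesis using main unfolding x_def[symmetric] by blast
qed

lemma pattern_involution:
  assumes "h \<in> carrier_mat N N" "has_pattern N b (gram N h)" "b permutes {..<N}"
  shows "b \<in> involutions N"
proof (rule involutionI)
  show less: "b p < N" if "p < N" for p using permutes_in_image[OF assms(3), of p] that by simp
  show "b p = p" if "\<not> p < N" for p using permutes_not_in[OF assms(3), of p] that by simp
  fix p assume p: "p < N"
  have "gram N h $$ (b p, p) \<noteq> 0" using assms(2) p less[OF p] by (simp add: has_pattern_def)
  then have "gram N h $$ (p, b p) \<noteq> 0"
    using symmetric_entry[OF transpose_gram[OF assms(1)] gram_carrier[OF assms(1)] less[OF p] p] by simp
  then show "b (b p) = p" using assms(2) p less[OF p] by (simp add: has_pattern_def)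
qed

subsection \<open>Rank conditions\<close>

text \<open>For an involution \<open>b\<close> this counts the nonzero entries in the block of rows
  from \<open>k\<close> and columns from \<open>l\<close> of a monomial matrix of pattern
  \<open>b\<close>, and so is the rank of that block.\<close>

definition corank_fun :: "nat \<Rightarrow> (nat \<Rightarrow> nat) \<Rightarrow> nat \<Rightarrow> nat \<Rightarrow> nat" where
  "corank_fun N b k l = card {p. k \<le> p \<and> p < N \<and> l \<le> b p}"

text \<open>The Gram matrix has rank less than \<open>m\<close> as a pairing of the span of the columns with index
  at least \<open>k\<close> with the span of the columns with index at least \<open>l\<close>.\<close>

definition small_rank :: "nat \<Rightarrow> nat \<Rightarrow> nat \<Rightarrow> nat \<Rightarrow> complex mat \<Rightarrow> bool" where
  "small_rank N k l m M \<longleftrightarrow> (\<forall>X\<in>carrier_mat N m. \<forall>Y\<in>carrier_mat N m.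
     (\<forall>p<N. \<forall>a<m. p < k \<longrightarrow> X $$ (p, a) = 0) \<longrightarrow> (\<forall>p<N. \<forall>a<m. p < l \<longrightarrow> Y $$ (p, a) = 0) \<longrightarrow>
     det (transpose_mat X * M * Y) = 0)"

lemma det_zero_col:
  assumes "A \<in> carrier_mat m m" "j < m" "\<And>i. i < m \<Longrightarrow> A $$ (i, j) = (0::complex)"
  shows "det A = 0"
proof -
  have "det A = (\<Sum>p\<in>{p. p permutes {0..<m}}. signof p * (\<Prod>i = 0..<m. A $$ (i, p i)))"
    by (rule det_def'[OF assms(1)])
  also have "\<dots> = 0"
  proof (rule sum.neutral, rule ballI)
    fix p assume "p \<in> {p. p permutes {0..<m}}"
    then have p: "p permutes {0..<m}" by simp
    obtain i where i: "p i = j" using permutes_surj[OF p] by (metis surjD)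
    then have "i < m" using assms(2) permutes_in_image[OF p, of i] by simp
    then have "(\<Prod>i = 0..<m. A $$ (i, p i)) = 0" using assms(3) i by (intro prod_zero bexI[of _ i]) auto
    then show "signof p * (\<Prod>i = 0..<m. A $$ (i, p i)) = 0" by simp
  qed
  finally show ?thesis .
qed

text \<open>If the block has at least \<open>m\<close> nonzero entries, \<open>X\<close> and
  \<open>Y\<close> select rows and columns that leave an invertible diagonal matrix. If it has
  fewer, the pairing factors through a space of dimension less than \<open>m\<close>.\<close>

lemma small_rank_pattern:
  assumes M: "M \<in> carrier_mat N N" "has_pattern N b M" and b: "b \<in> involutions N"
  shows "small_rank N k l m M \<longleftrightarrow> corank_fun N b k l < m"
proof -
  define R where "R = {p. k \<le> p \<and> p < N \<and> l \<le> b p}"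
  have fin: "finite R" unfolding R_def by simp
  have cR: "card R = corank_fun N b k l" by (simp add: R_def corank_fun_def)
  have M0: "M $$ (p, q) = 0" if "p < N" "q < N" "q \<noteq> b p" for p q
    using M(2) that involution_eq_iff[OF b, of q p] unfolding has_pattern_def by metis
  obtain e where e: "bij_betw e {..<card R} R"
    using ex_bij_betw_nat_finite[OF fin] by (auto simp: atLeast0LessThan)
  have eR: "e j \<in> R" if "j < card R" for j using e that by (auto simp: bij_betw_def)
  show ?thesis unfolding cR[symmetric]
  proof
    assume small: "small_rank N k l m M"
    show "card R < m"
    proof (rule ccontr)
      assume "\<not> card R < m"
      then have em: "e a \<in> R" if "a < m" for a using eR that by simp
      have einj: "e a = e c \<longleftrightarrow> a = c" if "a < m" "c < m" for a c
        using e that \<open>\<not> card R < m\<close> unfolding bij_betw_def inj_on_def by auto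
      let ?X = "mat N m (\<lambda>(p, a). if p = e a then 1 else 0 :: complex)"
      let ?Y = "mat N m (\<lambda>(p, a). if p = b (e a) then 1 else 0 :: complex)"
      have ent: "(transpose_mat ?X * M * ?Y) $$ (a, c) = M $$ (e a, b (e c))" if ac: "a < m" "c < m" for a c
      proof -
        have ea: "e a < N" "e c < N" "b (e c) < N"
          using em[OF ac(1)] em[OF ac(2)] involution_less[OF b] by (auto simp: R_def)
        have "(transpose_mat ?X * M * ?Y) $$ (a, c) =
            (\<Sum>p<N. \<Sum>q<N. ?X $$ (p, a) * M $$ (p, q) * ?Y $$ (q, c))"
          by (rule quadratic_entry[OF M(1)]) (use ac in auto)
        also have "\<dots> = (\<Sum>q<N. ?X $$ (e a, a) * M $$ (e a, q) * ?Y $$ (q, c))"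
          by (rule sum_one_point[OF ea(1)]) (use ac in auto)
        also have "\<dots> = ?X $$ (e a, a) * M $$ (e a, b (e c)) * ?Y $$ (b (e c), c)"
          by (rule sum_one_point[OF ea(3)]) (use ac in auto)
        finally show ?thesis using ea ac by simp
      qed
      have "det (transpose_mat ?X * M * ?Y) = prod_list (diag_mat (transpose_mat ?X * M * ?Y))"
      proof (rule det_lower_triangular[of m])
        show "(transpose_mat ?X * M * ?Y) $$ (a, c) = 0" if "a < c" "c < m" for a c
        proof -
          have a: "a < m" using that by simp
          have "b (e c) \<noteq> b (e a)" using involution_involutive[OF b] einj[OF a that(2)] that(1) by (metis less_irrefl)
          then show ?thesis unfolding ent[OF a that(2)]
            using em[OF a] em[OF that(2)] involution_less[OF b] by (intro M0) (auto simp: R_def)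
        qed
      qed (use M in auto)
      also have "\<dots> = (\<Prod>a = 0..<m. (transpose_mat ?X * M * ?Y) $$ (a, a))"
        by (simp add: prod_list_diag_prod)
      also have "\<dots> \<noteq> 0"
      proof -
        have "(transpose_mat ?X * M * ?Y) $$ (a, a) \<noteq> 0" if "a < m" for a
        proof -
          have "e a < N" "b (e a) < N" using em[OF that] involution_less[OF b] by (auto simp: R_def)
          then show ?thesis unfolding ent[OF that that] using M(2) involution_involutive[OF b] by (auto simp: has_pattern_def)
        qed
        then show ?thesis by simp
      qed
      finally have "det (transpose_mat ?X * M * ?Y) \<noteq> 0" .
      moreover have "det (transpose_mat ?X * M * ?Y) = 0"
        by (rule small[unfolded small_rank_def, rule_format]) (use em in \<open>force simp: R_def\<close>)+
      ultimately show False by blast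
    qed
  next
    assume lt: "card R < m"
    show "small_rank N k l m M" unfolding small_rank_def
    proof (intro ballI impI)
      fix X Y :: "complex mat"
      assume X: "X \<in> carrier_mat N m" "\<forall>p<N. \<forall>a<m. p < k \<longrightarrow> X $$ (p, a) = 0"
        and Y: "Y \<in> carrier_mat N m" "\<forall>p<N. \<forall>a<m. p < l \<longrightarrow> Y $$ (p, a) = 0"
      \<comment> \<open>One column of \<open>?A\<close> for each nonzero entry of the block; as
        there are fewer than \<open>m\<close>, column \<open>card R\<close> is zero.\<close>
      let ?A = "mat m m (\<lambda>(a, j). if j < card R then X $$ (e j, a) * M $$ (e j, b (e j)) else 0)"
      let ?C = "mat m m (\<lambda>(j, c). if j < card R then Y $$ (b (e j), c) else 0)"
      have "transpose_mat X * M * Y = ?A * ?C"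
      proof (rule eq_matI)
        fix a c assume "a < dim_row (?A * ?C)" "c < dim_col (?A * ?C)"
        then have ac: "a < m" "c < m" by simp_all
        have "(transpose_mat X * M * Y) $$ (a, c) = (\<Sum>p<N. \<Sum>q<N. X $$ (p, a) * M $$ (p, q) * Y $$ (q, c))"
          by (rule quadratic_entry[OF M(1) X(1) Y(1) ac])
        also have "\<dots> = (\<Sum>p<N. X $$ (p, a) * M $$ (p, b p) * Y $$ (b p, c))"
        proof (rule sum.cong[OF refl])
          fix p assume "p \<in> {..<N}"
          then show "(\<Sum>q<N. X $$ (p, a) * M $$ (p, q) * Y $$ (q, c)) = X $$ (p, a) * M $$ (p, b p) * Y $$ (b p, c)"
            using M0[of p] involution_less[OF b, of p] by (intro sum_one_point) auto
        qed
        also have "\<dots> = (\<Sum>p\<in>R. X $$ (p, a) * M $$ (p, b p) * Y $$ (b p, c))"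
        proof (rule sum.mono_neutral_right)
          show "\<forall>p\<in>{..<N} - R. X $$ (p, a) * M $$ (p, b p) * Y $$ (b p, c) = 0"
          proof
            fix p assume "p \<in> {..<N} - R"
            then have "p < N" "p < k \<or> b p < l" by (auto simp: R_def)
            then show "X $$ (p, a) * M $$ (p, b p) * Y $$ (b p, c) = 0"
              using X(2) Y(2) ac involution_less[OF b] by auto
          qed
        qed (auto simp: R_def)
        also have "\<dots> = (\<Sum>j<card R. X $$ (e j, a) * M $$ (e j, b (e j)) * Y $$ (b (e j), c))"
          by (rule sum.reindex_bij_betw[OF e, symmetric])
        also have "\<dots> = (\<Sum>j<m. ?A $$ (a, j) * ?C $$ (j, c))"
          using lt ac by (intro sum.mono_neutral_cong_left) auto
        also have "\<dots> = (?A * ?C) $$ (a, c)"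
          by (rule mult_mat_entry[symmetric, of _ m m]) (use ac in auto)
        finally show "(transpose_mat X * M * Y) $$ (a, c) = (?A * ?C) $$ (a, c)" .
      qed (use X Y M in auto)
      moreover have "det (?A * ?C) = det ?A * det ?C" by (rule det_mult[of _ m]) auto
      moreover have "det ?A = 0" by (rule det_zero_col[of _ m "card R"]) (use lt in auto)
      ultimately show "det (transpose_mat X * M * Y) = 0" by simp
    qed
  qed
qed

text \<open>A lower triangular matrix preserves the span of the coordinates with index at least
  \<open>k\<close>, so \<open>\<beta> X\<close> and \<open>\<beta> Y\<close> satisfy the same
  support conditions as \<open>X\<close> and \<open>Y\<close>.\<close>

lemma small_rank_borel:
  assumes M: "M \<in> carrier_mat N N" and \<beta>: "\<beta> \<in> borel_subgroup N" and s: "small_rank N k l m M"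
  shows "small_rank N k l m (transpose_mat \<beta> * M * \<beta>)"
  unfolding small_rank_def
proof (intro ballI impI)
  fix X Y :: "complex mat"
  assume X: "X \<in> carrier_mat N m" "\<forall>p<N. \<forall>a<m. p < k \<longrightarrow> X $$ (p, a) = 0"
    and Y: "Y \<in> carrier_mat N m" "\<forall>p<N. \<forall>a<m. p < l \<longrightarrow> Y $$ (p, a) = 0"
  have bm: "\<beta> \<in> carrier_mat N N" using \<beta> borel_SL SL_carrier_mat by blast
  have supp: "(\<beta> * Z) $$ (p, a) = 0"
    if Z: "Z \<in> carrier_mat N m" "\<forall>p<N. \<forall>a<m. p < k' \<longrightarrow> Z $$ (p, a) = 0" and pa: "p < N" "a < m" "p < k'" for Z p a k'
  proof -
    have "(\<beta> * Z) $$ (p, a) = (\<Sum>q<N. \<beta> $$ (p, q) * Z $$ (q, a))"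
      by (rule mult_mat_entry[OF bm Z(1) pa(1,2)])
    also have "\<dots> = 0"
    proof (rule sum.neutral, rule ballI)
      fix q assume "q \<in> {..<N}"
      then show "\<beta> $$ (p, q) * Z $$ (q, a) = 0"
        using \<beta> Z(2) pa by (cases "p < q") (auto simp: borel_subgroup_def)
    qed
    finally show ?thesis .
  qed
  have "transpose_mat X * (transpose_mat \<beta> * M * \<beta>) * Y = transpose_mat (\<beta> * X) * M * (\<beta> * Y)"
  proof -
    have t: "transpose_mat (\<beta> * X) = transpose_mat X * transpose_mat \<beta>"
      by (rule transpose_mult[OF bm X(1)])
    have a1: "transpose_mat X * transpose_mat \<beta> * M = transpose_mat X * (transpose_mat \<beta> * M)"
      by (rule assoc_mult_mat[of _ m N _ N _ N]) (use X bm M in auto)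
    have a2: "transpose_mat X * (transpose_mat \<beta> * M) * (\<beta> * Y) = transpose_mat X * ((transpose_mat \<beta> * M) * (\<beta> * Y))"
      by (rule assoc_mult_mat[of _ m N _ N _ m]) (use X Y bm M in auto)
    have a3: "(transpose_mat \<beta> * M) * (\<beta> * Y) = (transpose_mat \<beta> * M * \<beta>) * Y"
      by (rule assoc_mult_mat[symmetric, of _ N N _ N _ m]) (use X Y bm M in auto)
    have a4: "transpose_mat X * ((transpose_mat \<beta> * M * \<beta>) * Y) = transpose_mat X * (transpose_mat \<beta> * M * \<beta>) * Y"
      by (rule assoc_mult_mat[symmetric, of _ m N _ N _ m]) (use X Y bm M in auto)
    show ?thesis unfolding t a1 a2 a3 a4 ..
  qed
  moreover have "det (transpose_mat (\<beta> * X) * M * (\<beta> * Y)) = 0"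
    by (rule s[unfolded small_rank_def, rule_format])
      (use supp[OF X] supp[OF Y] bm X Y in auto)
  ultimately show "det (transpose_mat X * (transpose_mat \<beta> * M * \<beta>) * Y) = 0" by simp
qed

lemma small_rank_adapted:
  assumes h: "h \<in> adapted N b" and b: "b \<in> involutions N"
  shows "small_rank N k l m (gram N h) \<longleftrightarrow> corank_fun N b k l < m"
proof -
  obtain \<beta> where \<beta>: "\<beta> \<in> borel_subgroup N" "has_pattern N b (gram N (h * \<beta>))" and hc: "h \<in> carrier (SL N)"
    using h by (auto simp: adapted_def)
  note bc = borel_SL[OF \<beta>(1)]
  note hm = SL_carrier_mat[OF hc] and bm = SL_carrier_mat[OF bc]
  have ic: "SL_inv N \<beta> \<in> carrier (SL N)" by (rule SL_inv_closed[OF bc])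
  have hb: "h * \<beta> \<in> carrier_mat N N" by (rule mat_mult_carrier[OF hm bm])
  have "small_rank N k l m (gram N h) \<longleftrightarrow> small_rank N k l m (gram N (h * \<beta>))"
  proof
    assume "small_rank N k l m (gram N h)"
    from small_rank_borel[OF gram_carrier[OF hm] \<beta>(1) this]
    show "small_rank N k l m (gram N (h * \<beta>))" by (simp add: gram_mult[OF hm bm])
  next
    assume "small_rank N k l m (gram N (h * \<beta>))"
    from small_rank_borel[OF gram_carrier[OF hb] borel_inv[OF \<beta>(1)] this]
    have "small_rank N k l m (gram N (h * \<beta> * SL_inv N \<beta>))"
      by (simp only: gram_mult[OF hb SL_carrier_mat[OF ic]])
    then show "small_rank N k l m (gram N h)" by (simp only: SL_inv_mult_cancel(3)[OF bc hc])
  qed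
  then show ?thesis using small_rank_pattern[OF gram_carrier[OF hb] \<beta>(2) b] by simp
qed

text \<open>Passing from \<open>Suc p\<close> to \<open>p\<close> in the first argument adds one
  exactly when \<open>l \<le> b p\<close>, and these conditions for all \<open>l\<close> determine
  \<open>b p\<close>.\<close>

lemma corank_fun_determines:
  assumes b: "b \<in> involutions N" "c \<in> involutions N" and eq: "\<And>k l. corank_fun N b k l = corank_fun N c k l"
  shows "b = c"
proof
  fix p
  show "b p = c p"
  proof (cases "p < N")
    case True
    have step: "corank_fun N b p l = corank_fun N b (Suc p) l + (if l \<le> b p then 1 else 0)" for b l
    proof -
      have "{q. p \<le> q \<and> q < N \<and> l \<le> b q} = {q. Suc p \<le> q \<and> q < N \<and> l \<le> b q} \<union> (if l \<le> b p then {p} else {})"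
        using True by (auto simp: Suc_le_eq le_less)
      then show ?thesis unfolding corank_fun_def by (auto simp: card_insert_if)
    qed
    have "l \<le> b p \<longleftrightarrow> l \<le> c p" for l
      using step[of b l] step[of c l] eq[of p l] eq[of "Suc p" l] by (auto split: if_splits)
    then show ?thesis by (meson eq_iff)
  next
    case False
    then show ?thesis using involution_outside b by metis
  qed
qed

text \<open>Each of the determinants defining \<open>small_rank\<close> is a polynomial function of
  \<open>h\<close>, so its vanishing passes to the closure.\<close>

lemma zcl_small_rank:
  assumes "A \<subseteq> carrier (SL N)" "\<And>h. h \<in> A \<Longrightarrow> small_rank N k l m (gram N h)" "g \<in> zcl N A"
  shows "small_rank N k l m (gram N g)"
  unfolding small_rank_def
proof (intro ballI impI)
  fix X Y :: "complex mat"
  assume X: "X \<in> carrier_mat N m" "\<forall>p<N. \<forall>a<m. p < k \<longrightarrow> X $$ (p, a) = 0"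
    and Y: "Y \<in> carrier_mat N m" "\<forall>p<N. \<forall>a<m. p < l \<longrightarrow> Y $$ (p, a) = 0"
  define F where "F a c h = (\<Sum>p<N. \<Sum>q<N. X $$ (p, a) *
      (\<Sum>r<N. \<Sum>s<N. h $$ (r, p) * antidiag N $$ (r, s) * h $$ (s, q)) * Y $$ (q, c))" for a c h
  have Fp: "F a c \<in> poly_funs N" for a c
    unfolding F_def by (auto intro!: poly_funs_sum poly_funs.mult intro: poly_funs.const poly_funs.entry)
  have Fe: "transpose_mat X * gram N h * Y = mat m m (\<lambda>(a, c). F a c h)" if h: "h \<in> carrier (SL N)" for h
  proof (rule eq_matI)
    note hm = SL_carrier_mat[OF h]
    fix a c assume "a < dim_row (mat m m (\<lambda>(a, c). F a c h))" "c < dim_col (mat m m (\<lambda>(a, c). F a c h))"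
    then have ac: "a < m" "c < m" by simp_all
    have "(transpose_mat X * gram N h * Y) $$ (a, c) = (\<Sum>p<N. \<Sum>q<N. X $$ (p, a) * gram N h $$ (p, q) * Y $$ (q, c))"
      by (rule quadratic_entry[OF gram_carrier[OF hm] X(1) Y(1) ac])
    also have "\<dots> = F a c h" unfolding F_def gram_def
      by (intro sum.cong refl) (simp add: quadratic_entry[OF antidiag_carrier hm hm])
    finally show "(transpose_mat X * gram N h * Y) $$ (a, c) = mat m m (\<lambda>(a, c). F a c h) $$ (a, c)"
      using ac by simp
  qed (use X Y in auto)
  let ?f = "\<lambda>h. det (mat m m (\<lambda>(a, c). F a c h))"
  have "?f \<in> poly_funs N" by (rule poly_funs_det[OF Fp])
  moreover have "\<forall>h\<in>A. ?f h = 0"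
  proof
    fix h assume h: "h \<in> A"
    then have "det (transpose_mat X * gram N h * Y) = 0"
      using assms(2)[OF h] X Y unfolding small_rank_def by blast
    then show "?f h = 0" using Fe[of h] h assms(1) by auto
  qed
  ultimately have "?f g = 0" using bspec[of "poly_funs N" _ ?f] assms(3) unfolding zcl_def by blast
  then show "det (transpose_mat X * gram N g * Y) = 0"
    using Fe[OF subsetD[OF zcl_subset_carrier assms(3)]] by simp
qed

lemma adapted_SL: "adapted N b \<subseteq> carrier (SL N)"
  by (auto simp: adapted_def)

lemma adapted_closure_corank:
  assumes "b \<in> involutions N" "c \<in> involutions N" "h \<in> adapted N c" "h \<in> zcl N (adapted N b)"
  shows "corank_fun N c k l \<le> corank_fun N b k l"
proof -
  have "small_rank N k l (Suc (corank_fun N b k l)) (gram N h)"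
    by (rule zcl_small_rank[OF adapted_SL _ assms(4)]) (simp add: small_rank_adapted[OF _ assms(1)])
  then show ?thesis using small_rank_adapted[OF assms(3,2)] by simp
qed

lemma adapted_unique:
  assumes "b \<in> involutions N" "c \<in> involutions N" "h \<in> adapted N b" "h \<in> adapted N c"
  shows "b = c"
proof (rule corank_fun_determines[OF assms(1,2)])
  fix k l
  have "corank_fun N b k l < m \<longleftrightarrow> corank_fun N c k l < m" for m
    using small_rank_adapted[OF assms(3,1)] small_rank_adapted[OF assms(4,2)] by blast
  then show "corank_fun N b k l = corank_fun N c k l" by (meson linorder_neqE_nat less_irrefl)
qed

section \<open>Each stratum is a single double coset of K and B\<close>

lemma diag_congruence:
  fixes t :: "nat \<Rightarrow> complex"
  assumes M: "M \<in> carrier_mat N N" and pq: "p < N" "q < N"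
  defines "D \<equiv> mat N N (\<lambda>(r, c). if r = c then t r else 0)"
  shows "(transpose_mat D * M * D) $$ (p, q) = t p * M $$ (p, q) * t q"
proof -
  have "(transpose_mat D * M * D) $$ (p, q) = (\<Sum>k<N. \<Sum>l<N. D $$ (k, p) * M $$ (k, l) * D $$ (l, q))"
    by (rule quadratic_entry[OF M]) (use pq in \<open>auto simp: D_def\<close>)
  also have "\<dots> = (\<Sum>l<N. D $$ (p, p) * M $$ (p, l) * D $$ (l, q))"
    by (rule sum_one_point[OF pq(1)]) (use pq in \<open>auto simp: D_def\<close>)
  also have "\<dots> = D $$ (p, p) * M $$ (p, q) * D $$ (q, q)"
    by (rule sum_one_point[OF pq(2)]) (use pq in \<open>auto simp: D_def\<close>)
  finally show ?thesis using pq by (simp add: D_def)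
qed

text \<open>The determinant of the diagonal matrix relating two Gram matrices of the same pattern is
  \<open>1\<close> or \<open>-1\<close>; this is where odd \<open>N\<close> enters, through the sign change \<open>t \<mapsto> -t\<close>.\<close>

lemma pattern_same_orbit:
  assumes odd: "odd N" and b: "b \<in> involutions N"
    and h: "h1 \<in> carrier (SL N)" "h2 \<in> carrier (SL N)"
    and p: "has_pattern N b (gram N h1)" "has_pattern N b (gram N h2)"
  shows "\<exists>k\<in>fixed_group N. \<exists>\<beta>\<in>borel_subgroup N. h2 = k * h1 * \<beta>"
proof -
  note m = SL_carrier_mat[OF h(1)] SL_carrier_mat[OF h(2)]
  let ?M = "gram N h1" and ?L = "gram N h2"
  have sym: "?M $$ (p, q) = ?M $$ (q, p)" "?L $$ (p, q) = ?L $$ (q, p)" if "p < N" "q < N" for p q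
    using symmetric_entry[OF transpose_gram gram_carrier] m that by blast+
  \<comment> \<open>A fixed point of \<open>b\<close> needs a square root of the ratio of the
    entries, while for a two-cycle the whole ratio is put at the larger index and \<open>1\<close>
    at the smaller.\<close>
  define u where "u p = (if p < b p then 1 else if p = b p then csqrt (?L $$ (p, p) / ?M $$ (p, p))
      else ?L $$ (p, b p) / ?M $$ (p, b p))" for p
  have nz: "?M $$ (p, b p) \<noteq> 0" if "p < N" for p
    using p(1) that involution_less[OF b that] involution_involutive[OF b] by (simp add: has_pattern_def)
  have u: "u p * ?M $$ (p, b p) * u (b p) = ?L $$ (p, b p)" if "p < N" for p
  proof (cases p "b p" rule: linorder_cases)
    case less
    then show ?thesis using nz[OF that] sym[OF that involution_less[OF b that]] involution_involutive[OF b, of p]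
      by (simp add: u_def)
  next
    case equal
    have "csqrt (?L $$ (p, p) / ?M $$ (p, p)) * csqrt (?L $$ (p, p) / ?M $$ (p, p)) = ?L $$ (p, p) / ?M $$ (p, p)"
      by (simp flip: power2_eq_square)
    then show ?thesis using nz[OF that] equal[symmetric] by (simp add: u_def field_simps)
  next
    case greater
    then show ?thesis using nz[OF that] involution_involutive[OF b, of p] by (simp add: u_def)
  qed
  have cong: "transpose_mat D * ?M * D = ?L"
    if D: "D = mat N N (\<lambda>(r, c). if r = c then t r else 0)" "\<And>p. t p = e * u p" "e * e = 1" for D t e
  proof (rule eq_matI)
    fix p q assume "p < dim_row ?L" "q < dim_col ?L"
    then have pq: "p < N" "q < N" using gram_carrier[OF m(2)] by auto
    have "(transpose_mat D * ?M * D) $$ (p, q) = t p * ?M $$ (p, q) * t q"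
      unfolding D(1) by (rule diag_congruence[OF gram_carrier[OF m(1)] pq])
    also have "\<dots> = (e * e) * (u p * ?M $$ (p, q) * u q)" unfolding D(2) by (simp add: algebra_simps)
    also have "\<dots> = ?L $$ (p, q)"
    proof (cases "q = b p")
      case True
      then show ?thesis using u[OF pq(1)] D(3) by simp
    next
      case False
      then have "p \<noteq> b q" using involution_eq_iff[OF b, of p q] by auto
      then have "?M $$ (p, q) = 0" "?L $$ (p, q) = 0" using p pq unfolding has_pattern_def by blast+
      then show ?thesis by simp
    qed
    finally show "(transpose_mat D * ?M * D) $$ (p, q) = ?L $$ (p, q)" .
  qed (use gram_carrier[OF m(1)] gram_carrier[OF m(2)] D in auto)
  define D where "D e = mat N N (\<lambda>(r, c). if r = c then e * u r else 0)" for e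
  have detD: "det (D e) = e ^ N * (\<Prod>r = 0..<N. u r)" for e
  proof -
    have "det (D e) = prod_list (diag_mat (D e))" by (rule det_lower_triangular[of N]) (auto simp: D_def)
    also have "\<dots> = (\<Prod>r = 0..<N. D e $$ (r, r))" by (simp add: prod_list_diag_prod D_def)
    also have "\<dots> = (\<Prod>r = 0..<N. e * u r)" by (intro prod.cong) (auto simp: D_def)
    finally show ?thesis by (simp add: prod.distrib)
  qed
  have "det (transpose_mat (D 1) * ?M * D 1) = det ?L" using cong[of "D 1" "\<lambda>r. 1 * u r" 1] by (simp only: D_def mult_1_left)
  then have "det (D 1) * det ?M * det (D 1) = det ?L"
    using gram_carrier[OF m(1)] by (simp add: det_mult[of _ N] det_transpose[of _ N] D_def mat_mult_carrier)
  then have "det (D 1) * det (D 1) * det (antidiag N) = det (antidiag N)"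
    using det_gram h by (simp add: algebra_simps)
  then have "det (D 1) * det (D 1) = 1" using det_antidiag_nonzero[of N] by auto
  then have "det (D 1) = 1 \<or> det (D 1) = -1" by (simp add: square_eq_1_iff)
  then obtain e where e: "e * e = 1" "det (D e) = 1"
  proof
    assume "det (D 1) = 1"
    then show ?thesis using that[of 1] by simp
  next
    assume "det (D 1) = - 1"
    then have "det (D (- 1)) = 1" using odd by (simp add: detD)
    then show ?thesis using that[of "- 1"] by simp
  qed
  have DB: "D e \<in> borel_subgroup N" using e(2) by (auto simp: borel_subgroup_def SL_carrier_iff D_def)
  note Dc = borel_SL[OF DB]
  have "gram N (h1 * D e) = gram N h2"
    unfolding gram_mult[OF m(1) SL_carrier_mat[OF Dc]] by (rule cong[of _ "\<lambda>r. e * u r" e]) (auto simp: D_def e)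
  from fixed_of_gram_eq[OF SL_mult_closed[OF h(1) Dc] h(2) this]
  have k: "h2 * SL_inv N (h1 * D e) \<in> fixed_group N" .
  have "h2 = h2 * SL_inv N (h1 * D e) * (h1 * D e)"
    by (rule SL_inv_mult_cancel(4)[OF SL_mult_closed[OF h(1) Dc] h(2), symmetric])
  also have "\<dots> = h2 * SL_inv N (h1 * D e) * h1 * D e"
    by (rule SL_assoc[OF fixed_SL[OF k] h(1) Dc, symmetric])
  finally show ?thesis using k DB by blast
qed

lemma adapted_rstable: "rstable (borel_subgroup N) (adapted N b)"
  unfolding rstable_def
proof (intro ballI)
  fix h \<gamma> assume h: "h \<in> adapted N b" and g: "\<gamma> \<in> borel_subgroup N"
  then obtain \<beta> where \<beta>: "\<beta> \<in> borel_subgroup N" "has_pattern N b (gram N (h * \<beta>))" "h \<in> carrier (SL N)"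
    by (auto simp: adapted_def)
  have gi: "SL_inv N \<gamma> * \<beta> \<in> borel_subgroup N" by (rule borel_mult[OF borel_inv[OF g] \<beta>(1)])
  have "h * \<gamma> * (SL_inv N \<gamma> * \<beta>) = h * (\<gamma> * (SL_inv N \<gamma> * \<beta>))"
    by (rule SL_assoc[OF \<beta>(3) borel_SL[OF g] borel_SL[OF gi]])
  also have "\<gamma> * (SL_inv N \<gamma> * \<beta>) = \<beta>" by (rule SL_inv_mult_cancel(2)[OF borel_SL[OF g] borel_SL[OF \<beta>(1)]])
  finally show "h * \<gamma> \<in> adapted N b"
    using \<beta> gi SL_mult_closed[OF \<beta>(3) borel_SL[OF g]] unfolding adapted_def by (metis (mono_tags, lifting) mem_Collect_eq)
qed

lemma adapted_lstable:
  assumes "h \<in> adapted N b" "k \<in> fixed_group N" shows "k * h \<in> adapted N b"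
proof -
  obtain \<beta> where \<beta>: "\<beta> \<in> borel_subgroup N" "has_pattern N b (gram N (h * \<beta>))" "h \<in> carrier (SL N)"
    using assms(1) by (auto simp: adapted_def)
  have "gram N (k * h * \<beta>) = gram N (k * (h * \<beta>))"
    using SL_assoc[OF fixed_SL[OF assms(2)] \<beta>(3) borel_SL[OF \<beta>(1)]] by simp
  also have "\<dots> = gram N (h * \<beta>)"
    by (rule gram_fixed_mult[OF assms(2) SL_carrier_mat[OF SL_mult_closed[OF \<beta>(3) borel_SL[OF \<beta>(1)]]]])
  finally show ?thesis
    using \<beta> SL_mult_closed[OF fixed_SL[OF assms(2)] \<beta>(3)] unfolding adapted_def
    by (intro CollectI conjI bexI[of _ \<beta>]) simp_all
qed

lemma pattern_adapted: "h \<in> carrier (SL N) \<Longrightarrow> has_pattern N b (gram N h) \<Longrightarrow> h \<in> adapted N b"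
  unfolding adapted_def using SL_right_one[of h N] borel_one[of N] by force

lemma adapted_double_coset:
  assumes odd: "odd N" and b: "b \<in> involutions N" and h: "h1 \<in> adapted N b" "h2 \<in> adapted N b"
  shows "\<exists>k\<in>fixed_group N. \<exists>\<beta>\<in>borel_subgroup N. h2 = k * h1 * \<beta>"
proof -
  obtain \<beta>1 \<beta>2 where 1: "\<beta>1 \<in> borel_subgroup N" "has_pattern N b (gram N (h1 * \<beta>1))" "h1 \<in> carrier (SL N)"
    and 2: "\<beta>2 \<in> borel_subgroup N" "has_pattern N b (gram N (h2 * \<beta>2))" "h2 \<in> carrier (SL N)"
    using h by (auto simp: adapted_def)
  note c = SL_mult_closed borel_SL 1(3) 2(3) borel_inv SL_inv_closed
  obtain k \<gamma> where k: "k \<in> fixed_group N" "\<gamma> \<in> borel_subgroup N" "h2 * \<beta>2 = k * (h1 * \<beta>1) * \<gamma>"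
    using pattern_same_orbit[OF odd b _ _ 1(2) 2(2)] 1 2 SL_mult_closed borel_SL by metis
  have kc: "k \<in> carrier (SL N)" by (rule fixed_SL[OF k(1)])
  have "h2 = h2 * \<beta>2 * SL_inv N \<beta>2" by (rule SL_inv_mult_cancel(3)[OF borel_SL[OF 2(1)] 2(3), symmetric])
  also have "\<dots> = k * h1 * (\<beta>1 * (\<gamma> * SL_inv N \<beta>2))"
    unfolding k(3) using kc borel_SL[OF k(2)] borel_SL[OF 1(1)] borel_SL[OF 2(1)] 1(3)
    by (simp add: SL_assoc[of _ N] SL_mult_closed SL_inv_closed)
  finally show ?thesis
    using k(1) borel_mult[OF 1(1) borel_mult[OF k(2) borel_inv[OF 2(1)]]] by blast
qed

text \<open>For a two-cycle the columns are \<open>(e + \<i> e') / sqrt 2\<close> and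
  \<open>(e - \<i> e') / sqrt 2\<close>, with \<open>e\<close>, \<open>e'\<close> the two unit
  vectors: isotropic for the sum of squares and pairing to \<open>1\<close>. The matrix is a change
  of basis from the sum of squares to the form with pattern \<open>b\<close>.\<close>

definition inv_root :: "nat \<Rightarrow> (nat \<Rightarrow> nat) \<Rightarrow> complex mat" where
  "inv_root N b = mat N N (\<lambda>(p, q).
     if q = b q then (if p = q then 1 else 0)
     else if q < b q then (if p = q then 1 else if p = b q then \<i> else 0) / csqrt 2
     else (if p = b q then 1 else if p = q then - \<i> else 0) / csqrt 2)"

lemma inv_root_square:
  assumes b: "b \<in> involutions N"
  shows "transpose_mat (inv_root N b) * inv_root N b = mat N N (\<lambda>(p, q). if p = b q then 1 else 0)"
proof (rule eq_matI)
  fix p q assume "p < dim_row (mat N N (\<lambda>(p, q). if p = b q then 1 else 0 :: complex))"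
    "q < dim_col (mat N N (\<lambda>(p, q). if p = b q then 1 else 0 :: complex))"
  then have pq: "p < N" "q < N" by simp_all
  let ?C = "inv_root N b"
  have C0: "?C $$ (k, q) = 0" if "k < N" "q < N" "k \<noteq> q" "k \<noteq> b q" for k q
    using that by (auto simp: inv_root_def)
  have bq: "b q < N" by (rule involution_less[OF b pq(2)])
  have bb: "b (b q) = q" by (rule involution_involutive[OF b])
  have half: "1 / (csqrt 2 * csqrt 2) = (1 / 2 :: complex)"
    by (simp only: power2_eq_square[symmetric] power2_csqrt)
  have "(transpose_mat ?C * ?C) $$ (p, q) = (\<Sum>k<N. transpose_mat ?C $$ (p, k) * ?C $$ (k, q))"
    by (rule mult_mat_entry[of _ N N]) (use pq in \<open>auto simp: inv_root_def\<close>)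
  also have "\<dots> = (\<Sum>k<N. ?C $$ (k, p) * ?C $$ (k, q))"
    using pq by (intro sum.cong) (auto simp: inv_root_def)
  also have "\<dots> = (if p = b q then 1 else 0)"
  proof (cases "q = b q")
    case True
    have "(\<Sum>k<N. ?C $$ (k, p) * ?C $$ (k, q)) = ?C $$ (q, p) * ?C $$ (q, q)"
      by (rule sum_one_point[OF pq(2)]) (use C0[of _ q] pq True in auto)
    also have "\<dots> = (if p = q then 1 else 0)"
      using True pq C0[of q p] involution_eq_iff[OF b, of p q] by (auto simp: inv_root_def)
    finally show ?thesis using True by simp
  next
    case False
    have sum: "(\<Sum>k<N. ?C $$ (k, p) * ?C $$ (k, q)) = ?C $$ (q, p) * ?C $$ (q, q) + ?C $$ (b q, p) * ?C $$ (b q, q)"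
      by (rule sum_two_points[OF pq(2) bq False]) (use C0[of _ q] pq in auto)
    consider "p = q" | "p = b q" | "p \<noteq> q" "p \<noteq> b q" by blast
    then show ?thesis
    proof cases
      case 1
      then show ?thesis unfolding sum using pq bq False half
        by (cases "q < b q") (auto simp: inv_root_def)
    next
      case 2
      then show ?thesis unfolding sum using pq bq False half bb
        by (cases "q < b q") (auto simp: inv_root_def)
    next
      case 3
      then have "b p \<noteq> q" "b p \<noteq> b q" using involution_eq_iff[OF b] bb by metis+
      then have "?C $$ (q, p) = 0" "?C $$ (b q, p) = 0"
        using C0[of q p] C0[of "b q" p] 3 pq bq by auto
      then show ?thesis unfolding sum using 3 by simp
    qed
  qed
  finally show "(transpose_mat ?C * ?C) $$ (p, q) = mat N N (\<lambda>(p, q). if p = b q then 1 else 0) $$ (p, q)"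
    using pq by simp
qed (simp_all add: inv_root_def)

text \<open>Both \<open>J\<close> and the permutation matrix of \<open>b\<close> are congruent to
  the identity through \<open>inv_root\<close>, so the inverse of the root for
  \<open>longest N\<close> times the root for \<open>b\<close> has the required Gram matrix. An
  \<open>N\<close>-th root of the reciprocal of its determinant rescales it into the group.\<close>

lemma adapted_exists:
  assumes N: "0 < N" and b: "b \<in> involutions N"
  shows "\<exists>h\<in>carrier (SL N). has_pattern N b (gram N h)"
proof -
  let ?C = "inv_root N" and ?P = "\<lambda>b. mat N N (\<lambda>(p, q). if p = b q then 1 else 0 :: complex)"
  have Cm: "?C c \<in> carrier_mat N N" for c by (simp add: inv_root_def)
  have dC: "det (?C c) \<noteq> 0" if c: "c \<in> involutions N" for c
  proof -
    have "?P c * ?P c = 1\<^sub>m N"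
    proof (rule eq_matI)
      fix p q assume "p < dim_row (1\<^sub>m N)" "q < dim_col (1\<^sub>m N)"
      then have pq: "p < N" "q < N" by simp_all
      have "(?P c * ?P c) $$ (p, q) = (\<Sum>k<N. ?P c $$ (p, k) * ?P c $$ (k, q))"
        by (rule mult_mat_entry[of _ N N]) (use pq in auto)
      also have "\<dots> = ?P c $$ (p, c q) * ?P c $$ (c q, q)"
        by (rule sum_one_point[OF involution_less[OF c pq(2)]]) (use pq in auto)
      finally show "(?P c * ?P c) $$ (p, q) = 1\<^sub>m N $$ (p, q)"
        using pq involution_less[OF c pq(2)] involution_involutive[OF c, of q] by simp
    qed auto
    moreover have "det (?P c * ?P c) = det (?P c) * det (?P c)" by (rule det_mult[of _ N]) auto
    ultimately have "det (?P c) \<noteq> 0" by auto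
    moreover have "det (?P c) = det (?C c) * det (?C c)"
      unfolding inv_root_square[OF c, symmetric]
      by (simp add: det_mult[of _ N] Cm det_transpose[of _ N])
    ultimately show ?thesis by auto
  qed
  let ?w = "longest N"
  have J: "antidiag N = transpose_mat (?C ?w) * ?C ?w"
    unfolding inv_root_square[OF longest_involution] by (rule eq_matI) (auto simp: antidiag_def longest_def)
  define d where "d = det (?C ?w)"
  define Ci where "Ci = (1 / d) \<cdot>\<^sub>m adj_mat (?C ?w)"
  have dnz: "d \<noteq> 0" unfolding d_def by (rule dC[OF longest_involution])
  have Cim: "Ci \<in> carrier_mat N N" using adj_mat(1)[OF Cm[of ?w]] by (simp add: Ci_def)
  have CCi: "?C ?w * Ci = 1\<^sub>m N"
  proof -
    have "?C ?w * Ci = (1 / d) \<cdot>\<^sub>m (?C ?w * adj_mat (?C ?w))"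
      unfolding Ci_def by (rule mult_smult_distrib[OF Cm adj_mat(1)[OF Cm]])
    also have "\<dots> = 1\<^sub>m N" using adj_mat(2)[OF Cm[of ?w]] dnz by (auto simp: d_def intro!: eq_matI)
    finally show ?thesis .
  qed
  define h0 where "h0 = Ci * ?C b"
  have h0m: "h0 \<in> carrier_mat N N" unfolding h0_def by (rule mat_mult_carrier[OF Cim Cm])
  have Ch0: "?C ?w * h0 = ?C b"
    unfolding h0_def using CCi by (simp add: mat_assoc[of _ N, symmetric] Cm Cim left_mult_one_mat[of _ N N])
  have gram0: "gram N h0 = ?P b"
  proof -
    have "gram N h0 = transpose_mat (?C ?w * h0) * (?C ?w * h0)"
      unfolding gram_def J by (simp add: transpose_mult_SL[of _ N] mat_assoc[of _ N] Cm h0m mat_mult_carrier)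
    then show ?thesis unfolding Ch0 inv_root_square[OF b] .
  qed
  have dh0: "det h0 \<noteq> 0"
    using dC[OF b] det_mult[OF Cm h0m, of ?w] unfolding Ch0 by auto
  obtain z where z: "z ^ N = 1 / det h0" using nth_root_exists[OF N] by blast
  then have znz: "z \<noteq> 0" using dh0 N by (auto simp: zero_power)
  have hc: "z \<cdot>\<^sub>m h0 \<in> carrier (SL N)"
    using h0m z dh0 by (auto simp: SL_carrier_iff det_smult)
  have "gram N (z \<cdot>\<^sub>m h0) $$ (p, q) = z * z * ?P b $$ (p, q)" if "p < N" "q < N" for p q
  proof -
    have "gram N (z \<cdot>\<^sub>m h0) $$ (p, q) = (\<Sum>k<N. \<Sum>l<N. (z \<cdot>\<^sub>m h0) $$ (k, p) * antidiag N $$ (k, l) * (z \<cdot>\<^sub>m h0) $$ (l, q))"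
      unfolding gram_def by (rule quadratic_entry[OF antidiag_carrier]) (use h0m that in auto)
    also have "\<dots> = z * z * (\<Sum>k<N. \<Sum>l<N. h0 $$ (k, p) * antidiag N $$ (k, l) * h0 $$ (l, q))"
      unfolding sum_distrib_left using h0m that by (intro sum.cong refl) (auto simp: algebra_simps)
    also have "(\<Sum>k<N. \<Sum>l<N. h0 $$ (k, p) * antidiag N $$ (k, l) * h0 $$ (l, q)) = gram N h0 $$ (p, q)"
      unfolding gram_def by (rule quadratic_entry[OF antidiag_carrier h0m h0m that, symmetric])
    finally show ?thesis unfolding gram0 .
  qed
  then have "has_pattern N b (gram N (z \<cdot>\<^sub>m h0))" unfolding has_pattern_def using znz by simp
  then show ?thesis using hc by blast
qed

section \<open>The orbits and the Richardson-Springer parametrization\<close>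

definition orb :: "nat \<Rightarrow> (nat \<Rightarrow> nat) \<Rightarrow> complex mat set set" where
  "orb N b = coset_img N (borel_subgroup N) (adapted N b)"

lemma orb_eq_iff:
  assumes "0 < N" "b \<in> involutions N" "c \<in> involutions N" shows "orb N b = orb N c \<longleftrightarrow> b = c"
proof
  assume "orb N b = orb N c"
  then have "adapted N b = adapted N c"
    unfolding orb_def
    using coset_img_eq_iff[OF borel_subgroup_SL adapted_SL adapted_SL adapted_rstable adapted_rstable] by blast
  moreover obtain h where "h \<in> adapted N b"
    using adapted_exists[OF assms(1,2)] pattern_adapted by blast
  ultimately show "b = c" using adapted_unique[OF assms(2,3)] by blast
qed simp

lemma K_orbit_adapted:
  assumes odd: "odd N" and b: "b \<in> involutions N" and h: "h \<in> adapted N b"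
  shows "K_orbit N (h <#\<^bsub>SL N\<^esub> borel_subgroup N) = orb N b"
proof -
  have hc: "h \<in> carrier (SL N)" using h adapted_SL by blast
  have Bc: "borel_subgroup N \<subseteq> carrier (SL N)" using borel_SL by blast
  have "K_orbit N (h <#\<^bsub>SL N\<^esub> borel_subgroup N) =
      {k <#\<^bsub>SL N\<^esub> (h <#\<^bsub>SL N\<^esub> borel_subgroup N) | k. k \<in> fixed_group N}"
    by (simp add: K_orbit_def orbit_def)
  also have "\<dots> = {(k * h) <#\<^bsub>SL N\<^esub> borel_subgroup N | k. k \<in> fixed_group N}"
    using group.lcos_m_assoc[OF group_SL Bc _ hc] fixed_SL by force
  also have "\<dots> = orb N b"
  proof
    show "{(k * h) <#\<^bsub>SL N\<^esub> borel_subgroup N | k. k \<in> fixed_group N} \<subseteq> orb N b"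
      using adapted_lstable[OF h] by (auto simp: orb_def coset_img_def)
    show "orb N b \<subseteq> {(k * h) <#\<^bsub>SL N\<^esub> borel_subgroup N | k. k \<in> fixed_group N}"
    proof
      fix x assume "x \<in> orb N b"
      then obtain h' where h': "h' \<in> adapted N b" "x = h' <#\<^bsub>SL N\<^esub> borel_subgroup N"
        by (auto simp: orb_def coset_img_def)
      obtain k \<beta> where k: "k \<in> fixed_group N" "\<beta> \<in> borel_subgroup N" "h' = k * h * \<beta>"
        using adapted_double_coset[OF odd b h h'(1)] by blast
      have "(k * h) <#\<^bsub>SL N\<^esub> borel_subgroup N = h' <#\<^bsub>SL N\<^esub> borel_subgroup N"
        using lcos_eq_iff[OF borel_subgroup_SL SL_mult_closed[OF fixed_SL[OF k(1)] hc], of h'] k h'(1) adapted_SL by blast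
      then show "x \<in> {(k * h) <#\<^bsub>SL N\<^esub> borel_subgroup N | k. k \<in> fixed_group N}" using h'(2) k(1) by blast
    qed
  qed
  finally show ?thesis .
qed

lemma K_orbits_eq:
  assumes odd: "odd N" shows "K_orbits N = orb N ` involutions N"
proof
  have N: "0 < N" using odd by (auto intro: Nat.gr0I)
  show "K_orbits N \<subseteq> orb N ` involutions N"
  proof
    fix Q assume "Q \<in> K_orbits N"
    then obtain h where h: "h \<in> carrier (SL N)" "Q = K_orbit N (h <#\<^bsub>SL N\<^esub> borel_subgroup N)"
      by (auto simp: K_orbits_def orbits_def K_orbit_def LCOSETS_def)
    obtain b where "b \<in> involutions N" "h \<in> adapted N b" using adapted_cover[OF h(1)] by blast
    then show "Q \<in> orb N ` involutions N" using K_orbit_adapted[OF odd] h(2) by blast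
  qed
  show "orb N ` involutions N \<subseteq> K_orbits N"
  proof
    fix Q assume "Q \<in> orb N ` involutions N"
    then obtain b where b: "b \<in> involutions N" "Q = orb N b" by blast
    obtain h where h: "h \<in> adapted N b" using adapted_exists[OF N b(1)] pattern_adapted by blast
    then have "Q = K_orbit N (h <#\<^bsub>SL N\<^esub> borel_subgroup N)" using K_orbit_adapted[OF odd b(1)] b(2) by simp
    moreover have "h <#\<^bsub>SL N\<^esub> borel_subgroup N \<in> lcosets\<^bsub>SL N\<^esub> borel_subgroup N"
      using h adapted_SL by (auto simp: LCOSETS_def)
    ultimately show "Q \<in> K_orbits N" unfolding K_orbits_def orbits_def K_orbit_def by blast
  qed
qed

text \<open>A representative \<open>h\<close> with monomial Gram matrix provides \<open>g\<close> as
  its inverse. Any other admissible \<open>g\<close> leads to a Gram matrix of pattern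
  \<open>w \<circ> longest N\<close>, and the orbit determines that pattern.\<close>

lemma RS_map_orb:
  assumes odd: "odd N" and b: "b \<in> involutions N"
  shows "RS_map N (orb N b) = b \<circ> longest N"
  unfolding RS_map_def
proof (rule the_equality)
  have N: "0 < N" using odd by (auto intro: Nat.gr0I)
  have ll: "longest N \<circ> longest N = id" using longest_involution[of N] by (simp add: involutions_def)
  obtain h where h: "h \<in> carrier (SL N)" "has_pattern N b (gram N h)" using adapted_exists[OF N b] by blast
  let ?g = "SL_inv N h"
  have g: "?g \<in> carrier (SL N)" "SL_inv N ?g = h" using SL_inv_closed SL_inv_inv h(1) by blast+
  have "orb N b = K_orbit N (SL_inv N ?g <#\<^bsub>SL N\<^esub> borel_subgroup N)"
    unfolding g(2) by (rule K_orbit_adapted[OF odd b pattern_adapted[OF h], symmetric])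
  moreover have "represents N (?g \<otimes>\<^bsub>SL N\<^esub> SL_inv N (theta N ?g)) (b \<circ> longest N)"
    unfolding represents_iff_pattern[OF g(1)] g(2)
    using h(2) permutes_compose[OF involution_permutes[OF longest_involution] involution_permutes[OF b]]
    by (simp add: comp_assoc ll)
  ultimately show "\<exists>g\<in>carrier (SL N). orb N b = K_orbit N (SL_inv N g <#\<^bsub>SL N\<^esub> borel_subgroup N) \<and>
      represents N (g \<otimes>\<^bsub>SL N\<^esub> SL_inv N (theta N g)) (b \<circ> longest N)" using g(1) by blast
  fix w assume "\<exists>g\<in>carrier (SL N). orb N b = K_orbit N (SL_inv N g <#\<^bsub>SL N\<^esub> borel_subgroup N) \<and>
      represents N (g \<otimes>\<^bsub>SL N\<^esub> SL_inv N (theta N g)) w"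
  then obtain g where g: "g \<in> carrier (SL N)" "orb N b = K_orbit N (SL_inv N g <#\<^bsub>SL N\<^esub> borel_subgroup N)"
    "represents N (g \<otimes>\<^bsub>SL N\<^esub> SL_inv N (theta N g)) w" by blast
  have i: "SL_inv N g \<in> carrier (SL N)" by (rule SL_inv_closed[OF g(1)])
  have w: "w permutes {..<N}" "has_pattern N (w \<circ> longest N) (gram N (SL_inv N g))"
    using g(3) represents_iff_pattern[OF g(1)] by blast+
  have c: "w \<circ> longest N \<in> involutions N"
    by (rule pattern_involution[OF SL_carrier_mat[OF i] w(2) permutes_compose[OF involution_permutes[OF longest_involution] w(1)]])
  have "orb N b = orb N (w \<circ> longest N)"
    using g(2) K_orbit_adapted[OF odd c pattern_adapted[OF i w(2)]] by simp
  then have "b = w \<circ> longest N" using orb_eq_iff[OF N b c] by blast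
  then show "w = b \<circ> longest N" by (simp add: comp_assoc ll)
qed

lemma orbit_param_orb:
  assumes "odd N" "b \<in> involutions N" shows "orbit_param N (orb N b) = b"
proof -
  have ll: "longest N \<circ> longest N = id" using longest_involution[of N] by (simp add: involutions_def)
  show ?thesis unfolding orbit_param_def RS_map_orb[OF assms] by (simp add: comp_assoc ll)
qed

lemma bij_orbit_param:
  assumes "odd N" shows "bij_betw (orbit_param N) (K_orbits N) (involutions N)"
  unfolding K_orbits_eq[OF assms]
  by (rule bij_betw_byWitness[where f' = "orb N"]) (auto simp: orbit_param_orb[OF assms])

lemma orbit_of_orb:
  assumes "odd N" "b \<in> involutions N" shows "orbit_of N b = orb N b"
  unfolding orbit_of_def
proof (rule the_inv_into_f_eq)
  show "inj_on (orbit_param N) (K_orbits N)" using bij_orbit_param[OF assms(1)] by (simp add: bij_betw_def)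
  show "orbit_param N (orb N b) = b" by (rule orbit_param_orb[OF assms])
  show "orb N b \<in> K_orbits N" using K_orbits_eq[OF assms(1)] assms(2) by blast
qed

section \<open>Fibres over the minimal parabolic quotient\<close>

text \<open>The effect of \<open>lineR\<close> on a bilinear form, and in \<open>shear_form\<close>
  that of \<open>addrows\<close>, written for functions on an arbitrary index type. In this form the
  fibre computation is a case analysis without range conditions.\<close>

definition line_form :: "'a \<Rightarrow> 'a \<Rightarrow> complex \<Rightarrow> ('a \<Rightarrow> 'a \<Rightarrow> complex) \<Rightarrow> 'a \<Rightarrow> 'a \<Rightarrow> complex" where
  "line_form i j \<tau> f p q = (let R = \<lambda>p. if q = i then - f p j else if q = j then f p i + \<tau> * f p j else f p q
     in if p = i then - R j else if p = j then R i + \<tau> * R j else R p)"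

definition shear_form :: "'a \<Rightarrow> ('a \<Rightarrow> complex) \<Rightarrow> ('a \<Rightarrow> 'a \<Rightarrow> complex) \<Rightarrow> 'a \<Rightarrow> 'a \<Rightarrow> complex" where
  "shear_form r c f p q = f p q + c p * f r q + c q * f p r + c p * c q * f r r"

text \<open>\<open>m\<close> lists the nonzero entries of a symmetric monomial form. The partners
  \<open>k\<close>, \<open>l\<close> of \<open>i\<close>, \<open>j\<close> and the entries there are
  named because the change in columns \<open>i\<close> and \<open>j\<close> affects nothing
  else.\<close>

locale monomial_form =
  fixes b :: "'a \<Rightarrow> 'a" and m :: "'a \<Rightarrow> complex" and i j k l :: 'a and \<mu> \<nu> \<tau> :: complex
  assumes bb: "\<And>p. b (b p) = p" and mm: "\<And>p. m (b p) = m p" and m0: "\<And>p. m p \<noteq> 0"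
    and k: "b i = k" and l: "b j = l" and mu: "m i = \<mu>" and nu: "m j = \<nu>" and ij: "i \<noteq> j"
begin

lemma bk: "b k = i" "b l = j" "m k = \<mu>" "m l = \<nu>"
  using bb mm k l mu nu by metis+

lemma biff: "b q = i \<longleftrightarrow> q = k" "b q = j \<longleftrightarrow> q = l" "b q = k \<longleftrightarrow> q = i" "b q = l \<longleftrightarrow> q = j"
   "i = b q \<longleftrightarrow> q = k" "j = b q \<longleftrightarrow> q = l" "k = b q \<longleftrightarrow> q = i" "l = b q \<longleftrightarrow> q = j"
  using bb k l bk by metis+

lemma nz: "\<mu> \<noteq> 0" "\<nu> \<noteq> 0" using m0 mu nu by metis+

definition "F p q = (if p = b q then m q else 0)"

lemma FF: "F i q = (if q = k then \<mu> else 0)" "F p i = (if p = k then \<mu> else 0)"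
  "F j q = (if q = l then \<nu> else 0)" "F p j = (if p = l then \<nu> else 0)"
  "F k q = (if q = i then \<mu> else 0)" "F p k = (if p = i then \<mu> else 0)"
  "F l q = (if q = j then \<nu> else 0)" "F p l = (if p = j then \<nu> else 0)"
  by (auto simp: F_def biff bk k l mu nu)

lemma F0: "F p q = 0 \<longleftrightarrow> p \<noteq> b q"
  using m0 by (simp add: F_def)

definition "G = line_form i j \<tau> F"

lemma G_ii: "G i i = F j j" "G i j = - F j i - \<tau> * F j j" "G j i = - F i j - \<tau> * F j j"
  "G j j = F i i + \<tau> * F i j + \<tau> * F j i + \<tau> * \<tau> * F j j"
  using ij by (simp_all add: G_def line_form_def algebra_simps)

lemma G_q: assumes "q \<noteq> i" "q \<noteq> j"
  shows "G i q = - F j q" "G q i = - F q j" "G j q = F i q + \<tau> * F j q" "G q j = F q i + \<tau> * F q j"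
  using ij assms by (simp_all add: G_def line_form_def)

lemma G_pq: assumes "q \<noteq> i" "q \<noteq> j" "p \<noteq> i" "p \<noteq> j" shows "G p q = F p q"
  using ij assms by (simp add: G_def line_form_def)

lemma tr: "transpose i j i = j" "transpose i j j = i" "q \<noteq> i \<Longrightarrow> q \<noteq> j \<Longrightarrow> transpose i j q = q"
  by (simp_all add: transpose_def)

text \<open>After the change \<open>j\<close> pairs with both \<open>k\<close> and \<open>l\<close>,
  with entries \<open>\<mu>\<close> and \<open>\<tau> \<nu>\<close>; adding a multiple of
  \<open>k\<close> to \<open>l\<close> removes the second pairing.\<close>

lemma adapted_generic:
  assumes "k \<noteq> i" "k \<noteq> j" "l \<noteq> i" "l \<noteq> j"
  shows "shear_form k (\<lambda>q. if q = l then - \<tau> * \<nu> / \<mu> else 0) G p q \<noteq> 0 \<longleftrightarrow>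
    p = (transpose i j \<circ> b \<circ> transpose i j) q"
proof -
  have kl: "k \<noteq> l" using bk ij by metis
  note ne = assms assms[THEN not_sym] kl kl[THEN not_sym] ij ij[THEN not_sym]
  have Gk: "G k q = (if q = j then \<mu> else 0)" "G q k = (if q = j then \<mu> else 0)" for q
    by (cases "q = i"; cases "q = j"; simp add: G_q[OF assms(1,2)] G_pq assms FF(5,6) ij ij[THEN not_sym])+
  have Gl: "G l q = (if q = i then - \<nu> else if q = j then \<tau> * \<nu> else 0)"
    "G q l = (if q = i then - \<nu> else if q = j then \<tau> * \<nu> else 0)" for q
    by (cases "q = i"; cases "q = j"; simp add: G_q[OF assms(3,4)] G_pq assms FF(7,8) ij ij[THEN not_sym])+
  have Gi: "G i q = (if q = l then - \<nu> else 0)" "G q i = (if q = l then - \<nu> else 0)" for q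
    using ne by (cases "q = i"; cases "q = j"; simp add: G_ii G_q FF)+
  have Gj: "G j q = (if q = k then \<mu> else if q = l then \<tau> * \<nu> else 0)"
      "G q j = (if q = k then \<mu> else if q = l then \<tau> * \<nu> else 0)" for q
    using ne by (cases "q = i"; cases "q = j"; simp add: G_ii G_q FF)+
  let ?H = "shear_form k (\<lambda>q. if q = l then - \<tau> * \<nu> / \<mu> else 0) G"
  define B where "B = transpose i j \<circ> b \<circ> transpose i j"
  have b': "B i = l" "B j = k" "B k = j" "B l = i"
    using ne by (simp_all add: B_def tr k l bk)
  have BB: "B (B q) = q" for q by (simp add: B_def bb)
  have H1: "?H i q = (if q = l then - \<nu> else 0)" for q using ne by (simp add: shear_form_def Gi Gk)
  have H2: "?H j q = (if q = k then \<mu> else 0)" for q using ne nz by (simp add: shear_form_def Gj Gk)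
  have H3: "?H k q = (if q = j then \<mu> else 0)" for q using ne nz by (simp add: shear_form_def Gk)
  have H4: "?H l q = (if q = i then - \<nu> else 0)" for q using ne nz by (simp add: shear_form_def Gk Gl)
  have b'': "i = B q \<longleftrightarrow> q = l" "j = B q \<longleftrightarrow> q = k" "k = B q \<longleftrightarrow> q = j" "l = B q \<longleftrightarrow> q = i" for q
    using b' BB by metis+
  have "?H p q \<noteq> 0 \<longleftrightarrow> p = B q"
  proof -
    consider "p = i" | "p = j" | "p = k" | "p = l" | "p \<noteq> i" "p \<noteq> j" "p \<noteq> k" "p \<noteq> l" by blast
    then show ?thesis
    proof cases
      case 1 then show ?thesis using H1[of q] b''[of q] nz by simp
    next
      case 2 then show ?thesis using H2[of q] b''[of q] nz by simp
    next
      case 3 then show ?thesis using H3[of q] b''[of q] nz by simp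
    next
      case 4 then show ?thesis using H4[of q] b''[of q] nz by simp
    next
      case p: 5
      consider "q = i" | "q = j" | "q = k" | "q = l" | "q \<noteq> i" "q \<noteq> j" "q \<noteq> k" "q \<noteq> l" by blast
      then show ?thesis
      proof cases
        case q: 5
        have "?H p q = F p q" using p q by (simp add: shear_form_def G_pq)
        moreover have "B q = b q" using q biff[of q] by (simp add: B_def tr)
        ultimately show ?thesis using F0 by simp
      qed (use p b' in \<open>simp_all add: shear_form_def Gi Gj Gk Gl\<close>)
    qed
  qed
  then show ?thesis by (simp only: B_def)
qed

text \<open>Here \<open>j\<close> becomes anisotropic with square \<open>\<mu>\<close> and also
  pairs with \<open>l\<close>. Splitting it off leaves a square at \<open>l\<close>, which is
  removed through the pairing of \<open>i\<close> with \<open>l\<close>; it changes from both sides,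
  hence the factor \<open>2\<close>.\<close>

lemma adapted_fixed_i:
  assumes "k = i" "l \<noteq> i" "l \<noteq> j"
  shows "shear_form i (\<lambda>q. if q = l then - (\<tau> * \<tau>) * \<nu> / (2 * \<mu>) else 0)
      (shear_form j (\<lambda>q. if q = l then - \<tau> * \<nu> / \<mu> else 0) G) p q \<noteq> 0 \<longleftrightarrow>
    p = (transpose i j \<circ> b \<circ> transpose i j) q"
proof -
  note ne = assms(2,3) assms(2,3)[THEN not_sym] ij ij[THEN not_sym]
  note FF' = FF[unfolded assms(1)]
  have Gl: "G l q = (if q = i then - \<nu> else if q = j then \<tau> * \<nu> else 0)"
    "G q l = (if q = i then - \<nu> else if q = j then \<tau> * \<nu> else 0)" for q
    using ne by (cases "q = i"; cases "q = j"; simp add: G_q G_pq FF')+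
  have Gi: "G i q = (if q = l then - \<nu> else 0)" "G q i = (if q = l then - \<nu> else 0)" for q
    using ne by (cases "q = i"; cases "q = j"; simp add: G_ii G_q FF')+
  have Gj: "G j q = (if q = j then \<mu> else if q = l then \<tau> * \<nu> else 0)"
      "G q j = (if q = j then \<mu> else if q = l then \<tau> * \<nu> else 0)" for q
    using ne by (cases "q = i"; cases "q = j"; simp add: G_ii G_q FF')+
  define H1 where "H1 = shear_form j (\<lambda>q. if q = l then - \<tau> * \<nu> / \<mu> else 0) G"
  have H1i: "H1 i q = (if q = l then - \<nu> else 0)" "H1 q i = (if q = l then - \<nu> else 0)" for q
    using ne nz by (auto simp: H1_def shear_form_def Gi Gj)
  have H1j: "H1 j q = (if q = j then \<mu> else 0)" "H1 q j = (if q = j then \<mu> else 0)" for q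
    using ne nz by (auto simp: H1_def shear_form_def Gj)
  have H1l: "H1 l q = (if q = i then - \<nu> else if q = l then - (\<tau> * \<tau> * \<nu> * \<nu>) / \<mu> else 0)"
     "H1 q l = (if q = i then - \<nu> else if q = l then - (\<tau> * \<tau> * \<nu> * \<nu>) / \<mu> else 0)" for q
    using ne nz by (auto simp: H1_def shear_form_def Gj Gl field_simps)
  let ?H = "shear_form i (\<lambda>q. if q = l then - (\<tau> * \<tau>) * \<nu> / (2 * \<mu>) else 0) H1"
  define B where "B = transpose i j \<circ> b \<circ> transpose i j"
  have b': "B i = l" "B j = j" "B l = i"
    using ne k l bk unfolding assms(1) by (simp_all add: B_def tr)
  have BB: "B (B q) = q" for q by (simp add: B_def bb)
  have H2: "?H i q = (if q = l then - \<nu> else 0)" for q using ne by (simp add: shear_form_def H1i)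
  have H3: "?H j q = (if q = j then \<mu> else 0)" for q using ne nz by (simp add: shear_form_def H1j H1i)
  have H4: "?H l q = (if q = i then - \<nu> else 0)" for q
    using ne nz by (auto simp: shear_form_def H1l H1i field_simps)
  have b'': "i = B q \<longleftrightarrow> q = l" "j = B q \<longleftrightarrow> q = j" "l = B q \<longleftrightarrow> q = i" for q
    using b' BB by metis+
  have "?H p q \<noteq> 0 \<longleftrightarrow> p = B q"
  proof -
    consider "p = i" | "p = j" | "p = l" | "p \<noteq> i" "p \<noteq> j" "p \<noteq> l" by blast
    then show ?thesis
    proof cases
      case 1 then show ?thesis using H2[of q] b''[of q] nz by simp
    next
      case 2 then show ?thesis using H3[of q] b''[of q] nz by simp
    next
      case 3 then show ?thesis using H4[of q] b''[of q] nz by simp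
    next
      case p: 4
      consider "q = i" | "q = j" | "q = l" | "q \<noteq> i" "q \<noteq> j" "q \<noteq> l" by blast
      then show ?thesis
      proof cases
        case q: 4
        have "?H p q = F p q" using p q by (simp add: shear_form_def H1_def G_pq)
        moreover have "B q = b q" using q biff[of q] unfolding assms(1) by (simp add: B_def tr)
        ultimately show ?thesis using F0 by simp
      qed (use p b' in \<open>simp_all add: shear_form_def H1i H1j H1l\<close>)
    qed
  qed
  then show ?thesis by (simp only: B_def H1_def)
qed

text \<open>Now \<open>k\<close> pairs only with \<open>j\<close>, so a single shear along
  \<open>k\<close> clears both the pairing of \<open>i\<close> with \<open>j\<close> and, with a
  factor \<open>2\<close> for the two sides, the square at \<open>j\<close>.\<close>

lemma adapted_fixed_j:
  assumes "l = j" "k \<noteq> i" "k \<noteq> j"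
  shows "shear_form k (\<lambda>q. if q = j then - (\<tau> * \<tau>) * \<nu> / (2 * \<mu>) else if q = i then \<tau> * \<nu> / \<mu> else 0) G p q \<noteq> 0 \<longleftrightarrow>
    p = (transpose i j \<circ> b \<circ> transpose i j) q"
proof -
  note ne = assms(2,3) assms(2,3)[THEN not_sym] ij ij[THEN not_sym]
  note FF' = FF[unfolded assms(1)]
  have Gk: "G k q = (if q = j then \<mu> else 0)" "G q k = (if q = j then \<mu> else 0)" for q
    using ne by (cases "q = i"; cases "q = j"; simp add: G_q G_pq FF')+
  have Gi: "G i q = (if q = i then \<nu> else if q = j then - \<tau> * \<nu> else 0)"
      "G q i = (if q = i then \<nu> else if q = j then - \<tau> * \<nu> else 0)" for q
    using ne by (cases "q = i"; cases "q = j"; simp add: G_ii G_q FF')+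
  have Gj: "G j q = (if q = k then \<mu> else if q = i then - \<tau> * \<nu> else if q = j then \<tau> * \<tau> * \<nu> else 0)"
      "G q j = (if q = k then \<mu> else if q = i then - \<tau> * \<nu> else if q = j then \<tau> * \<tau> * \<nu> else 0)" for q
    using ne by (cases "q = i"; cases "q = j"; simp add: G_ii G_q FF')+
  let ?H = "shear_form k (\<lambda>q. if q = j then - (\<tau> * \<tau>) * \<nu> / (2 * \<mu>) else if q = i then \<tau> * \<nu> / \<mu> else 0) G"
  define B where "B = transpose i j \<circ> b \<circ> transpose i j"
  have b': "B i = i" "B j = k" "B k = j"
    using ne k l bk unfolding assms(1) by (simp_all add: B_def tr)
  have BB: "B (B q) = q" for q by (simp add: B_def bb)
  have H1: "?H i q = (if q = i then \<nu> else 0)" for q using ne nz by (auto simp: shear_form_def Gi Gk field_simps)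
  have H2: "?H j q = (if q = k then \<mu> else 0)" for q using ne nz by (auto simp: shear_form_def Gj Gk field_simps)
  have H3: "?H k q = (if q = j then \<mu> else 0)" for q using ne nz by (auto simp: shear_form_def Gk)
  have b'': "i = B q \<longleftrightarrow> q = i" "j = B q \<longleftrightarrow> q = k" "k = B q \<longleftrightarrow> q = j" for q
    using b' BB by metis+
  have "?H p q \<noteq> 0 \<longleftrightarrow> p = B q"
  proof -
    consider "p = i" | "p = j" | "p = k" | "p \<noteq> i" "p \<noteq> j" "p \<noteq> k" by blast
    then show ?thesis
    proof cases
      case 1 then show ?thesis using H1[of q] b''[of q] nz by simp
    next
      case 2 then show ?thesis using H2[of q] b''[of q] nz by simp
    next
      case 3 then show ?thesis using H3[of q] b''[of q] nz by simp
    next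
      case p: 4
      consider "q = i" | "q = j" | "q = k" | "q \<noteq> i" "q \<noteq> j" "q \<noteq> k" by blast
      then show ?thesis
      proof cases
        case q: 4
        have "?H p q = F p q" using p q by (simp add: shear_form_def G_pq)
        moreover have "B q = b q" using q biff[of q] unfolding assms(1) by (simp add: B_def tr)
        ultimately show ?thesis using F0 by simp
      qed (use p b' in \<open>simp_all add: shear_form_def Gi Gj Gk\<close>)
    qed
  qed
  then show ?thesis by (simp only: B_def)
qed

text \<open>The plane of \<open>i\<close> and \<open>j\<close> is hyperbolic. For
  \<open>\<tau> \<noteq> 0\<close> the new vector at \<open>j\<close> has square
  \<open>2 \<tau> \<mu>\<close>, so it is anisotropic and can be split off from \<open>i\<close>;
  the two-cycle turns into two fixed points.\<close>

lemma adapted_commuting: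
  assumes "k = j" "\<tau> \<noteq> 0"
  shows "shear_form j (\<lambda>q. if q = i then 1 / (2 * \<tau>) else 0) G p q \<noteq> 0 \<longleftrightarrow> p = (transpose i j \<circ> b) q"
proof -
  have li: "l = i" and mn: "\<nu> = \<mu>" using bk nu l assms(1) by auto
  note ne = ij ij[THEN not_sym]
  note FF' = FF[unfolded assms(1) li mn]
  have Gi: "G i q = (if q = j then - \<mu> else 0)" "G q i = (if q = j then - \<mu> else 0)" for q
    using ne by (cases "q = i"; cases "q = j"; simp add: G_ii G_q FF')+
  have Gj: "G j q = (if q = i then - \<mu> else if q = j then 2 * \<tau> * \<mu> else 0)"
      "G q j = (if q = i then - \<mu> else if q = j then 2 * \<tau> * \<mu> else 0)" for q
    using ne by (cases "q = i"; cases "q = j"; simp add: G_ii G_q FF')+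
  let ?H = "shear_form j (\<lambda>q. if q = i then 1 / (2 * \<tau>) else 0) G"
  define B where "B = transpose i j \<circ> b"
  have b': "B i = i" "B j = j"
    using ne k l unfolding assms(1) li by (simp_all add: B_def tr)
  have H1: "?H i q = (if q = i then - \<mu> / (2 * \<tau>) else 0)" for q
    using ne nz assms(2) by (auto simp: shear_form_def Gi Gj field_simps)
  have H2: "?H j q = (if q = j then 2 * \<tau> * \<mu> else 0)" for q
    using ne nz assms(2) by (auto simp: shear_form_def Gj field_simps)
  have bo: "B q = b q" "b q \<noteq> i" "b q \<noteq> j" if "q \<noteq> i" "q \<noteq> j" for q
    using that biff[of q] unfolding assms(1) li by (simp_all add: B_def tr)
  have "?H p q \<noteq> 0 \<longleftrightarrow> p = B q"
  proof -
    consider "p = i" | "p = j" | "p \<noteq> i" "p \<noteq> j" by blast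
    then show ?thesis
    proof cases
      case 1
      then show ?thesis using H1[of q] b' bo[of q] nz assms(2) ne by (cases "q = i"; cases "q = j"; simp)
    next
      case 2
      then show ?thesis using H2[of q] b' bo[of q] nz assms(2) ne by (cases "q = i"; cases "q = j"; simp)
    next
      case p: 3
      consider "q = i" | "q = j" | "q \<noteq> i" "q \<noteq> j" by blast
      then show ?thesis
      proof cases
        case q: 3
        have "?H p q = F p q" using p q by (simp add: shear_form_def G_pq)
        then show ?thesis using F0 bo(1)[OF q] by simp
      qed (use p b' in \<open>simp_all add: shear_form_def Gi Gj\<close>)
    qed
  qed
  then show ?thesis by (simp only: B_def)
qed

text \<open>At \<open>\<tau> = 0\<close> the two isotropic lines of the hyperbolic plane are
  exchanged, so the pattern survives: this is the second point of the fibre in the same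
  orbit.\<close>

lemma adapted_commuting_zero:
  assumes "k = j" "\<tau> = 0"
  shows "G p q \<noteq> 0 \<longleftrightarrow> p = b q"
proof -
  have li: "l = i" and mn: "\<nu> = \<mu>" using bk nu l assms(1) by auto
  note ne = ij ij[THEN not_sym]
  note FF' = FF[unfolded assms(1) li mn]
  have Gi: "G i q = (if q = j then - \<mu> else 0)" "G q i = (if q = j then - \<mu> else 0)" for q
    using ne by (cases "q = i"; cases "q = j"; simp add: G_ii G_q FF')+
  have Gj: "G j q = (if q = i then - \<mu> else if q = j then 2 * \<tau> * \<mu> else 0)"
      "G q j = (if q = i then - \<mu> else if q = j then 2 * \<tau> * \<mu> else 0)" for q
    using ne by (cases "q = i"; cases "q = j"; simp add: G_ii G_q FF')+
  note bf = biff[of q, unfolded assms(1) li] k[unfolded assms(1)] l[unfolded li]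
  consider "p = i" | "p = j" | "q = i" | "q = j" | "p \<noteq> i" "p \<noteq> j" "q \<noteq> i" "q \<noteq> j" by blast
  then show ?thesis
  proof cases
    case 1
    then show ?thesis using Gi(1)[of q] bf nz by simp
  next
    case 2
    then show ?thesis using Gj(1)[of q] bf nz assms(2) by simp
  next
    case 3
    then show ?thesis using Gi(2)[of p] bf nz by simp
  next
    case 4
    then show ?thesis using Gj(2)[of p] bf nz assms(2) by simp
  next
    case 5
    then show ?thesis using F0[of p q] by (simp add: G_pq)
  qed
qed

end

section \<open>Transfer of the fibre computation to Gram matrices\<close>

lemma lineR_congruence:
  assumes M: "M \<in> carrier_mat N N" and i: "Suc i < N" and pq: "p < N" "q < N"
  shows "(transpose_mat (lineR N i \<tau>) * M * lineR N i \<tau>) $$ (p, q) =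
    line_form i (Suc i) \<tau> (\<lambda>p q. M $$ (p, q)) p q"
proof -
  have L: "lineR N i \<tau> \<in> carrier_mat N N" by (simp add: lineR_def blk_carrier)
  let ?X = "M * lineR N i \<tau>"
  have Xm: "?X \<in> carrier_mat N N" by (rule mat_mult_carrier[OF M L])
  have X: "?X $$ (r, s) = (if s = i then - M $$ (r, Suc i) else if s = Suc i then M $$ (r, i) + \<tau> * M $$ (r, Suc i) else M $$ (r, s))"
    if "r < N" "s < N" for r s
    unfolding lineR_def blk_mult_right[OF i M that] by simp
  have "transpose_mat (lineR N i \<tau>) * M * lineR N i \<tau> = transpose_mat (lineR N i \<tau>) * ?X"
    using mat_assoc[of "transpose_mat (lineR N i \<tau>)" N M "lineR N i \<tau>"] M L by simp
  also have "\<dots> = transpose_mat (transpose_mat ?X * lineR N i \<tau>)"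
    using transpose_mult_SL[of "transpose_mat ?X" N "lineR N i \<tau>"] Xm L by simp
  also have "\<dots> $$ (p, q) = (transpose_mat ?X * lineR N i \<tau>) $$ (q, p)"
    using Xm L pq by simp
  also have "\<dots> = (if p = i then - transpose_mat ?X $$ (q, Suc i)
      else if p = Suc i then transpose_mat ?X $$ (q, i) + \<tau> * transpose_mat ?X $$ (q, Suc i) else transpose_mat ?X $$ (q, p))"
    unfolding lineR_def by (subst blk_mult_right[OF i _ pq(2,1)]) (use Xm in \<open>simp_all add: lineR_def\<close>)
  also have "\<dots> = (if p = i then - ?X $$ (Suc i, q) else if p = Suc i then ?X $$ (i, q) + \<tau> * ?X $$ (Suc i, q) else ?X $$ (p, q))"
  proof -
    have "transpose_mat ?X $$ (q, r) = ?X $$ (r, q)" if "r < N" for r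
      using Xm pq that by (metis carrier_matD index_transpose_mat(1))
    then show ?thesis using i pq by simp
  qed
  finally show ?thesis using X[of i q] X[of "Suc i" q] X[of p q] i pq
    unfolding line_form_def Let_def by simp
qed

lemma shear_congruence:
  assumes "M \<in> carrier_mat N N" "r < N" "p < N" "q < N" "\<And>q. \<not> q < r \<Longrightarrow> a q = 0"
  shows "(transpose_mat (addrows N r a) * M * addrows N r a) $$ (p, q) = shear_form r a (\<lambda>p q. M $$ (p, q)) p q"
proof -
  have a: "(if x < r then a x else 0) = a x" for x using assms(5) by auto
  show ?thesis using addrows_congruence[OF assms(1-4), of a] unfolding a shear_form_def .
qed

lemma line_form_cong:
  "(\<And>p q. p < N \<Longrightarrow> q < N \<Longrightarrow> f p q = g p q) \<Longrightarrow> i < N \<Longrightarrow> j < N \<Longrightarrow> p < N \<Longrightarrow> q < N \<Longrightarrow>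
    line_form i j \<tau> f p q = line_form i j \<tau> g p q" for N :: nat
  by (simp add: line_form_def Let_def)

lemma shear_form_cong:
  "(\<And>p q. p < N \<Longrightarrow> q < N \<Longrightarrow> f p q = g p q) \<Longrightarrow> r < N \<Longrightarrow> p < N \<Longrightarrow> q < N \<Longrightarrow>
    shear_form r a f p q = shear_form r a g p q" for N :: nat
  by (simp add: shear_form_def)

abbreviation conj_refl :: "nat \<Rightarrow> (nat \<Rightarrow> nat) \<Rightarrow> nat \<Rightarrow> nat" where
  "conj_refl i b \<equiv> simple_refl i \<circ> b \<circ> simple_refl i"

text \<open>Commuting with the reflection makes \<open>b i\<close> the reflection of
  \<open>b (Suc i)\<close>; as the two values differ, they are \<open>i\<close> and
  \<open>Suc i\<close>.\<close>

lemma commuting_descent: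
  assumes "b (Suc i) < b i" "conj_refl i b = b" shows "b i = Suc i" "b (Suc i) = i"
proof -
  have "simple_refl i (b (simple_refl i i)) = b i" using fun_cong[OF assms(2), of i] by simp
  then have "simple_refl i (b (Suc i)) = b i" by simp
  then show "b i = Suc i" "b (Suc i) = i" using assms(1) by (auto simp: transpose_def split: if_splits)
qed

lemma commuting_iff:
  assumes b: "b \<in> involutions N" and d: "b (Suc i) < b i"
  shows "conj_refl i b = b \<longleftrightarrow> b i = Suc i"
proof
  assume e: "b i = Suc i"
  then have e': "b (Suc i) = i" using involution_involutive[OF b, of i] by simp
  show "conj_refl i b = b"
  proof
    fix p
    show "conj_refl i b p = b p"
    proof (cases "p = i \<or> p = Suc i")
      case True
      then show ?thesis using e e' by auto
    next
      case False
      then have "b p \<noteq> i" "b p \<noteq> Suc i" using e e' involution_involutive[OF b, of p] by auto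
      then show ?thesis using False by (simp add: transpose_def)
    qed
  qed
qed (use commuting_descent[OF d] in blast)

text \<open>At a descent \<open>l = b (Suc i)\<close> is smaller than \<open>k = b i\<close>. This
  order is what makes the shears of \<open>monomial_form\<close> lower triangular.\<close>

lemma gram_fibre:
  assumes h: "h \<in> carrier (SL N)" "has_pattern N b (gram N h)" and b: "b \<in> involutions N"
    and i: "Suc i < N" and d: "b (Suc i) < b i"
  shows "conj_refl i b \<noteq> b \<Longrightarrow> h * lineR N i \<tau> \<in> adapted N (conj_refl i b)"
    and "conj_refl i b = b \<Longrightarrow> h * lineR N i 0 \<in> adapted N b"
    and "conj_refl i b = b \<Longrightarrow> \<tau> \<noteq> 0 \<Longrightarrow> h * lineR N i \<tau> \<in> adapted N (simple_refl i \<circ> b)"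
proof -
  note hm = SL_carrier_mat[OF h(1)]
  let ?M = "gram N h"
  note Mm = gram_carrier[OF hm]
  \<comment> \<open>The value \<open>1\<close> outside the range keeps \<open>m\<close> nowhere
    zero, as the locale demands.\<close>
  define m where "m q = (if q < N then ?M $$ (b q, q) else 1)" for q
  define k where "k = b i"
  define l where "l = b (Suc i)"
  have kl: "l < k" "k < N" "l < N" using d involution_less[OF b, of i] involution_less[OF b, of "Suc i"] i
    by (auto simp: k_def l_def)
  have bl: "b p < N \<longleftrightarrow> p < N" for p using involution_less[OF b, of p] involution_less[OF b, of "b p"] involution_involutive[OF b, of p] by auto
  interpret monomial_form b m i "Suc i" k l "m i" "m (Suc i)" \<tau> for \<tau>
  proof
    show "b (b p) = p" for p by (rule involution_involutive[OF b])
    show "m (b p) = m p" for p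
      using symmetric_entry[OF transpose_gram[OF hm] Mm, of p "b p"] bl involution_involutive[OF b, of p] by (simp add: m_def)
    show "m p \<noteq> 0" for p using h(2) bl by (simp add: m_def has_pattern_def)
  qed (simp_all add: k_def l_def)
  have FM: "?M $$ (p, q) = F p q" if "p < N" "q < N" for p q
    using h(2) that unfolding F_def m_def has_pattern_def by (cases "p = b q") auto
  define M1 where "M1 \<tau> = gram N (h * lineR N i \<tau>)" for \<tau>
  have Lc: "lineR N i \<tau> \<in> carrier (SL N)" for \<tau> using parabolic_SL[OF lineR_parabolic[OF i]] .
  have hL: "h * lineR N i \<tau> \<in> carrier (SL N)" for \<tau> by (rule SL_mult_closed[OF h(1) Lc])
  have M1m: "M1 \<tau> \<in> carrier_mat N N" for \<tau> unfolding M1_def by (rule gram_carrier[OF SL_carrier_mat[OF hL]])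
  have M1: "M1 \<tau> $$ (p, q) = G \<tau> p q" if "p < N" "q < N" for p q \<tau>
    unfolding M1_def gram_mult[OF hm SL_carrier_mat[OF Lc]] lineR_congruence[OF Mm i that] G_def
    by (rule line_form_cong[where N = N]) (use FM i that in auto)
  have shear: "has_pattern N c (transpose_mat (addrows N r a) * M * addrows N r a)"
    if "M \<in> carrier_mat N N" "r < N" "\<And>q. \<not> q < r \<Longrightarrow> a q = 0" "\<And>p q. p < N \<Longrightarrow> q < N \<Longrightarrow> M $$ (p, q) = f p q"
      "\<And>p q. shear_form r a f p q \<noteq> 0 \<longleftrightarrow> p = c q" for M r a f c
    unfolding has_pattern_def
  proof (intro allI impI)
    fix p q assume pq: "p < N" "q < N"
    have "(transpose_mat (addrows N r a) * M * addrows N r a) $$ (p, q) = shear_form r a (\<lambda>p q. M $$ (p, q)) p q"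
      by (rule shear_congruence[OF that(1,2) pq that(3)])
    also have "\<dots> = shear_form r a f p q"
      by (rule shear_form_cong[where N = N]) (use that pq in auto)
    finally have "(transpose_mat (addrows N r a) * M * addrows N r a) $$ (p, q) = shear_form r a f p q" .
    then show "(transpose_mat (addrows N r a) * M * addrows N r a) $$ (p, q) \<noteq> 0 \<longleftrightarrow> p = c q" using that(5) by simp
  qed
  have am: "addrows N r a \<in> carrier_mat N N" for r a by (simp add: addrows_def)
  have adapt1: "h * lineR N i \<tau> \<in> adapted N c"
    if "r < N" "\<And>q. \<not> q < r \<Longrightarrow> a q = 0" "\<And>p q. shear_form r a (G \<tau>) p q \<noteq> 0 \<longleftrightarrow> p = c q" for r a c \<tau>
  proof -
    have "has_pattern N c (gram N (h * lineR N i \<tau> * addrows N r a))"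
      unfolding gram_mult[OF SL_carrier_mat[OF hL] am] M1_def[symmetric]
      by (rule shear[OF M1m that(1,2) _ that(3)]) (use M1 in auto)
    then show ?thesis using hL addrows_borel unfolding adapted_def by blast
  qed
  show "h * lineR N i \<tau> \<in> adapted N (conj_refl i b)" if "conj_refl i b \<noteq> b"
  proof -
    have nk: "k \<noteq> Suc i" using that commuting_iff[OF b d] by (simp add: k_def)
    have nl: "l \<noteq> i" using nk bk(2) by (auto simp: k_def)
    consider "k = i" | "l = Suc i" | "k \<noteq> i" "l \<noteq> Suc i" by blast
    then show ?thesis
    proof cases
      case 1
      have nl': "l \<noteq> Suc i" using kl 1 by simp
      let ?a = "\<lambda>q. if q = l then - \<tau> * m (Suc i) / m i else 0"
      let ?a' = "\<lambda>q. if q = l then - (\<tau> * \<tau>) * m (Suc i) / (2 * m i) else 0"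
      \<comment> \<open>Two successive shears, along \<open>Suc i\<close> and along
        \<open>i\<close>; both modify only column \<open>l\<close>, which lies to the left since
        \<open>l < k = i\<close>.\<close>
      let ?A = "addrows N (Suc i) ?a" and ?A' = "addrows N i ?a'"
      let ?M2 = "transpose_mat ?A * M1 \<tau> * ?A"
      have M2: "?M2 $$ (p, q) = shear_form (Suc i) ?a (G \<tau>) p q" if "p < N" "q < N" for p q
      proof -
        have "?M2 $$ (p, q) = shear_form (Suc i) ?a (\<lambda>p q. M1 \<tau> $$ (p, q)) p q"
          by (rule shear_congruence[OF M1m i that]) (use kl 1 in auto)
        also have "\<dots> = shear_form (Suc i) ?a (G \<tau>) p q"
          by (rule shear_form_cong[where N = N]) (use M1 i that in auto)
        finally show ?thesis .
      qed
      have M2m: "?M2 \<in> carrier_mat N N" using M1m am by (auto intro!: mat_mult_carrier)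
      have "has_pattern N (conj_refl i b) (transpose_mat ?A' * ?M2 * ?A')"
        by (rule shear[OF M2m _ _ M2 adapted_fixed_i[OF 1 nl nl']]) (use kl 1 i in auto)
      moreover have "transpose_mat ?A' * ?M2 * ?A' = gram N (h * lineR N i \<tau> * (?A * ?A'))"
        unfolding gram_mult[OF SL_carrier_mat[OF hL] mat_mult_carrier[OF am am]] M1_def[symmetric]
        by (simp add: transpose_mult_SL[of _ N] mat_assoc[of _ N] mat_mult_carrier am M1m)
      ultimately have "has_pattern N (conj_refl i b) (gram N (h * lineR N i \<tau> * (?A * ?A')))" by simp
      then show ?thesis using hL borel_mult[OF addrows_borel addrows_borel] unfolding adapted_def by blast
    next
      case 2
      show ?thesis
        by (rule adapt1[OF kl(2) _ adapted_fixed_j[OF 2]]) (use kl nk 2 in auto)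
    next
      case 3
      show ?thesis
        by (rule adapt1[OF kl(2) _ adapted_generic[OF 3(1) nk nl 3(2)]]) (use kl in auto)
    qed
  qed
  show "h * lineR N i 0 \<in> adapted N b" if "conj_refl i b = b"
  proof -
    have "k = Suc i" using commuting_iff[OF b d] that by (simp add: k_def)
    then have "has_pattern N b (M1 0)" unfolding has_pattern_def using M1 adapted_commuting_zero by simp
    then show ?thesis unfolding M1_def by (rule pattern_adapted[OF hL])
  qed
  show "h * lineR N i \<tau> \<in> adapted N (simple_refl i \<circ> b)" if "conj_refl i b = b" "\<tau> \<noteq> 0"
  proof -
    have k: "k = Suc i" using commuting_iff[OF b d] that(1) by (simp add: k_def)
    show ?thesis by (rule adapt1[OF i _ adapted_commuting[OF k that(2)]]) auto
  qed
qed

section \<open>Lengths in the symmetric group\<close>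

definition inversions :: "nat \<Rightarrow> (nat \<Rightarrow> nat) \<Rightarrow> (nat \<times> nat) set" where
  "inversions N w = {(p, q). p < q \<and> q < N \<and> w q < w p}"

lemma finite_inversions: "finite (inversions N w)"
  by (rule finite_subset[of _ "{..<N} \<times> {..<N}"]) (auto simp: inversions_def)

lemma inversions_id: "inversions N id = {}"
  by (auto simp: inversions_def)

lemma simple_refl_less_iff:
  assumes "x \<noteq> y" "\<not> (x = i \<and> y = Suc i)" "\<not> (x = Suc i \<and> y = i)"
  shows "simple_refl i x < simple_refl i y \<longleftrightarrow> x < y"
  using assms by (auto simp: transpose_def)

lemma simple_refl_permutes: "Suc i < N \<Longrightarrow> simple_refl i permutes {..<N}"
  by (rule permutes_swap_id) auto

text \<open>Composing with the reflection exchanges the values \<open>i\<close> and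
  \<open>Suc i\<close>, so only the pair of positions carrying these two values changes its
  order.\<close>

lemma inversions_ascent:
  assumes w: "w permutes {..<N}" and p: "w p0 = i" "w p1 = Suc i" "p0 < p1" "p1 < N"
  shows "card (inversions N (simple_refl i \<circ> w)) = Suc (card (inversions N w))"
proof -
  have inj: "w p = w q \<longleftrightarrow> p = q" for p q using permutes_inj[OF w] by (auto dest: injD)
  have "inversions N (simple_refl i \<circ> w) = insert (p0, p1) (inversions N w)"
  proof (rule Set.set_eqI, clarify)
    fix p q
    show "(p, q) \<in> inversions N (simple_refl i \<circ> w) \<longleftrightarrow> (p, q) \<in> insert (p0, p1) (inversions N w)"
    proof (cases "(p, q) = (p0, p1)")
      case True
      then show ?thesis using p by (simp add: inversions_def)
    next
      case False
      show ?thesis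
      proof (cases "p < q")
        case pq: True
        have "\<not> (w q = i \<and> w p = Suc i)" using inj[of q p0] inj[of p p1] p pq by auto
        moreover have "\<not> (w q = Suc i \<and> w p = i)" using inj[of q p1] inj[of p p0] p False by auto
        moreover have "w q \<noteq> w p" using inj pq by simp
        ultimately have "simple_refl i (w q) < simple_refl i (w p) \<longleftrightarrow> w q < w p"
          by (intro simple_refl_less_iff) auto
        then show ?thesis using False by (auto simp: inversions_def)
      qed (use False in \<open>simp add: inversions_def\<close>)
    qed
  qed
  moreover have "(p0, p1) \<notin> inversions N w" using p by (simp add: inversions_def)
  ultimately show ?thesis using finite_inversions by simp
qed

lemma inversions_descent:
  assumes w: "w permutes {..<N}" and p: "w p0 = i" "w p1 = Suc i" "p1 < p0" "p0 < N" and i: "Suc i < N"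
  shows "Suc (card (inversions N (simple_refl i \<circ> w))) = card (inversions N w)"
proof -
  have "(simple_refl i \<circ> w) permutes {..<N}" by (rule permutes_compose[OF w simple_refl_permutes[OF i]])
  from inversions_ascent[OF this, of p1 i p0] p
  show ?thesis by (simp add: comp_assoc[symmetric] transpose_comp_involutory)
qed

lemma permutes_preimages:
  assumes w: "w permutes {..<N}" and i: "Suc i < N"
  obtains p0 p1 where "w p0 = i" "w p1 = Suc i" "p0 < N" "p1 < N" "p0 \<noteq> p1"
proof -
  have "i \<in> w ` {..<N}" "Suc i \<in> w ` {..<N}" using permutes_image[OF w] i by auto
  then obtain p0 p1 where "w p0 = i" "w p1 = Suc i" "p0 < N" "p1 < N" by auto
  moreover from this have "p0 \<noteq> p1" by auto
  ultimately show ?thesis using that by blast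
qed

abbreviation word :: "nat list \<Rightarrow> nat \<Rightarrow> nat" where
  "word is \<equiv> foldr (\<lambda>i f. simple_refl i \<circ> f) is id"

lemma word_permutes: "\<forall>i\<in>set is. Suc i < N \<Longrightarrow> word is permutes {..<N}"
  by (induction "is") (auto intro: permutes_compose[OF _ simple_refl_permutes] simp: permutes_id)

lemma inversions_word: "\<forall>i\<in>set is. Suc i < N \<Longrightarrow> card (inversions N (word is)) \<le> length is"
proof (induction "is")
  case Nil
  have "inversions N (word []) = {}" by (auto simp: inversions_def)
  then show ?case by (simp only: card.empty)
next
  case (Cons i "is")
  define v where "v = word is"
  have w: "v permutes {..<N}" and i: "Suc i < N" using Cons.prems by (simp_all add: v_def word_permutes)
  obtain p0 p1 where p: "v p0 = i" "v p1 = Suc i" "p0 < N" "p1 < N" "p0 \<noteq> p1"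
    by (rule permutes_preimages[OF w i])
  have "card (inversions N (simple_refl i \<circ> v)) \<le> Suc (card (inversions N v))"
  proof (cases "p0 < p1")
    case True
    then show ?thesis using inversions_ascent[OF w p(1,2)] p(4) by simp
  next
    case False
    then show ?thesis using inversions_descent[OF w p(1,2) _ p(3) i] p(5) by simp
  qed
  moreover have "card (inversions N v) \<le> length is"
    unfolding v_def by (rule Cons.IH) (use Cons.prems in simp)
  moreover have "word (i # is) = simple_refl i \<circ> v" by (simp add: v_def)
  ultimately show ?case by (simp only: length_Cons)
qed

text \<open>The inverse \<open>v\<close> is increasing on \<open>{..<N}\<close>; comparing with both
  ends of the interval pins every value.\<close>

lemma no_descent_id:
  assumes w: "w permutes {..<N}"
    and no: "\<And>i p0 p1. Suc i < N \<Longrightarrow> w p0 = i \<Longrightarrow> w p1 = Suc i \<Longrightarrow> p0 < p1"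
  shows "w = id"
proof -
  define v where "v = inv_into UNIV w"
  have wv: "w (v q) = q" "v (w q) = q" for q using permutes_inverses[OF w] by (simp_all add: v_def)
  have vN: "v q < N" if "q < N" for q using permutes_in_image[OF w, of "v q"] that wv by simp
  have step: "v i < v (Suc i)" if "Suc i < N" for i using no[OF that wv(1) wv(1)] .
  have ge: "q \<le> v q" if "q < N" for q using that
  proof (induction q)
    case (Suc q)
    then show ?case using step[of q] by simp
  qed simp
  have le: "v q + k < N" if "q + k < N" for q k using that
  proof (induction k arbitrary: q)
    case 0
    then show ?case using vN by simp
  next
    case (Suc k)
    then have "v (Suc q) + k < N" by simp
    then show ?case using step[of q] Suc.prems by simp
  qed
  have "v q = q" if "q < N" for q
    using ge[OF that] le[of q "N - 1 - q"] that by simp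
  then have "w q = q" if "q < N" for q using wv that by metis
  then show ?thesis using permutes_not_in[OF w] by (auto simp: fun_eq_iff)
qed

text \<open>Each letter changes the number of inversions by one, and a permutation other than the
  identity has a letter that lowers it.\<close>

lemma coxeter_length_inversions:
  assumes w: "w permutes {..<N}" shows "coxeter_length N w = card (inversions N w)"
  unfolding coxeter_length_def
proof (rule Least_equality)
  show "\<exists>is. length is = card (inversions N w) \<and> (\<forall>i\<in>set is. Suc i < N) \<and> w = word is"
    using w
  proof (induction "card (inversions N w)" arbitrary: w rule: less_induct)
    case less
    show ?case
    proof (cases "\<exists>i p0 p1. Suc i < N \<and> w p0 = i \<and> w p1 = Suc i \<and> p1 < p0")
      case True
      then obtain i p0 p1 where i: "Suc i < N" "w p0 = i" "w p1 = Suc i" "p1 < p0" by blast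
      have "p0 < N" using permutes_in_image[OF less.prems, of p0] i by simp
      note d = inversions_descent[OF less.prems i(2-4) this i(1)]
      have sw: "(simple_refl i \<circ> w) permutes {..<N}" by (rule permutes_compose[OF less.prems simple_refl_permutes[OF i(1)]])
      obtain "is" where "is": "length is = card (inversions N (simple_refl i \<circ> w))" "\<forall>i\<in>set is. Suc i < N"
        "simple_refl i \<circ> w = word is"
        using less.hyps[OF _ sw] d by auto
      have "w = simple_refl i \<circ> (simple_refl i \<circ> w)" by (simp add: comp_assoc[symmetric] transpose_comp_involutory)
      then have "w = word (i # is)" using "is"(3) by simp
      moreover have "length (i # is) = card (inversions N w)" using "is"(1) d by simp
      moreover have "\<forall>j\<in>set (i # is). Suc j < N" using "is"(2) i(1) by simp
      ultimately show ?thesis by blast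
    next
      case False
      have "w = id"
      proof (rule no_descent_id[OF less.prems])
        fix i p0 p1 assume h: "Suc i < N" "w p0 = i" "w p1 = Suc i"
        then have "p0 \<noteq> p1" by auto
        moreover have "\<not> p1 < p0" using False h by blast
        ultimately show "p0 < p1" by simp
      qed
      then show ?thesis by (intro exI[of _ "[]"]) (simp add: inversions_id)
    qed
  qed
next
  fix k assume "\<exists>is. length is = k \<and> (\<forall>i\<in>set is. Suc i < N) \<and> w = word is"
  then show "card (inversions N w) \<le> k" using inversions_word by blast
qed

text \<open>For an involution the positions of the values \<open>i\<close> and \<open>Suc i\<close>
  are \<open>b i\<close> and \<open>b (Suc i)\<close>, so the criterion on positions becomes one on
  values.\<close>

lemma involution_descent_iff:
  assumes b: "b \<in> involutions N" and i: "Suc i < N"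
  shows "coxeter_length N (simple_refl i \<circ> b) < coxeter_length N b \<longleftrightarrow> b (Suc i) < b i"
proof -
  note w = involution_permutes[OF b]
  have sw: "(simple_refl i \<circ> b) permutes {..<N}" by (rule permutes_compose[OF w simple_refl_permutes[OF i]])
  have p: "b (b i) = i" "b (b (Suc i)) = Suc i" "b i < N" "b (Suc i) < N"
    using involution_involutive[OF b] involution_less[OF b] i by simp_all
  have ne: "b i \<noteq> b (Suc i)" using p by auto
  show ?thesis unfolding coxeter_length_inversions[OF w] coxeter_length_inversions[OF sw]
    using inversions_ascent[OF w p(1,2) _ p(4)] inversions_descent[OF w p(1,2) _ p(3) i] ne
    by (cases "b i < b (Suc i)") auto
qed

section \<open>The upward step of the weak order on involutions, along which the length
  decreases\<close>

definition ascend :: "nat \<Rightarrow> (nat \<Rightarrow> nat) \<Rightarrow> nat \<Rightarrow> nat" where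
  "ascend i b = (if conj_refl i b = b then simple_refl i \<circ> b else conj_refl i b)"

text \<open>For an involution: length plus number of two-cycles. It turns out to be twice the
  codimension of the orbit of \<open>b\<close> in the flag variety, see
  \<open>orbit_dim_orb\<close>.\<close>

definition rank_defect :: "nat \<Rightarrow> (nat \<Rightarrow> nat) \<Rightarrow> nat" where
  "rank_defect N b = card (inversions N b) + card {p. p < N \<and> p < b p}"

lemma simple_refl_outside: "Suc i < N \<Longrightarrow> \<not> p < N \<Longrightarrow> simple_refl i p = p"
  by (auto simp: transpose_def)

lemma simple_refl_less: "Suc i < N \<Longrightarrow> p < N \<Longrightarrow> simple_refl i p < N"
  by (auto simp: transpose_def)

lemma conj_refl_involution:
  assumes "b \<in> involutions N" "Suc i < N" shows "conj_refl i b \<in> involutions N"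
  by (rule involutionI)
    (use assms involution_less[OF assms(1)] involution_involutive[OF assms(1)] involution_outside[OF assms(1)]
       simple_refl_less[OF assms(2)] simple_refl_outside[OF assms(2)] in auto)

lemma refl_comp_involution:
  assumes b: "b \<in> involutions N" "Suc i < N" and c: "conj_refl i b = b"
  shows "simple_refl i \<circ> b \<in> involutions N"
proof (rule involutionI)
  show "(simple_refl i \<circ> b) p < N" if "p < N" for p
    using involution_less[OF b(1) that] simple_refl_less[OF b(2)] by simp
  show "(simple_refl i \<circ> b) p = p" if "\<not> p < N" for p
    using involution_outside[OF b(1) that] simple_refl_outside[OF b(2) that] by simp
  show "(simple_refl i \<circ> b) ((simple_refl i \<circ> b) p) = p" for p
    using fun_cong[OF c, of "b p"] involution_involutive[OF b(1), of p] by simp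
qed

lemma ascend_involution:
  "b \<in> involutions N \<Longrightarrow> Suc i < N \<Longrightarrow> ascend i b \<in> involutions N"
  by (simp add: ascend_def conj_refl_involution refl_comp_involution)

text \<open>If \<open>b\<close> commutes with the reflection, one inversion and one two-cycle
  disappear; otherwise the length drops by two and the two-cycles are only renamed.\<close>

lemma ascend_rank_defect:
  assumes b: "b \<in> involutions N" and i: "Suc i < N" and d: "b (Suc i) < b i"
  shows "rank_defect N b = rank_defect N (ascend i b) + 2"
proof -
  note w = involution_permutes[OF b]
  have p: "b (b i) = i" "b (b (Suc i)) = Suc i" "b i < N" "b (Suc i) < N"
    using involution_involutive[OF b] involution_less[OF b] i by simp_all
  have s1: "Suc (card (inversions N (simple_refl i \<circ> b))) = card (inversions N b)"
    by (rule inversions_descent[OF w p(1,2) d p(3) i])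
  show ?thesis
  proof (cases "conj_refl i b = b")
    case True
    note bi = commuting_descent[OF d True]
    have o: "b p \<noteq> i" "b p \<noteq> Suc i" if "p \<noteq> i" "p \<noteq> Suc i" for p
      using that bi involution_involutive[OF b, of p] by auto
    have "{p. p < N \<and> p < b p} = insert i {p. p < N \<and> p < (simple_refl i \<circ> b) p}"
    proof (rule Set.set_eqI)
      fix p
      show "p \<in> {p. p < N \<and> p < b p} \<longleftrightarrow> p \<in> insert i {p. p < N \<and> p < (simple_refl i \<circ> b) p}"
        using bi i o[of p] by (cases "p = i"; cases "p = Suc i") (auto simp: transpose_def)
    qed
    moreover have "i \<notin> {p. p < N \<and> p < (simple_refl i \<circ> b) p}" using bi by simp
    ultimately show ?thesis using s1 True by (simp add: rank_defect_def ascend_def)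
  next
    case False
    have nc: "\<not> (b i = Suc i \<and> b (Suc i) = i)" using False commuting_iff[OF b d] by blast
    let ?v = "b \<circ> simple_refl i" and ?c = "conj_refl i b"
    have v: "?v permutes {..<N}" by (rule permutes_compose[OF simple_refl_permutes[OF i] w])
    \<comment> \<open>The products of \<open>b\<close> with the reflection on either side are
      inverse to each other and so have equally many inversions; the second one is then shortened
      from the left.\<close>
    have "bij_betw (\<lambda>(p, q). (simple_refl i (b q), simple_refl i (b p))) (inversions N (simple_refl i \<circ> b)) (inversions N ?v)"
    proof (rule bij_betw_byWitness[where f' = "\<lambda>(p, q). (b (simple_refl i q), b (simple_refl i p))"])
      have bb: "b (b p) = p" for p by (rule involution_involutive[OF b])
      have lt: "b p < N" if "p < N" for p by (rule involution_less[OF b that])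
      show "\<forall>a\<in>inversions N (simple_refl i \<circ> b). (\<lambda>(p, q). (b (simple_refl i q), b (simple_refl i p)))
          ((\<lambda>(p, q). (simple_refl i (b q), simple_refl i (b p))) a) = a" by (auto simp: bb)
      show "\<forall>a\<in>inversions N ?v. (\<lambda>(p, q). (simple_refl i (b q), simple_refl i (b p)))
          ((\<lambda>(p, q). (b (simple_refl i q), b (simple_refl i p))) a) = a" by (auto simp: bb)
      show "(\<lambda>(p, q). (simple_refl i (b q), simple_refl i (b p))) ` inversions N (simple_refl i \<circ> b) \<subseteq> inversions N ?v"
        using lt simple_refl_less[OF i] by (auto simp: inversions_def bb)
      show "(\<lambda>(p, q). (b (simple_refl i q), b (simple_refl i p))) ` inversions N ?v \<subseteq> inversions N (simple_refl i \<circ> b)"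
        using lt simple_refl_less[OF i] by (auto simp: inversions_def bb)
    qed
    then have s2: "card (inversions N (simple_refl i \<circ> b)) = card (inversions N ?v)" by (rule bij_betw_same_card)
    have less: "simple_refl i (b (Suc i)) < simple_refl i (b i)"
      using d nc by (subst simple_refl_less_iff) auto
    have "Suc (card (inversions N (simple_refl i \<circ> ?v))) = card (inversions N ?v)"
    proof (rule inversions_descent[OF v _ _ less _ i])
      show "?v (simple_refl i (b i)) = i" "?v (simple_refl i (b (Suc i))) = Suc i" using p by simp_all
      show "simple_refl i (b i) < N" using p simple_refl_less[OF i] by simp
    qed
    then have s3: "Suc (card (inversions N ?c)) = card (inversions N ?v)" by (simp add: comp_assoc)
    have "bij_betw (simple_refl i) {p. p < N \<and> p < b p} {p. p < N \<and> p < ?c p}"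
    proof (rule bij_betw_byWitness[where f' = "simple_refl i"])
      have e: "simple_refl i p < simple_refl i (b p) \<longleftrightarrow> p < b p" for p
      proof (cases "p = b p")
        case ne: False
        show ?thesis using nc involution_involutive[OF b, of p] ne
          by (intro simple_refl_less_iff) auto
      qed simp
      show "simple_refl i ` {p. p < N \<and> p < b p} \<subseteq> {p. p < N \<and> p < ?c p}"
        using simple_refl_less[OF i] e by auto
      show "simple_refl i ` {p. p < N \<and> p < ?c p} \<subseteq> {p. p < N \<and> p < b p}"
      proof clarify
        fix p assume h: "p < N" "p < ?c p"
        have "simple_refl i (simple_refl i p) < simple_refl i (b (simple_refl i p))" using h(2) by simp
        then show "simple_refl i p < N \<and> simple_refl i p < b (simple_refl i p)"
          using e[of "simple_refl i p"] simple_refl_less[OF i h(1)] by blast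
      qed
    qed auto
    then have "card {p. p < N \<and> p < b p} = card {p. p < N \<and> p < ?c p}" by (rule bij_betw_same_card)
    then show ?thesis using s1 s2 s3 False by (simp add: rank_defect_def ascend_def)
  qed
qed

text \<open>Composition and conjugation with the reflection are their own inverses, and each
  preserves the distinction between the commuting and the other case; so the lower neighbour is
  given by the same formula.\<close>

lemma ascend_of_ascent:
  assumes b: "b \<in> involutions N" and i: "Suc i < N" and asc: "\<not> b (Suc i) < b i"
  obtains c where "c \<in> involutions N" "c (Suc i) < c i" "ascend i c = b"
proof (cases "conj_refl i b = b")
  case True
  let ?c = "simple_refl i \<circ> b"
  have c: "?c \<in> involutions N" by (rule refl_comp_involution[OF b i True])
  have ne: "b i \<noteq> b (Suc i)" using involution_involutive[OF b, of i] involution_involutive[OF b, of "Suc i"] by auto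
  have "simple_refl i (b (Suc i)) = b i" using fun_cong[OF True, of i] by simp
  then have bi: "b i = i" "b (Suc i) = Suc i" using asc ne by (auto simp: transpose_def split: if_splits)
  have cc: "conj_refl i ?c = ?c" using True by (metis comp_assoc)
  have "ascend i ?c = b" unfolding ascend_def if_P[OF cc] by (simp add: comp_assoc[symmetric] transpose_comp_involutory)
  then show ?thesis using that[OF c] bi by simp
next
  case False
  let ?c = "conj_refl i b"
  have c: "?c \<in> involutions N" by (rule conj_refl_involution[OF b i])
  have ne: "b i \<noteq> b (Suc i)" using involution_involutive[OF b, of i] involution_involutive[OF b, of "Suc i"] by auto
  have cc: "conj_refl i ?c = b" by (simp add: fun_eq_iff)
  have nf: "\<not> (b i = i \<and> b (Suc i) = Suc i)"
  proof
    assume f: "b i = i \<and> b (Suc i) = Suc i"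
    have "conj_refl i b = b"
    proof
      fix p
      show "conj_refl i b p = b p"
      proof (cases "p = i \<or> p = Suc i")
        case True
        then show ?thesis using f by auto
      next
        case False
        then have "b p \<noteq> i" "b p \<noteq> Suc i" using f involution_involutive[OF b, of p] by auto
        then show ?thesis using False by (simp add: transpose_def)
      qed
    qed
    then show False using False by blast
  qed
  have nf': "\<not> (b i = Suc i \<and> b (Suc i) = i)" using asc by auto
  have "simple_refl i (b i) < simple_refl i (b (Suc i))"
    using asc ne nf nf' by (subst simple_refl_less_iff) auto
  moreover have "ascend i ?c = b" unfolding ascend_def using cc False by auto
  ultimately show ?thesis using that[OF c] by simp
qed

text \<open>The block with rows from \<open>Suc i\<close> and columns from \<open>b i\<close> gains
  the entry in row \<open>Suc i\<close> and keeps the others. Its rank separates the upper orbit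
  from the closure of the lower one.\<close>

lemma corank_fun_ascend:
  assumes b: "b \<in> involutions N" and i: "Suc i < N" and d: "b (Suc i) < b i"
  shows "corank_fun N b (Suc i) (b i) < corank_fun N (ascend i b) (Suc i) (b i)"
proof -
  let ?k = "b i" and ?c = "ascend i b"
  have bb: "b (b p) = p" for p by (rule involution_involutive[OF b])
  have cS: "?k \<le> ?c (Suc i)"
  proof (cases "conj_refl i b = b")
    case True
    then show ?thesis using commuting_descent[OF d True] by (simp add: ascend_def)
  next
    case False
    then have "b i \<noteq> Suc i" using commuting_iff[OF b d] by blast
    then show ?thesis using False by (auto simp: ascend_def transpose_def)
  qed
  have rest: "?k \<le> ?c p \<longleftrightarrow> ?k \<le> b p" if p: "Suc (Suc i) \<le> p" for p
  proof (cases "conj_refl i b = b")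
    case True
    note bi = commuting_descent[OF d True]
    have "b p \<noteq> i" "b p \<noteq> Suc i" using p bb[of p] bi by auto
    then show ?thesis using True by (simp add: ascend_def transpose_def)
  next
    case False
    then have nk: "b i \<noteq> Suc i" using commuting_iff[OF b d] by blast
    have "simple_refl i p = p" using p by (simp add: transpose_def)
    then have "?c p = simple_refl i (b p)" using False by (simp add: ascend_def)
    then show ?thesis using nk by (auto simp: transpose_def)
  qed
  have "{p. Suc i \<le> p \<and> p < N \<and> ?k \<le> b p} \<subset> {p. Suc i \<le> p \<and> p < N \<and> ?k \<le> ?c p}"
  proof
    show "{p. Suc i \<le> p \<and> p < N \<and> ?k \<le> b p} \<subseteq> {p. Suc i \<le> p \<and> p < N \<and> ?k \<le> ?c p}"
    proof clarify
      fix p assume h: "Suc i \<le> p" "p < N" "?k \<le> b p"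
      then have "p \<noteq> Suc i" using d by auto
      then show "?k \<le> ?c p" using rest[of p] h by simp
    qed
    have "Suc i \<in> {p. Suc i \<le> p \<and> p < N \<and> ?k \<le> ?c p}" "Suc i \<notin> {p. Suc i \<le> p \<and> p < N \<and> ?k \<le> b p}"
      using cS i d by auto
    then show "{p. Suc i \<le> p \<and> p < N \<and> ?k \<le> b p} \<noteq> {p. Suc i \<le> p \<and> p < N \<and> ?k \<le> ?c p}" by metis
  qed
  then show ?thesis unfolding corank_fun_def by (intro psubset_card_mono) auto
qed

lemma rank_defect_longest:
  "rank_defect (2 * n + 1) (longest (2 * n + 1)) = 2 * n * (n + 1)"
proof -
  let ?N = "2 * n + 1"
  have "inversions ?N (longest ?N) = (\<lambda>(q, p). (p, q)) ` Sigma {..<?N} (\<lambda>q. {..<q})"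
    by (auto simp: inversions_def longest_def image_iff)
  moreover have "inj_on (\<lambda>(q, p). (p, q)) (Sigma {..<?N} (\<lambda>q. {..<q}))" by (auto simp: inj_on_def)
  ultimately have "card (inversions ?N (longest ?N)) = card (Sigma {..<?N} (\<lambda>q. {..<q}))"
    by (simp add: card_image)
  also have "\<dots> = (\<Sum>q<?N. q)" by simp
  also have "\<dots> = n * (2 * n + 1)" by (induction n) (auto simp: algebra_simps)
  finally have 1: "card (inversions ?N (longest ?N)) = n * (2 * n + 1)" .
  have "{p. p < ?N \<and> p < longest ?N p} = {..<n}" by (auto simp: longest_def)
  then show ?thesis unfolding rank_defect_def 1 by (simp add: algebra_simps)
qed

lemma rank_defect_id: "rank_defect N id = 0"
proof -
  have "{p. p < N \<and> p < id p} = {}" by auto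
  then show ?thesis by (simp add: rank_defect_def inversions_id)
qed

lemma descent_exists:
  assumes b: "b \<in> involutions N" "b \<noteq> id" shows "\<exists>i. Suc i < N \<and> b (Suc i) < b i"
proof (rule ccontr)
  assume no: "\<not> ?thesis"
  have "b = id"
  proof (rule no_descent_id[OF involution_permutes[OF b(1)]])
    fix i p0 p1 assume h: "Suc i < N" "b p0 = i" "b p1 = Suc i"
    then have "p0 = b i" "p1 = b (Suc i)" using involution_involutive[OF b(1)] by metis+
    moreover have "b i \<noteq> b (Suc i)" using calculation h by auto
    ultimately show "p0 < p1" using no h(1) by (meson linorder_neqE_nat)
  qed
  then show False using b(2) by simp
qed

lemma ascent_exists:
  assumes b: "b \<in> involutions N" "b \<noteq> longest N" shows "\<exists>i. Suc i < N \<and> b i < b (Suc i)"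
proof (rule ccontr)
  assume no: "\<not> ?thesis"
  let ?w = "longest N \<circ> b"
  have w: "?w permutes {..<N}" by (rule permutes_compose[OF involution_permutes[OF b(1)] involution_permutes[OF longest_involution]])
  have lt: "b p < N" if "p < N" for p by (rule involution_less[OF b(1) that])
  have step: "b (Suc i) < b i" if "Suc i < N" for i
  proof -
    have "b i \<noteq> b (Suc i)" using involution_involutive[OF b(1), of i] involution_involutive[OF b(1), of "Suc i"] by auto
    then show ?thesis using no that by (meson linorder_neqE_nat)
  qed
  have dec: "b (p + k) + k \<le> b p" if "p + k < N" for p k using that
  proof (induction k)
    case (Suc k)
    then show ?case using step[of "p + k"] by simp
  qed simp
  have "b p = longest N p" if p: "p < N" for p
  proof -
    have "b p + p \<le> b 0" using dec[of 0 p] p by simp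
    moreover have "b 0 < N" using lt p by simp
    moreover have "N - 1 - p \<le> b p" using dec[of p "N - 1 - p"] p by simp
    ultimately show ?thesis using p by (simp add: longest_def)
  qed
  then have "b = longest N" using involution_outside[OF b(1)] by (auto simp: fun_eq_iff longest_def)
  then show False using b(2) by simp
qed

text \<open>A permutation sends at most \<open>l\<close> indices below \<open>l\<close>, so at least
  \<open>N - k - l\<close> of the indices from \<open>k\<close> on go to values from
  \<open>l\<close> on; \<open>longest N\<close> attains this bound.\<close>

lemma longest_corank_minimal:
  assumes c: "c \<in> involutions N" shows "corank_fun N (longest N) k l \<le> corank_fun N c k l"
proof -
  have A: "corank_fun N (longest N) k l = N - k - l"
  proof -
    have "{p. k \<le> p \<and> p < N \<and> l \<le> longest N p} = {k..<N - l}" by (auto simp: longest_def)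
    then show ?thesis by (simp add: corank_fun_def)
  qed
  let ?R = "{p. k \<le> p \<and> p < N \<and> l \<le> c p}" and ?S = "{p. p < N \<and> c p < l}"
  have "c ` ?S \<subseteq> {..<l}" by auto
  moreover have inj: "inj_on c ?S" using permutes_inj[OF involution_permutes[OF c]] by (rule inj_on_subset) simp
  ultimately have "card ?S \<le> l" using card_inj_on_le[OF inj, of "{..<l}"] by simp
  moreover have "{k..<N} \<subseteq> ?R \<union> ?S" by auto
  then have "card {k..<N} \<le> card (?R \<union> ?S)" by (intro card_mono) auto
  then have "N - k \<le> card ?R + card ?S" using card_Un_le[of ?R ?S] by simp
  ultimately show ?thesis unfolding A by (simp add: corank_fun_def)
qed

section \<open>Closures and minimal parabolic saturations\<close>

lemma parabolic_subset_SL: "min_parabolic N i \<subseteq> carrier (SL N)"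
  using parabolic_SL by blast

lemma borel_subset_SL: "borel_subgroup N \<subseteq> carrier (SL N)"
  using borel_SL by blast

lemma SL_subset_mat: "A \<subseteq> carrier (SL N) \<Longrightarrow> A \<subseteq> carrier_mat N N"
  using SL_carrier_mat by blast

lemma zirr_singleton: "zirr N {h}"
  by (auto simp: zirr_def)

text \<open>The setting of one edge: the orbits of \<open>b\<close> and of
  \<open>ascend i b\<close>, the lower and the upper one, together form a set stable under the
  minimal parabolic subgroup of type \<open>i\<close>.\<close>

locale descent =
  fixes N i b
  assumes odd: "odd N" and b: "b \<in> involutions N" and i: "Suc i < N" and d: "b (Suc i) < b i"
begin

abbreviation "b' \<equiv> ascend i b"
abbreviation "P \<equiv> min_parabolic N i"

lemma b': "b' \<in> involutions N"
  by (rule ascend_involution[OF b i])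

lemma Npos: "0 < N" using i by simp

lemma lineR_SL: "lineR N i \<tau> \<in> carrier (SL N)"
  by (rule parabolic_SL[OF lineR_parabolic[OF i]])

lemma pattern_line:
  assumes h: "h \<in> carrier (SL N)" "has_pattern N b (gram N h)"
  shows "h * lineR N i \<tau> \<in> adapted N b \<union> adapted N b'" "\<tau> \<noteq> 0 \<Longrightarrow> h * lineR N i \<tau> \<in> adapted N b'"
proof -
  show "\<tau> \<noteq> 0 \<Longrightarrow> h * lineR N i \<tau> \<in> adapted N b'"
    using gram_fibre(1)[OF h b i d, of \<tau>] gram_fibre(3)[OF h b i d, of \<tau>] by (auto simp: ascend_def)
  then show "h * lineR N i \<tau> \<in> adapted N b \<union> adapted N b'"
    using gram_fibre(1)[OF h b i d, of \<tau>] gram_fibre(2)[OF h b i d] by (cases "\<tau> = 0") (auto simp: ascend_def)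
qed

lemma adapted_pattern_rep:
  assumes "h \<in> adapted N c"
  obtains \<beta> where "\<beta> \<in> borel_subgroup N" "h * \<beta> \<in> carrier (SL N)" "has_pattern N c (gram N (h * \<beta>))"
    "h = h * \<beta> * SL_inv N \<beta>"
proof -
  obtain \<beta> where \<beta>: "\<beta> \<in> borel_subgroup N" "has_pattern N c (gram N (h * \<beta>))" "h \<in> carrier (SL N)"
    using assms by (auto simp: adapted_def)
  then show ?thesis using that[of \<beta>] SL_mult_closed[OF \<beta>(3) borel_SL[OF \<beta>(1)]]
      SL_inv_mult_cancel(3)[OF borel_SL[OF \<beta>(1)] \<beta>(3)] by simp
qed

lemma lower_saturate:
  assumes h: "h \<in> adapted N b" and p: "p \<in> P"
  shows "h * p \<in> adapted N b \<union> adapted N b'"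
proof -
  obtain \<beta> where \<beta>: "\<beta> \<in> borel_subgroup N" "h * \<beta> \<in> carrier (SL N)" "has_pattern N b (gram N (h * \<beta>))"
    "h = h * \<beta> * SL_inv N \<beta>" by (rule adapted_pattern_rep[OF h])
  have hc: "h \<in> carrier (SL N)" using h adapted_SL by blast
  let ?p = "SL_inv N \<beta> * p"
  have p': "?p \<in> P" using borel_inv[OF \<beta>(1)] borel_parabolic parabolic_mult p by blast
  have hp: "h * p = h * \<beta> * ?p"
    using SL_assoc[OF \<beta>(2) SL_inv_closed[OF borel_SL[OF \<beta>(1)]] parabolic_SL[OF p]] \<beta>(4) by simp
  from p' i show ?thesis
  proof (cases rule: parabolic_cases_right)
    case 1
    have "h * \<beta> \<in> adapted N b" by (rule pattern_adapted[OF \<beta>(2,3)])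
    then show ?thesis unfolding hp using 1 adapted_rstable[of N b] unfolding rstable_def by blast
  next
    case (2 \<gamma> t)
    have "h * p = h * \<beta> * lineR N i t * \<gamma>"
      unfolding hp 2(2) by (rule SL_assoc[OF \<beta>(2) lineR_SL borel_SL[OF 2(1)], symmetric])
    moreover have "h * \<beta> * lineR N i t \<in> adapted N b \<union> adapted N b'" by (rule pattern_line(1)[OF \<beta>(2,3)])
    ultimately show ?thesis using 2(1) adapted_rstable[of N b] adapted_rstable[of N b'] unfolding rstable_def by auto
  qed
qed

lemma lower_to_upper:
  assumes h: "h \<in> adapted N b" shows "\<exists>p\<in>P. h * p \<in> adapted N b'"
proof -
  obtain \<beta> where \<beta>: "\<beta> \<in> borel_subgroup N" "h * \<beta> \<in> carrier (SL N)" "has_pattern N b (gram N (h * \<beta>))"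
    by (rule adapted_pattern_rep[OF h])
  have hc: "h \<in> carrier (SL N)" using h adapted_SL by blast
  have "h * (\<beta> * lineR N i 1) = h * \<beta> * lineR N i 1"
    by (rule SL_assoc[OF hc borel_SL[OF \<beta>(1)] lineR_SL, symmetric])
  then have "h * (\<beta> * lineR N i 1) \<in> adapted N b'" using pattern_line(2)[OF \<beta>(2,3), of 1] by simp
  moreover have "\<beta> * lineR N i 1 \<in> P" using \<beta>(1) borel_parabolic lineR_parabolic[OF i] parabolic_mult by blast
  ultimately show ?thesis by blast
qed

text \<open>One point of the lower orbit has a neighbour in the upper one. Since the upper stratum
  is a single double coset, \<open>K\<close> and \<open>B\<close> carry this pair to any other point
  of it.\<close>

lemma upper_to_lower:
  assumes h: "h \<in> adapted N b'" shows "\<exists>p\<in>P. h * p \<in> adapted N b"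
proof -
  obtain g where g: "g \<in> carrier (SL N)" "has_pattern N b (gram N g)" using adapted_exists[OF Npos b] by blast
  obtain p where p: "p \<in> P" "g * p \<in> adapted N b'" using lower_to_upper[OF pattern_adapted[OF g]] by blast
  obtain k \<beta> where k: "k \<in> fixed_group N" "\<beta> \<in> borel_subgroup N" "h = k * (g * p) * \<beta>"
    using adapted_double_coset[OF odd b' p(2) h] by blast
  note c = fixed_SL[OF k(1)] g(1) parabolic_SL[OF p(1)] borel_SL[OF k(2)]
  have pb: "p * \<beta> \<in> P" using p(1) k(2) borel_parabolic parabolic_mult by blast
  have "h = k * g * (p * \<beta>)" unfolding k(3) using c by (simp add: SL_assoc[of _ N] SL_mult_closed)
  then have "h * SL_inv N (p * \<beta>) = k * g"
    using SL_inv_mult_cancel(3)[OF parabolic_SL[OF pb] SL_mult_closed[OF c(1,2)]] by simp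
  moreover have "k * g \<in> adapted N b" by (rule adapted_lstable[OF pattern_adapted[OF g] k(1)])
  ultimately show ?thesis using parabolic_inv[OF pb i] by metis
qed

lemma saturated: "rstable P (adapted N b \<union> adapted N b')"
  unfolding rstable_def
proof (intro ballI)
  fix h p assume h: "h \<in> adapted N b \<union> adapted N b'" and p: "p \<in> P"
  show "h * p \<in> adapted N b \<union> adapted N b'"
  proof (cases "h \<in> adapted N b")
    case True
    then show ?thesis by (rule lower_saturate[OF _ p])
  next
    case False
    then have h': "h \<in> adapted N b'" using h by blast
    then have hc: "h \<in> carrier (SL N)" using adapted_SL by blast
    obtain q where q: "q \<in> P" "h * q \<in> adapted N b" using upper_to_lower[OF h'] by blast
    have r: "SL_inv N q * p \<in> P" by (rule parabolic_mult[OF parabolic_inv[OF q(1) i] p])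
    have "h * q * (SL_inv N q * p) = h * (q * (SL_inv N q * p))"
      by (rule SL_assoc[OF hc parabolic_SL[OF q(1)] parabolic_SL[OF r]])
    also have "\<dots> = h * p" using SL_inv_mult_cancel(2)[OF parabolic_SL[OF q(1)] parabolic_SL[OF p]] by simp
    finally show ?thesis using lower_saturate[OF q(2) r] by simp
  qed
qed

lemma upper_not_in_closure: "h \<in> adapted N b' \<Longrightarrow> h \<notin> zcl N (adapted N b)"
  using adapted_closure_corank[OF b b'] corank_fun_ascend[OF b i d] not_le by blast

lemma union_minus_closure:
  assumes "V \<subseteq> adapted N b \<union> adapted N b'" shows "V - zcl N (adapted N b) = V \<inter> adapted N b'"
  using assms upper_not_in_closure subset_zcl[OF adapted_SL, of N b] by blast

lemma parabolic_one_mult: "Z \<subseteq> carrier (SL N) \<Longrightarrow> Z \<subseteq> set_mul Z P"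
  using set_mulI[OF _ parabolic_one[of N i]] SL_right_one by (metis subsetD subsetI)

lemma set_mul_saturated: "Z \<subseteq> adapted N b \<union> adapted N b' \<Longrightarrow> set_mul Z P \<subseteq> adapted N b \<union> adapted N b'"
  using saturated unfolding set_mul_def rstable_def by blast

text \<open>The product with \<open>P\<close> is irreducible, and its part outside the closure of
  the lower orbit is exactly its part in the upper orbit; this part is nonempty, hence irreducible
  and dense.\<close>

lemma sweep:
  assumes Z: "Z \<subseteq> adapted N b" "zirr N Z"
  defines "V \<equiv> set_mul Z P"
  shows "zirr N V" "V \<subseteq> adapted N b \<union> adapted N b'" "V \<inter> adapted N b' \<noteq> {}"
    "zirr N (V \<inter> adapted N b')" "zdense N (V \<inter> adapted N b') V" "Z \<subseteq> V"
proof -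
  have Zc: "Z \<subseteq> carrier (SL N)" using Z adapted_SL by blast
  show irr: "zirr N V" unfolding V_def
    by (rule zirr_set_mul[OF Z(2) zirr_parabolic SL_subset_mat[OF Zc] SL_subset_mat[OF parabolic_subset_SL]])
  show sub: "V \<subseteq> adapted N b \<union> adapted N b'" unfolding V_def by (rule set_mul_saturated) (use Z in blast)
  obtain z where "z \<in> Z" using Z(2) by (auto simp: zirr_def)
  then obtain p where "p \<in> P" "z * p \<in> adapted N b'" using lower_to_upper Z(1) by blast
  then show ne: "V \<inter> adapted N b' \<noteq> {}" using set_mulI[OF \<open>z \<in> Z\<close>] unfolding V_def by blast
  have Vc: "V \<subseteq> carrier (SL N)" using sub adapted_SL by blast
  have "\<not> V \<subseteq> zcl N (adapted N b)" using ne upper_not_in_closure by blast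
  from zirr_open[OF irr Vc this] show "zirr N (V \<inter> adapted N b')" "zdense N (V \<inter> adapted N b') V"
    unfolding union_minus_closure[OF sub] .
  show "Z \<subseteq> V" unfolding V_def by (rule parabolic_one_mult[OF Zc])
qed

text \<open>Sweeping a single point \<open>h\<close> of the lower orbit along \<open>P\<close> gives
  an irreducible set containing \<open>h\<close> in which the part in the upper orbit is
  dense.\<close>

lemma lower_in_closure: "adapted N b \<subseteq> zcl N (adapted N b')"
proof
  fix h assume h: "h \<in> adapted N b"
  have "{h} \<subseteq> adapted N b" using h by blast
  note s = sweep[OF this zirr_singleton]
  have "zdense N (set_mul {h} P \<inter> adapted N b') {h}" using s(5) zdense_mono[OF s(6)] zdense_trans by blast
  then have "{h} \<subseteq> zcl N (set_mul {h} P \<inter> adapted N b')"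
    using zdense_iff_subset_zcl[of "{h}"] h adapted_SL by blast
  then show "h \<in> zcl N (adapted N b')" using zcl_mono[of "set_mul {h} P \<inter> adapted N b'" "adapted N b'" N] by blast
qed

section \<open>Saturation along the projection and the dense orbit in it\<close>

lemma proj_coset:
  assumes "g \<in> carrier (SL N)"
  shows "proj N i (g <#\<^bsub>SL N\<^esub> borel_subgroup N) = g <#\<^bsub>SL N\<^esub> P"
proof
  show "proj N i (g <#\<^bsub>SL N\<^esub> borel_subgroup N) \<subseteq> g <#\<^bsub>SL N\<^esub> P"
  proof
    fix x assume "x \<in> proj N i (g <#\<^bsub>SL N\<^esub> borel_subgroup N)"
    then obtain \<beta> p where x: "\<beta> \<in> borel_subgroup N" "p \<in> P" "x = g * \<beta> * p"
      by (auto simp: proj_def set_mult_def lcos_eq)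
    have "x = g * (\<beta> * p)" unfolding x(3) by (rule SL_assoc[OF assms borel_SL[OF x(1)] parabolic_SL[OF x(2)]])
    moreover have "\<beta> * p \<in> P" using x borel_parabolic parabolic_mult by blast
    ultimately show "x \<in> g <#\<^bsub>SL N\<^esub> P" unfolding lcos_eq by blast
  qed
  show "g <#\<^bsub>SL N\<^esub> P \<subseteq> proj N i (g <#\<^bsub>SL N\<^esub> borel_subgroup N)"
  proof
    fix x assume "x \<in> g <#\<^bsub>SL N\<^esub> P"
    then obtain p where p: "p \<in> P" "x = g * p" unfolding lcos_eq by blast
    have "g \<in> g <#\<^bsub>SL N\<^esub> borel_subgroup N"
      unfolding lcos_eq using borel_one SL_right_one[OF assms] by (metis image_eqI)
    then show "x \<in> proj N i (g <#\<^bsub>SL N\<^esub> borel_subgroup N)"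
      using p by (auto simp: proj_def set_mult_def)
  qed
qed

lemma saturation_orb:
  assumes c: "c = b \<or> c = b'"
  shows "saturation N i (orb N c) = coset_img N (borel_subgroup N) (adapted N b \<union> adapted N b')"
proof
  note P = parabolic_subgroup_SL[OF i]
  show "saturation N i (orb N c) \<subseteq> coset_img N (borel_subgroup N) (adapted N b \<union> adapted N b')"
  proof
    fix x assume x: "x \<in> saturation N i (orb N c)"
    then obtain g where g: "g \<in> carrier (SL N)" "x = g <#\<^bsub>SL N\<^esub> borel_subgroup N"
      by (auto simp: saturation_def LCOSETS_def)
    obtain h where h: "h \<in> adapted N c" "proj N i x = proj N i (h <#\<^bsub>SL N\<^esub> borel_subgroup N)"
      using x by (auto simp: saturation_def orb_def coset_img_def)
    have hc: "h \<in> carrier (SL N)" using h adapted_SL by blast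
    have "h <#\<^bsub>SL N\<^esub> P = g <#\<^bsub>SL N\<^esub> P" using h(2) unfolding g(2) proj_coset[OF g(1)] proj_coset[OF hc] by simp
    then obtain p where "p \<in> P" "g = h * p" using lcos_eq_iff[OF P hc g(1)] by blast
    then have "g \<in> adapted N b \<union> adapted N b'" using saturated h(1) c unfolding rstable_def by blast
    then show "x \<in> coset_img N (borel_subgroup N) (adapted N b \<union> adapted N b')" using g(2) by (auto simp: coset_img_def)
  qed
  show "coset_img N (borel_subgroup N) (adapted N b \<union> adapted N b') \<subseteq> saturation N i (orb N c)"
  proof
    fix x assume "x \<in> coset_img N (borel_subgroup N) (adapted N b \<union> adapted N b')"
    then obtain g where g: "g \<in> adapted N b \<union> adapted N b'" "x = g <#\<^bsub>SL N\<^esub> borel_subgroup N"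
      by (auto simp: coset_img_def)
    have gc: "g \<in> carrier (SL N)" using g adapted_SL by blast
    have "\<exists>p\<in>P. g * p \<in> adapted N c"
    proof -
      have "\<exists>p\<in>P. g * p \<in> adapted N e" if "g \<in> adapted N e" for e
        using parabolic_one[of N i] SL_right_one[OF gc] that by (intro bexI[of _ "1\<^sub>m N"]) auto
      then show ?thesis using g(1) c lower_to_upper upper_to_lower by blast
    qed
    then obtain p where p: "p \<in> P" "g * p \<in> adapted N c" by blast
    have gpc: "g * p \<in> carrier (SL N)" using p(2) adapted_SL by blast
    have "g <#\<^bsub>SL N\<^esub> P = (g * p) <#\<^bsub>SL N\<^esub> P" using lcos_eq_iff[OF P gc gpc] p(1) by blast
    then have "proj N i x = proj N i ((g * p) <#\<^bsub>SL N\<^esub> borel_subgroup N)"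
      unfolding g(2) proj_coset[OF gc] proj_coset[OF gpc] .
    moreover have "(g * p) <#\<^bsub>SL N\<^esub> borel_subgroup N \<in> orb N c" using p(2) by (auto simp: orb_def coset_img_def)
    moreover have "x \<in> flag_variety N" using g gc by (auto simp: LCOSETS_def)
    ultimately show "x \<in> saturation N i (orb N c)" unfolding saturation_def by blast
  qed
qed

text \<open>The saturated set consists of only two orbits; the upper one is dense in it, and the
  closure of the lower one misses the upper.\<close>

lemma simple_act_orb:
  assumes c: "c = b \<or> c = b'" shows "simple_act N i (orb N c) = orb N b'"
  unfolding simple_act_def saturation_orb[OF c]
proof (rule the_equality)
  let ?S = "adapted N b \<union> adapted N b'"
  have Sc: "?S \<subseteq> carrier (SL N)" using adapted_SL by blast
  have cl: "flag_top N closure_of orb N e = coset_img N (borel_subgroup N) (zcl N (adapted N e))" for e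
    unfolding orb_def by (rule closure_of_coset_img[OF borel_subgroup_SL adapted_SL adapted_rstable])
  have rz: "rstable (borel_subgroup N) (zcl N (adapted N e))" for e
    by (rule rstable_zcl[OF borel_subset_SL adapted_SL adapted_rstable])
  have iff: "coset_img N (borel_subgroup N) ?S \<subseteq> flag_top N closure_of orb N e \<longleftrightarrow> ?S \<subseteq> zcl N (adapted N e)" for e
    unfolding cl by (rule coset_img_mono_iff[OF borel_subgroup_SL Sc zcl_subset_carrier rz])
  have "?S \<subseteq> zcl N (adapted N b')" using lower_in_closure subset_zcl[OF adapted_SL] by blast
  then show "orb N b' \<in> K_orbits N \<and> orb N b' \<subseteq> coset_img N (borel_subgroup N) ?S \<and>
      coset_img N (borel_subgroup N) ?S \<subseteq> flag_top N closure_of orb N b'"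
    using iff K_orbits_eq[OF odd] b' by (auto simp: orb_def coset_img_def)
  fix Q assume Q: "Q \<in> K_orbits N \<and> Q \<subseteq> coset_img N (borel_subgroup N) ?S \<and>
      coset_img N (borel_subgroup N) ?S \<subseteq> flag_top N closure_of Q"
  then obtain e where e: "e \<in> involutions N" "Q = orb N e" using K_orbits_eq[OF odd] by blast
  have S: "?S \<subseteq> zcl N (adapted N e)" using Q iff unfolding e(2) by blast
  obtain h where h: "h \<in> adapted N e" using adapted_exists[OF Npos e(1)] pattern_adapted by blast
  have "rstable (borel_subgroup N) ?S" using adapted_rstable[of N b] adapted_rstable[of N b'] by (auto simp: rstable_def)
  then have "adapted N e \<subseteq> ?S"
    using Q coset_img_mono_iff[OF borel_subgroup_SL adapted_SL Sc, of e] unfolding e(2) orb_def by blast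
  then have "e = b \<or> e = b'" using h adapted_unique[OF e(1) b] adapted_unique[OF e(1) b'] by blast
  moreover have "e \<noteq> b"
  proof
    assume "e = b"
    moreover obtain h' where "h' \<in> adapted N b'" using adapted_exists[OF Npos b'] pattern_adapted by blast
    ultimately show False using S upper_not_in_closure by blast
  qed
  ultimately show "Q = orb N b'" using e(2) by blast
qed

text \<open>\<open>P\<close> is \<open>B\<close> together with the cosets \<open>B lineL\<close>,
  and \<open>Z\<close> is right \<open>B\<close>-stable; so every point of the sweep in the upper
  orbit is \<open>z * lineL N i t\<close> with \<open>z\<close> in \<open>Z\<close>, a family affine
  in the one parameter \<open>t\<close>. This part is dense in the sweep.\<close>

lemma growth_sweep:
  assumes Z: "Z \<subseteq> adapted N b" "zirr N Z" "rstable (borel_subgroup N) Z" and gr: "growth N Z a"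
  shows "growth N (set_mul Z P) (Suc a)"
proof -
  let ?V = "set_mul Z P"
  have Zc: "Z \<subseteq> carrier (SL N)" using Z adapted_SL by blast
  let ?A1 = "mat N N (\<lambda>(r, s). if r = i \<and> s = i then 1 else 0 :: complex)"
  have line: "lineL N i t = lineL N i 0 + t \<cdot>\<^sub>m ?A1" for t
    by (rule eq_matI) (use i in \<open>auto simp: lineL_def blk_def\<close>)
  have "growth N (?V \<inter> adapted N b') (Suc a)"
  proof (rule growth_mult_line[OF gr SL_subset_mat[OF Zc], of "lineL N i 0" ?A1])
    show "lineL N i 0 \<in> carrier_mat N N" by (simp add: lineL_def blk_carrier)
    fix w assume w: "w \<in> ?V \<inter> adapted N b'"
    then obtain z p where z: "z \<in> Z" "p \<in> P" "w = z * p" unfolding set_mul_def by blast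
    have zc: "z \<in> carrier (SL N)" using z Zc by blast
    from z(2) i show "\<exists>z\<in>Z. \<exists>t. w = z * (lineL N i 0 + t \<cdot>\<^sub>m ?A1)"
    proof (cases rule: parabolic_cases_left)
      case 1
      then have "w \<in> adapted N b" using z Z(1,3) unfolding rstable_def by blast
      then show ?thesis using w upper_not_in_closure subset_zcl[OF adapted_SL, of N b] by blast
    next
      case (2 \<beta> t)
      have "w = z * \<beta> * lineL N i t"
        unfolding z(3) 2(2) by (rule SL_assoc[OF zc borel_SL[OF 2(1)] parabolic_SL[OF lineL_parabolic[OF i]], symmetric])
      moreover have "z * \<beta> \<in> Z" using Z(3) z(1) 2(1) unfolding rstable_def by blast
      ultimately show ?thesis using line by metis
    qed
  qed simp
  then show ?thesis using growth_dense sweep(5)[OF Z(1,2)] by blast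
qed

end

section \<open>Chains of closed irreducible sets\<close>

lemma growth_all:
  assumes A: "A \<subseteq> carrier_mat N N" shows "growth N A (N * N)"
proof -
  have "growth N (supp_mat N ({..<N} \<times> {..<N})) (card ({..<N} \<times> {..<N}))" by (rule growth_supp_mat) simp
  then have "growth N (supp_mat N ({..<N} \<times> {..<N})) (N * N)" by (simp add: card_cartesian_product)
  then show ?thesis by (rule growth_subset) (use A in \<open>auto simp: supp_mat_def\<close>)
qed

text \<open>The equation \<open>det = 1\<close> costs one of the \<open>N * N\<close> parameters;
  the zero matrix violates it because \<open>0 < N\<close>.\<close>

lemma growth_SL: assumes "0 < N" shows "growth N (carrier (SL N)) (N * N - 1)"
proof -
  let ?M = "supp_mat N ({..<N} \<times> {..<N})"
  obtain f where f: "f \<in> poly_funs N" "\<And>A. A \<in> carrier_mat N N \<Longrightarrow> f A = det A" by (rule poly_funs_det_mat[of N]) blast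
  have "growth N ?M (card ({..<N} \<times> {..<N}))" by (rule growth_supp_mat) simp
  then have gr: "growth N ?M (N * N)" by (simp add: card_cartesian_product)
  have "0 < N * N \<and> growth N (carrier (SL N)) (N * N - 1)"
  proof (rule growth_strict[OF zirr_supp_mat])
    show "(\<lambda>A. f A - 1) \<in> poly_funs N" by (rule poly_funs_diff[OF f(1) poly_funs.const])
    show "0\<^sub>m N N \<in> ?M" by (simp add: supp_mat_def)
    show "f (0\<^sub>m N N) - 1 \<noteq> 0" using f(2)[of "0\<^sub>m N N"] assms by simp
    show "\<forall>z\<in>carrier (SL N). f z - 1 = 0" using f(2) by (simp add: SL_carrier_iff)
    show "carrier (SL N) \<noteq> {}" using SL_one_closed by blast
    show "carrier (SL N) \<subseteq> ?M" by (auto simp: SL_carrier_iff supp_mat_def)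
  qed (rule gr)
  then show ?thesis by blast
qed

text \<open>Scalar multiples of \<open>B\<close> fill the invertible lower triangular matrices,
  which are dense in a linear space of dimension \<open>N (N + 1) / 2\<close>. The scalar is one
  line parameter, so \<open>N (N + 1) / 2 \<le> r + 1\<close>.\<close>

lemma growth_borel_ge:
  assumes "growth N (borel_subgroup N) r" "0 < N" shows "N * (N + 1) \<le> 2 * (r + 1)"
proof -
  let ?S = "{(r, c). c \<le> r \<and> r < N}"
  let ?L = "supp_mat N ?S"
  define W where "W = {w \<in> ?L. det w \<noteq> 0}"
  have grW: "growth N W (Suc r)"
  proof (rule growth_mult_line[OF assms(1) SL_subset_mat[OF borel_subset_SL], of "0\<^sub>m N N" "1\<^sub>m N"])
    fix w assume w: "w \<in> W"
    then have wm: "w \<in> carrier_mat N N" "det w \<noteq> 0" by (auto simp: W_def supp_mat_def)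
    obtain t where t: "t ^ N = det w" using nth_root_exists[OF assms(2)] by blast
    have tnz: "t \<noteq> 0" using t wm(2) assms(2) by (auto simp: zero_power)
    let ?z = "(1 / t) \<cdot>\<^sub>m w"
    have "det ?z = 1" using wm t tnz by (simp add: det_smult power_divide)
    then have "?z \<in> borel_subgroup N" using w wm
      by (auto simp: borel_subgroup_def SL_carrier_iff W_def supp_mat_def)
    moreover have "w = ?z * (0\<^sub>m N N + t \<cdot>\<^sub>m 1\<^sub>m N)"
    proof -
      have "0\<^sub>m N N + t \<cdot>\<^sub>m 1\<^sub>m N = t \<cdot>\<^sub>m 1\<^sub>m N" by (rule eq_matI) auto
      moreover have "?z * (t \<cdot>\<^sub>m 1\<^sub>m N) = t \<cdot>\<^sub>m (?z * 1\<^sub>m N)" by (rule mult_smult_distrib[of _ N N _ N]) (use wm in auto)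
      moreover have "?z * 1\<^sub>m N = ?z" by (rule right_mult_one_mat[of _ N N]) (use wm in auto)
      moreover have "t \<cdot>\<^sub>m ?z = w" by (rule eq_matI) (use tnz in auto)
      ultimately show ?thesis by simp
    qed
    ultimately show "\<exists>z\<in>borel_subgroup N. \<exists>t. w = z * (0\<^sub>m N N + t \<cdot>\<^sub>m 1\<^sub>m N)" by blast
  qed auto
  have "zdense N W ?L" unfolding zdense_def
  proof (intro ballI impI)
    fix f w assume f: "f \<in> poly_funs N" "\<forall>z\<in>W. f z = 0" and w: "w \<in> ?L"
    obtain g where g: "g \<in> poly_funs N" "\<And>A. A \<in> carrier_mat N N \<Longrightarrow> g A = det A" by (rule poly_funs_det_mat[of N]) blast
    have "\<forall>z\<in>?L. g z * f z = 0" using f(2) g(2) by (auto simp: W_def supp_mat_def)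
    then have "(\<forall>z\<in>?L. g z = 0) \<or> (\<forall>z\<in>?L. f z = 0)" using zirr_supp_mat[of N ?S] g(1) f(1) unfolding zirr_def by blast
    moreover have "1\<^sub>m N \<in> ?L" "g (1\<^sub>m N) = 1" using g(2) by (auto simp: supp_mat_def)
    ultimately show "f w = 0" using w by force
  qed
  then have "growth N ?L (Suc r)" by (rule growth_dense[OF grW])
  moreover have "?S \<subseteq> {..<N} \<times> {..<N}" by auto
  ultimately have le: "card ?S \<le> Suc r" using growth_supp_mat_ge by blast
  have "?S = Sigma {..<N} (\<lambda>r. {..r})" by auto
  then have "card ?S = (\<Sum>r<N. Suc r)" by simp
  moreover have "2 * (\<Sum>r<N. Suc r) = N * (N + 1)" by (induction N) auto
  ultimately show ?thesis using le by simp
qed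

text \<open>The closures of the \<open>T j\<close> within \<open>X\<close> form the chain. This
  leaves the \<open>T j\<close> free to be any stable irreducible sets, with strictness tested
  against the previous closure.\<close>

lemma flag_chainI:
  assumes X: "X \<subseteq> carrier (SL N)" "rstable (borel_subgroup N) X"
    and irr: "\<And>j. j \<le> k \<Longrightarrow> zirr N (T j)" and st: "\<And>j. j \<le> k \<Longrightarrow> rstable (borel_subgroup N) (T j)"
    and TX: "\<And>j. T j \<subseteq> X" and mono: "\<And>j. j < k \<Longrightarrow> T j \<subseteq> T (Suc j)"
    and strict: "\<And>j. j < k \<Longrightarrow> \<not> T (Suc j) \<subseteq> zcl N (T j)"
  shows "flag_chain N X (\<lambda>j. X \<inter> zcl N (T j)) k"
proof -
  define W where "W j = X \<inter> zcl N (T j)" for j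
  have Tc: "T j \<subseteq> carrier (SL N)" for j using TX X(1) by blast
  have TW: "T j \<subseteq> W j" for j unfolding W_def using TX subset_zcl[OF Tc] by blast
  have "flag_chain N X W k"
    unfolding flag_chain_def
  proof (intro conjI allI impI)
    fix j assume j: "j \<le> k"
    have Wc: "W j \<subseteq> carrier (SL N)" unfolding W_def using X(1) by blast
    have "zdense N (T j) (W j)" using zdense_iff_subset_zcl[OF Wc] unfolding W_def by blast
    then show "zirr N (W j)" by (rule zirr_dense[OF irr[OF j] _ TW])
    show "rstable (borel_subgroup N) (W j)" unfolding W_def
      by (rule rstable_Int[OF X(2) rstable_zcl[OF borel_subset_SL Tc st[OF j]]])
    have "zcl N (W j) \<subseteq> zcl N (T j)" by (rule zcl_minimal) (simp add: W_def)
    then show "X \<inter> zcl N (W j) = W j" using subset_zcl[OF Wc] unfolding W_def by blast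
  next
    fix j assume j: "j < k"
    show "W j \<subset> W (Suc j)"
    proof
      show "W j \<subseteq> W (Suc j)" unfolding W_def using zcl_mono[OF mono[OF j]] by blast
      show "W j \<noteq> W (Suc j)" using strict[OF j] TW[of "Suc j"] unfolding W_def by blast
    qed
  qed
  then show ?thesis unfolding W_def .
qed

lemma flag_chain_sub: "flag_chain N X Z k \<Longrightarrow> j \<le> k \<Longrightarrow> Z j \<subseteq> X"
  unfolding flag_chain_def by blast

lemma closed_separation:
  assumes "X \<inter> zcl N A = A" "w \<in> X" "w \<notin> A" "X \<subseteq> carrier (SL N)"
  obtains f where "f \<in> poly_funs N" "\<forall>z\<in>A. f z = 0" "f w \<noteq> 0"
proof -
  have "w \<notin> zcl N A" "w \<in> carrier (SL N)" using assms by blast+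
  then show ?thesis using that unfolding zcl_def by blast
qed

lemma flag_chain_growth_step:
  assumes ch: "flag_chain N X Z k" "X \<subseteq> carrier (SL N)" "j < k" and gr: "growth N (Z (Suc j)) r"
  shows "0 < r \<and> growth N (Z j) (r - 1)"
proof -
  have Z: "zirr N (Z j)" "X \<inter> zcl N (Z j) = Z j" "zirr N (Z (Suc j))" "Z j \<subset> Z (Suc j)"
    using ch(1,3) unfolding flag_chain_def by auto
  obtain w where w: "w \<in> Z (Suc j)" "w \<notin> Z j" using Z(4) by blast
  have "w \<in> X" using flag_chain_sub[OF ch(1), of "Suc j"] ch(3) w(1) by auto
  then obtain f where f: "f \<in> poly_funs N" "\<forall>z\<in>Z j. f z = 0" "f w \<noteq> 0"
    using closed_separation[OF Z(2) _ w(2) ch(2)] by blast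
  have "Z j \<noteq> {}" using Z(1) by (simp add: zirr_def)
  then show ?thesis using growth_strict[OF Z(3) _ _ f(1,2) w(1) f(3) gr] Z(4) by blast
qed

text \<open>The top of a chain has growth exponent at most \<open>N * N - 1\<close>, each step down
  costs one, and the bottom contains a translate of \<open>B\<close>, whose exponent is at least
  \<open>N (N + 1) / 2 - 1\<close>. The difference \<open>N (N - 1) / 2\<close> is the dimension of
  the flag variety.\<close>

lemma flag_chain_bound:
  assumes ch: "flag_chain N X Z k" "X \<subseteq> carrier (SL N)" and N: "0 < N"
  shows "2 * k \<le> N * (N - 1)"
proof -
  have step: "j \<le> N * N - 1 \<and> growth N (Z (k - j)) (N * N - 1 - j)" if "j \<le> k" for j
    using that
  proof (induction j)
    case 0
    have "Z k \<subseteq> carrier (SL N)" using flag_chain_sub[OF ch(1)] ch(2) by blast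
    then show ?case using growth_subset[OF growth_SL[OF N]] by simp
  next
    case (Suc j)
    have "k - j = Suc (k - Suc j)" using Suc.prems by simp
    then have "growth N (Z (Suc (k - Suc j))) (N * N - 1 - j)" using Suc by simp
    from flag_chain_growth_step[OF ch _ this] Suc.prems
    show ?case by (auto simp: Suc_le_eq)
  qed
  have k: "k \<le> N * N - 1" "growth N (Z 0) (N * N - 1 - k)" using step[of k] by auto
  have Z0: "zirr N (Z 0)" "rstable (borel_subgroup N) (Z 0)" using ch(1) unfolding flag_chain_def by auto
  obtain z where z: "z \<in> Z 0" using Z0(1) by (auto simp: zirr_def)
  have zc: "z \<in> carrier (SL N)" using z flag_chain_sub[OF ch(1), of 0] ch(2) by auto
  have "(*) z ` borel_subgroup N \<subseteq> Z 0" using Z0(2) z unfolding rstable_def by blast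
  then have "growth N ((*) z ` borel_subgroup N) (N * N - 1 - k)" by (rule growth_subset[OF k(2)])
  then have "growth N (borel_subgroup N) (N * N - 1 - k)"
    by (rule growth_left_translate[OF _ SL_subset_mat[OF borel_subset_SL] SL_carrier_mat[OF zc]
          SL_carrier_mat[OF SL_inv_closed[OF zc]] SL_inv_left[OF zc]])
  from growth_borel_ge[OF this N] have "N * (N + 1) \<le> 2 * (N * N - 1 - k + 1)" .
  then have "N * (N + 1) + 2 * k \<le> 2 * (N * N)" using k(1) N by (cases "N * N") auto
  then show ?thesis using N by (cases N) (auto simp: algebra_simps)
qed

context descent
begin

lemma growth_least:
  assumes "A \<subseteq> carrier_mat N N"
  obtains a where "growth N A a" "\<And>c. growth N A c \<Longrightarrow> a \<le> c"
  using growth_all[OF assms] LeastI[of "growth N A"] Least_le[of "growth N A"] that by metis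

text \<open>Sweeping along \<open>P\<close> and keeping the part in the upper orbit gives one
  irreducible set for each member of the chain; a coset \<open>y B\<close> below them is the
  additional member. Strictness is read off from least growth exponents, which rise by exactly one
  under sweeping.\<close>

lemma flag_chain_ascend:
  assumes ch: "flag_chain N (adapted N b) Z k"
  shows "\<exists>Z'. flag_chain N (adapted N b') Z' (Suc k)"
proof -
  have Z: "zirr N (Z j)" "rstable (borel_subgroup N) (Z j)" "adapted N b \<inter> zcl N (Z j) = Z j" "Z j \<subseteq> adapted N b"
    if "j \<le> k" for j
    using ch that flag_chain_sub[OF ch that] unfolding flag_chain_def by blast+
  have Zmono: "Z j \<subset> Z (Suc j)" if "j < k" for j using ch that unfolding flag_chain_def by blast
  have Zc: "Z j \<subseteq> carrier (SL N)" if "j \<le> k" for j using Z(4)[OF that] adapted_SL by blast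
  define V where "V j = set_mul (Z j) P" for j
  define Y where "Y j = V j \<inter> adapted N b'" for j
  note sw = sweep[OF Z(4) Z(1), folded V_def]
  have Yc: "Y j \<subseteq> carrier (SL N)" for j unfolding Y_def using adapted_SL by blast
  have Yirr: "zirr N (Y j)" and Yd: "zdense N (Y j) (V j)" and ZV: "Z j \<subseteq> V j" and Virr: "zirr N (V j)"
    if "j \<le> k" for j
    using sw[OF that that] unfolding Y_def by blast+
  have Yst: "rstable (borel_subgroup N) (Y j)" if "j \<le> k" for j
  proof -
    have "rstable (borel_subgroup N) (V j)" unfolding rstable_def
    proof (intro ballI)
      fix a h assume "a \<in> V j" and h: "h \<in> borel_subgroup N"
      then obtain z p where z: "z \<in> Z j" "p \<in> P" "a = z * p" unfolding V_def set_mul_def by blast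
      have zc: "z \<in> carrier (SL N)" using z Zc[OF that] by blast
      have "a * h = z * (p * h)" unfolding z(3) by (rule SL_assoc[OF zc parabolic_SL[OF z(2)] borel_SL[OF h]])
      moreover have "p * h \<in> P" using z(2) h borel_parabolic parabolic_mult by blast
      ultimately show "a * h \<in> V j" unfolding V_def using set_mulI[OF z(1)] by metis
    qed
    then show ?thesis unfolding Y_def by (rule rstable_Int[OF _ adapted_rstable])
  qed
  have Ymono: "Y j \<subseteq> Y (Suc j)" if "j < k" for j
    using Zmono[OF that] unfolding Y_def V_def set_mul_def by blast
  \<comment> \<open>Sweeping properly enlarges the closure: some polynomial vanishes on the whole
    lower orbit but not at a swept point. So \<open>Z j\<close> has an exponent smaller by
    one.\<close>
  have strictV: "0 < r \<and> growth N (Z j) (r - 1)" if jk: "j \<le> k" "growth N (V j) r" for j r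
  proof -
    obtain y where y: "y \<in> Y j" using Yirr[OF jk(1)] by (auto simp: zirr_def)
    then have "y \<notin> zcl N (adapted N b)" "y \<in> carrier (SL N)" "y \<in> V j"
      using upper_not_in_closure Yc unfolding Y_def by blast+
    then obtain f where f: "f \<in> poly_funs N" "\<forall>z\<in>adapted N b. f z = 0" "f y \<noteq> 0" unfolding zcl_def by blast
    have "\<forall>z\<in>Z j. f z = 0" using f(2) Z(4)[OF jk(1)] by blast
    moreover have "Z j \<noteq> {}" using Z(1)[OF jk(1)] by (simp add: zirr_def)
    ultimately show ?thesis
      by (rule growth_strict[OF Virr[OF jk(1)] ZV[OF jk(1)] _ f(1) _ \<open>y \<in> V j\<close> f(3) jk(2), rotated])
  qed
  obtain y where y: "y \<in> Y 0" using Yirr[of 0] by (auto simp: zirr_def)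
  have yc: "y \<in> carrier (SL N)" using y Yc by blast
  define T where "T = (\<lambda>j. if j = 0 then (*) y ` borel_subgroup N else Y (j - 1))"
  have Tc: "T j \<subseteq> carrier (SL N)" for j
    unfolding T_def using Yc SL_mult_closed[OF yc borel_SL] by auto
  have T0: "(*) y ` borel_subgroup N = set_mul {y} (borel_subgroup N)" by (auto simp: set_mul_def)
  have Tirr: "zirr N (T j)" if "j \<le> Suc k" for j
  proof (cases j)
    case 0
    have "zirr N (set_mul {y} (borel_subgroup N))"
      by (rule zirr_set_mul[OF zirr_singleton zirr_borel]) (use SL_carrier_mat yc borel_SL in blast)+
    then show ?thesis using 0 by (simp add: T_def T0)
  qed (use that Yirr in \<open>simp add: T_def\<close>)
  have Tst: "rstable (borel_subgroup N) (T j)" if "j \<le> Suc k" for j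
  proof (cases j)
    case 0
    have "y * \<beta> * h \<in> (*) y ` borel_subgroup N" if "\<beta> \<in> borel_subgroup N" "h \<in> borel_subgroup N" for \<beta> h
      using SL_assoc[OF yc borel_SL[OF that(1)] borel_SL[OF that(2)]] borel_mult[OF that] by (metis image_eqI)
    then show ?thesis using 0 by (auto simp: T_def rstable_def)
  qed (use that Yst in \<open>simp add: T_def\<close>)
  have TA: "T j \<subseteq> adapted N b'" for j
    using y adapted_rstable[of N b'] unfolding T_def Y_def rstable_def by auto
  have Tmono: "T j \<subseteq> T (Suc j)" if "j < Suc k" for j
  proof (cases j)
    case 0
    then show ?thesis using Yst[of 0] y unfolding T_def rstable_def by auto
  next
    case (Suc j')
    then show ?thesis using Ymono[of j'] that by (simp add: T_def)
  qed
  have Tstrict: "\<not> T (Suc j) \<subseteq> zcl N (T j)" if "j < Suc k" for j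
  proof
    assume sub: "T (Suc j) \<subseteq> zcl N (T j)"
    then have dense: "zdense N (T j) (T (Suc j))" using zdense_iff_subset_zcl[OF Tc] by blast
    have jk: "j \<le> k" using that by simp
    have TS: "T (Suc j) = Y j" by (simp add: T_def)
    have grow: "growth N (V j) a" if "growth N (T j) a" for a
      using growth_dense[OF growth_dense[OF that dense]] Yd[OF jk] unfolding TS by blast
    show False
    proof (cases j)
      case 0
      \<comment> \<open>If \<open>y B\<close> were dense in the first swept set, that set would have
        the least exponent of \<open>B\<close>; then \<open>Z 0\<close>, which contains a translate
        of \<open>B\<close>, would have a smaller one.\<close>
      obtain a where a: "growth N (borel_subgroup N) a" "\<And>c. growth N (borel_subgroup N) c \<Longrightarrow> a \<le> c"
        using growth_least[OF SL_subset_mat[OF borel_subset_SL]] by blast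
      have undo: "(*) (SL_inv N y) ` ((*) y ` borel_subgroup N) = borel_subgroup N"
      proof -
        have "SL_inv N y * (y * \<beta>) = \<beta>" if "\<beta> \<in> borel_subgroup N" for \<beta>
          by (rule SL_inv_mult_cancel(1)[OF yc borel_SL[OF that]])
        then show ?thesis by (force simp: image_image)
      qed
      have "growth N ((*) y ` borel_subgroup N) a"
        by (rule growth_left_translate[of N "SL_inv N y" _ a y])
          (use a(1) undo Tc[of 0] SL_carrier_mat yc SL_inv_closed[OF yc] SL_inv_right[OF yc] in \<open>auto simp: T_def\<close>)
      then have "growth N (V 0) a" using grow[of a] 0 by (simp add: T_def)
      then have s: "0 < a" "growth N (Z 0) (a - 1)" using strictV[of 0 a] by auto
      obtain z where z: "z \<in> Z 0" using Z(1)[of 0] by (auto simp: zirr_def)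
      have zc: "z \<in> carrier (SL N)" using z Zc[of 0] by auto
      have "(*) z ` borel_subgroup N \<subseteq> Z 0" using Z(2)[of 0] z unfolding rstable_def by blast
      then have "growth N ((*) z ` borel_subgroup N) (a - 1)" by (rule growth_subset[OF s(2)])
      then have "growth N (borel_subgroup N) (a - 1)"
        by (rule growth_left_translate[OF _ SL_subset_mat[OF borel_subset_SL] SL_carrier_mat[OF zc]
              SL_carrier_mat[OF SL_inv_closed[OF zc]] SL_inv_left[OF zc]])
      from a(2)[OF this] s(1) show False by simp
    next
      case (Suc j')
      have j': "j' \<le> k" "j' < k" using that Suc by auto
      have Tj: "T j = Y j'" using Suc by (simp add: T_def)
      \<comment> \<open>If two consecutive swept sets had the same closure, the larger one would
        have exponent \<open>a + 1\<close>, the member of the chain it comes from \<open>a\<close>,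
        and \<open>Z j'\<close> below that \<open>a - 1\<close>, against the choice of
        \<open>a\<close>.\<close>
      obtain a where a: "growth N (Z j') a" "\<And>c. growth N (Z j') c \<Longrightarrow> a \<le> c"
        using growth_least[OF SL_subset_mat[OF Zc[OF j'(1)]]] by blast
      have "growth N (V j') (Suc a)" unfolding V_def by (rule growth_sweep[OF Z(4,1,2)[OF j'(1)] a(1)])
      then have "growth N (Y j') (Suc a)" by (rule growth_subset) (simp add: Y_def)
      then have "growth N (V j) (Suc a)" using grow Tj by simp
      then have "growth N (Z (Suc j')) a" using strictV[OF jk] Suc by fastforce
      from flag_chain_growth_step[OF ch adapted_SL j'(2) this] a(2)[of "a - 1"] show False by auto
    qed
  qed
  have "flag_chain N (adapted N b') (\<lambda>j. adapted N b' \<inter> zcl N (T j)) (Suc k)"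
    using Tirr Tst TA Tmono Tstrict by (rule flag_chainI[where T = T, OF adapted_SL adapted_rstable])
  then show ?thesis by blast
qed

end

section \<open>The closed orbit\<close>

text \<open>Root subgroups of the orthogonal group; the last term appears for the short roots only.\<close>

definition root_elt :: "nat \<Rightarrow> nat \<Rightarrow> nat \<Rightarrow> complex \<Rightarrow> complex mat" where
  "root_elt N i j t = mat N N (\<lambda>(k, q). (if k = q then 1 else 0) + (if k = i \<and> q = j then t else 0)
     - (if k = N - 1 - j \<and> q = N - 1 - i then t else 0)
     - (if k = i \<and> q = N - 1 - i \<and> j = N - 1 - j then t * t / 2 else 0))"

lemma root_elt_carrier: "root_elt N i j t \<in> carrier_mat N N"
  by (simp add: root_elt_def)

lemma root_elt_upper:
  assumes "i < j" "i + j < N - 1" "r < N" "c < N"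
  shows "c < r \<Longrightarrow> root_elt N i j t $$ (r, c) = 0" "root_elt N i j t $$ (r, r) = 1"
  using assms by (auto simp: root_elt_def)

lemma gram_entry:
  assumes "x \<in> carrier_mat N N" "p < N" "q < N"
  shows "gram N x $$ (p, q) = (\<Sum>k<N. x $$ (k, p) * x $$ (N - 1 - k, q))"
proof -
  have "gram N x $$ (p, q) = (\<Sum>k<N. \<Sum>l<N. x $$ (k, p) * antidiag N $$ (k, l) * x $$ (l, q))"
    unfolding gram_def by (rule quadratic_entry[OF antidiag_carrier assms(1,1,2,3)])
  also have "\<dots> = (\<Sum>k<N. x $$ (k, p) * x $$ (N - 1 - k, q))"
  proof (rule sum.cong[OF refl])
    fix k assume "k \<in> {..<N}"
    then have k: "k < N" by simp
    have "(\<Sum>l<N. x $$ (k, p) * antidiag N $$ (k, l) * x $$ (l, q)) = x $$ (k, p) * antidiag N $$ (k, N - 1 - k) * x $$ (N - 1 - k, q)"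
      by (rule sum_one_point) (use k in \<open>auto simp: antidiag_def\<close>)
    then show "(\<Sum>l<N. x $$ (k, p) * antidiag N $$ (k, l) * x $$ (l, q)) = x $$ (k, p) * x $$ (N - 1 - k, q)"
      using k by (simp add: antidiag_def)
  qed
  finally show ?thesis .
qed

text \<open>Primes denote partners under \<open>J\<close>. The element is the exponential of
  \<open>t (E(i,j) - E(j',i'))\<close>; this nilpotent matrix squares to zero unless
  \<open>j = j'\<close>, when its square contributes \<open>- t^2 / 2\<close> at
  \<open>(i, i')\<close>.\<close>

lemma root_elt_fixed:
  assumes ij: "i < j" "i + j < N - 1" shows "root_elt N i j t \<in> fixed_group N"
proof -
  define i' where "i' = N - 1 - i"
  define j' where "j' = N - 1 - j"
  have N: "i < N" "j < N" "i' < N" "j' < N" using ij by (auto simp: i'_def j'_def)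
  have ne: "i \<noteq> j" "i \<noteq> i'" "j \<noteq> i'" "j' \<noteq> i'" "i \<noteq> j'" using ij by (auto simp: i'_def j'_def)
  have star: "N - 1 - i = i'" "N - 1 - j = j'" "N - 1 - i' = i" "N - 1 - j' = j"
    using ij by (auto simp: i'_def j'_def)
  define s where "s = (if j = j' then t * t / 2 else 0)"
  let ?x = "root_elt N i j t"
  have x: "?x $$ (k, q) = (if k = q then 1 else 0) + (if k = i then (if q = j then t else 0) - (if q = i' then s else 0) else 0)
      + (if k = j' then (if q = i' then - t else 0) else 0)" if "k < N" "q < N" for k q
  proof -
    have "?x $$ (k, q) = (if k = q then 1 else 0) + (if k = i \<and> q = j then t else 0)
        - (if k = j' \<and> q = i' then t else 0) - (if k = i \<and> q = i' \<and> j = j' then t * t / 2 else 0)"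
      unfolding root_elt_def i'_def j'_def using that by (simp only: index_mat(1) prod.case)
    then show ?thesis unfolding s_def by (simp split del: if_split, simp)
  qed
  have y: "?x $$ (N - 1 - k, q) = (if k = N - 1 - q then 1 else 0) + (if k = i' then (if q = j then t else 0) - (if q = i' then s else 0) else 0)
      + (if k = j then (if q = i' then - t else 0) else 0)" if "k < N" "q < N" for k q
  proof -
    have "N - 1 - k = q \<longleftrightarrow> k = N - 1 - q" "N - 1 - k = i \<longleftrightarrow> k = i'" "N - 1 - k = j' \<longleftrightarrow> k = j"
      using that N by (auto simp: i'_def j'_def)
    then show ?thesis using x[of "N - 1 - k" q] that by simp
  qed
  have "gram N ?x = antidiag N"
  proof (rule eq_matI)
    fix p q assume "p < dim_row (antidiag N)" "q < dim_col (antidiag N)"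
    then have pq: "p < N" "q < N" by (simp_all add: antidiag_def)
    define q' where "q' = N - 1 - q"
    define Y where "Y k = ?x $$ (N - 1 - k, q)" for k
    have Y: "Y k = (if k = q' then 1 else 0) + (if k = i' then (if q = j then t else 0) - (if q = i' then s else 0) else 0)
        + (if k = j then (if q = i' then - t else 0) else 0)" if "k < N" for k
      using y[OF that pq(2)] unfolding Y_def q'_def .
    let ?a = "(if p = j then t else 0) - (if p = i' then s else 0)" and ?b = "if p = i' then - t else 0"
    have "gram N ?x $$ (p, q) = (\<Sum>k<N. ?x $$ (k, p) * Y k)"
      unfolding Y_def by (rule gram_entry[OF root_elt_carrier pq])
    also have "\<dots> = (\<Sum>k<N. (if k = p then Y p else 0) + (if k = i then ?a * Y i else 0) + (if k = j' then ?b * Y j' else 0))"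
      by (rule sum.cong[OF refl]) (simp only: x[OF _ pq(1)] lessThan_iff, simp add: algebra_simps)
    also have "\<dots> = Y p + ?a * Y i + ?b * Y j'"
      unfolding sum.distrib using pq N by (simp add: sum.delta)
    also have "\<dots> = (if p = q' then 1 else 0)"
    proof -
      have qi: "i = q' \<longleftrightarrow> q = i'" "j' = q' \<longleftrightarrow> q = j" using pq N by (auto simp: i'_def j'_def q'_def)
      have yi: "Y i = (if q = i' then 1 else 0)" unfolding Y[OF N(1)] qi using ne by simp
      have yj: "Y j' = (if q = j then 1 else 0) - (if j' = j \<and> q = i' then t else 0)"
        unfolding Y[OF N(4)] qi using ne by simp
      have yp: "Y p = (if p = q' then 1 else 0) + (if p = i' then (if q = j then t else 0) - (if q = i' then s else 0) else 0)
          - (if p = j \<and> q = i' then t else 0)" unfolding Y[OF pq(1)] by simp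
      have ss: "2 * s = (if j' = j then t * t else 0)" by (auto simp: s_def)
      show ?thesis unfolding yi yj yp using ne(3) ss
        by (cases "p = i'"; cases "p = j"; cases "q = i'"; cases "q = j"; cases "j' = j") (simp_all add: algebra_simps)
    qed
    finally show "gram N ?x $$ (p, q) = antidiag N $$ (p, q)" using pq by (auto simp: antidiag_def q'_def)
  qed (simp_all add: gram_def antidiag_def root_elt_def)
  moreover have "det ?x = 1"
    by (rule det_unitriangular[OF root_elt_carrier]) (use root_elt_upper[OF ij] in auto)
  ultimately show ?thesis by (simp add: fixed_group_iff SL_carrier_iff root_elt_carrier)
qed

lemma zirr_root_elts:
  "zirr N (range (root_elt N i j))"
proof (rule zirr_rational_curves)
  fix x y assume "x \<in> range (root_elt N i j)" "y \<in> range (root_elt N i j)"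
  then obtain t u where tu: "x = root_elt N i j t" "y = root_elt N i j u" by blast
  define \<gamma> where "\<gamma> s = root_elt N i j (t + s * (u - t))" for s
  have "\<exists>P. \<forall>s. poly 1 s \<noteq> 0 \<longrightarrow> \<gamma> s $$ (r, c) * poly 1 s = poly P s" if "r < N" "c < N" for r c
  proof -
    \<comment> \<open>The index conditions enter as Booleans, which turns the polynomial identity
      into sixteen cases.\<close>
    define p where "p A B C D = (if A then 1 else 0) + (if B then [:t, u - t:] else 0) - (if C then [:t, u - t:] else 0)
        - (if D then smult (1 / 2) ([:t, u - t:] * [:t, u - t:]) else 0)" for A B C D
    let ?P = "p (r = c) (r = i \<and> c = j) (r = N - 1 - j \<and> c = N - 1 - i) (r = i \<and> c = N - 1 - i \<and> j = N - 1 - j)"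
    have p: "poly (p A B C D) s = (if A then 1 else 0) + (if B then t + s * (u - t) else 0)
        - (if C then t + s * (u - t) else 0)
        - (if D then (t + s * (u - t)) * (t + s * (u - t)) / 2 else 0)" for A B C D s
      unfolding p_def by (cases A; cases B; cases C; cases D) (simp_all add: field_simps)
    have "\<gamma> s $$ (r, c) = poly ?P s" for s
      unfolding \<gamma>_def root_elt_def p using that by (simp only: index_mat(1) prod.case)
    then show ?thesis by (intro exI[of _ ?P]) simp
  qed
  then show "\<exists>\<gamma> D. \<gamma> 0 = x \<and> \<gamma> 1 = y \<and> poly D 0 \<noteq> 0 \<and> poly D 1 \<noteq> 0 \<and>
      (\<forall>s. poly D s \<noteq> 0 \<longrightarrow> \<gamma> s \<in> range (root_elt N i j)) \<and>
      (\<forall>r<N. \<forall>c<N. \<exists>P. \<forall>s. poly D s \<noteq> 0 \<longrightarrow> \<gamma> s $$ (r, c) * poly D s = poly P s)"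
    by (intro exI[of _ \<gamma>] exI[of _ 1]) (simp add: tu \<gamma>_def)
qed blast

text \<open>A Pluecker coordinate of the span of the columns from \<open>j\<close> on, with rows
  \<open>i\<close>, \<open>j + 1\<close>, ..., \<open>N - 1\<close>. Right multiplication by
  \<open>B\<close> only changes the basis of this span, so vanishing is a condition on
  flags.\<close>

definition flag_minor :: "nat \<Rightarrow> nat \<Rightarrow> nat \<Rightarrow> complex mat \<Rightarrow> complex" where
  "flag_minor N i j g = det (mat (N - j) (N - j) (\<lambda>(a, c). g $$ (if a = 0 then i else j + a, j + c)))"

lemma flag_minor_poly: "i < N \<Longrightarrow> j < N \<Longrightarrow> flag_minor N i j \<in> poly_funs N"
  unfolding flag_minor_def by (rule poly_funs_det) (auto intro: poly_funs.entry)

text \<open>Triangularity of \<open>\<beta>\<close> confines the columns from \<open>j\<close> on to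
  combinations of each other, so the minor is multiplied by the determinant of the lower right block
  of \<open>\<beta>\<close>.\<close>

lemma flag_minor_borel:
  assumes g: "g \<in> carrier_mat N N" and \<beta>: "\<beta> \<in> borel_subgroup N" and ij: "i < N" "j < N" and z: "flag_minor N i j g = 0"
  shows "flag_minor N i j (g * \<beta>) = 0"
proof -
  let ?m = "N - j" and ?r = "\<lambda>a. if a = 0 then i else j + a"
  let ?W = "\<lambda>g. mat ?m ?m (\<lambda>(a, c). g $$ (?r a, j + c))"
  let ?b = "mat ?m ?m (\<lambda>(a, c). \<beta> $$ (j + a, j + c))"
  have bm: "\<beta> \<in> carrier_mat N N" using \<beta> borel_SL SL_carrier_mat by blast
  have "?W (g * \<beta>) = ?W g * ?b"
  proof (rule eq_matI)
    fix a c assume "a < dim_row (?W g * ?b)" "c < dim_col (?W g * ?b)"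
    then have ac: "a < ?m" "c < ?m" by simp_all
    have r: "?r a < N" "j + c < N" using ac ij by auto
    have "(g * \<beta>) $$ (?r a, j + c) = (\<Sum>s<N. g $$ (?r a, s) * \<beta> $$ (s, j + c))"
      by (rule mult_mat_entry[OF g bm r])
    also have "\<dots> = (\<Sum>s\<in>{j..<N}. g $$ (?r a, s) * \<beta> $$ (s, j + c))"
      using \<beta> r by (intro sum.mono_neutral_right) (auto simp: borel_subgroup_def)
    also have "\<dots> = (\<Sum>s<?m. g $$ (?r a, j + s) * \<beta> $$ (j + s, j + c))"
      by (rule sum.reindex_bij_witness[of _ "\<lambda>s. j + s" "\<lambda>s. s - j"]) auto
    also have "\<dots> = (\<Sum>s<?m. ?W g $$ (a, s) * ?b $$ (s, c))"
      using ac by (intro sum.cong) auto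
    also have "\<dots> = (?W g * ?b) $$ (a, c)"
      by (rule mult_mat_entry[symmetric, of _ ?m ?m]) (use ac in auto)
    finally show "?W (g * \<beta>) $$ (a, c) = (?W g * ?b) $$ (a, c)" using ac by simp
  qed auto
  then have "flag_minor N i j (g * \<beta>) = flag_minor N i j g * det ?b"
    unfolding flag_minor_def by (simp add: det_mult[of _ ?m])
  then show ?thesis using z by simp
qed

text \<open>The minor is upper triangular with diagonal \<open>u(i, j)\<close>, \<open>1\<close>,
  ..., \<open>1\<close>, so on unitriangular matrices this coordinate of the flag reads off one
  entry.\<close>

lemma flag_minor_unitriangular:
  assumes u: "\<And>r c. r < N \<Longrightarrow> c < r \<Longrightarrow> u $$ (r, c) = 0" "\<And>r. r < N \<Longrightarrow> u $$ (r, r) = 1" and j: "j < N"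
  shows "flag_minor N i j u = u $$ (i, j)"
proof -
  let ?m = "N - j"
  let ?W = "mat ?m ?m (\<lambda>(a, c). u $$ (if a = 0 then i else j + a, j + c))"
  have "det ?W = prod_list (diag_mat ?W)"
  proof (rule det_upper_triangular[of _ ?m])
    show "upper_triangular ?W" by (rule upper_triangularI) (use u(1) in auto)
  qed simp
  also have "\<dots> = (\<Prod>a = 0..<?m. ?W $$ (a, a))" by (simp add: prod_list_diag_prod)
  also have "\<dots> = (\<Prod>a = 0..<?m. if a = 0 then u $$ (i, j) else 1)"
    by (intro prod.cong) (use u(2) in auto)
  also have "\<dots> = u $$ (i, j)" using j by simp
  finally show ?thesis unfolding flag_minor_def .
qed

text \<open>\<open>A 0 \<subseteq> \<dots> \<subseteq> A k\<close> are products of root subgroups, taken row by row from the innermost row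
  outwards; all positions of row \<open>i\<close> from column \<open>j\<close> on are still unused.\<close>

definition root_chain :: "nat \<Rightarrow> nat \<Rightarrow> nat \<Rightarrow> nat \<Rightarrow> (nat \<Rightarrow> complex mat set) \<Rightarrow> bool" where
  "root_chain N i j k A \<longleftrightarrow>
     (\<forall>m\<le>k. A m \<subseteq> fixed_group N \<and> zirr N (A m)) \<and>
     (\<forall>m<k. A m \<subseteq> A (Suc m) \<and> \<not> A (Suc m) \<subseteq> zcl N (set_mul (A m) (borel_subgroup N))) \<and>
     (\<forall>u\<in>A k. (\<forall>r<N. \<forall>c<r. u $$ (r, c) = 0) \<and> (\<forall>r<N. u $$ (r, r) = 1) \<and>
        (\<forall>r<i. \<forall>c<N. r \<noteq> c \<longrightarrow> u $$ (r, c) = 0) \<and> (\<forall>c. j \<le> c \<and> c < N - 1 - i \<longrightarrow> u $$ (i, c) = 0))"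

text \<open>On \<open>A k\<close> the coordinate \<open>flag_minor N i j\<close> is the entry at
  \<open>(i, j)\<close>, which is still zero; so it vanishes on all of \<open>A k\<close> times
  \<open>B\<close>. After multiplication by \<open>root_elt N i j t\<close> that entry becomes
  \<open>t\<close>.\<close>

lemma root_chain_step:
  assumes ch: "root_chain N i j k A" and ij: "i < j" "i + j < N - 1"
  shows "\<exists>A. root_chain N i (Suc j) (Suc k) A"
proof -
  let ?R = "range (root_elt N i j)"
  define A' where "A' m = (if m \<le> k then A m else set_mul (A k) ?R)" for m
  have Ak: "A k \<subseteq> fixed_group N" "zirr N (A k)" using ch unfolding root_chain_def by auto
  have u: "\<And>r c. r < N \<Longrightarrow> c < r \<Longrightarrow> u $$ (r, c) = 0" "\<And>r. r < N \<Longrightarrow> u $$ (r, r) = 1"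
    "\<And>r c. r < i \<Longrightarrow> c < N \<Longrightarrow> r \<noteq> c \<Longrightarrow> u $$ (r, c) = 0" "\<And>c. j \<le> c \<Longrightarrow> c < N - 1 - i \<Longrightarrow> u $$ (i, c) = 0"
    "u \<in> carrier_mat N N" if "u \<in> A k" for u
  proof -
    from ch have "\<forall>u\<in>A k. (\<forall>r<N. \<forall>c<r. u $$ (r, c) = 0) \<and> (\<forall>r<N. u $$ (r, r) = 1) \<and>
        (\<forall>r<i. \<forall>c<N. r \<noteq> c \<longrightarrow> u $$ (r, c) = 0) \<and> (\<forall>c. j \<le> c \<and> c < N - 1 - i \<longrightarrow> u $$ (i, c) = 0)"
      unfolding root_chain_def by (elim conjE)
    from bspec[OF this that] show "\<And>r c. r < N \<Longrightarrow> c < r \<Longrightarrow> u $$ (r, c) = 0" "\<And>r. r < N \<Longrightarrow> u $$ (r, r) = 1"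
      "\<And>r c. r < i \<Longrightarrow> c < N \<Longrightarrow> r \<noteq> c \<Longrightarrow> u $$ (r, c) = 0" "\<And>c. j \<le> c \<Longrightarrow> c < N - 1 - i \<Longrightarrow> u $$ (i, c) = 0"
      by iprover+
    show "u \<in> carrier_mat N N" using that Ak(1) fixed_SL SL_carrier_mat by blast
  qed
  have N: "i < N" "j < N" "j < N - 1 - i" "N - 1 - i < N" "N - 1 - j < N" using ij by auto
  have Rf: "?R \<subseteq> fixed_group N" using root_elt_fixed[OF ij] by blast
  have new: "set_mul (A k) ?R \<subseteq> fixed_group N" using Ak(1) Rf fixed_mult unfolding set_mul_def by blast
  have irr: "zirr N (set_mul (A k) ?R)"
    by (rule zirr_set_mul[OF Ak(2) zirr_root_elts]) (use Ak(1) fixed_SL SL_carrier_mat root_elt_carrier in blast)+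
  have e0: "root_elt N i j 0 = 1\<^sub>m N" by (rule eq_matI) (auto simp: root_elt_def)
  have mono: "A k \<subseteq> set_mul (A k) ?R"
  proof
    fix u assume "u \<in> A k"
    then have "u * root_elt N i j 0 \<in> set_mul (A k) ?R" by (intro set_mulI) auto
    then show "u \<in> set_mul (A k) ?R" unfolding e0 using \<open>u \<in> A k\<close> Ak(1) fixed_SL SL_right_one by force
  qed
  have prod: "(u * root_elt N i j t) $$ (r, c) = u $$ (r, c) + (if c = j then t * u $$ (r, i) else 0)
      - (if c = N - 1 - i then t * u $$ (r, N - 1 - j) + (if j = N - 1 - j then t * t / 2 * u $$ (r, i) else 0) else 0)"
    if ua: "u \<in> A k" and rc: "r < N" "c < N" for u t r c
  proof -
    have "(u * root_elt N i j t) $$ (r, c) = (\<Sum>s<N. u $$ (r, s) * root_elt N i j t $$ (s, c))"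
      by (rule mult_mat_entry[OF u(5)[OF ua] root_elt_carrier rc])
    also have "\<dots> = (\<Sum>s<N. (if s = c then u $$ (r, c) else 0) + (if s = i then (if c = j then t * u $$ (r, i) else 0)
        - (if c = N - 1 - i \<and> j = N - 1 - j then t * t / 2 * u $$ (r, i) else 0) else 0)
        - (if s = N - 1 - j then (if c = N - 1 - i then t * u $$ (r, N - 1 - j) else 0) else 0))"
    proof (rule sum.cong[OF refl])
      fix s assume "s \<in> {..<N}"
      then have s: "s < N" by simp
      have "root_elt N i j t $$ (s, c) = (if s = c then 1 else 0) + (if s = i \<and> c = j then t else 0)
          - (if s = N - 1 - j \<and> c = N - 1 - i then t else 0)
          - (if s = i \<and> c = N - 1 - i \<and> j = N - 1 - j then t * t / 2 else 0)"
        unfolding root_elt_def using s rc(2) by (simp only: index_mat(1) prod.case)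
      moreover have "x s * ((if A then 1 else 0) + (if B \<and> C then t else 0) - (if D \<and> E then t else 0)
          - (if B \<and> E \<and> F then t * t / 2 else 0)) =
        (if A then x c else 0) + (if B then (if C then t * x i else 0)
        - (if E \<and> F then t * t / 2 * x i else 0) else 0)
        - (if D then (if E then t * x j' else 0) else 0)"
        if "A \<Longrightarrow> s = c" "B \<Longrightarrow> s = i" "D \<Longrightarrow> s = j'" for A B C D E F j' and x :: "nat \<Rightarrow> complex"
        using that by (cases A; cases B; cases C; cases D; cases E; cases F) (simp_all add: algebra_simps)
      ultimately show "u $$ (r, s) * root_elt N i j t $$ (s, c) = (if s = c then u $$ (r, c) else 0)
        + (if s = i then (if c = j then t * u $$ (r, i) else 0)
        - (if c = N - 1 - i \<and> j = N - 1 - j then t * t / 2 * u $$ (r, i) else 0) else 0)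
        - (if s = N - 1 - j then (if c = N - 1 - i then t * u $$ (r, N - 1 - j) else 0) else 0)"
        by (simp only:)
    qed
    also have "\<dots> = u $$ (r, c) + ((if c = j then t * u $$ (r, i) else 0)
        - (if c = N - 1 - i \<and> j = N - 1 - j then t * t / 2 * u $$ (r, i) else 0))
        - (if c = N - 1 - i then t * u $$ (r, N - 1 - j) else 0)"
      unfolding sum.distrib sum_subtractf using rc N by (simp add: sum.delta)
    finally show ?thesis by simp
  qed
  have strict: "\<not> set_mul (A k) ?R \<subseteq> zcl N (set_mul (A k) (borel_subgroup N))"
  proof
    assume sub: "set_mul (A k) ?R \<subseteq> zcl N (set_mul (A k) (borel_subgroup N))"
    obtain v where v: "v \<in> A k" using Ak(2) by (auto simp: zirr_def)
    let ?w = "v * root_elt N i j 1"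
    have "?w \<in> zcl N (set_mul (A k) (borel_subgroup N))" using sub set_mulI[OF v] by blast
    moreover have "\<forall>g\<in>set_mul (A k) (borel_subgroup N). flag_minor N i j g = 0"
    proof
      fix g assume "g \<in> set_mul (A k) (borel_subgroup N)"
      then obtain x \<beta> where x: "x \<in> A k" "\<beta> \<in> borel_subgroup N" "g = x * \<beta>" unfolding set_mul_def by blast
      have "flag_minor N i j x = x $$ (i, j)" by (rule flag_minor_unitriangular[OF u(1,2)[OF x(1)] N(2)])
      also have "\<dots> = 0" using u(4)[OF x(1)] N(3) by simp
      finally show "flag_minor N i j g = 0" unfolding x(3) by (rule flag_minor_borel[OF u(5)[OF x(1)] x(2) N(1,2)])
    qed
    ultimately have "flag_minor N i j ?w = 0"
      using flag_minor_poly[OF N(1,2)] unfolding zcl_def by blast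
    moreover have "flag_minor N i j ?w = ?w $$ (i, j)"
    proof (rule flag_minor_unitriangular[OF _ _ N(2)])
      show "?w $$ (r, c) = 0" if "r < N" "c < r" for r c
        using prod[OF v that(1), of c 1] that u(1)[OF v that(1)] ij by auto
      show "?w $$ (r, r) = 1" if "r < N" for r
        using prod[OF v that that, of 1] that u(1,2)[OF v that] ij by auto
    qed
    moreover have "?w $$ (i, j) = 1"
      using prod[OF v N(1,2), of 1] u(4)[OF v, of j] u(2)[OF v N(1)] N(3) by simp
    ultimately show False by simp
  qed
  have "root_chain N i (Suc j) (Suc k) A'"
    unfolding root_chain_def
  proof (intro conjI allI impI ballI)
    fix m assume m: "m \<le> Suc k"
    show "A' m \<subseteq> fixed_group N" "zirr N (A' m)"
      using ch new irr m unfolding root_chain_def A'_def by auto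
  next
    fix m assume m: "m < Suc k"
    show "A' m \<subseteq> A' (Suc m)"
      using ch mono m unfolding root_chain_def A'_def by (cases "m = k") auto
    show "\<not> A' (Suc m) \<subseteq> zcl N (set_mul (A' m) (borel_subgroup N))"
      using ch strict m unfolding root_chain_def A'_def by (cases "m = k") auto
  next
    fix w assume "w \<in> A' (Suc k)"
    then obtain v t where v: "v \<in> A k" "w = v * root_elt N i j t" by (auto simp: A'_def set_mul_def)
    show "w $$ (r, c) = 0" if "r < N" "c < r" for r c
      using prod[OF v(1) that(1), of c t] that u(1)[OF v(1) that(1)] ij unfolding v(2) by auto
    show "w $$ (r, r) = 1" if "r < N" for r
      using prod[OF v(1) that that, of t] that u(1,2)[OF v(1) that] ij unfolding v(2) by auto
    show "w $$ (r, c) = 0" if "r < i" "c < N" "r \<noteq> c" for r c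
      using prod[OF v(1) _ that(2), of r t] that u(3)[OF v(1) that(1)] ij unfolding v(2) by auto
    show "w $$ (i, c) = 0" if "Suc j \<le> c \<and> c < N - 1 - i" for c
      using prod[OF v(1) N(1), of c t] that u(4)[OF v(1), of c] unfolding v(2) by auto
  qed
  then show ?thesis by blast
qed

lemma root_chain_row:
  assumes ch: "root_chain N i (Suc i) k A" and N: "i + d < N - 1 - i"
  shows "\<exists>A. root_chain N i (Suc (i + d)) (k + d) A"
  using N
proof (induction d)
  case 0
  then show ?case using ch by auto
next
  case (Suc d)
  then obtain A where "root_chain N i (Suc (i + d)) (k + d) A" by auto
  from root_chain_step[OF this] Suc.prems show ?case by auto
qed

lemma root_chain_full:
  assumes "m \<le> n" "0 < m"
  shows "\<exists>A. root_chain (2 * n + 1) (n - m) (n + m) (m * m) A"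
  using assms
proof (induction m)
  case (Suc m)
  let ?N = "2 * n + 1" and ?i = "n - Suc m"
  have start: "\<exists>A. root_chain ?N ?i (Suc ?i) (m * m) A"
  proof (cases "m = 0")
    case True
    have one: "zirr ?N {1\<^sub>m ?N}" by (rule zirr_singleton)
    have "root_chain ?N ?i (Suc ?i) 0 (\<lambda>_. {1\<^sub>m ?N})"
      unfolding root_chain_def using one fixed_one[of ?N] Suc.prems by (auto simp: True)
    then show ?thesis using True by auto
  next
    case False
    then obtain A where A: "root_chain ?N (n - m) (n + m) (m * m) A" using Suc by auto
    have "root_chain ?N ?i (Suc ?i) (m * m) A"
      unfolding root_chain_def
    proof (intro conjI ballI allI impI)
      fix u assume uA: "u \<in> A (m * m)"
      have row: "u $$ (r, c) = 0" if "r < n - m" "c < ?N" "r \<noteq> c" for r c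
        using A uA that unfolding root_chain_def by blast
      show "u $$ (r, c) = 0" if "r < ?i" "c < ?N" "r \<noteq> c" for r c using row that by simp
      show "u $$ (?i, c) = 0" if "Suc ?i \<le> c \<and> c < ?N - 1 - ?i" for c using row that Suc.prems by simp
    qed (use A in \<open>auto simp: root_chain_def\<close>)
    then show ?thesis by blast
  qed
  then obtain A where A: "root_chain ?N ?i (Suc ?i) (m * m) A" by blast
  have "?i + (2 * m + 1) < ?N - 1 - ?i" using Suc.prems by simp
  from root_chain_row[OF A this] obtain A where "root_chain ?N ?i (Suc (?i + (2 * m + 1))) (m * m + (2 * m + 1)) A" by blast
  moreover have "Suc (?i + (2 * m + 1)) = n + Suc m" using Suc.prems by simp
  moreover have "m * m + (2 * m + 1) = Suc m * Suc m" by simp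
  ultimately show ?case by metis
qed simp

text \<open>An element of \<open>K\<close> has Gram matrix \<open>J\<close>, of pattern
  \<open>longest N\<close>, so the products of root subgroups all lie over one orbit; each of the
  \<open>n * n\<close> positive roots of \<open>K\<close> contributes one step.\<close>

lemma closed_orbit_chain:
  assumes N: "N = 2 * n + 1"
  shows "\<exists>Z. flag_chain N (adapted N (longest N)) Z (n * n)"
proof -
  have "\<exists>i j A. root_chain N i j (n * n) A"
  proof (cases "n = 0")
    case True
    have "root_chain N 0 N 0 (\<lambda>_. {1\<^sub>m N})"
      unfolding root_chain_def using zirr_singleton[of N "1\<^sub>m N"] fixed_one[of N] by (auto simp: N True)
    then show ?thesis using True by auto
  qed (use root_chain_full[of n n] N in blast)
  then obtain i j A where A: "root_chain N i j (n * n) A" by blast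
  \<comment> \<open>Empty beyond the last index, because \<open>flag_chainI\<close> asks for
    \<open>T m \<subseteq> X\<close> for every \<open>m\<close>.\<close>
  define T where "T m = (if m \<le> n * n then set_mul (A m) (borel_subgroup N) else {})" for m
  have Af: "A m \<subseteq> fixed_group N" "zirr N (A m)" if "m \<le> n * n" for m using A that unfolding root_chain_def by auto
  have Ac: "A m \<subseteq> carrier (SL N)" if "m \<le> n * n" for m using Af[OF that] fixed_SL by blast
  have Ax: "A m \<subseteq> adapted N (longest N)" if "m \<le> n * n" for m
  proof
    fix u assume "u \<in> A m"
    then have u: "u \<in> carrier (SL N)" "gram N u = antidiag N" using Af[OF that] fixed_group_iff by blast+
    have "has_pattern N (longest N) (antidiag N)" by (auto simp: has_pattern_def antidiag_def longest_def)
    then show "u \<in> adapted N (longest N)" using pattern_adapted[OF u(1)] u(2) by simp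
  qed
  have "flag_chain N (adapted N (longest N)) (\<lambda>m. adapted N (longest N) \<inter> zcl N (T m)) (n * n)"
  proof (rule flag_chainI[OF adapted_SL adapted_rstable])
    fix m
    show "T m \<subseteq> adapted N (longest N)"
      unfolding T_def set_mul_def using Ax[of m] adapted_rstable[of N "longest N"] unfolding rstable_def by auto
    show "zirr N (T m)" if "m \<le> n * n"
      unfolding T_def using that
      by (simp add: zirr_set_mul[OF Af(2)[OF that] zirr_borel SL_subset_mat[OF Ac[OF that]] SL_subset_mat[OF borel_subset_SL]])
    show "rstable (borel_subgroup N) (T m)" if m: "m \<le> n * n"
      unfolding rstable_def
    proof (intro ballI)
      fix a h assume "a \<in> T m" and h: "h \<in> borel_subgroup N"
      then obtain x \<beta> where x: "x \<in> A m" "\<beta> \<in> borel_subgroup N" "a = x * \<beta>" using m by (auto simp: T_def set_mul_def)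
      have xc: "x \<in> carrier (SL N)" using x(1) Ac[OF m] by blast
      have "a * h = x * (\<beta> * h)" unfolding x(3) by (rule SL_assoc[OF xc borel_SL[OF x(2)] borel_SL[OF h]])
      then show "a * h \<in> T m" using m set_mulI[OF x(1) borel_mult[OF x(2) h]] by (simp add: T_def)
    qed
    show "T m \<subseteq> T (Suc m)" if "m < n * n"
      using A that unfolding root_chain_def T_def set_mul_def by auto blast
    show "\<not> T (Suc m) \<subseteq> zcl N (T m)" if m: "m < n * n"
    proof
      assume sub: "T (Suc m) \<subseteq> zcl N (T m)"
      have "A (Suc m) \<subseteq> T (Suc m)"
      proof
        fix u assume u: "u \<in> A (Suc m)"
        have "u * 1\<^sub>m N \<in> set_mul (A (Suc m)) (borel_subgroup N)" by (rule set_mulI[OF u borel_one])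
        moreover have "u * 1\<^sub>m N = u" by (rule SL_right_one) (use u Ac[of "Suc m"] m in auto)
        ultimately show "u \<in> T (Suc m)" using m by (simp add: T_def)
      qed
      then have "A (Suc m) \<subseteq> zcl N (set_mul (A m) (borel_subgroup N))" using sub m by (simp add: T_def)
      then show False using A m unfolding root_chain_def by blast
    qed
  qed
  then show ?thesis by blast
qed

section \<open>Dimensions of the orbits\<close>

lemma rank_defect_le: "rank_defect N b \<le> N * N + N"
proof -
  have "card (inversions N b) \<le> card ({..<N} \<times> {..<N})"
    by (rule card_mono) (auto simp: inversions_def)
  moreover have "card {p. p < N \<and> p < b p} \<le> card {..<N}" by (rule card_mono) auto
  ultimately show ?thesis unfolding rank_defect_def by simp
qed

text \<open>Every involution other than \<open>longest N\<close> is an upward step from one of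
  larger rank defect; the bound \<open>rank_defect_le\<close> turns this increase into a decreasing
  measure.\<close>

lemma involution_ascend_induct [consumes 1, case_names longest ascend]:
  assumes b: "b \<in> involutions N" and base: "Q (longest N)"
    and step: "\<And>i c. c \<in> involutions N \<Longrightarrow> Suc i < N \<Longrightarrow> c (Suc i) < c i \<Longrightarrow> Q c \<Longrightarrow> Q (ascend i c)"
  shows "Q b"
  using b
proof (induction "N * N + N - rank_defect N b" arbitrary: b rule: less_induct)
  case less
  show ?case
  proof (cases "b = longest N")
    case False
    then obtain i where i: "Suc i < N" "b i < b (Suc i)" using ascent_exists[OF less.prems] by blast
    then have "\<not> b (Suc i) < b i" by simp
    then obtain c where c: "c \<in> involutions N" "c (Suc i) < c i" "ascend i c = b"
      using ascend_of_ascent[OF less.prems i(1)] by blast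
    have "rank_defect N c = rank_defect N b + 2" using ascend_rank_defect[OF c(1) i(1) c(2)] c(3) by simp
    then have "N * N + N - rank_defect N c < N * N + N - rank_defect N b" using rank_defect_le[of N c] by simp
    from step[OF c(1) i(1) c(2) less.hyps[OF this c(1)]] show ?thesis unfolding c(3) .
  qed (use base in simp)
qed

lemma flag_chain_exists:
  assumes N: "N = 2 * n + 1" and b: "b \<in> involutions N"
  shows "\<exists>k Z. flag_chain N (adapted N b) Z k \<and> 2 * k + rank_defect N b = N * (N - 1)"
  using b
proof (induction rule: involution_ascend_induct)
  case longest
  have "2 * (n * n) + rank_defect N (longest N) = N * (N - 1)"
    unfolding N rank_defect_longest by (simp add: algebra_simps)
  then show ?case using closed_orbit_chain[OF N] by blast
next
  case (ascend i c)
  interpret descent N i c by unfold_locales (use N ascend in auto)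
  obtain k Z where k: "flag_chain N (adapted N c) Z k" "2 * k + rank_defect N c = N * (N - 1)" using ascend.IH by blast
  have "2 * Suc k + rank_defect N (ascend i c) = N * (N - 1)"
    using k(2) ascend_rank_defect[OF b i d] by simp
  then show ?case using flag_chain_ascend[OF k(1)] by blast
qed

text \<open>Along each upward step the chain is lengthened by one while the rank defect drops by
  two, so the left-hand side is unchanged. At the identity, the parameter of the open orbit,
  \<open>flag_chain_bound\<close> applies.\<close>

lemma flag_chain_le:
  assumes N: "odd N" and b: "b \<in> involutions N" and ch: "flag_chain N (adapted N b) Z k"
  shows "2 * k + rank_defect N b \<le> N * (N - 1)"
  using b ch
proof (induction "rank_defect N b" arbitrary: b Z k rule: less_induct)
  case less
  show ?case
  proof (cases "b = id")
    case True
    have "0 < N" using N by (rule odd_pos)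
    then show ?thesis using flag_chain_bound[OF less.prems(2) adapted_SL] unfolding True by (simp add: rank_defect_id)
  next
    case False
    then obtain i where i: "Suc i < N" "b (Suc i) < b i" using descent_exists[OF less.prems(1)] by blast
    interpret descent N i b by unfold_locales (use N less.prems i in auto)
    obtain Z' where Z': "flag_chain N (adapted N b') Z' (Suc k)" using flag_chain_ascend[OF less.prems(2)] by blast
    have rd: "rank_defect N b = rank_defect N b' + 2" by (rule ascend_rank_defect[OF b i d])
    have "2 * Suc k + rank_defect N b' \<le> N * (N - 1)" by (rule less.hyps[OF _ b' Z']) (simp add: rd)
    then show ?thesis using rd by simp
  qed
qed

lemma orbit_dim_orb:
  assumes N: "N = 2 * n + 1" and b: "b \<in> involutions N"
  obtains k where "orbit_dim N (orb N b) = enat k" "2 * k + rank_defect N b = N * (N - 1)"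
proof -
  obtain k Z where k: "flag_chain N (adapted N b) Z k" "2 * k + rank_defect N b = N * (N - 1)"
    using flag_chain_exists[OF N b] by blast
  have odd: "odd N" using N by simp
  have "orbit_dim N (orb N b) = Sup {enat k | k. \<exists>Z. flag_chain N (adapted N b) Z k}"
    unfolding orbit_dim_def orb_def by (rule krull_dim_flag_subset[OF adapted_SL adapted_rstable])
  also have "\<dots> = enat k"
  proof (rule antisym)
    show "Sup {enat k | k. \<exists>Z. flag_chain N (adapted N b) Z k} \<le> enat k"
    proof (rule Sup_least)
      fix x assume "x \<in> {enat k | k. \<exists>Z. flag_chain N (adapted N b) Z k}"
      then obtain j Z where j: "x = enat j" "flag_chain N (adapted N b) Z j" by blast
      have "2 * j + rank_defect N b \<le> N * (N - 1)" by (rule flag_chain_le[OF odd b j(2)])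
      then show "x \<le> enat k" using k(2) j(1) by simp
    qed
    show "enat k \<le> Sup {enat k | k. \<exists>Z. flag_chain N (adapted N b) Z k}"
      by (rule Sup_upper) (use k(1) in blast)
  qed
  finally show ?thesis using that k(2) by blast
qed

section \<open>Edges of the weak order and the closed orbit\<close>

lemma weak_cover_ascend:
  assumes N: "N = 2 * n + 1" and desc: "b \<in> involutions N" "Suc i < N" "b (Suc i) < b i"
  shows "weak_cover N i b (ascend i b)"
proof -
  interpret descent N i b by unfold_locales (use N desc in auto)
  obtain k where k: "orbit_dim N (orb N b) = enat k" "2 * k + rank_defect N b = N * (N - 1)"
    by (rule orbit_dim_orb[OF N b])
  obtain k' where k': "orbit_dim N (orb N b') = enat k'" "2 * k' + rank_defect N b' = N * (N - 1)"
    by (rule orbit_dim_orb[OF N b'])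
  have "k' = Suc k" using k(2) k'(2) ascend_rank_defect[OF b i d] by simp
  then have "orbit_dim N (orb N b') = orbit_dim N (orb N b) + 1" using k(1) k'(1) by (simp add: eSuc_enat plus_1_eSuc)
  then show ?thesis
    unfolding weak_cover_def orbit_cover_def orbit_of_orb[OF odd b] orbit_of_orb[OF odd b']
    using b b' i simple_act_orb[of b] by simp
qed

text \<open>At an ascent \<open>b\<close> is itself the upper orbit over some \<open>c\<close>, so
  the dense orbit of its saturation is the orbit of \<open>b\<close>, and the dimension, being
  finite, cannot increase.\<close>

lemma weak_cover_descent:
  assumes N: "N = 2 * n + 1" and w: "weak_cover N i b b''"
  shows "b (Suc i) < b i"
proof (rule ccontr)
  assume asc: "\<not> b (Suc i) < b i"
  have bi: "b \<in> involutions N" "Suc i < N" and cov: "orbit_cover N i (orbit_of N b) (orbit_of N b'')"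
    using w unfolding weak_cover_def by auto
  obtain c where c: "c \<in> involutions N" "c (Suc i) < c i" "ascend i c = b" by (rule ascend_of_ascent[OF bi asc])
  interpret descent N i c by unfold_locales (use N c bi in auto)
  have "simple_act N i (orb N b) = orb N b" using simple_act_orb[of b] c(3) by simp
  then have "orbit_dim N (orb N b) = orbit_dim N (orb N b) + 1"
    using cov unfolding orbit_cover_def orbit_of_orb[OF odd bi(1)] by metis
  moreover obtain k where "orbit_dim N (orb N b) = enat k" by (rule orbit_dim_orb[OF N bi(1)])
  ultimately show False by (simp add: eSuc_enat plus_1_eSuc)
qed

lemma weak_order_from_longest:
  assumes N: "N = 2 * n + 1" and b: "b \<in> involutions N" shows "(longest N, b) \<in> weak_order N"
  using b
proof (induction rule: involution_ascend_induct)
  case longest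
  then show ?case unfolding weak_order_def by simp
next
  case (ascend i c)
  have "(c, ascend i c) \<in> {(b, b'). \<exists>i. weak_cover N i b b'}" using weak_cover_ascend[OF N ascend.hyps] by blast
  then show ?case using ascend.IH unfolding weak_order_def by (rule rtrancl_into_rtrancl[rotated])
qed

text \<open>Every other orbit has a lower neighbour in its closure. For \<open>longest N\<close> all
  ranks are already minimal, so no other stratum meets the closure.\<close>

lemma closed_orb_iff:
  assumes N: "odd N" and inv: "b \<in> involutions N"
  shows "closedin (flag_top N) (orb N b) \<longleftrightarrow> b = longest N"
proof
  assume cl: "closedin (flag_top N) (orb N b)"
  show "b = longest N"
  proof (rule ccontr)
    assume "b \<noteq> longest N"
    then obtain i where asc: "Suc i < N" "b i < b (Suc i)" using ascent_exists[OF inv] by blast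
    then have "\<not> b (Suc i) < b i" by simp
    then obtain c where c: "c \<in> involutions N" "c (Suc i) < c i" "ascend i c = b"
      using ascend_of_ascent[OF inv asc(1)] by blast
    interpret descent N i c by unfold_locales (use N c asc in auto)
    have "coset_img N (borel_subgroup N) (zcl N (adapted N b)) = coset_img N (borel_subgroup N) (adapted N b)"
      using closure_of_closedin[OF cl]
      unfolding orb_def closure_of_coset_img[OF borel_subgroup_SL adapted_SL adapted_rstable] .
    then have "zcl N (adapted N b) = adapted N b"
      using coset_img_eq_iff[OF borel_subgroup_SL zcl_subset_carrier adapted_SL
          rstable_zcl[OF borel_subset_SL adapted_SL adapted_rstable] adapted_rstable] by blast
    then have "adapted N c \<subseteq> adapted N b" using lower_in_closure c(3) by simp
    moreover obtain h where h: "h \<in> carrier (SL N)" "has_pattern N c (gram N h)" using adapted_exists[OF Npos c(1)] by blast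
    ultimately have "h \<in> adapted N b" using pattern_adapted by blast
    then have "c = b" using adapted_unique[OF c(1) inv pattern_adapted[OF h]] by blast
    then show False using c(2) asc(2) by simp
  qed
next
  assume bl: "b = longest N"
  have "zcl N (adapted N b) \<subseteq> adapted N b"
  proof
    fix h assume h: "h \<in> zcl N (adapted N b)"
    then have "h \<in> carrier (SL N)" using zcl_subset_carrier by blast
    then obtain c where c: "c \<in> involutions N" "h \<in> adapted N c" using adapted_cover by blast
    have "corank_fun N c k l \<le> corank_fun N b k l" for k l by (rule adapted_closure_corank[OF inv c h])
    then have "corank_fun N c k l = corank_fun N b k l" for k l
      using longest_corank_minimal[OF c(1)] unfolding bl by (simp add: le_antisym)
    then have "c = b" by (rule corank_fun_determines[OF c(1) inv])
    then show "h \<in> adapted N b" using c(2) by simp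
  qed
  then have "zcl N (adapted N b) = adapted N b" using subset_zcl[OF adapted_SL] by blast
  then show "closedin (flag_top N) (orb N b)"
    unfolding orb_def by (rule closedin_coset_img[OF borel_subgroup_SL adapted_SL adapted_rstable])
qed

section \<open>Degrees of the projections\<close>

lemma lineR_not_borel: assumes "Suc i < N" shows "lineR N i t \<notin> borel_subgroup N"
proof
  assume "lineR N i t \<in> borel_subgroup N"
  then have "lineR N i t $$ (i, Suc i) = 0" using assms unfolding borel_subgroup_def by auto
  then show False using assms by (simp add: lineR_def blk_def)
qed

lemma finite_involutions: "finite (involutions N)"
  by (rule finite_subset[OF _ finite_permutations[of "{..<N}"]]) (auto simp: involutions_def)

context descent
begin

lemma union_in_upper_closure: "adapted N b \<union> adapted N b' \<subseteq> zcl N (adapted N b')"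
  using lower_in_closure subset_zcl[OF adapted_SL] by blast

text \<open>The upper orbit and the whole saturated set have the same closure, and the latter set is
  stable under \<open>P\<close>.\<close>

lemma upper_closure_stable: "rstable P (zcl N (adapted N b'))"
proof -
  have "zcl N (adapted N b \<union> adapted N b') = zcl N (adapted N b')"
    by (intro subset_antisym zcl_minimal union_in_upper_closure zcl_mono) auto
  moreover have "rstable P (zcl N (adapted N b \<union> adapted N b'))"
    by (rule rstable_zcl[OF parabolic_subset_SL _ saturated]) (use adapted_SL in blast)
  ultimately show ?thesis by simp
qed

lemma union_to_upper:
  assumes "h \<in> adapted N b \<union> adapted N b'" shows "\<exists>p\<in>P. h * p \<in> adapted N b'"
proof (cases "h \<in> adapted N b")
  case False
  then have h: "h \<in> adapted N b'" using assms by blast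
  then have "h * 1\<^sub>m N = h" using adapted_SL SL_right_one by blast
  then show ?thesis using parabolic_one[of N i] h by metis
qed (rule lower_to_upper)

text \<open>The other saturated strata whose closure avoids the stratum of \<open>b\<close> cut out its complement in
  the closure: the closure order on strata is antisymmetric.\<close>

lemma stratum_complement:
  assumes g: "g \<in> zcl N (adapted N b)" "g \<notin> adapted N b \<union> adapted N b'"
  shows "\<exists>f\<in>involutions N. f (Suc i) < f i \<and> g \<in> zcl N (adapted N (ascend i f)) \<and>
    (adapted N b \<union> adapted N b') \<inter> zcl N (adapted N (ascend i f)) = {}"
proof -
  have gc: "g \<in> carrier (SL N)" using g(1) zcl_subset_carrier by blast
  obtain c where c: "c \<in> involutions N" "g \<in> adapted N c" using adapted_cover[OF gc] by blast
  have "\<exists>f\<in>involutions N. f (Suc i) < f i \<and> (c = f \<or> c = ascend i f)"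
  proof (cases "c (Suc i) < c i")
    case False
    show ?thesis by (rule ascend_of_ascent[OF c(1) i False]) blast
  qed (use c(1) in blast)
  then obtain f where f: "f \<in> involutions N" "f (Suc i) < f i" "c = f \<or> c = ascend i f" by blast
  interpret f: descent N i f by unfold_locales (use odd f i in auto)
  have gS: "g \<in> adapted N f \<union> adapted N f.b'" using c(2) f(3) by blast
  have gD: "g \<in> zcl N (adapted N f.b')" using gS f.union_in_upper_closure by blast
  have "h \<notin> zcl N (adapted N f.b')" if h: "h \<in> adapted N b \<union> adapted N b'" for h
  proof
    assume hD: "h \<in> zcl N (adapted N f.b')"
    \<comment> \<open>Both saturated sets are represented by their upper orbits. Each upper orbit
      then has a point in the closure of the other, all ranks agree, and the two sets
      coincide.\<close>
    obtain p where p: "p \<in> P" "h * p \<in> adapted N b'" using union_to_upper[OF h] by blast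
    have "h * p \<in> zcl N (adapted N f.b')" using f.upper_closure_stable hD p(1) unfolding rstable_def by blast
    note le1 = adapted_closure_corank[OF f.b' b' p(2) this]
    obtain q where q: "q \<in> P" "g * q \<in> adapted N f.b'" using f.union_to_upper[OF gS] by blast
    have "g \<in> zcl N (adapted N b')" using g(1) zcl_minimal[OF lower_in_closure] by blast
    then have "g * q \<in> zcl N (adapted N b')" using upper_closure_stable q(1) unfolding rstable_def by blast
    note le2 = adapted_closure_corank[OF b' f.b' q(2) this]
    have "f.b' = b'" by (rule corank_fun_determines[OF f.b' b']) (intro le_antisym le1 le2)
    then have "g * q * SL_inv N q \<in> adapted N b \<union> adapted N b'"
      using q(2) parabolic_inv[OF q(1) i] saturated unfolding rstable_def by auto
    then show False using g(2) SL_inv_mult_cancel(3)[OF parabolic_SL[OF q(1)] gc] by simp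
  qed
  then show ?thesis using f(1,2) gD by blast
qed

lemma parabolic_image_stratum:
  "coset_img N P (adapted N b \<union> adapted N b') = coset_img N P (adapted N b)"
proof
  show "coset_img N P (adapted N b \<union> adapted N b') \<subseteq> coset_img N P (adapted N b)"
  proof
    fix y assume "y \<in> coset_img N P (adapted N b \<union> adapted N b')"
    then obtain g where g: "g \<in> adapted N b \<union> adapted N b'" "y = g <#\<^bsub>SL N\<^esub> P" by (auto simp: coset_img_def)
    show "y \<in> coset_img N P (adapted N b)"
    proof (cases "g \<in> adapted N b")
      case True
      then show ?thesis using g(2) by (auto simp: coset_img_def)
    next
      case False
      then obtain p where p: "p \<in> P" "g * p \<in> adapted N b" using upper_to_lower g(1) by blast
      have "g \<in> carrier (SL N)" "g * p \<in> carrier (SL N)" using g(1) p(2) adapted_SL by blast+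
      then have "y = (g * p) <#\<^bsub>SL N\<^esub> P" using lcos_eq_iff[OF parabolic_subgroup_SL[OF i]] p(1) g(2) by blast
      then show ?thesis using p(2) by (auto simp: coset_img_def)
    qed
  qed
qed (auto simp: coset_img_def)

lemma proj_closure:
  "proj N i ` (flag_top N closure_of orb N b) = coset_img N P (zcl N (adapted N b))"
proof -
  have "proj N i (g <#\<^bsub>SL N\<^esub> borel_subgroup N) = g <#\<^bsub>SL N\<^esub> P" if "g \<in> zcl N (adapted N b)" for g
    by (rule proj_coset) (use that zcl_subset_carrier in blast)
  then show ?thesis
    unfolding orb_def closure_of_coset_img[OF borel_subgroup_SL adapted_SL adapted_rstable]
    by (simp add: coset_img_def image_image)
qed

text \<open>Off the stratum, the closure is covered by finitely many closed \<open>P\<close>-stable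
  sets that miss the stratum, namely those found in \<open>stratum_complement\<close>; their images
  are closed.\<close>

lemma stratum_open:
  "openin (subtopology (coset_top N P) (coset_img N P (zcl N (adapted N b)))) (coset_img N P (adapted N b))"
proof -
  let ?S = "adapted N b \<union> adapted N b'" and ?im = "coset_img N P (zcl N (adapted N b))"
  note Pg = parabolic_subgroup_SL[OF i]
  define I where "I = {f \<in> involutions N. f (Suc i) < f i \<and> ?S \<inter> zcl N (adapted N (ascend i f)) = {}}"
  define F where "F = (\<Union>f\<in>I. coset_img N P (zcl N (adapted N (ascend i f))))"
  have Sc: "?S \<subseteq> carrier (SL N)" using adapted_SL by blast
  have stab: "rstable P (zcl N (adapted N (ascend i f)))" if "f \<in> I" for f
  proof -
    interpret f: descent N i f by unfold_locales (use odd that i in \<open>auto simp: I_def\<close>)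
    show ?thesis by (rule f.upper_closure_stable)
  qed
  have F: "closedin (coset_top N P) F" unfolding F_def
  proof (rule closedin_Union)
    show "finite ((\<lambda>f. coset_img N P (zcl N (adapted N (ascend i f)))) ` I)"
      using finite_involutions[of N] by (auto simp: I_def)
    fix C assume "C \<in> (\<lambda>f. coset_img N P (zcl N (adapted N (ascend i f)))) ` I"
    then obtain f where f: "f \<in> I" "C = coset_img N P (zcl N (adapted N (ascend i f)))" by blast
    show "closedin (coset_top N P) C" unfolding f(2)
      by (rule closedin_coset_img[OF Pg zcl_subset_carrier stab[OF f(1)] zcl_idem])
  qed
  have "coset_img N P (adapted N b) = (topspace (coset_top N P) - F) \<inter> ?im"
  proof -
    have key: "g <#\<^bsub>SL N\<^esub> P \<in> coset_img N P (adapted N b) \<longleftrightarrow> g <#\<^bsub>SL N\<^esub> P \<notin> F" if g: "g \<in> zcl N (adapted N b)" for g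
    proof -
      have gc: "g \<in> carrier (SL N)" using g zcl_subset_carrier by blast
      have "g <#\<^bsub>SL N\<^esub> P \<in> coset_img N P (adapted N b) \<longleftrightarrow> g \<in> ?S"
        unfolding parabolic_image_stratum[symmetric] by (rule mem_coset_img[OF Pg Sc saturated gc])
      also have "\<dots> \<longleftrightarrow> \<not> (\<exists>f\<in>I. g \<in> zcl N (adapted N (ascend i f)))"
        using stratum_complement[OF g] unfolding I_def by blast
      also have "(\<exists>f\<in>I. g \<in> zcl N (adapted N (ascend i f))) \<longleftrightarrow> g <#\<^bsub>SL N\<^esub> P \<in> F"
        unfolding F_def using mem_coset_img[OF Pg zcl_subset_carrier stab gc] by simp
      finally show ?thesis .
    qed
    have sub: "coset_img N P (adapted N b) \<subseteq> ?im"
      unfolding coset_img_def by (rule image_mono[OF subset_zcl[OF adapted_SL]])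
    have top: "?im \<subseteq> topspace (coset_top N P)"
      unfolding topspace_coset_top by (rule coset_img_lcosets[OF zcl_subset_carrier])
    have "x \<in> coset_img N P (adapted N b) \<longleftrightarrow> x \<notin> F" if "x \<in> ?im" for x
      using key that unfolding coset_img_def[of N P "zcl N (adapted N b)"] by blast
    then show ?thesis using sub top by blast
  qed
  then show ?thesis using F unfolding openin_subtopology by blast
qed

lemma stratum_dense:
  "coset_img N P (zcl N (adapted N b)) \<subseteq> coset_top N P closure_of coset_img N P (adapted N b)"
proof -
  have "coset_top N P closure_of coset_img N P (adapted N b) = coset_img N P (zcl N (adapted N b \<union> adapted N b'))"
    unfolding parabolic_image_stratum[symmetric]
    by (rule closure_of_coset_img[OF parabolic_subgroup_SL[OF i] _ saturated]) (use adapted_SL in blast)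
  moreover have "zcl N (adapted N b) \<subseteq> zcl N (adapted N b \<union> adapted N b')" by (rule zcl_mono) blast
  ultimately show ?thesis unfolding coset_img_def by blast
qed

text \<open>The fibre of \<open>G/B\<close> is a projective line: the base point and the points
  \<open>h * lineR N i t\<close>. Points of the upper orbit are not in the closure, and by
  \<open>gram_fibre\<close> only \<open>t = 0\<close> in the commuting case stays in the lower
  orbit.\<close>

lemma fibre_over_stratum:
  assumes h: "h \<in> carrier (SL N)" "has_pattern N b (gram N h)"
  shows "{x \<in> flag_top N closure_of orb N b. proj N i x = h <#\<^bsub>SL N\<^esub> P} =
    (if conj_refl i b = b then {h <#\<^bsub>SL N\<^esub> borel_subgroup N, (h * lineR N i 0) <#\<^bsub>SL N\<^esub> borel_subgroup N}
     else {h <#\<^bsub>SL N\<^esub> borel_subgroup N})" (is "?L = ?R")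
proof
  note Pg = parabolic_subgroup_SL[OF i]
  have cl: "flag_top N closure_of orb N b = coset_img N (borel_subgroup N) (zcl N (adapted N b))"
    unfolding orb_def by (rule closure_of_coset_img[OF borel_subgroup_SL adapted_SL adapted_rstable])
  have hb: "h \<in> adapted N b" by (rule pattern_adapted[OF h])
  have up: "h * lineR N i t \<in> adapted N b'" if "\<not> (conj_refl i b = b \<and> t = 0)" for t
    using gram_fibre(1)[OF h b i d, of t] pattern_line(2)[OF h, of t] that by (auto simp: ascend_def)
  show "?L \<subseteq> ?R"
  proof
    fix x assume x: "x \<in> ?L"
    then obtain g where g: "g \<in> zcl N (adapted N b)" "x = g <#\<^bsub>SL N\<^esub> borel_subgroup N"
      unfolding cl by (auto simp: coset_img_def)
    have gc: "g \<in> carrier (SL N)" using g(1) zcl_subset_carrier by blast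
    have "h <#\<^bsub>SL N\<^esub> P = g <#\<^bsub>SL N\<^esub> P" using x unfolding g(2) by (simp add: proj_coset[OF gc])
    then obtain p where p: "p \<in> P" "g = h * p" using lcos_eq_iff[OF Pg h(1) gc] by blast
    have up': "g \<notin> adapted N b'" using g(1) upper_not_in_closure by blast
    from p(1) i show "x \<in> ?R"
    proof (cases rule: parabolic_cases_right)
      case 1
      then have "h <#\<^bsub>SL N\<^esub> borel_subgroup N = x"
        using lcos_eq_iff[OF borel_subgroup_SL h(1) gc] p(2) unfolding g(2) by blast
      then show ?thesis by auto
    next
      case (2 \<beta> t)
      have hl: "h * lineR N i t \<in> carrier (SL N)" by (rule SL_mult_closed[OF h(1) lineR_SL])
      have gl: "g = h * lineR N i t * \<beta>"
        unfolding p(2) 2(2) by (rule SL_assoc[OF h(1) lineR_SL borel_SL[OF 2(1)], symmetric])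
      have "h * lineR N i t \<notin> adapted N b'"
        using up' adapted_rstable[of N b'] 2(1) unfolding gl rstable_def by blast
      then have "conj_refl i b = b" "t = 0" using up by blast+
      moreover have "(h * lineR N i t) <#\<^bsub>SL N\<^esub> borel_subgroup N = x"
        using lcos_eq_iff[OF borel_subgroup_SL hl gc] 2(1) gl unfolding g(2) by blast
      ultimately show ?thesis by auto
    qed
  qed
  have mem: "k <#\<^bsub>SL N\<^esub> borel_subgroup N \<in> ?L" if k: "k \<in> adapted N b" "p \<in> P" "k = h * p" for k p
  proof -
    have kc: "k \<in> carrier (SL N)" using k(1) adapted_SL by blast
    have "h <#\<^bsub>SL N\<^esub> P = k <#\<^bsub>SL N\<^esub> P" using lcos_eq_iff[OF Pg h(1) kc] k by blast
    moreover have "k \<in> zcl N (adapted N b)" using k(1) subset_zcl[OF adapted_SL] by blast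
    ultimately show ?thesis unfolding cl by (simp add: proj_coset[OF kc] coset_img_def)
  qed
  have "h <#\<^bsub>SL N\<^esub> borel_subgroup N \<in> ?L"
    by (rule mem[OF hb parabolic_one]) (simp add: SL_right_one[OF h(1)])
  moreover have "(h * lineR N i 0) <#\<^bsub>SL N\<^esub> borel_subgroup N \<in> ?L" if "conj_refl i b = b"
    by (rule mem[OF gram_fibre(2)[OF h b i d that] lineR_parabolic[OF i] refl])
  ultimately show "?R \<subseteq> ?L" by (simp split: if_split)
qed

text \<open>The image of the orbit itself is taken as the dense open set; each of its points has a
  representative with monomial Gram matrix, so all fibres over it are known. In the commuting case
  the two points differ because \<open>lineR N i 0\<close> is not in \<open>B\<close>.\<close>

lemma proj_degree_orb: "proj_degree N i (orb N b) (if conj_refl i b = b then 2 else 1)"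
  unfolding proj_degree_def has_degree_over_image_def proj_closure
proof (intro exI[of _ "coset_img N P (adapted N b)"] conjI stratum_open stratum_dense ballI)
  fix y assume "y \<in> coset_img N P (adapted N b)"
  then obtain g where g: "g \<in> adapted N b" "y = g <#\<^bsub>SL N\<^esub> P" by (auto simp: coset_img_def)
  obtain \<beta> where \<beta>: "\<beta> \<in> borel_subgroup N" "g * \<beta> \<in> carrier (SL N)" "has_pattern N b (gram N (g * \<beta>))"
    by (rule adapted_pattern_rep[OF g(1)])
  let ?h = "g * \<beta>"
  have gc: "g \<in> carrier (SL N)" using g(1) adapted_SL by blast
  have y: "y = ?h <#\<^bsub>SL N\<^esub> P"
    unfolding g(2) using lcos_eq_iff[OF parabolic_subgroup_SL[OF i] gc \<beta>(2)] \<beta>(1) borel_parabolic by blast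
  have ne: "?h <#\<^bsub>SL N\<^esub> borel_subgroup N \<noteq> (?h * lineR N i 0) <#\<^bsub>SL N\<^esub> borel_subgroup N"
  proof
    assume "?h <#\<^bsub>SL N\<^esub> borel_subgroup N = (?h * lineR N i 0) <#\<^bsub>SL N\<^esub> borel_subgroup N"
    then obtain \<gamma> where \<gamma>: "\<gamma> \<in> borel_subgroup N" "?h * lineR N i 0 = ?h * \<gamma>"
      using lcos_eq_iff[OF borel_subgroup_SL \<beta>(2) SL_mult_closed[OF \<beta>(2) lineR_SL]] by blast
    have "lineR N i 0 = SL_inv N ?h * (?h * lineR N i 0)" by (rule SL_inv_mult_cancel(1)[OF \<beta>(2) lineR_SL, symmetric])
    also have "\<dots> = \<gamma>" unfolding \<gamma>(2) by (rule SL_inv_mult_cancel(1)[OF \<beta>(2) borel_SL[OF \<gamma>(1)]])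
    finally show False using lineR_not_borel[OF i, of 0] \<gamma>(1) by simp
  qed
  show "finite {x \<in> flag_top N closure_of orb N b. proj N i x = y}"
    unfolding y fibre_over_stratum[OF \<beta>(2,3)] by simp
  show "card {x \<in> flag_top N closure_of orb N b. proj N i x = y} = (if conj_refl i b = b then 2 else 1)"
    unfolding y fibre_over_stratum[OF \<beta>(2,3)] using ne by simp
qed

end

text \<open>The last two conjuncts express that the order is generated upwards from
  \<open>longest N\<close>: every cover comes from a length descent, and every involution is reached
  by covers.\<close>

theorem corollary2p2p5:
  fixes n N :: nat
  assumes "N = 2 * n + 1"
  shows "bij_betw (orbit_param N) (K_orbits N) (involutions N) \<and>
    {Q \<in> K_orbits N. closedin (flag_top N) Q} = {orbit_of N (longest N)} \<and>
    (\<forall>b\<in>involutions N. \<forall>i. Suc i < N \<and>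
        coxeter_length N (simple_refl i \<circ> b) < coxeter_length N b \<longrightarrow>
          (simple_refl i \<circ> b \<circ> simple_refl i \<noteq> b \<longrightarrow>
             weak_cover N i b (simple_refl i \<circ> b \<circ> simple_refl i) \<and>
             black_edge N i b (simple_refl i \<circ> b \<circ> simple_refl i)) \<and>
          (simple_refl i \<circ> b \<circ> simple_refl i = b \<longrightarrow>
             weak_cover N i b (simple_refl i \<circ> b) \<and>
             blue_edge N i b (simple_refl i \<circ> b))) \<and>
    (\<forall>b b' i. weak_cover N i b b' \<longrightarrow>
        coxeter_length N (simple_refl i \<circ> b) < coxeter_length N b) \<and>
    (\<forall>b\<in>involutions N. (longest N, b) \<in> weak_order N)"
proof (intro conjI ballI allI impI)
  have odd: "odd N" using assms by simp
  show "bij_betw (orbit_param N) (K_orbits N) (involutions N)" by (rule bij_orbit_param[OF odd])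
  show "{Q \<in> K_orbits N. closedin (flag_top N) Q} = {orbit_of N (longest N)}"
    unfolding K_orbits_eq[OF odd] orbit_of_orb[OF odd longest_involution]
    using closed_orb_iff[OF odd] longest_involution[of N] by blast
  fix b assume inv: "b \<in> involutions N"
  show "(longest N, b) \<in> weak_order N" by (rule weak_order_from_longest[OF assms inv])
  fix i assume "Suc i < N \<and> coxeter_length N (simple_refl i \<circ> b) < coxeter_length N b"
  then have desc: "Suc i < N" "b (Suc i) < b i" using involution_descent_iff[OF inv] by blast+
  interpret descent N i b by unfold_locales (use odd inv desc in auto)
  note cover = weak_cover_ascend[OF assms b i d]
  have conj: "ascend i b = conj_refl i b" "proj_degree N i (orb N b) 1" if "conj_refl i b \<noteq> b"
    using proj_degree_orb that unfolding ascend_def by presburger+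
  have comm: "ascend i b = simple_refl i \<circ> b" "proj_degree N i (orb N b) 2" if "conj_refl i b = b"
    using proj_degree_orb that unfolding ascend_def by presburger+
  show "weak_cover N i b (conj_refl i b)" if "conj_refl i b \<noteq> b" using cover unfolding conj(1)[OF that] .
  then show "black_edge N i b (conj_refl i b)" if "conj_refl i b \<noteq> b"
    unfolding black_edge_def orbit_of_orb[OF odd b] using conj(2)[OF that] that by blast
  show "weak_cover N i b (simple_refl i \<circ> b)" if "conj_refl i b = b" using cover unfolding comm(1)[OF that] .
  then show "blue_edge N i b (simple_refl i \<circ> b)" if "conj_refl i b = b"
    unfolding blue_edge_def orbit_of_orb[OF odd b] using comm(2)[OF that] that by blast
next
  fix b b' i assume w: "weak_cover N i b b'"
  then have "b \<in> involutions N" "Suc i < N" unfolding weak_cover_def by blast+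
  then show "coxeter_length N (simple_refl i \<circ> b) < coxeter_length N b"
    using involution_descent_iff weak_cover_descent[OF assms w] by blast
qed

end
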